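(* Let $W$ be a complex reflection group, with set of reflecting hyperplanes $\mathcal{A}$, $N=|\mathcal{A}|$, braid group $B$ and pure braid group $P$. Then the group $B/(P,P)$ is crystallographic with holonomy group $W/Z(W)$, of dimension $N=|\mathcal{A}|$. The kernel of the projection map $B/(P,P)\to W/Z(W)$ is the subgroup $P_0$ of $B/(P,P)$ generated by $P^{ab}$ and (the image of) $Z_0(B)$. Moreover $P_0\simeq \mathbf{Z}^N$.
   Context: A complex reflection group is a finite subgroup $W<\mathrm{GL}_n(\mathbf{C})$ generated by (pseudo-)reflections, i.e. elements $\neq 1$ fixing pointwise a hyperplane. $\mathcal{A}$ is the set of reflecting hyperplanes (the hyperplanes $\mathrm{Ker}(s-1)$, $s$ a reflection of $W$), and $X=\mathbf{C}^n\setminus\bigcup\mathcal{A}$. Fix a base point $x_0\in X$. The group $W$ acts freely on $X$; set $P=\pi_1(X,x_0)$ (pure braid group) and $B=\pi_1(X/W,\bar x_0)$ (braid group), so there is an exact sequence $1\to P\to B\to W\to 1$. $(P,P)$ is the commutator subgroup of $P$ and $P^{ab}=P/(P,P)\subset B/(P,P)$. $Z(W)$ is the center of $W$, and $B/(P,P)\to W/Z(W)$ is the composite of $B/(P,P)\to B/P=W$ and $W\to W/Z(W)$. Definition of $Z_0(B)$: decompose $W=W_1\times\dots\times W_r$ into irreducible components, $W_k$ acting irreducibly on a subspace $V_k$ and trivially on the other summands of the corresponding decomposition of $\mathbf{C}^n$; then $B=B_1\times\dots\times B_r$ where $B_k$ is the braid group of $W_k$ acting on $V_k$. Let $X_k\subset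 V_k$ be the complement of the reflecting hyperplanes of $W_k$ in $V_k$, let $x_k\in X_k$ be the component of the base point, let $d_k=|Z(W_k)|$, and let $\mathbf{z}_k\in B_k=\pi_1(X_k/W_k)$ be the homotopy class of $t\mapsto e^{2\pi \mathrm{i} t/d_k}x_k$, $t\in[0,1]$ (this is a central element). $Z_0(B)$ is the central subgroup of $B$ generated by $\mathbf{z}_1,\dots,\mathbf{z}_r$. A group $\Gamma$ is crystallographic of dimension $N$ with holonomy group $\Phi$ if there is an exact sequence $1\to\mathbf{Z}^N\to\Gamma\to\Phi\to1$ with $\Phi$ finite and $\mathbf{Z}^N$ maximal abelian in $\Gamma$ (equivalently, $\Phi$ finite and the induced action $\Phi\to\mathrm{Aut}(\mathbf{Z}^N)$ faithful). *)

theory Defs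
  imports "HOL-Analysis.Analysis" "HOL-Algebra.Algebra"
begin

section \<open>Fundamental groups\<close>

text \<open>
  The path and homotopy notions of HOL-Analysis are tied to subsets of a topological type; the orbit
  space below is a topology on a set of orbits, so loops are taken in an abstract topology.
  Only the values on the unit interval matter: loops that agree there are homotopic.
\<close>

definition loops_at :: "'a topology \<Rightarrow> 'a \<Rightarrow> (real \<Rightarrow> 'a) set" where
  "loops_at T x = {g. continuous_map (top_of_set {0..1}) T g \<and> g 0 = x \<and> g 1 = x}"

definition loop_homotopy_rel :: "'a topology \<Rightarrow> 'a \<Rightarrow> ((real \<Rightarrow> 'a) \<times> (real \<Rightarrow> 'a)) set" where
  "loop_homotopy_rel T x = {(f, g). f \<in> loops_at T x \<and> g \<in> loops_at T x \<and>
     homotopic_with (\<lambda>h. h 0 = x \<and> h 1 = x) (top_of_set {0..1}) T f g}"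

definition loop_class :: "'a topology \<Rightarrow> 'a \<Rightarrow> (real \<Rightarrow> 'a) \<Rightarrow> (real \<Rightarrow> 'a) set" where
  "loop_class T x g = loop_homotopy_rel T x `` {g}"

definition loop_join :: "(real \<Rightarrow> 'a) \<Rightarrow> (real \<Rightarrow> 'a) \<Rightarrow> real \<Rightarrow> 'a" where
  "loop_join f g = (\<lambda>t. if t \<le> 1/2 then f (2 * t) else g (2 * t - 1))"

text \<open>Convention: the product of two classes traverses the left factor first.\<close>

definition fundamental_group :: "'a topology \<Rightarrow> 'a \<Rightarrow> (real \<Rightarrow> 'a) set monoid" where
  "fundamental_group T x =
     \<lparr>carrier = loops_at T x // loop_homotopy_rel T x,
      monoid.mult = (\<lambda>a b. \<Union>f\<in>a. \<Union>g\<in>b. loop_class T x (loop_join f g)),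
      one = loop_class T x (\<lambda>_. x)\<rparr>"

text \<open>The map induced by \<open>\<phi>\<close> from loop classes to loop classes in \<open>T\<close> based at \<open>y\<close>, where \<open>\<phi>\<close> takes
  the base point of the source to \<open>y\<close>.\<close>

definition induced_map ::
  "'b topology \<Rightarrow> 'b \<Rightarrow> ('a \<Rightarrow> 'b) \<Rightarrow> (real \<Rightarrow> 'a) set \<Rightarrow> (real \<Rightarrow> 'b) set" where
  "induced_map T y \<phi> a = (\<Union>g\<in>a. loop_class T y (\<phi> \<circ> g))"


section \<open>Groups\<close>

definition group_center :: "('a, 'b) monoid_scheme \<Rightarrow> 'a set" where
  "group_center G = {z \<in> carrier G. \<forall>g\<in>carrier G. z \<otimes>\<^bsub>G\<^esub> g = g \<otimes>\<^bsub>G\<^esub> z}"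

definition free_abelian_of_rank :: "nat \<Rightarrow> (nat \<Rightarrow> int) monoid" where
  "free_abelian_of_rank N = product_group {..<N} (\<lambda>_. integer_group)"

definition abelian_subgroup :: "'a set \<Rightarrow> ('a, 'b) monoid_scheme \<Rightarrow> bool" where
  "abelian_subgroup A G \<longleftrightarrow> subgroup A G \<and> (\<forall>a\<in>A. \<forall>b\<in>A. a \<otimes>\<^bsub>G\<^esub> b = b \<otimes>\<^bsub>G\<^esub> a)"

definition maximal_abelian_subgroup :: "'a set \<Rightarrow> ('a, 'b) monoid_scheme \<Rightarrow> bool" where
  "maximal_abelian_subgroup A G \<longleftrightarrow>
     abelian_subgroup A G \<and> (\<forall>H. abelian_subgroup H G \<and> A \<subseteq> H \<longrightarrow> H = A)"

text \<open>\<open>i\<close> and \<open>p\<close> are the maps of a short exact sequence \<open>1 \<rightarrow> \<int>\<^sup>N \<rightarrow> \<Gamma> \<rightarrow> \<Phi> \<rightarrow> 1\<close>.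
  The library's \<open>exact_seq\<close> requires all its groups to have the same element type.\<close>

definition crystallographic ::
  "('a, 'b) monoid_scheme \<Rightarrow> nat \<Rightarrow> ('c, 'd) monoid_scheme \<Rightarrow> bool" where
  "crystallographic \<Gamma> N \<Phi> \<longleftrightarrow> group \<Gamma> \<and> group \<Phi> \<and> finite (carrier \<Phi>) \<and>
     (\<exists>i p. i \<in> mon (free_abelian_of_rank N) \<Gamma> \<and> p \<in> epi \<Gamma> \<Phi> \<and>
        i ` carrier (free_abelian_of_rank N) = kernel \<Gamma> \<Phi> p \<and>
        maximal_abelian_subgroup (i ` carrier (free_abelian_of_rank N)) \<Gamma>)"


section \<open>Complex reflection groups\<close>

definition general_linear_group :: "(complex^'n^'n) monoid" where
  "general_linear_group = \<lparr>carrier = {A. invertible A}, monoid.mult = (**), one = mat 1\<rparr>"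

definition matrix_group :: "(complex^'n^'n) set \<Rightarrow> (complex^'n^'n) monoid" where
  "matrix_group W = general_linear_group\<lparr>carrier := W\<rparr>"

definition is_hyperplane :: "(complex^'n) set \<Rightarrow> bool" where
  "is_hyperplane H \<longleftrightarrow> vec.subspace H \<and> vec.dim H + 1 = CARD('n)"

definition is_reflection :: "complex^'n^'n \<Rightarrow> bool" where
  "is_reflection s \<longleftrightarrow> s \<noteq> mat 1 \<and> (\<exists>H. is_hyperplane H \<and> (\<forall>v\<in>H. s *v v = v))"

definition complex_reflection_group :: "(complex^'n^'n) set \<Rightarrow> bool" where
  "complex_reflection_group W \<longleftrightarrow> subgroup W general_linear_group \<and> finite W \<and>
     generate general_linear_group {s \<in> W. is_reflection s} = W"

definition reflecting_hyperplanes :: "(complex^'n^'n) set \<Rightarrow> (complex^'n) set set" where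
  "reflecting_hyperplanes W = {{v. (s - mat 1) *v v = 0} | s. s \<in> W \<and> is_reflection s}"

text \<open>For \<open>U = UNIV\<close> this is the space \<open>X\<close>. The parameter \<open>U\<close> is needed for a component \<open>W\<^sub>k\<close> of \<open>W\<close>
  acting on the subspace \<open>V\<^sub>k\<close>: elements of \<open>W\<^sub>k\<close> act trivially on a complement of \<open>V\<^sub>k\<close>, so the
  reflecting hyperplanes of \<open>W\<^sub>k\<close> in \<open>V\<^sub>k\<close> are the intersections with \<open>V\<^sub>k\<close> of those in the whole space.\<close>

definition hyperplane_complement :: "(complex^'n) set \<Rightarrow> (complex^'n^'n) set \<Rightarrow> (complex^'n) set" where
  "hyperplane_complement U W = U - \<Union>(reflecting_hyperplanes W)"

definition orbit_of :: "(complex^'n^'n) set \<Rightarrow> complex^'n \<Rightarrow> (complex^'n) set" where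
  "orbit_of W x = (\<lambda>w. w *v x) ` W"

definition orbit_space :: "(complex^'n) set \<Rightarrow> (complex^'n^'n) set \<Rightarrow> (complex^'n) set topology" where
  "orbit_space Y W =
     topology (\<lambda>U. U \<subseteq> orbit_of W ` Y \<and> openin (top_of_set Y) {y \<in> Y. orbit_of W y \<in> U})"

lemma openin_orbit_space:
  "openin (orbit_space Y W) U \<longleftrightarrow>
     U \<subseteq> orbit_of W ` Y \<and> openin (top_of_set Y) {y \<in> Y. orbit_of W y \<in> U}"
proof -
  have "istopology (\<lambda>U. U \<subseteq> orbit_of W ` Y \<and> openin (top_of_set Y) {y \<in> Y. orbit_of W y \<in> U})"
    unfolding istopology_def
  proof (intro conjI allI impI; (elim conjE)?)
    fix S T
    assume "openin (top_of_set Y) {y \<in> Y. orbit_of W y \<in> S}"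
      and "openin (top_of_set Y) {y \<in> Y. orbit_of W y \<in> T}"
    then have "openin (top_of_set Y) ({y \<in> Y. orbit_of W y \<in> S} \<inter> {y \<in> Y. orbit_of W y \<in> T})"
      by (rule openin_Int)
    also have "{y \<in> Y. orbit_of W y \<in> S} \<inter> {y \<in> Y. orbit_of W y \<in> T} = {y \<in> Y. orbit_of W y \<in> S \<inter> T}"
      by auto
    finally show "openin (top_of_set Y) {y \<in> Y. orbit_of W y \<in> S \<inter> T}" .
  next
    fix K
    assume K: "\<forall>S\<in>K. S \<subseteq> orbit_of W ` Y \<and> openin (top_of_set Y) {y \<in> Y. orbit_of W y \<in> S}"
    then have "openin (top_of_set Y) (\<Union>S\<in>K. {y \<in> Y. orbit_of W y \<in> S})"
      by (intro openin_Union) auto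
    also have "(\<Union>S\<in>K. {y \<in> Y. orbit_of W y \<in> S}) = {y \<in> Y. orbit_of W y \<in> \<Union>K}"
      by auto
    finally show "openin (top_of_set Y) {y \<in> Y. orbit_of W y \<in> \<Union>K}" .
  qed auto
  then show ?thesis
    unfolding orbit_space_def by simp
qed

lemma quotient_map_orbit_space:
  "quotient_map (top_of_set Y) (orbit_space Y W) (orbit_of W)"
proof -
  have "topspace (orbit_space Y W) = orbit_of W ` Y"
  proof
    show "orbit_of W ` Y \<subseteq> topspace (orbit_space Y W)"
      by (rule openin_subset) (auto simp: openin_orbit_space cong: conj_cong)
    show "topspace (orbit_space Y W) \<subseteq> orbit_of W ` Y"
      using openin_topspace openin_orbit_space by blast
  qed
  then show ?thesis
    by (auto simp: quotient_map_def openin_orbit_space)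
qed


section \<open>Braid groups\<close>

definition braid_group ::
  "(complex^'n) set \<Rightarrow> (complex^'n^'n) set \<Rightarrow> complex^'n \<Rightarrow> (real \<Rightarrow> (complex^'n) set) set monoid" where
  "braid_group U W x = fundamental_group (orbit_space (hyperplane_complement U W) W) (orbit_of W x)"

definition pure_braid_group ::
  "(complex^'n^'n) set \<Rightarrow> complex^'n \<Rightarrow> (real \<Rightarrow> complex^'n) set monoid" where
  "pure_braid_group W x0 = fundamental_group (top_of_set (hyperplane_complement UNIV W)) x0"

definition pure_to_braid ::
  "(complex^'n^'n) set \<Rightarrow> complex^'n \<Rightarrow> (real \<Rightarrow> complex^'n) set \<Rightarrow> (real \<Rightarrow> (complex^'n) set) set" where
  "pure_to_braid W x0 =
     induced_map (orbit_space (hyperplane_complement UNIV W) W) (orbit_of W x0) (orbit_of W)"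

text \<open>The map \<open>B \<rightarrow> W\<close>: lift a loop of \<open>X/W\<close> to a path of \<open>X\<close> starting at \<open>x0\<close>; it ends at \<open>w x0\<close>.\<close>

definition braid_to_reflection_group ::
  "(complex^'n^'n) set \<Rightarrow> complex^'n \<Rightarrow> (real \<Rightarrow> (complex^'n) set) set \<Rightarrow> complex^'n^'n" where
  "braid_to_reflection_group W x0 b = (THE w. w \<in> W \<and>
     (\<exists>g. continuous_map (top_of_set {0..1}) (top_of_set (hyperplane_complement UNIV W)) g \<and>
          g 0 = x0 \<and> g 1 = w *v x0 \<and> orbit_of W \<circ> g \<in> b))"

text \<open>The image in \<open>B\<close> of the commutator subgroup of \<open>P\<close>.\<close>

definition pure_commutator ::
  "(complex^'n^'n) set \<Rightarrow> complex^'n \<Rightarrow> (real \<Rightarrow> (complex^'n) set) set set" where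
  "pure_commutator W x0 =
     pure_to_braid W x0 ` derived (pure_braid_group W x0) (carrier (pure_braid_group W x0))"

definition braid_mod_pure_commutator ::
  "(complex^'n^'n) set \<Rightarrow> complex^'n \<Rightarrow> (real \<Rightarrow> (complex^'n) set) set set monoid" where
  "braid_mod_pure_commutator W x0 = braid_group UNIV W x0 Mod pure_commutator W x0"

definition braid_to_quotient ::
  "(complex^'n^'n) set \<Rightarrow> complex^'n \<Rightarrow> (real \<Rightarrow> (complex^'n) set) set \<Rightarrow>
     (real \<Rightarrow> (complex^'n) set) set set" where
  "braid_to_quotient W x0 b = pure_commutator W x0 #>\<^bsub>braid_group UNIV W x0\<^esub> b"

definition pure_abelianization ::
  "(complex^'n^'n) set \<Rightarrow> complex^'n \<Rightarrow> (real \<Rightarrow> (complex^'n) set) set set set" where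
  "pure_abelianization W x0 =
     braid_to_quotient W x0 ` pure_to_braid W x0 ` carrier (pure_braid_group W x0)"

definition central_quotient :: "(complex^'n^'n) set \<Rightarrow> (complex^'n^'n) set monoid" where
  "central_quotient W = matrix_group W Mod group_center (matrix_group W)"

text \<open>\<open>B \<rightarrow> W\<close> is constant on cosets of \<open>(P,P)\<close>, whence \<open>the_elem\<close>.\<close>

definition quotient_projection ::
  "(complex^'n^'n) set \<Rightarrow> complex^'n \<Rightarrow> (real \<Rightarrow> (complex^'n) set) set set \<Rightarrow> (complex^'n^'n) set" where
  "quotient_projection W x0 c =
     group_center (matrix_group W) #>\<^bsub>matrix_group W\<^esub> the_elem (braid_to_reflection_group W x0 ` c)"


section \<open>Irreducible components and the central subgroup of the braid group\<close>

definition acts_irreducibly :: "(complex^'n^'n) set \<Rightarrow> (complex^'n) set \<Rightarrow> bool" where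
  "acts_irreducibly W V \<longleftrightarrow> vec.subspace V \<and> V \<noteq> {0} \<and> (\<forall>w\<in>W. (*v) w ` V \<subseteq> V) \<and>
     (\<forall>U. vec.subspace U \<and> U \<subseteq> V \<and> (\<forall>w\<in>W. (*v) w ` U \<subseteq> U) \<longrightarrow> U = {0} \<or> U = V)"

text \<open>
  \<open>W = Wc 0 \<times> \<dots> \<times> Wc (r - 1)\<close> as an internal direct product, and the whole space is the direct sum of
  \<open>V 0, \<dots>, V (r - 1)\<close>. Vectors fixed by \<open>W\<close> are accounted for by lines \<open>V k\<close> with trivial \<open>Wc k\<close>.
\<close>

definition irreducible_decomposition ::
  "(complex^'n^'n) set \<Rightarrow> nat \<Rightarrow> (nat \<Rightarrow> (complex^'n) set) \<Rightarrow> (nat \<Rightarrow> (complex^'n^'n) set) \<Rightarrow> bool" where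
  "irreducible_decomposition W r V Wc \<longleftrightarrow>
     (\<forall>k<r. subgroup (Wc k) (matrix_group W)) \<and>
     (\<lambda>g. foldr (\<lambda>k A. g k ** A) [0..<r] (mat 1))
       \<in> iso (product_group {..<r} (\<lambda>k. matrix_group (Wc k))) (matrix_group W) \<and>
     (\<forall>x. \<exists>!v. v \<in> (\<Pi>\<^sub>E k\<in>{..<r}. V k) \<and> x = (\<Sum>k<r. v k)) \<and>
     (\<forall>k<r. acts_irreducibly (Wc k) (V k)) \<and>
     (\<forall>k<r. \<forall>j<r. j \<noteq> k \<longrightarrow> (\<forall>w\<in>Wc k. \<forall>v\<in>V j. w *v v = v))"

definition direct_sum_component :: "nat \<Rightarrow> (nat \<Rightarrow> (complex^'n) set) \<Rightarrow> complex^'n \<Rightarrow> nat \<Rightarrow> complex^'n" where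
  "direct_sum_component r V x = (THE v. v \<in> (\<Pi>\<^sub>E k\<in>{..<r}. V k) \<and> x = (\<Sum>k<r. v k))"

text \<open>The element \<open>\<^bold>z\<close> of the braid group of an irreducible \<open>G\<close> acting on \<open>U\<close>.\<close>

definition central_braid ::
  "(complex^'n) set \<Rightarrow> (complex^'n^'n) set \<Rightarrow> complex^'n \<Rightarrow> (real \<Rightarrow> (complex^'n) set) set" where
  "central_braid U G x = loop_class (orbit_space (hyperplane_complement U G) G) (orbit_of G x)
     (\<lambda>t. orbit_of G
        (exp (2 * of_real pi * \<i> * of_real t / of_nat (card (group_center (matrix_group G)))) *s x))"

text \<open>The inclusion of the factor \<open>B\<^sub>k\<close> in \<open>B = B\<^sub>1 \<times> \<dots> \<times> B\<^sub>r\<close>. It is induced by the map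
  \<open>X\<^sub>k/W\<^sub>k \<rightarrow> X/W\<close> that fills the other coordinates with those of the base point. All the points
  \<open>y + (x0 - x\<^sub>k)\<close> with \<open>y\<close> in one \<open>W\<^sub>k\<close>-orbit have the same \<open>W\<close>-orbit.\<close>

definition component_braid_inclusion ::
  "(complex^'n^'n) set \<Rightarrow> complex^'n \<Rightarrow> nat \<Rightarrow> (nat \<Rightarrow> (complex^'n) set) \<Rightarrow> nat \<Rightarrow>
     (real \<Rightarrow> (complex^'n) set) set \<Rightarrow> (real \<Rightarrow> (complex^'n) set) set" where
  "component_braid_inclusion W x0 r V k =
     induced_map (orbit_space (hyperplane_complement UNIV W) W) (orbit_of W x0)
       (\<lambda>c. \<Union>y\<in>c. orbit_of W (y + (x0 - direct_sum_component r V x0 k)))"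

definition central_braid_subgroup ::
  "(complex^'n^'n) set \<Rightarrow> complex^'n \<Rightarrow> nat \<Rightarrow> (nat \<Rightarrow> (complex^'n) set) \<Rightarrow>
     (nat \<Rightarrow> (complex^'n^'n) set) \<Rightarrow> (real \<Rightarrow> (complex^'n) set) set set" where
  "central_braid_subgroup W x0 r V Wc = generate (braid_group UNIV W x0)
     {component_braid_inclusion W x0 r V k (central_braid (V k) (Wc k) (direct_sum_component r V x0 k)) | k. k < r}"

definition P0_subgroup ::
  "(complex^'n^'n) set \<Rightarrow> complex^'n \<Rightarrow> nat \<Rightarrow> (nat \<Rightarrow> (complex^'n) set) \<Rightarrow>
     (nat \<Rightarrow> (complex^'n^'n) set) \<Rightarrow> (real \<Rightarrow> (complex^'n) set) set set set" where
  "P0_subgroup W x0 r V Wc = generate (braid_mod_pure_commutator W x0)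
     (pure_abelianization W x0 \<union> braid_to_quotient W x0 ` central_braid_subgroup W x0 r V Wc)"

end

theory Submission
  imports Defs "HOL-Complex_Analysis.Conformal_Mappings"
begin


section \<open>Linear forms and polynomial functions\<close>

definition form :: "complex^'n \<Rightarrow> complex^'n \<Rightarrow> complex" where
  "form a v = (\<Sum>i\<in>UNIV. a $ i * v $ i)"

lemma form_add [simp]: "form a (v + w) = form a v + form a w"
  by (simp add: form_def algebra_simps sum.distrib)

lemma form_diff [simp]: "form a (v - w) = form a v - form a w"
  by (simp add: form_def algebra_simps sum_subtractf)

lemma form_scale [simp]: "form a (c *s v) = c * form a v"
  by (simp add: form_def sum_distrib_left algebra_simps)

lemma form_0 [simp]: "form a 0 = 0" "form 0 v = 0"
  by (simp_all add: form_def)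

lemma form_uminus [simp]: "form a (- v) = - form a v"
  by (simp add: form_def sum_negf)

lemma form_scaleR [simp]: "form a (r *\<^sub>R v) = r *\<^sub>R form a v"
  by (simp add: form_def scaleR_sum_right)

lemma form_sum: "form a (\<Sum>k\<in>K. f k) = (\<Sum>k\<in>K. form a (f k))"
  by (induction K rule: infinite_finite_induct) auto

lemma form_left_diff: "form (a - b) v = form a v - form b v"
  by (simp add: form_def algebra_simps sum_subtractf)

lemma form_left_scale: "form (c *s a) v = c * form a v"
  by (simp add: form_def sum_distrib_left algebra_simps)

lemma form_axis: "form a (axis i c) = a $ i * c"
  by (simp add: form_def axis_def if_distrib cong: if_cong)

lemma form_mult_vec: "form a (A *v v) = form (a v* A) v"
  unfolding form_def matrix_vector_mult_def vector_matrix_mult_def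
  by (simp add: sum_distrib_left sum_distrib_right, subst sum.swap, simp add: mult_ac)

lemma matrix_vector_nth: "(A *v v) $ i = form (A $ i) v"
  by (simp add: matrix_vector_mult_def form_def)

lemma form_nonzero: "a \<noteq> 0 \<Longrightarrow> \<exists>v. form a v = 1"
proof -
  assume "a \<noteq> 0"
  then obtain i where "a $ i \<noteq> 0"
    by (auto simp: vec_eq_iff)
  then show ?thesis
    by (intro exI[of _ "axis i (1 / a $ i)"]) (simp add: form_axis)
qed

lemma continuous_on_form [continuous_intros]:
  "continuous_on S f \<Longrightarrow> continuous_on S (\<lambda>x. form a (f x))"
  unfolding form_def by (intro continuous_intros)

lemma subspace_form_kernel: "vec.subspace {v. form a v = 0}"
  by (auto simp: vec.subspace_def)

lemma exists_avoiding_forms: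
  assumes "finite S" "0 \<notin> S"
  shows "\<exists>v. \<forall>a\<in>S. form a v \<noteq> 0"
  using assms
proof (induction S)
  case (insert a S)
  then obtain v where v: "\<forall>b\<in>S. form b v \<noteq> 0"
    by auto
  obtain c where c: "form a c = 1"
    using form_nonzero insert.prems by auto
  let ?bad = "insert (- form a v) ((\<lambda>b. - form b v / form b c) ` S)"
  obtain t where t: "t \<notin> ?bad"
    using ex_new_if_finite[OF infinite_UNIV_char_0, of ?bad] insert.hyps by blast
  have "form b (v + t *s c) \<noteq> 0" if "b \<in> insert a S" for b
  proof (cases "b = a")
    case True
    with t c show ?thesis by (auto simp: eq_neg_iff_add_eq_0 add.commute)
  next
    case False
    then have b: "b \<in> S" using that by auto
    show ?thesis
    proof
      assume e: "form b (v + t *s c) = 0"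
      then have "form b c \<noteq> 0" using v b by auto
      then have "t = - form b v / form b c"
        using e by (simp add: field_simps eq_neg_iff_add_eq_0)
      then show False using t b by auto
    qed
  qed
  then show ?case by blast
qed auto

lemma hyperplane_form_kernel:
  fixes a :: "complex^'n"
  assumes "a \<noteq> 0"
  shows "is_hyperplane {v. form a v = 0}"
proof -
  obtain c where c: "form a c = 1" using form_nonzero[OF assms] by auto
  let ?H = "{v. form a v = 0}"
  have sp: "vec.span ?H = ?H"
    by (simp add: subspace_form_kernel)
  have "x \<in> vec.span (insert c ?H)" for x
    by (auto simp: vec.span_insert sp c intro!: exI[of _ "form a x"])
  then have "vec.span (insert c ?H) = UNIV" by auto
  then have "vec.dim (insert c ?H) = CARD('n)"
    by (metis vec.dim_span vec.dim_UNIV vec.dimension_def card_cart_basis)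
  moreover have "c \<notin> vec.span ?H" by (subst sp) (simp add: c)
  ultimately show ?thesis
    using vec.dim_insert[of c ?H] by (simp add: is_hyperplane_def subspace_form_kernel)
qed

lemma hyperplane_is_form_kernel:
  fixes H :: "(complex^'n) set"
  assumes "is_hyperplane H"
  obtains a where "a \<noteq> 0" "H = {v. form a v = 0}"
proof -
  have sub: "vec.subspace H" and dm: "vec.dim H + 1 = CARD('n)"
    using assms by (auto simp: is_hyperplane_def)
  have spH: "vec.span H = H" using sub by simp
  have "H \<noteq> UNIV"
    using dm by (metis vec.dim_UNIV vec.dimension_def card_cart_basis n_not_Suc_n Suc_eq_plus1)
  then obtain c where c: "c \<notin> H" by auto
  obtain B where B: "B \<subseteq> H" "vec.independent B" "H \<subseteq> vec.span B"
    using vec.basis_exists[of H] by metis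
  have spB: "vec.span B = H"
    using B spH by (metis vec.span_mono subset_antisym)
  have ind: "vec.independent (insert c B)"
    using c spB B(2) by (auto simp: vec.independent_insert)
  have "vec.dim (insert c H) = CARD('n)"
    using vec.dim_insert[of c H] c spH dm by auto
  then have "vec.span (insert c H) = UNIV"
    by (metis vec.dim_eq_full vec.dim_UNIV vec.dimension_def card_cart_basis)
  then have full: "\<exists>k. x - k *s c \<in> H" for x
    using vec.span_insert[of c H] spH by auto
  obtain f where f: "Vector_Spaces.linear (*s) (*s) f"
      and fB: "\<forall>x\<in>insert c B. f x = (if x = c then c else 0)"
    using vec.linear_independent_extend[OF ind, of "\<lambda>x. if x = c then c else 0"] by blast
  have cB: "c \<notin> B" using c spB vec.span_superset by blast
  have fB0: "f y = 0" if "y \<in> B" for y using fB cB that by (metis insertI2)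
  have f0: "f x = 0" if "x \<in> H" for x
  proof -
    have "x \<in> vec.span B" using that spB by simp
    then show ?thesis
      using fB0 by (metis vec.linear_eq_0_on_span[OF f])
  qed
  have fc: "f c = c" using fB by simp
  have "c \<noteq> 0" using c sub by (auto simp: vec.subspace_def)
  then obtain i where i: "c $ i \<noteq> 0" by (auto simp: vec_eq_iff)
  define a where "a = matrix f $ i"
  have fa: "form a v = f v $ i" for v
    using matrix_works[OF f] by (simp add: a_def matrix_vector_nth[symmetric])
  have "H = {v. form a v = 0}"
  proof (intro equalityI subsetI)
    fix v assume "v \<in> {v. form a v = 0}"
    then have "f v $ i = 0" using fa by auto
    obtain k where k: "v - k *s c \<in> H" using full by blast
    have "f (v - k *s c) = f v - k *s c"
      using f fc by (simp add: vec.linear_diff vec.linear_scale)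
    then have "f v = k *s c" using f0[OF k] by simp
    then have "k = 0" using \<open>f v $ i = 0\<close> i by simp
    then show "v \<in> H" using k by simp
  qed (simp add: fa f0)
  moreover have "a \<noteq> 0"
    using fa[of c] fc i by auto
  ultimately show ?thesis using that by blast
qed

inductive_set poly_fun :: "(complex^'n \<Rightarrow> complex) set" where
  const: "(\<lambda>_. c) \<in> poly_fun"
| coord: "(\<lambda>v. v $ i) \<in> poly_fun"
| add: "f \<in> poly_fun \<Longrightarrow> g \<in> poly_fun \<Longrightarrow> (\<lambda>v. f v + g v) \<in> poly_fun"
| mult: "f \<in> poly_fun \<Longrightarrow> g \<in> poly_fun \<Longrightarrow> (\<lambda>v. f v * g v) \<in> poly_fun"

lemma poly_fun_sum: "(\<And>k. k \<in> K \<Longrightarrow> f k \<in> poly_fun) \<Longrightarrow> (\<lambda>v. \<Sum>k\<in>K. f k v) \<in> poly_fun"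
  by (induction K rule: infinite_finite_induct) (auto intro: poly_fun.intros)

lemma poly_fun_prod: "(\<And>k. k \<in> K \<Longrightarrow> f k \<in> poly_fun) \<Longrightarrow> (\<lambda>v. \<Prod>k\<in>K. f k v) \<in> poly_fun"
  by (induction K rule: infinite_finite_induct) (auto intro: poly_fun.intros)

lemma poly_fun_form: "(\<lambda>v. form a v) \<in> poly_fun"
  unfolding form_def by (intro poly_fun_sum poly_fun.intros)

lemma poly_fun_comp_matrix: "f \<in> poly_fun \<Longrightarrow> (\<lambda>v. f (A *v v)) \<in> poly_fun"
  by (induction rule: poly_fun.induct)
     (auto intro: poly_fun.intros simp: matrix_vector_nth poly_fun_form)

lemma continuous_on_poly_fun: "f \<in> poly_fun \<Longrightarrow> continuous_on S f"
  by (induction rule: poly_fun.induct) (auto intro!: continuous_intros)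

lemma poly_fun_on_line: "f \<in> poly_fun \<Longrightarrow> \<exists>P. \<forall>t. f (v + t *s u) = poly P t"
proof (induction rule: poly_fun.induct)
  case (const c)
  show ?case by (rule exI[of _ "[:c:]"]) simp
next
  case (coord i)
  show ?case by (rule exI[of _ "[:v $ i, u $ i:]"]) simp
next
  case (add f g)
  then show ?case by (metis poly_add)
next
  case (mult f g)
  then show ?case by (metis poly_mult)
qed

lemma poly_fun_cancel:
  assumes "p \<in> poly_fun" "f \<in> poly_fun" "p v0 \<noteq> 0" "\<And>v. p v * f v = 0"
  shows "f v = 0"
proof -
  obtain P where P: "\<And>t. p (v + t *s (v0 - v)) = poly P t"
    using poly_fun_on_line[OF assms(1)] by metis
  obtain F where F: "\<And>t. f (v + t *s (v0 - v)) = poly F t"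
    using poly_fun_on_line[OF assms(2)] by metis
  have "poly (P * F) t = 0" for t
    using assms(4) P F by (metis poly_mult)
  then have "P * F = 0" using poly_all_0_iff_0 by blast
  moreover have "P \<noteq> 0" using P[of 1] assms(3) by auto
  ultimately have "F = 0" by simp
  then show ?thesis using F[of 0] by simp
qed

lemma poly_fun_interpolate:
  assumes "finite T" "v \<notin> T"
  shows "\<exists>h\<in>poly_fun. h v = 1 \<and> (\<forall>u\<in>T. h u = 0)"
  using assms
proof (induction T)
  case empty
  show ?case by (rule bexI[of _ "\<lambda>_. 1"]) (auto intro: poly_fun.const)
next
  case (insert u T)
  then obtain h where h: "h \<in> poly_fun" "h v = 1" "\<forall>u\<in>T. h u = 0" by auto
  obtain i where i: "v $ i \<noteq> u $ i" using insert.prems by (auto simp: vec_eq_iff)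
  let ?k = "\<lambda>x. (x $ i + (- u $ i)) * (1 / (v $ i - u $ i))"
  have "?k \<in> poly_fun" by (intro poly_fun.intros)
  then have 1: "(\<lambda>x. h x * ?k x) \<in> poly_fun" using h(1) by (rule poly_fun.mult[rotated])
  have "h v * ?k v = 1 \<and> (\<forall>w\<in>insert u T. h w * ?k w = 0)" using h i by auto
  then show ?case using 1 by (rule bexI[where x = "\<lambda>x. h x * ?k x"])
qed

text \<open>Homogeneity is recorded by an integer degree, so that a difference of degrees never has to be
  truncated: the homogeneous functions of negative degree are just zero.\<close>

definition hom_poly :: "int \<Rightarrow> (complex^'n \<Rightarrow> complex) set" where
  "hom_poly k = {f \<in> poly_fun. \<forall>t v. t \<noteq> 0 \<longrightarrow> f (t *s v) = t powi k * f v}"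

lemma hom_poly_poly_fun: "f \<in> hom_poly k \<Longrightarrow> f \<in> poly_fun"
  by (simp add: hom_poly_def)

lemma hom_poly_zero: "(\<lambda>_. 0) \<in> hom_poly k"
  by (simp add: hom_poly_def poly_fun.const)

lemma hom_poly_const: "(\<lambda>_. c) \<in> hom_poly 0"
  by (simp add: hom_poly_def poly_fun.const)

lemma hom_poly_add: "f \<in> hom_poly k \<Longrightarrow> g \<in> hom_poly k \<Longrightarrow> (\<lambda>v. f v + g v) \<in> hom_poly k"
  by (auto simp: hom_poly_def algebra_simps intro: poly_fun.add)

lemma hom_poly_mult: "f \<in> hom_poly k \<Longrightarrow> g \<in> hom_poly l \<Longrightarrow> (\<lambda>v. f v * g v) \<in> hom_poly (k + l)"
  by (auto simp: hom_poly_def power_int_add intro: poly_fun.mult)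

lemma hom_poly_cmult: "f \<in> hom_poly k \<Longrightarrow> (\<lambda>v. c * f v) \<in> hom_poly k"
  using hom_poly_mult[OF hom_poly_const] by fastforce

lemma hom_poly_diff: "f \<in> hom_poly k \<Longrightarrow> g \<in> hom_poly k \<Longrightarrow> (\<lambda>v. f v - g v) \<in> hom_poly k"
  using hom_poly_add[OF _ hom_poly_cmult[of g k "-1"], of f] by simp

lemma hom_poly_sum:
  "(\<And>j. j \<in> J \<Longrightarrow> f j \<in> hom_poly k) \<Longrightarrow> (\<lambda>v. \<Sum>j\<in>J. f j v) \<in> hom_poly k"
  by (induction J rule: infinite_finite_induct) (auto intro: hom_poly_zero hom_poly_add)

lemma hom_poly_prod:
  "(\<And>j. j \<in> J \<Longrightarrow> f j \<in> hom_poly (e j)) \<Longrightarrow> finite J \<Longrightarrow> (\<lambda>v. \<Prod>j\<in>J. f j v) \<in> hom_poly (\<Sum>j\<in>J. e j)"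
  by (induction J rule: infinite_finite_induct) (auto intro: hom_poly_const hom_poly_mult)

lemma hom_poly_comp_matrix: "f \<in> hom_poly k \<Longrightarrow> (\<lambda>v. f (A *v v)) \<in> hom_poly k"
  by (auto simp: hom_poly_def poly_fun_comp_matrix vector_scalar_commute)

lemma hom_poly_radial_limit:
  fixes f :: "complex^'n \<Rightarrow> complex"
  assumes "f \<in> hom_poly k"
  shows "(\<lambda>n. f (of_real (inverse (real (Suc n))) *s v)) \<longlonglongrightarrow> f 0"
proof -
  have 1: "(\<lambda>n. (of_real (inverse (real (Suc n))) :: complex) *s v) \<longlonglongrightarrow> 0"
  proof (rule vec_tendstoI)
    fix i
    have "(\<lambda>n. (of_real (inverse (real (Suc n))) :: complex)) \<longlonglongrightarrow> of_real 0"
      by (intro tendsto_of_real LIMSEQ_inverse_real_of_nat)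
    then show "(\<lambda>n. ((of_real (inverse (real (Suc n))) :: complex) *s v) $ i) \<longlonglongrightarrow> (0::complex^'n) $ i"
      using tendsto_mult_left_zero[of _ sequentially "v $ i"] by simp
  qed
  have "isCont f 0"
    using continuous_on_poly_fun[OF hom_poly_poly_fun[OF assms], of UNIV]
    by (simp add: continuous_on_eq_continuous_at)
  from isCont_tendsto_compose[OF this 1] show ?thesis .
qed

lemma hom_poly_degree_zero:
  fixes f :: "complex^'n \<Rightarrow> complex"
  assumes "f \<in> hom_poly 0"
  shows "f v = f 0"
proof -
  have "f (of_real (inverse (real (Suc n))) *s v) = f v" for n
  proof -
    have "(of_real (inverse (real (Suc n))) :: complex) \<noteq> 0"
      by (metis inverse_nonzero_iff_nonzero nat.simps(3) of_nat_eq_0_iff of_real_eq_0_iff)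
    then show ?thesis using assms unfolding hom_poly_def by auto
  qed
  with hom_poly_radial_limit[OF assms, of v] have "(\<lambda>n. f v) \<longlonglongrightarrow> f 0" by simp
  then show ?thesis by (simp add: LIMSEQ_const_iff)
qed

lemma hom_poly_degree_negative:
  fixes f :: "complex^'n \<Rightarrow> complex"
  assumes f: "f \<in> hom_poly k" and "k < 0"
  shows "f v = 0"
proof -
  define m where "m = nat (- k)"
  have m: "m > 0" "k = - int m" using \<open>k < 0\<close> by (auto simp: m_def)
  define t where "t n = (of_real (inverse (real (Suc n))) :: complex)" for n
  have t0: "t n \<noteq> 0" for n
    unfolding t_def by (metis inverse_nonzero_iff_nonzero nat.simps(3) of_nat_eq_0_iff of_real_eq_0_iff)
  have "f v = t n ^ m * f (t n *s v)" for n
  proof -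
    have "f (t n *s v) = t n powi k * f v"
      using f t0 unfolding hom_poly_def by auto
    then show ?thesis using t0[of n] by (simp add: m power_int_minus)
  qed
  moreover have "(\<lambda>n. t n ^ m * f (t n *s v)) \<longlonglongrightarrow> 0 ^ m * f 0"
  proof (intro tendsto_mult tendsto_power)
    have "(\<lambda>n. (of_real (inverse (real (Suc n))) :: complex)) \<longlonglongrightarrow> of_real 0"
      by (intro tendsto_of_real LIMSEQ_inverse_real_of_nat)
    then show "t \<longlonglongrightarrow> 0" unfolding t_def by simp
    show "(\<lambda>n. f (t n *s v)) \<longlonglongrightarrow> f 0"
      using hom_poly_radial_limit[OF f] unfolding t_def .
  qed
  ultimately have "(\<lambda>n::nat. f v) \<longlonglongrightarrow> 0 ^ m * f 0" by simp
  then show ?thesis using m by (simp add: LIMSEQ_const_iff)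
qed

text \<open>The additive span of the homogeneous functions is closed under products, so every polynomial
  function is a sum of homogeneous ones.\<close>

inductive_set hom_span :: "(complex^'n \<Rightarrow> complex) set" where
  hom: "f \<in> hom_poly k \<Longrightarrow> f \<in> hom_span"
| add: "f \<in> hom_span \<Longrightarrow> g \<in> hom_span \<Longrightarrow> (\<lambda>v. f v + g v) \<in> hom_span"

lemma hom_span_mult:
  assumes "f \<in> hom_span" "g \<in> hom_span"
  shows "(\<lambda>v. f v * g v) \<in> hom_span"
  using assms(1)
proof (induction rule: hom_span.induct)
  case (hom f k)
  show ?case using assms(2)
  proof (induction rule: hom_span.induct)
    case (hom g l)
    with \<open>f \<in> hom_poly k\<close> show ?case by (intro hom_span.hom[of _ "k + l"] hom_poly_mult)
  next
    case (add g h)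
    then show ?case using hom_span.add[OF add.IH] by (simp add: algebra_simps)
  qed
next
  case (add f h)
  then show ?case using hom_span.add[OF add.IH] by (simp add: algebra_simps)
qed

lemma poly_fun_hom_span: "f \<in> poly_fun \<Longrightarrow> f \<in> hom_span"
proof (induction rule: poly_fun.induct)
  case (const c)
  show ?case by (rule hom_span.hom[OF hom_poly_const])
next
  case (coord i)
  show ?case by (rule hom_span.hom[of _ 1]) (auto simp: hom_poly_def poly_fun.coord)
qed (auto intro: hom_span.add hom_span_mult)


section \<open>Reflections\<close>

lemma reflection_form:
  fixes s :: "complex^'n^'n"
  assumes "is_reflection s"
  obtains a b where "a \<noteq> 0" "b \<noteq> 0" "\<And>v. s *v v = v + form a v *s b"
    "{v. (s - mat 1) *v v = 0} = {v. form a v = 0}"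
proof -
  obtain H where H: "is_hyperplane H" "\<forall>v\<in>H. s *v v = v" and s1: "s \<noteq> mat 1"
    using assms by (auto simp: is_reflection_def)
  obtain a where a: "a \<noteq> 0" "H = {v. form a v = 0}"
    using hyperplane_is_form_kernel[OF H(1)] by blast
  obtain c where c: "form a c = 1" using form_nonzero[OF a(1)] by auto
  define b where "b = s *v c - c"
  have sv: "s *v v = v + form a v *s b" for v
  proof -
    have "v - form a v *s c \<in> H" using a c by simp
    then have "s *v (v - form a v *s c) = v - form a v *s c" using H by auto
    then show ?thesis
      by (simp add: b_def matrix_vector_mult_diff_distrib vector_scalar_commute algebra_simps
          vec.scale_right_diff_distrib)
  qed
  have b0: "b \<noteq> 0"
  proof
    assume "b = 0"
    then have "s *v v = mat 1 *v v" for v using sv by simp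
    then show False using s1 by (simp add: matrix_eq)
  qed
  have "{v. (s - mat 1) *v v = 0} = {v. form a v = 0}"
    using b0 by (auto simp: matrix_vector_mult_diff_rdistrib sv)
  then show ?thesis by (rule that[OF a(1) b0 sv])
qed

lemma divided_difference:
  assumes "f \<in> poly_fun" and s: "\<And>v. s *v v = v + form a v *s b"
  shows "\<exists>g\<in>poly_fun. \<forall>v. f v - f (s *v v) = form a v * g v"
  using assms(1)
proof (induction rule: poly_fun.induct)
  case (const c)
  show ?case by (rule bexI[OF _ poly_fun.const[of 0]]) simp
next
  case (coord i)
  show ?case by (rule bexI[OF _ poly_fun.const[of "- b $ i"]]) (simp add: s)
next
  case (add f h)
  then obtain g k where g: "g \<in> poly_fun" "\<And>v. f v - f (s *v v) = form a v * g v"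
    and k: "k \<in> poly_fun" "\<And>v. h v - h (s *v v) = form a v * k v" by blast
  have "f v + h v - (f (s *v v) + h (s *v v)) = form a v * (g v + k v)" for v
    using g(2)[of v] k(2)[of v] by (simp add: algebra_simps)
  then show ?case
    using poly_fun.add[OF g(1) k(1)] by (intro bexI[of _ "\<lambda>v. g v + k v"]) auto
next
  case (mult f h)
  then obtain g k where g: "g \<in> poly_fun" "\<And>v. f v - f (s *v v) = form a v * g v"
    and k: "k \<in> poly_fun" "\<And>v. h v - h (s *v v) = form a v * k v" by blast
  have "f v * h v - f (s *v v) * h (s *v v) = form a v * (g v * h v + f (s *v v) * k v)" for v
  proof -
    have "f v * h v - f (s *v v) * h (s *v v) = (f v - f (s *v v)) * h v + f (s *v v) * (h v - h (s *v v))"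
      by (simp add: algebra_simps)
    then show ?thesis unfolding g k by (simp add: algebra_simps)
  qed
  moreover have "(\<lambda>v. g v * h v + f (s *v v) * k v) \<in> poly_fun"
    using mult.hyps g(1) k(1) by (intro poly_fun.intros poly_fun_comp_matrix)
  ultimately show ?case by (intro bexI[of _ "\<lambda>v. g v * h v + f (s *v v) * k v"]) auto
qed

lemma divided_difference_hom:
  assumes "f \<in> hom_poly k" "a \<noteq> 0" and s: "\<And>v. s *v v = v + form a v *s b"
  shows "\<exists>g\<in>hom_poly (k - 1). \<forall>v. f v - f (s *v v) = form a v * g v"
proof -
  obtain g where g: "g \<in> poly_fun" "\<And>v. f v - f (s *v v) = form a v * g v"
    using divided_difference[OF hom_poly_poly_fun[OF assms(1)] s] by blast
  obtain c where c: "form a c = 1" using form_nonzero[OF assms(2)] by auto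
  have "g (t *s v) = t powi (k - 1) * g v" if t: "t \<noteq> 0" for t v
  proof -
    let ?f = "\<lambda>v. g (mat t *v v) + (- (t powi (k - 1))) * g v"
    have m: "mat t *v v = t *s v" for v :: "complex^'b"
      by (simp add: vec_eq_iff matrix_vector_mult_def mat_def if_distrib[of "\<lambda>x. x * _"] cong: if_cong)
    have "?f v = 0"
    proof (rule poly_fun_cancel[OF poly_fun_form[of a], of ?f c])
      show "?f \<in> poly_fun"
        by (intro poly_fun.intros poly_fun_comp_matrix g(1))
      show "form a c \<noteq> 0" using c by simp
      fix v
      have "t * (form a v * g (t *s v)) = f (t *s v) - f (s *v (t *s v))"
        using g(2)[of "t *s v"] by simp
      also have "\<dots> = t powi k * (f v - f (s *v v))"
        using assms(1) t by (simp add: hom_poly_def vector_scalar_commute algebra_simps)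
      also have "\<dots> = t powi k * (form a v * g v)"
        by (simp add: g(2))
      also have "t powi k = t * t powi (k - 1)"
        using t power_int_add[of t 1 "k - 1"] by simp
      finally have "form a v * g (t *s v) = t powi (k - 1) * (form a v * g v)"
        using t by (metis mult.assoc mult_cancel_left)
      then show "form a v * ?f v = 0"
        by (simp add: m algebra_simps)
    qed
    then show ?thesis by (simp add: m)
  qed
  then have "g \<in> hom_poly (k - 1)" using g(1) by (simp add: hom_poly_def)
  then show ?thesis using g(2) by blast
qed

lemma nonreflection_forms:
  fixes w :: "complex^'n^'n"
  assumes "w \<noteq> mat 1" "\<not> is_reflection w"
  obtains p q where "p \<noteq> 0" "\<And>c. q \<noteq> c *s p"
    "\<And>v. w *v v = v \<Longrightarrow> form p v = 0 \<and> form q v = 0"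
proof -
  define A where "A = w - mat 1"
  have fixA: "w *v v = v \<longleftrightarrow> A *v v = 0" for v
    by (simp add: A_def matrix_vector_mult_diff_rdistrib)
  have "A \<noteq> 0" using assms by (auto simp: A_def)
  then obtain i where i: "A $ i \<noteq> 0" by (auto simp: vec_eq_iff)
  have "\<exists>j. \<forall>c. A $ j \<noteq> c *s (A $ i)"
  proof (rule ccontr)
    assume "\<not> ?thesis"
    then obtain c where c: "\<And>j. A $ j = c j *s (A $ i)" by metis
    have "w *v v = v" if "form (A $ i) v = 0" for v
    proof -
      have "(A *v v) $ j = 0" for j
        by (subst matrix_vector_nth, subst c) (simp add: form_left_scale that)
      then have "A *v v = 0" by (simp add: vec_eq_iff)
      then show ?thesis by (simp add: fixA)
    qed
    then have "is_reflection w"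
      using hyperplane_form_kernel[OF i] assms(1) unfolding is_reflection_def by blast
    then show False using assms by simp
  qed
  then obtain j where "\<forall>c. A $ j \<noteq> c *s (A $ i)" by auto
  then show ?thesis
  proof (intro that[of "A $ i" "A $ j"])
    fix v assume "w *v v = v"
    then have "A *v v = 0" by (simp add: fixA)
    then show "form (A $ i) v = 0 \<and> form (A $ j) v = 0"
      by (metis matrix_vector_nth zero_index)
  qed (use i in auto)
qed

lemma group_general_linear_group: "group (general_linear_group :: (complex^'n^'n) monoid)"
proof (rule groupI)
  fix x :: "complex^'n^'n" assume "x \<in> carrier general_linear_group"
  then obtain y where "x ** y = mat 1" "y ** x = mat 1"
    by (auto simp: general_linear_group_def invertible_def)
  then show "\<exists>y\<in>carrier general_linear_group. y \<otimes>\<^bsub>general_linear_group\<^esub> x = \<one>\<^bsub>general_linear_group\<^esub>"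
    by (auto simp: general_linear_group_def invertible_def)
next
  fix x y :: "complex^'n^'n"
  assume "x \<in> carrier general_linear_group" "y \<in> carrier general_linear_group"
  then show "x \<otimes>\<^bsub>general_linear_group\<^esub> y \<in> carrier general_linear_group"
    by (simp add: general_linear_group_def invertible_mult)
qed (auto simp: general_linear_group_def matrix_mul_assoc invertible_def intro: exI[of _ "mat 1"])

locale reflection_group =
  fixes W :: "(complex^'n^'n) set"
  assumes refl_W: "complex_reflection_group W"
begin

lemma subgroup_W: "subgroup W general_linear_group"
  using refl_W by (simp add: complex_reflection_group_def)

lemma finite_W [simp]: "finite W"
  using refl_W by (simp add: complex_reflection_group_def)

lemma one_W [simp]: "mat 1 \<in> W"
  using subgroup.one_closed[OF subgroup_W] by (simp add: general_linear_group_def)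

lemma mult_W [simp]: "v \<in> W \<Longrightarrow> w \<in> W \<Longrightarrow> v ** w \<in> W"
  using subgroup.m_closed[OF subgroup_W] by (simp add: general_linear_group_def)

lemma group_W: "group (matrix_group W)"
  unfolding matrix_group_def
  by (rule subgroup.subgroup_is_group[OF subgroup_W group_general_linear_group])

lemma matrix_group_simps [simp]:
  "carrier (matrix_group U) = U" "v \<otimes>\<^bsub>matrix_group U\<^esub> w = v ** w" "\<one>\<^bsub>matrix_group U\<^esub> = mat 1"
  by (simp_all add: matrix_group_def general_linear_group_def)

definition winv :: "complex^'n^'n \<Rightarrow> complex^'n^'n" where
  "winv w = inv\<^bsub>matrix_group W\<^esub> w"

lemma winv [simp]:
  assumes "w \<in> W"
  shows "winv w \<in> W" "winv w ** w = mat 1" "w ** winv w = mat 1"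
  using group.inv_closed[OF group_W] group.l_inv[OF group_W] group.r_inv[OF group_W] assms
  by (simp_all add: winv_def)

lemma winv_vec [simp]:
  assumes "w \<in> W"
  shows "winv w *v (w *v v) = v" "w *v (winv w *v v) = v"
  using assms by (simp_all add: matrix_vector_mul_assoc)

lemma W_inj: "w \<in> W \<Longrightarrow> w *v u = w *v v \<longleftrightarrow> u = v"
  by (metis winv_vec(1))

lemma winv_unique: "w \<in> W \<Longrightarrow> v ** w = mat 1 \<Longrightarrow> winv w = v"
  by (metis matrix_mul_assoc matrix_mul_lid matrix_mul_rid winv(3))

lemma winv_winv [simp]: "w \<in> W \<Longrightarrow> winv (winv w) = w"
  by (rule winv_unique) simp_all

lemma bij_mult_right: "u \<in> W \<Longrightarrow> bij_betw (\<lambda>w. w ** u) W W"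
  by (rule bij_betw_byWitness[where f' = "\<lambda>w. w ** winv u"])
     (auto simp flip: matrix_mul_assoc)

lemma bij_mult_left: "u \<in> W \<Longrightarrow> bij_betw (\<lambda>w. u ** w) W W"
  by (rule bij_betw_byWitness[where f' = "\<lambda>w. winv u ** w"])
     (auto simp: matrix_mul_assoc)

lemma W_induct [consumes 1, case_names one mult]:
  assumes "w \<in> W" and "P (mat 1)"
    and "\<And>s w. s \<in> W \<Longrightarrow> is_reflection s \<Longrightarrow> w \<in> W \<Longrightarrow> P w \<Longrightarrow> P (s ** w)"
  shows "P w"
proof -
  define T where "T = {s \<in> W. is_reflection s}"
  interpret GL: group "general_linear_group :: (complex^'n^'n) monoid"
    by (rule group_general_linear_group)
  have gen: "generate general_linear_group T = W"
    using refl_W by (simp add: complex_reflection_group_def T_def)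
  have TW: "T \<subseteq> W" by (auto simp: T_def)
  have inv_refl: "winv s \<in> T" if s: "s \<in> T" for s
  proof -
    from s have sW: "s \<in> W" and "is_reflection s" by (auto simp: T_def)
    then obtain H where H: "is_hyperplane H" "\<forall>v\<in>H. s *v v = v" "s \<noteq> mat 1"
      by (auto simp: is_reflection_def)
    have "\<forall>v\<in>H. winv s *v v = v" using H sW by (metis winv_vec(1))
    moreover have "winv s \<noteq> mat 1" using H sW by (metis matrix_mul_lid winv(2))
    ultimately show ?thesis using H sW by (auto simp: T_def is_reflection_def)
  qed
  have inv_eq: "inv\<^bsub>general_linear_group\<^esub> s = winv s" if "s \<in> W" for s
    using GL.m_inv_consistent[OF subgroup_W that] by (simp add: winv_def matrix_group_def)
  have all: "\<forall>w\<in>W. P w \<longrightarrow> P (g ** w)" if "g \<in> generate general_linear_group T" for g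
    using that
  proof (induction rule: generate.induct)
    case one
    then show ?case by (simp add: general_linear_group_def)
  next
    case (incl h)
    then show ?case using assms(3) by (auto simp: T_def)
  next
    case (inv h)
    then show ?case using assms(3) inv_refl[OF inv] TW inv_eq by (auto simp: T_def)
  next
    case (eng g h)
    have "h \<in> W" "g \<in> W" using eng gen by auto
    then show ?case using eng.IH
      by (simp add: general_linear_group_def matrix_mul_assoc[symmetric])
  qed
  from all[of w] have "P (w ** mat 1)" using assms(1,2) gen one_W by blast
  then show ?thesis by simp
qed

lemma reflection_generated:
  assumes "mat 1 \<in> S" "\<And>u v. u \<in> S \<Longrightarrow> v \<in> S \<Longrightarrow> u ** v \<in> S"
    "\<And>s. s \<in> W \<Longrightarrow> is_reflection s \<Longrightarrow> s \<in> S"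
  shows "W \<subseteq> S"
proof
  fix w assume "w \<in> W"
  then show "w \<in> S" by (induction rule: W_induct) (use assms in auto)
qed

end


section \<open>Invariants and equivariant polynomial maps\<close>

lemma matrix_vector_sum: "A *v (\<Sum>k\<in>K. f k) = (\<Sum>k\<in>K. A *v f k)"
  by (induction K rule: infinite_finite_induct) (auto simp: matrix_vector_right_distrib)

context reflection_group
begin

lemma sum_W_right: "u \<in> W \<Longrightarrow> (\<Sum>w\<in>W. f (w ** u)) = (\<Sum>w\<in>W. f w)"
  by (rule sum.reindex_bij_betw[OF bij_mult_right])

lemma sum_W_left: "u \<in> W \<Longrightarrow> (\<Sum>w\<in>W. f (u ** w)) = (\<Sum>w\<in>W. f w)"
  by (rule sum.reindex_bij_betw[OF bij_mult_left])

definition invariant_poly :: "int \<Rightarrow> (complex^'n \<Rightarrow> complex) set" where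
  "invariant_poly k = {f \<in> hom_poly k. \<forall>w\<in>W. \<forall>v. f (w *v v) = f v}"

definition covariants :: "int \<Rightarrow> (complex^'n \<Rightarrow> complex^'n) set" where
  "covariants k = {m. (\<forall>i. (\<lambda>v. m v $ i) \<in> hom_poly k) \<and> (\<forall>w\<in>W. \<forall>v. m (w *v v) = w *v m v)}"

inductive_set invariant_ideal :: "int \<Rightarrow> (complex^'n \<Rightarrow> complex) set" for k where
  gen: "r \<in> invariant_poly a \<Longrightarrow> 0 < a \<Longrightarrow> h \<in> hom_poly (k - a) \<Longrightarrow> (\<lambda>v. r v * h v) \<in> invariant_ideal k"
| add: "f \<in> invariant_ideal k \<Longrightarrow> g \<in> invariant_ideal k \<Longrightarrow> (\<lambda>v. f v + g v) \<in> invariant_ideal k"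

inductive_set decomposable_covariants :: "int \<Rightarrow> (complex^'n \<Rightarrow> complex^'n) set" for k where
  gen: "r \<in> invariant_poly a \<Longrightarrow> 0 < a \<Longrightarrow> m \<in> covariants (k - a) \<Longrightarrow>
    (\<lambda>v. r v *s m v) \<in> decomposable_covariants k"
| add: "f \<in> decomposable_covariants k \<Longrightarrow> g \<in> decomposable_covariants k \<Longrightarrow>
    (\<lambda>v. f v + g v) \<in> decomposable_covariants k"

lemma invariants_hom_poly: "r \<in> invariant_poly k \<Longrightarrow> r \<in> hom_poly k"
  by (simp add: invariant_poly_def)

lemma invariants_zero: "(\<lambda>_. 0) \<in> invariant_poly k"
  by (simp add: invariant_poly_def hom_poly_zero)

lemma invariants_const: "(\<lambda>_. c) \<in> invariant_poly 0"
  by (simp add: invariant_poly_def hom_poly_const)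

lemma invariants_add: "r \<in> invariant_poly k \<Longrightarrow> s \<in> invariant_poly k \<Longrightarrow> (\<lambda>v. r v + s v) \<in> invariant_poly k"
  by (auto simp: invariant_poly_def hom_poly_add)

lemma invariants_mult: "r \<in> invariant_poly k \<Longrightarrow> s \<in> invariant_poly l \<Longrightarrow> (\<lambda>v. r v * s v) \<in> invariant_poly (k + l)"
  by (auto simp: invariant_poly_def hom_poly_mult)

lemma invariants_cmult: "r \<in> invariant_poly k \<Longrightarrow> (\<lambda>v. c * r v) \<in> invariant_poly k"
  by (auto simp: invariant_poly_def hom_poly_cmult)

lemma invariants_sum: "(\<And>j. j \<in> J \<Longrightarrow> f j \<in> invariant_poly k) \<Longrightarrow> (\<lambda>v. \<Sum>j\<in>J. f j v) \<in> invariant_poly k"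
  by (induction J rule: infinite_finite_induct) (auto intro: invariants_zero invariants_add)

lemma covariants_add: "m \<in> covariants k \<Longrightarrow> n \<in> covariants k \<Longrightarrow> (\<lambda>v. m v + n v) \<in> covariants k"
  by (auto simp: covariants_def hom_poly_add matrix_vector_right_distrib)

lemma covariants_zero: "(\<lambda>_. 0) \<in> covariants k"
  by (auto simp: covariants_def hom_poly_zero)

lemma covariants_mult: "r \<in> invariant_poly k \<Longrightarrow> m \<in> covariants l \<Longrightarrow> (\<lambda>v. r v *s m v) \<in> covariants (k + l)"
  by (auto simp: covariants_def invariant_poly_def hom_poly_mult vector_scalar_commute)

lemma covariants_sum: "(\<And>j. j \<in> J \<Longrightarrow> f j \<in> covariants k) \<Longrightarrow> (\<lambda>v. \<Sum>j\<in>J. f j v) \<in> covariants k"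
  by (induction J rule: infinite_finite_induct) (auto intro: covariants_zero covariants_add)

lemma invariant_ideal_zero: "(\<lambda>_. 0) \<in> invariant_ideal k"
  using invariant_ideal.gen[OF invariants_zero, of 1 "\<lambda>_. 0" k] by (simp add: hom_poly_zero)

lemma invariant_ideal_neg: "f \<in> invariant_ideal k \<Longrightarrow> (\<lambda>v. - f v) \<in> invariant_ideal k"
proof (induction rule: invariant_ideal.induct)
  case (gen r a h)
  then show ?case
    using invariant_ideal.gen[OF gen(1,2) hom_poly_cmult[OF gen(3), of "-1"]] by simp
next
  case (add f g)
  then show ?case using invariant_ideal.add[OF add.IH] by simp
qed

lemma invariant_ideal_comp: "f \<in> invariant_ideal k \<Longrightarrow> w \<in> W \<Longrightarrow> (\<lambda>v. f (w *v v)) \<in> invariant_ideal k"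
proof (induction rule: invariant_ideal.induct)
  case (gen r a h)
  then show ?case
    using invariant_ideal.gen[OF gen(1,2) hom_poly_comp_matrix[OF gen(3)]] by (simp add: invariant_poly_def)
next
  case (add f g)
  then show ?case using invariant_ideal.add by simp
qed

lemma invariant_ideal_mult:
  "f \<in> invariant_ideal k \<Longrightarrow> h \<in> hom_poly l \<Longrightarrow> (\<lambda>v. h v * f v) \<in> invariant_ideal (l + k)"
proof (induction rule: invariant_ideal.induct)
  case (gen r a g)
  then show ?case
    using invariant_ideal.gen[OF gen(1,2), of "\<lambda>v. h v * g v" "l + k"] hom_poly_mult[OF gen(4,3)]
    by (simp add: algebra_simps)
next
  case (add f g)
  then show ?case using invariant_ideal.add by (simp add: algebra_simps)
qed

definition reynolds :: "(complex^'n \<Rightarrow> complex) \<Rightarrow> complex^'n \<Rightarrow> complex" where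
  "reynolds f v = (\<Sum>w\<in>W. f (w *v v)) / of_nat (card W)"

lemma W_nonempty [simp]: "W \<noteq> {}"
  using one_W by blast

lemma reynolds_invariants: "f \<in> hom_poly k \<Longrightarrow> reynolds f \<in> invariant_poly k"
proof -
  assume f: "f \<in> hom_poly k"
  have "reynolds f (u *v v) = reynolds f v" if "u \<in> W" for u v
    using sum_W_right[OF that, of "\<lambda>w. f (w *v v)"]
    by (simp add: reynolds_def matrix_vector_mul_assoc)
  moreover have "reynolds f \<in> hom_poly k"
    using hom_poly_cmult[OF hom_poly_sum[of W "\<lambda>w v. f (w *v v)"], of k "1 / of_nat (card W)"] f
      hom_poly_comp_matrix by (auto simp: reynolds_def[abs_def])
  ultimately show ?thesis by (simp add: invariant_poly_def)
qed

lemma reynolds_const: "(\<And>v. f v = c) \<Longrightarrow> reynolds f v = c"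
  by (simp add: reynolds_def)

lemma reynolds_invariant_factor:
  assumes "\<And>w v. w \<in> W \<Longrightarrow> r (w *v v) = r v"
  shows "reynolds (\<lambda>v. r v * f v) v = r v * reynolds f v"
  using assms by (simp add: reynolds_def sum_distrib_left)

lemma reynolds_sum:
  "reynolds (\<lambda>v. \<Sum>j\<in>J. f j v) v = (\<Sum>j\<in>J. reynolds (f j) v)"
  by (simp add: reynolds_def sum_divide_distrib[symmetric]) (subst sum.swap, simp)

text \<open>Chevalley's lemma. A divided difference by a reflection keeps the relation and lowers the degree
  of \<open>g l\<close>; modulo the ideal of positive invariant_poly, \<open>g l\<close> is therefore unchanged by every reflection,
  hence equal to its average, which is an invariant.\<close>

lemma chevalley:
  assumes "finite J" "l \<in> J"
    and r: "\<And>j. j \<in> J \<Longrightarrow> r j \<in> invariant_poly (a j)"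
    and irred: "\<not> (\<exists>c. (\<forall>j\<in>J - {l}. c j \<in> invariant_poly (a l - a j)) \<and>
                    (\<forall>v. r l v = (\<Sum>j\<in>J - {l}. c j v * r j v)))"
    and g: "\<And>j. j \<in> J \<Longrightarrow> g j \<in> hom_poly (D - a j)"
    and rel: "\<And>v. (\<Sum>j\<in>J. r j v * g j v) = 0"
  shows "g l \<in> invariant_ideal (D - a l)"
  using g rel
proof (induction "nat (D - a l)" arbitrary: g D rule: less_induct)
  case less
  define b where "b = D - a l"
  have gl: "g l \<in> hom_poly b" using less.prems(1)[OF assms(2)] by (simp add: b_def)
  consider "b < 0" | "b = 0" | "b > 0" by linarith
  then have "g l \<in> invariant_ideal b"
  proof cases
    case 1
    then have "g l = (\<lambda>_. 0)" using hom_poly_degree_negative[OF gl] by auto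
    then show ?thesis by (simp add: invariant_ideal_zero)
  next
    case 2
    define c where "c = g l 0"
    have gc: "g l v = c" for v using hom_poly_degree_zero[of "g l" v] gl 2 by (simp add: c_def)
    have "c = 0"
    proof (rule ccontr)
      assume c0: "c \<noteq> 0"
      define d where "d j v = (- 1 / c) * reynolds (g j) v" for j v
      have "d j \<in> invariant_poly (a l - a j)" if "j \<in> J" for j
      proof -
        have "D - a j = a l - a j" using 2 by (simp add: b_def)
        then have "reynolds (g j) \<in> invariant_poly (a l - a j)"
          using reynolds_invariants[OF less.prems(1)[OF that]] by simp
        then show ?thesis unfolding d_def by (rule invariants_cmult)
      qed
      moreover have "r l v = (\<Sum>j\<in>J - {l}. d j v * r j v)" for v
      proof -
        have "reynolds (\<lambda>v. \<Sum>j\<in>J. r j v * g j v) v = 0"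
          by (rule reynolds_const) (rule less.prems(2))
        then have "0 = (\<Sum>j\<in>J. r j v * reynolds (g j) v)"
          unfolding reynolds_sum
          using r by (subst (asm) sum.cong[OF refl reynolds_invariant_factor]) (auto simp: invariant_poly_def)
        also have "\<dots> = r l v * c + (\<Sum>j\<in>J - {l}. r j v * reynolds (g j) v)"
          using assms(1,2) by (subst sum.remove[of J l]) (auto simp: reynolds_const[OF gc])
        finally have "r l v * c = - (\<Sum>j\<in>J - {l}. r j v * reynolds (g j) v)"
          by (simp add: eq_neg_iff_add_eq_0)
        then have "r l v = - (\<Sum>j\<in>J - {l}. r j v * reynolds (g j) v) / c"
          using c0 by (simp add: field_simps)
        then show ?thesis
          by (simp add: d_def sum_divide_distrib sum_negf[symmetric] algebra_simps)
      qed
      ultimately show False using irred by blast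
    qed
    then have "g l = (\<lambda>_. 0)" using gc by auto
    then show ?thesis by (simp add: invariant_ideal_zero)
  next
    case 3
    have step: "(\<lambda>v. g l v - g l (s *v v)) \<in> invariant_ideal b" if s: "s \<in> W" "is_reflection s" for s
    proof -
      obtain al be where ab: "al \<noteq> 0" "\<And>v. s *v v = v + form al v *s be"
        using reflection_form[OF s(2)] by metis
      have "\<forall>j\<in>J. \<exists>h\<in>hom_poly (D - a j - 1). \<forall>v. g j v - g j (s *v v) = form al v * h v"
        using divided_difference_hom[OF less.prems(1) ab] by blast
      then obtain h where h: "\<And>j. j \<in> J \<Longrightarrow> h j \<in> hom_poly (D - a j - 1)"
        "\<And>j v. j \<in> J \<Longrightarrow> g j v - g j (s *v v) = form al v * h j v" by metis
      have rs: "r j (s *v v) = r j v" if "j \<in> J" for j v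
        using r[OF that] s by (simp add: invariant_poly_def)
      have relh: "(\<Sum>j\<in>J. r j v * h j v) = 0" for v
      proof -
        obtain v0 where v0: "form al v0 = 1" using form_nonzero[OF ab(1)] by auto
        show ?thesis
        proof (rule poly_fun_cancel[OF poly_fun_form[of al], of _ v0])
          show "(\<lambda>v. \<Sum>j\<in>J. r j v * h j v) \<in> poly_fun"
            using r h(1) by (intro poly_fun_sum poly_fun.mult)
              (auto intro: hom_poly_poly_fun invariants_hom_poly)
          show "form al v0 \<noteq> 0" using v0 by simp
          fix v
          have "form al v * (\<Sum>j\<in>J. r j v * h j v) = (\<Sum>j\<in>J. r j v * (g j v - g j (s *v v)))"
            by (simp add: sum_distrib_left h(2) algebra_simps)
          also have "\<dots> = (\<Sum>j\<in>J. r j v * g j v) - (\<Sum>j\<in>J. r j (s *v v) * g j (s *v v))"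
            by (simp add: rs algebra_simps sum_subtractf)
          finally show "form al v * (\<Sum>j\<in>J. r j v * h j v) = 0"
            by (simp add: less.prems(2))
        qed
      qed
      have "h l \<in> invariant_ideal ((D - 1) - a l)"
      proof (rule less.hyps)
        show "nat (D - 1 - a l) < nat (D - a l)" using 3 by (simp add: b_def)
        show "h j \<in> hom_poly (D - 1 - a j)" if "j \<in> J" for j
          using h(1)[OF that] by (simp add: algebra_simps)
      qed (rule relh)
      moreover have "form al \<in> hom_poly 1"
        using poly_fun_form[of al] by (simp add: hom_poly_def)
      ultimately have "(\<lambda>v. form al v * h l v) \<in> invariant_ideal (1 + (D - 1 - a l))"
        by (rule invariant_ideal_mult)
      then show ?thesis using h(2)[OF assms(2)] by (simp add: b_def)
    qed
    have all: "(\<lambda>v. g l v - g l (w *v v)) \<in> invariant_ideal b" if "w \<in> W" for w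
      using that
    proof (induction rule: W_induct)
      case one
      show ?case by (simp add: invariant_ideal_zero)
    next
      case (mult s w)
      have "(\<lambda>v. (g l v - g l (w *v v)) + (g l (w *v v) - g l (s *v (w *v v)))) \<in> invariant_ideal b"
        using mult invariant_ideal_comp[OF step[OF mult(1,2)] mult(3)] by (intro invariant_ideal.add)
      then show ?case by (simp add: matrix_vector_mul_assoc)
    qed
    have sumI: "finite K \<Longrightarrow> (\<And>k. k \<in> K \<Longrightarrow> f k \<in> invariant_ideal b) \<Longrightarrow>
        (\<lambda>v. \<Sum>k\<in>K. f k v) \<in> invariant_ideal b" for K and f :: "complex^'n^'n \<Rightarrow> complex^'n \<Rightarrow> complex"
      by (induction K rule: finite_induct) (auto intro: invariant_ideal_zero invariant_ideal.add)
    have "(\<lambda>v. \<Sum>w\<in>W. g l v - g l (w *v v)) \<in> invariant_ideal b"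
      using all by (intro sumI) auto
    then have "(\<lambda>v. (1 / of_nat (card W)) * (\<Sum>w\<in>W. g l v - g l (w *v v))) \<in> invariant_ideal (0 + b)"
      by (rule invariant_ideal_mult[OF _ hom_poly_const])
    moreover have "(1 / of_nat (card W)) * (\<Sum>w\<in>W. g l v - g l (w *v v)) = g l v - reynolds (g l) v" for v
      by (simp add: sum_subtractf reynolds_def field_simps)
    ultimately have 1: "(\<lambda>v. g l v - reynolds (g l) v) \<in> invariant_ideal b" by simp
    have "(\<lambda>v. reynolds (g l) v * 1) \<in> invariant_ideal b"
      using reynolds_invariants[OF gl] 3 hom_poly_const[of 1] by (intro invariant_ideal.gen[of _ b]) auto
    from invariant_ideal.add[OF 1 this] show ?thesis by simp
  qed
  then show ?case by (simp add: b_def)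
qed

definition covariant_average :: "(complex^'n \<Rightarrow> complex) \<Rightarrow> complex^'n \<Rightarrow> complex^'n \<Rightarrow> complex^'n" where
  "covariant_average f u v = (1 / of_nat (card W)) *s (\<Sum>w\<in>W. f (winv w *v v) *s (w *v u))"

lemma covariant_average_covariants:
  assumes "f \<in> hom_poly k"
  shows "covariant_average f u \<in> covariants k"
proof -
  have "(\<lambda>v. covariant_average f u v $ i) \<in> hom_poly k" for i
  proof -
    have "(\<lambda>v. (1 / of_nat (card W)) * (\<Sum>w\<in>W. (w *v u) $ i * f (winv w *v v))) \<in> hom_poly k"
      by (intro hom_poly_cmult hom_poly_sum hom_poly_comp_matrix assms)
    then show ?thesis by (simp add: covariant_average_def mult.commute)
  qed
  moreover have "covariant_average f u (x *v v) = x *v covariant_average f u v" if x: "x \<in> W" for x v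
  proof -
    have "(\<Sum>w\<in>W. f (winv w *v (x *v v)) *s (w *v u))
        = (\<Sum>w\<in>W. f (winv (x ** w) *v (x *v v)) *s ((x ** w) *v u))"
      using sum_W_left[OF x, of "\<lambda>w. f (winv w *v (x *v v)) *s (w *v u)"] by simp
    also have "\<dots> = (\<Sum>w\<in>W. x *v (f (winv w *v v) *s (w *v u)))"
    proof (rule sum.cong[OF refl])
      fix w assume w: "w \<in> W"
      have "winv (x ** w) = winv w ** winv x"
        using w x by (intro winv_unique)
          (auto simp: matrix_mul_assoc[symmetric], simp add: matrix_mul_assoc)
      then have "winv (x ** w) *v (x *v v) = winv w *v v"
        using x by (simp add: matrix_vector_mul_assoc[symmetric])
      then show "f (winv (x ** w) *v (x *v v)) *s ((x ** w) *v u) = x *v (f (winv w *v v) *s (w *v u))"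
        by (simp add: vector_scalar_commute matrix_vector_mul_assoc)
    qed
    also have "\<dots> = x *v (\<Sum>w\<in>W. f (winv w *v v) *s (w *v u))"
      by (simp add: matrix_vector_sum)
    finally show ?thesis by (simp add: covariant_average_def vector_scalar_commute)
  qed
  ultimately show ?thesis by (auto simp: covariants_def)
qed

lemma covariant_average_decomposable:
  assumes "f \<in> invariant_ideal k"
  shows "covariant_average f u \<in> decomposable_covariants k"
  using assms
proof (induction rule: invariant_ideal.induct)
  case (gen r a h)
  have "covariant_average (\<lambda>v. r v * h v) u v = r v *s covariant_average h u v" for v
  proof -
    have "r (winv w *v v) = r v" if "w \<in> W" for w
      using gen(1) that by (simp add: invariant_poly_def)
    then show ?thesis
      by (simp add: covariant_average_def vec.scale_sum_right mult_ac)
  qed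
  then have "covariant_average (\<lambda>v. r v * h v) u = (\<lambda>v. r v *s covariant_average h u v)" by auto
  then show ?case
    using decomposable_covariants.gen[OF gen(1,2) covariant_average_covariants[OF gen(3)]] by simp
next
  case (add f g)
  have "covariant_average (\<lambda>v. f v + g v) u = (\<lambda>v. covariant_average f u v + covariant_average g u v)"
    by (auto simp: covariant_average_def sum.distrib vec.scale_left_distrib vec.scale_right_distrib)
  then show ?case using decomposable_covariants.add[OF add.IH] by simp
qed

lemma decomposable_zero: "(\<lambda>_. 0) \<in> decomposable_covariants k"
  using decomposable_covariants.gen[OF invariants_zero, of 1 "\<lambda>_. 0" k] by (simp add: covariants_zero)

lemma covariant_in_ideal_decomposable:
  assumes m: "m \<in> covariants k" and id: "\<And>i. (\<lambda>v. m v $ i) \<in> invariant_ideal k"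
  shows "m \<in> decomposable_covariants k"
proof -
  have sumI: "finite K \<Longrightarrow> (\<And>k'. k' \<in> K \<Longrightarrow> f k' \<in> decomposable_covariants k) \<Longrightarrow>
      (\<lambda>v. \<Sum>k'\<in>K. f k' v) \<in> decomposable_covariants k" for K and f :: "'n \<Rightarrow> complex^'n \<Rightarrow> complex^'n"
    by (induction K rule: finite_induct) (auto intro: decomposable_zero decomposable_covariants.add)
  have "(\<lambda>v. \<Sum>i\<in>UNIV. covariant_average (\<lambda>v. m v $ i) (axis i 1) v) \<in> decomposable_covariants k"
    by (intro sumI covariant_average_decomposable id) auto
  moreover have "(\<Sum>i\<in>UNIV. covariant_average (\<lambda>v. m v $ i) (axis i 1) v) = m v" for v
  proof -
    have 1: "(\<Sum>i\<in>UNIV. x $ i *s (w *v axis i 1)) = w *v x" for w :: "complex^'n^'n" and x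
    proof -
      have "(\<Sum>i\<in>UNIV. x $ i *s (w *v axis i 1)) = w *v (\<Sum>i\<in>UNIV. x $ i *s axis i 1)"
        by (simp add: matrix_vector_sum vector_scalar_commute)
      then show ?thesis by (simp add: basis_expansion)
    qed
    have "(\<Sum>i\<in>UNIV. covariant_average (\<lambda>v. m v $ i) (axis i 1) v)
        = (1 / of_nat (card W)) *s (\<Sum>w\<in>W. \<Sum>i\<in>UNIV. m (winv w *v v) $ i *s (w *v axis i 1))"
      by (simp add: covariant_average_def vec.scale_sum_right[symmetric], subst sum.swap, simp)
    also have "\<dots> = (1 / of_nat (card W)) *s (\<Sum>w\<in>W. w *v m (winv w *v v))"
      by (simp add: 1)
    also have "(\<Sum>w\<in>W. w *v m (winv w *v v)) = (\<Sum>w\<in>W. m v)"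
      using m by (intro sum.cong) (auto simp: covariants_def)
    also have "(1 / of_nat (card W)) *s \<dots> = m v"
    proof -
      have "(\<Sum>w\<in>W. m v) $ i = of_nat (card W) * m v $ i" for i
        by (subst sum_component) simp
      then show ?thesis by (simp only: vec_eq_iff vector_smult_component) (simp add: field_simps)
    qed
    finally show ?thesis .
  qed
  ultimately show ?thesis by simp
qed


section \<open>Generation of the covariants\<close>

definition rowdet :: "('n \<Rightarrow> complex^'n \<Rightarrow> complex^'n) \<Rightarrow> complex^'n \<Rightarrow> complex" where
  "rowdet m v = det (\<chi> j. m j v)"

lemma rowdet_upd: "rowdet (m(k := y)) v = det (\<chi> j. if j = k then y v else m j v)"
  unfolding rowdet_def by (rule arg_cong[where f = det]) (simp add: vec_eq_iff)

lemma rowdet_hom_poly: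
  assumes "\<And>j i. (\<lambda>v. m j v $ i) \<in> hom_poly (e j)"
  shows "rowdet m \<in> hom_poly (\<Sum>j\<in>UNIV. e j)"
proof -
  have "(\<lambda>v. \<Sum>p | p permutes UNIV. of_int (sign p) * (\<Prod>i\<in>UNIV. m i v $ p i)) \<in> hom_poly (\<Sum>j\<in>UNIV. e j)"
    by (intro hom_poly_sum hom_poly_cmult hom_poly_prod assms) auto
  then show ?thesis by (simp add: rowdet_def[abs_def] det_def)
qed

lemma rowdet_upd_add:
  "rowdet (m(k := (\<lambda>v. x v + y v))) v = rowdet (m(k := x)) v + rowdet (m(k := y)) v"
  unfolding rowdet_upd by (rule det_row_add)

lemma rowdet_upd_scale: "rowdet (m(k := (\<lambda>v. c v *s y v))) v = c v * rowdet (m(k := y)) v"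
  unfolding rowdet_upd by (rule det_row_mul)

lemma rowdet_upd_zero: "rowdet (m(k := (\<lambda>v. 0))) v = 0"
  unfolding rowdet_upd by (rule det_row_0)

lemma rowdet_upd_sum:
  "finite K \<Longrightarrow> rowdet (m(k := (\<lambda>v. \<Sum>l\<in>K. c l v *s y l v))) v = (\<Sum>l\<in>K. c l v * rowdet (m(k := y l)) v)"
proof (induction K rule: finite_induct)
  case empty
  show ?case by (simp only: sum.empty rowdet_upd_zero)
next
  case (insert l K)
  then show ?case
    by (simp only: sum.insert[OF insert.hyps] rowdet_upd_add rowdet_upd_scale)
qed

lemma rowdet_upd_other: "j \<noteq> k \<Longrightarrow> rowdet (m(k := m j)) v = 0"
  unfolding rowdet_def by (rule det_identical_rows[of k j]) (auto simp: row_def)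

lemma rowdet_nonzero_solve:
  assumes "rowdet m v \<noteq> 0"
  shows "\<exists>x. y = (\<Sum>j\<in>UNIV. x j *s m j v)"
proof -
  define A where "A = (\<chi> j. m j v)"
  have "det (transpose A) \<noteq> 0" using assms by (simp add: A_def rowdet_def)
  then obtain B where "transpose A ** B = mat 1"
    by (metis invertible_det_nz invertible_right_inverse)
  then have "transpose A *v (B *v y) = y" by (simp add: matrix_vector_mul_assoc)
  moreover have "transpose A *v x = (\<Sum>j\<in>UNIV. (x $ j) *s m j v)" for x
    by (simp add: vec_eq_iff A_def transpose_def matrix_vector_mult_def sum_component mult.commute
        del: transpose_matrix_vector)
  ultimately show ?thesis by metis
qed

lemma rowdet_cramer:
  assumes "rowdet m v0 \<noteq> 0" and m: "\<And>j i. (\<lambda>v. m j v $ i) \<in> hom_poly (e j)"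
    and y: "\<And>i. (\<lambda>v. y v $ i) \<in> hom_poly d"
  shows "rowdet m v *s y v = (\<Sum>j\<in>UNIV. rowdet (m(j := y)) v *s m j v)"
proof -
  have upd: "rowdet (m(j := y)) \<in> poly_fun" for j
    by (rule hom_poly_poly_fun, rule rowdet_hom_poly[of _ "e(j := d)"]) (auto simp: m y)
  have rd: "rowdet m \<in> poly_fun"
    by (rule hom_poly_poly_fun, rule rowdet_hom_poly) (rule m)
  have "rowdet m v * y v $ i + (- 1) * (\<Sum>j\<in>UNIV. rowdet (m(j := y)) v * m j v $ i) = 0" for i
  proof (rule poly_fun_cancel[OF rd _ assms(1)])
    show "(\<lambda>v. rowdet m v * y v $ i + (- 1) * (\<Sum>j\<in>UNIV. rowdet (m(j := y)) v * m j v $ i)) \<in> poly_fun"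
      by (intro poly_fun.add poly_fun.mult poly_fun.const poly_fun_sum upd rd
          hom_poly_poly_fun[OF m] hom_poly_poly_fun[OF y])
    fix v
    show "rowdet m v * (rowdet m v * y v $ i + (- 1) * (\<Sum>j\<in>UNIV. rowdet (m(j := y)) v * m j v $ i)) = 0"
    proof (cases "rowdet m v = 0")
      case False
      then obtain x where x: "y v = (\<Sum>j\<in>UNIV. x j *s m j v)"
        using rowdet_nonzero_solve by blast
      have "rowdet (m(j := y)) v = x j * rowdet m v" for j
        using cramer_lemma_transpose[where x = "\<chi> i. x i" and k = j and A = "\<chi> j. m j v"] x
        by (simp only: rowdet_upd) (simp add: rowdet_def row_def cong: if_cong)
      then show ?thesis
        by (simp add: x sum_component sum_distrib_left sum_negf mult_ac)
    qed simp
  qed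
  then show ?thesis by (simp add: vec_eq_iff sum_component)
qed

lemma covariants_span_free_point:
  assumes free: "\<And>w. w \<in> W \<Longrightarrow> w *v v0 = v0 \<Longrightarrow> w = mat 1"
  shows "vec.span {m v0 | m k. m \<in> covariants k} = UNIV"
proof -
  let ?S = "{m v0 | m k. m \<in> covariants k}"
  have avg: "covariant_average f u v0 \<in> vec.span ?S" if "f \<in> hom_span" for f u
    using that
  proof (induction rule: hom_span.induct)
    case (hom f k)
    then have "covariant_average f u \<in> covariants k" by (rule covariant_average_covariants)
    then show ?case by (intro vec.span_base CollectI exI conjI) (rule refl)
  next
    case (add f g)
    have "covariant_average (\<lambda>v. f v + g v) u v0 = covariant_average f u v0 + covariant_average g u v0"
      by (simp add: covariant_average_def sum.distrib vec.scale_left_distrib vec.scale_right_distrib)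
    then show ?case using vec.span_add[OF add.IH] by (simp only:)
  qed
  have "u \<in> vec.span ?S" for u
  proof -
    have notin: "v0 \<notin> (\<lambda>w. winv w *v v0) ` (W - {mat 1})"
    proof
      assume "v0 \<in> (\<lambda>w. winv w *v v0) ` (W - {mat 1})"
      then obtain w where w: "w \<in> W" "w \<noteq> mat 1" "v0 = winv w *v v0" by auto
      then have "w *v v0 = v0" by (metis winv_vec(2))
      then show False using free w by blast
    qed
    obtain h where h: "h \<in> poly_fun" "h v0 = 1" "\<And>w. w \<in> W - {mat 1} \<Longrightarrow> h (winv w *v v0) = 0"
      using poly_fun_interpolate[OF _ notin] by auto
    have w1: "winv (mat 1) = mat 1" by (rule winv_unique) auto
    have "(\<Sum>w\<in>W. h (winv w *v v0) *s (w *v u)) = (\<Sum>w\<in>W. if w = mat 1 then u else 0)"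
    proof (rule sum.cong[OF refl])
      fix w assume "w \<in> W"
      show "h (winv w *v v0) *s (w *v u) = (if w = mat 1 then u else 0)"
      proof (cases "w = mat 1")
        case True
        then show ?thesis using h(2) w1 by simp
      next
        case False
        then show ?thesis using h(3)[of w] \<open>w \<in> W\<close> by simp
      qed
    qed
    then have "covariant_average h u v0 = (1 / of_nat (card W)) *s u"
      unfolding covariant_average_def by (simp only: sum.delta finite_W one_W if_True)
    then have "(1 / of_nat (card W)) *s u \<in> vec.span ?S"
      using avg[OF poly_fun_hom_span[OF h(1)], of u] by (simp only:)
    then have "of_nat (card W) *s ((1 / of_nat (card W)) *s u) \<in> vec.span ?S"
      by (rule vec.span_scale)
    then show ?thesis by (simp only: vec.scale_scale) simp
  qed
  then show ?thesis by (intro equalityI subsetI UNIV_I)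
qed

lemma spanning_set_rowdet:
  assumes "vec.span S = (UNIV :: (complex^'n) set)"
  obtains b where "\<And>j::'n. b j \<in> S" "det (\<chi> j. b j) \<noteq> 0"
proof -
  obtain B where B: "B \<subseteq> S" "vec.independent B" "S \<subseteq> vec.span B"
    using vec.maximal_independent_subset[of S] by blast
  have spB: "vec.span B = UNIV"
    by (metis B(3) assms top.extremum_uniqueI vec.span_mono vec.span_span)
  have "card B = CARD('n)"
    using vec.basis_card_eq_dim[of B UNIV] B spB
    by (metis top_greatest vec.dim_UNIV vec.dimension_def card_cart_basis)
  moreover have "finite B"
    using B vec.finiteI_independent by blast
  ultimately obtain b :: "'n \<Rightarrow> complex^'n" where b: "bij_betw b UNIV B"
    using finite_same_card_bij[of "UNIV :: 'n set" B] by auto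
  have "rows (\<chi> j. b j) = B"
    using b by (auto simp: rows_def row_def bij_betw_def)
  then have "invertible (\<chi> j. b j)"
    using matrix_left_invertible_span_rows_gen[of "\<chi> j. b j"] spB
    by (simp add: invertible_left_inverse)
  then have "det (\<chi> j. b j) \<noteq> 0" by (simp add: invertible_det_nz)
  moreover have "b j \<in> S" for j using b B by (auto simp: bij_betw_def)
  ultimately show ?thesis using that by blast
qed

lemma free_point_exists:
  obtains v0 where "\<And>w. w \<in> W \<Longrightarrow> w *v v0 = v0 \<Longrightarrow> w = mat 1"
proof -
  define row0 where "row0 w = (SOME a. a \<noteq> 0 \<and> (\<exists>i. a = (w - mat 1) $ i))" for w :: "complex^'n^'n"
  have r: "row0 w \<noteq> 0 \<and> (\<exists>i. row0 w = (w - mat 1) $ i)" if "w \<noteq> mat 1" for w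
  proof -
    have "w - mat 1 \<noteq> 0" using that by simp
    then have "\<exists>a. a \<noteq> 0 \<and> (\<exists>i. a = (w - mat 1) $ i)" by (metis vec_eq_iff zero_index)
    then show ?thesis unfolding row0_def by (rule someI_ex)
  qed
  obtain v0 where v0: "\<forall>a\<in>row0 ` (W - {mat 1}). form a v0 \<noteq> 0"
    using exists_avoiding_forms[of "row0 ` (W - {mat 1})"] r by fastforce
  show ?thesis
  proof
    fix w assume w: "w \<in> W" "w *v v0 = v0"
    show "w = mat 1"
    proof (rule ccontr)
      assume "w \<noteq> mat 1"
      then obtain i where i: "row0 w = (w - mat 1) $ i" using r by blast
      have "form (row0 w) v0 = ((w - mat 1) *v v0) $ i"
        by (simp add: i matrix_vector_nth)
      also have "\<dots> = 0" using w by (simp add: matrix_vector_mult_diff_rdistrib)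
      finally show False using v0 w \<open>w \<noteq> mat 1\<close> by auto
    qed
  qed
qed

definition covariant_basis :: "('n \<Rightarrow> complex^'n \<Rightarrow> complex^'n) \<Rightarrow> ('n \<Rightarrow> int) \<Rightarrow> bool" where
  "covariant_basis m e \<longleftrightarrow> (\<forall>j. m j \<in> covariants (e j)) \<and> (\<exists>v. rowdet m v \<noteq> 0)"

lemma covariant_basis_degree_nonneg:
  assumes "covariant_basis m e"
  shows "0 \<le> e j"
proof (rule ccontr)
  assume "\<not> 0 \<le> e j"
  moreover have "(\<lambda>v. m j v $ i) \<in> hom_poly (e j)" for i
    using assms by (auto simp: covariant_basis_def covariants_def)
  ultimately have "m j v = 0" for v
    using hom_poly_degree_negative[of "\<lambda>v. m j v $ i" "e j" v for i] by (simp add: vec_eq_iff)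
  then have "m j = (\<lambda>v. 0)" by auto
  then have "m = m(j := (\<lambda>v. 0))" by (metis fun_upd_triv)
  then have "rowdet m v = 0" for v by (metis rowdet_upd_zero)
  then show False using assms by (auto simp: covariant_basis_def)
qed

lemma covariant_basis_exists: "\<exists>m e. covariant_basis m e"
proof -
  obtain v0 where v0: "\<And>w. w \<in> W \<Longrightarrow> w *v v0 = v0 \<Longrightarrow> w = mat 1"
    using free_point_exists by blast
  obtain b where b: "\<And>j. b j \<in> {m v0 | m k. m \<in> covariants k}" "det (\<chi> j. b j) \<noteq> 0"
    using spanning_set_rowdet[OF covariants_span_free_point[OF v0]] by blast
  have "\<forall>j. \<exists>m k. b j = m v0 \<and> m \<in> covariants k" using b(1) by blast
  then obtain m k where "\<And>j. b j = m j v0 \<and> m j \<in> covariants (k j)" by metis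
  then have "covariant_basis m k" using b(2) by (auto simp: covariant_basis_def rowdet_def)
  then show ?thesis by blast
qed

lemma minimal_covariant_basis_exists:
  obtains m e where "covariant_basis m e"
    "\<And>k d y v. y \<in> covariants d \<Longrightarrow> d < e k \<Longrightarrow> rowdet (m(k := y)) v = 0"
proof -
  define Q where "Q = (\<lambda>(m, e). covariant_basis m e)"
  obtain m0 e0 where "Q (m0, e0)" using covariant_basis_exists by (auto simp: Q_def)
  from ex_has_least_nat[of Q, OF this, of "\<lambda>(m, e). nat (\<Sum>j\<in>UNIV. e j)"]
  obtain m e where m: "covariant_basis m e"
    and least: "\<And>m' e'. covariant_basis m' e' \<Longrightarrow> nat (\<Sum>j\<in>UNIV. e j) \<le> nat (\<Sum>j\<in>UNIV. e' j)"
    by (auto simp: Q_def)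
  show ?thesis
  proof (rule that[OF m], rule ccontr)
    fix k d y v assume y: "y \<in> covariants d" "d < e k" and nz: "rowdet (m(k := y)) v \<noteq> 0"
    have "covariant_basis (m(k := y)) (e(k := d))"
      using m y nz by (auto simp: covariant_basis_def)
    then have "nat (\<Sum>j\<in>UNIV. e j) \<le> nat (\<Sum>j\<in>UNIV. (e(k := d)) j)"
      and pos: "\<And>j. 0 \<le> (e(k := d)) j"
      using least covariant_basis_degree_nonneg by blast+
    moreover have "(\<Sum>j\<in>UNIV. (e(k := d)) j) < (\<Sum>j\<in>UNIV. e j)"
      by (rule sum_strict_mono_ex1) (use y in auto)
    moreover have "0 \<le> (\<Sum>j\<in>UNIV. (e(k := d)) j)"
      by (rule sum_nonneg) (rule pos)
    ultimately show False by linarith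
  qed
qed

definition generated_by :: "('n \<Rightarrow> complex^'n \<Rightarrow> complex^'n) \<Rightarrow> ('n \<Rightarrow> int) \<Rightarrow> int \<Rightarrow> (complex^'n \<Rightarrow> complex^'n) set" where
  "generated_by m e d = {y. \<exists>c. (\<forall>j. c j \<in> invariant_poly (d - e j)) \<and> (\<forall>v. y v = (\<Sum>j\<in>UNIV. c j v *s m j v))}"

lemma generated_by_add:
  assumes "y \<in> generated_by m e d" "z \<in> generated_by m e d"
  shows "(\<lambda>v. y v + z v) \<in> generated_by m e d"
proof -
  obtain c c' where "\<forall>j. c j \<in> invariant_poly (d - e j)" "\<forall>v. y v = (\<Sum>j\<in>UNIV. c j v *s m j v)"
    "\<forall>j. c' j \<in> invariant_poly (d - e j)" "\<forall>v. z v = (\<Sum>j\<in>UNIV. c' j v *s m j v)"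
    using assms by (auto simp: generated_by_def)
  then show ?thesis unfolding generated_by_def
    by (intro CollectI exI[of _ "\<lambda>j v. c j v + c' j v"])
       (auto simp: invariants_add vec.scale_left_distrib sum.distrib)
qed

lemma generated_by_mult:
  assumes "r \<in> invariant_poly a" "y \<in> generated_by m e d"
  shows "(\<lambda>v. r v *s y v) \<in> generated_by m e (a + d)"
proof -
  obtain c where "\<forall>j. c j \<in> invariant_poly (d - e j)" "\<forall>v. y v = (\<Sum>j\<in>UNIV. c j v *s m j v)"
    using assms by (auto simp: generated_by_def)
  then show ?thesis unfolding generated_by_def
    using invariants_mult[OF assms(1)]
    by (intro CollectI exI[of _ "\<lambda>j v. r v * c j v"])
       (force simp: vec.scale_sum_right algebra_simps)+
qed

lemma generated_by_zero: "(\<lambda>_. 0) \<in> generated_by m e d"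
  unfolding generated_by_def by (intro CollectI exI[of _ "\<lambda>_ _. 0"]) (auto simp: invariants_zero)

lemma generated_by_sum:
  "finite K \<Longrightarrow> (\<And>k. k \<in> K \<Longrightarrow> f k \<in> generated_by m e d) \<Longrightarrow> (\<lambda>v. \<Sum>k\<in>K. f k v) \<in> generated_by m e d"
  by (induction K rule: finite_induct) (auto intro: generated_by_zero generated_by_add)

lemma generated_by_base: "m j \<in> generated_by m e (e j)"
  unfolding generated_by_def
proof (intro CollectI exI conjI allI)
  fix i v
  show "(\<lambda>i v. if i = j then 1 else 0) i \<in> invariant_poly (e j - e i)"
    by (auto simp: invariants_zero invariants_const)
  show "m j v = (\<Sum>i\<in>UNIV. (\<lambda>i v. if i = j then 1 else 0) i v *s m i v)"
    by (simp add: if_distrib[of "\<lambda>c. c *s _"] cong: if_cong)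
qed

end


section \<open>Steinberg's theorem\<close>

context reflection_group
begin

lemma covariants_negative: "y \<in> covariants d \<Longrightarrow> d < 0 \<Longrightarrow> y = (\<lambda>_. 0)"
  using hom_poly_degree_negative[of "\<lambda>v. y v $ i" d for i]
  by (auto simp: covariants_def vec_eq_iff fun_eq_iff)

lemma minimal_basis_generates:
  assumes cb: "covariant_basis m e"
    and min: "\<And>k d y v. y \<in> covariants d \<Longrightarrow> d < e k \<Longrightarrow> rowdet (m(k := y)) v = 0"
    and "y \<in> covariants d"
  shows "y \<in> generated_by m e d"
  using assms(3)
proof (induction "nat d" arbitrary: y d rule: less_induct)
  case less
  note y = less.prems
  have IH: "z \<in> generated_by m e d'" if "z \<in> covariants d'" "d' < d" for z d'
  proof (cases "d' < 0")
    case True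
    then show ?thesis using covariants_negative[OF that(1)] generated_by_zero by simp
  next
    case False
    then show ?thesis using less.hyps[of d' z] that by simp
  qed
  have dec: "z \<in> generated_by m e d" if "z \<in> decomposable_covariants d" for z
    using that
  proof (induction rule: decomposable_covariants.induct)
    case (gen r a n)
    then show ?case using generated_by_mult[OF gen(1) IH[OF gen(3)]] by simp
  next
    case (add f g)
    then show ?case by (intro generated_by_add)
  qed
  obtain v0 where v0: "rowdet m v0 \<noteq> 0" using cb by (auto simp: covariant_basis_def)
  have m_cov: "m j \<in> covariants (e j)" for j using cb by (simp add: covariant_basis_def)
  have m_hom: "(\<lambda>v. m j v $ i) \<in> hom_poly (e j)" for i j
    using m_cov by (simp add: covariants_def)
  have y_hom: "(\<lambda>v. y v $ i) \<in> hom_poly d" for i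
    using y by (simp add: covariants_def)
  define E where "E i = (case i of None \<Rightarrow> d | Some j \<Rightarrow> e j)" for i
  define mm where "mm i = (case i of None \<Rightarrow> y | Some j \<Rightarrow> m j)" for i
  define q where "q i v = (case i of None \<Rightarrow> rowdet m v | Some j \<Rightarrow> - rowdet (m(j := y)) v)" for i v
  define Tot where "Tot = (\<Sum>j\<in>UNIV. e j) + d"
  have [simp]: "E None = d" "E (Some j) = e j" "mm None = y" "mm (Some j) = m j"
    "q None = rowdet m" "q (Some j) = (\<lambda>v. - rowdet (m(j := y)) v)" for j
    by (simp_all add: E_def mm_def q_def[abs_def])
  have mm_cov: "mm i \<in> covariants (E i)" for i
    by (cases i) (simp_all add: y m_cov)
  have q_hom: "q i \<in> hom_poly (Tot - E i)" for i
  proof (cases i)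
    case None
    then show ?thesis using rowdet_hom_poly[of m e] m_hom by (simp add: Tot_def)
  next
    case (Some j)
    have "rowdet (m(j := y)) \<in> hom_poly (\<Sum>k\<in>UNIV. (e(j := d)) k)"
      by (rule rowdet_hom_poly) (simp add: m_hom y_hom)
    moreover have "(\<Sum>k\<in>UNIV. (e(j := d)) k) = Tot - e j"
      by (simp add: Tot_def sum.remove[of UNIV j])
    ultimately have "(\<lambda>v. (-1) * rowdet (m(j := y)) v) \<in> hom_poly (Tot - e j)"
      by (intro hom_poly_cmult) simp
    then show ?thesis using Some by simp
  qed
  have q_rel: "(\<Sum>i\<in>UNIV. q i v *s mm i v) = 0" for v
  proof -
    have "(\<Sum>i\<in>UNIV. q i v *s mm i v) = q None v *s y v + (\<Sum>j\<in>UNIV. q (Some j) v *s m j v)"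
      by (simp add: UNIV_option_conv sum.reindex)
    also have "q None v *s y v = (\<Sum>j\<in>UNIV. rowdet (m(j := y)) v *s m j v)"
      using rowdet_cramer[OF v0 m_hom y_hom] by simp
    also have "(\<Sum>j\<in>UNIV. q (Some j) v *s m j v) = - (\<Sum>j\<in>UNIV. rowdet (m(j := y)) v *s m j v)"
      by (simp add: sum_negf vec.scale_minus_left)
    finally show ?thesis by (simp only: right_minus)
  qed
  \<comment> \<open>The coefficients of this relation are made invariant by averaging, after multiplication with a
    homogeneous function that keeps the first of them from vanishing.\<close>
  have "\<exists>h k. h \<in> hom_poly k \<and> reynolds (\<lambda>v. h v * q None v) v0 \<noteq> 0"
  proof (rule ccontr)
    assume neg: "\<not> ?thesis"
    have zero: "reynolds (\<lambda>v. h v * q None v) v0 = 0" if "h \<in> hom_span" for h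
      using that
    proof (induction rule: hom_span.induct)
      case (hom f k)
      then show ?case using neg by blast
    next
      case (add f g)
      have "reynolds (\<lambda>v. (f v + g v) * q None v) v0
        = reynolds (\<lambda>v. f v * q None v) v0 + reynolds (\<lambda>v. g v * q None v) v0"
        by (simp add: reynolds_def sum.distrib add_divide_distrib distrib_right)
      then show ?case using add.IH by simp
    qed
    obtain h where h: "h \<in> poly_fun" "h v0 = 1" "\<forall>u\<in>(\<lambda>w. w *v v0) ` W - {v0}. h u = 0"
      using poly_fun_interpolate[of "(\<lambda>w. w *v v0) ` W - {v0}" v0] by auto
    have "(\<Sum>w\<in>W. h (w *v v0) * q None (w *v v0))
        = (\<Sum>w\<in>W. if w *v v0 = v0 then q None v0 else 0)"
      using h by (intro sum.cong) auto
    also have "\<dots> = of_nat (card {w \<in> W. w *v v0 = v0}) * q None v0"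
      by (simp add: sum.If_cases Int_def)
    also have "\<dots> \<noteq> 0"
    proof -
      have "mat 1 \<in> {w \<in> W. w *v v0 = v0}" by simp
      then have "{w \<in> W. w *v v0 = v0} \<noteq> {}" by blast
      then have "card {w \<in> W. w *v v0 = v0} \<noteq> 0" by (simp only: card_eq_0_iff) simp
      then show ?thesis using v0 by simp
    qed
    finally show False
      using zero[OF poly_fun_hom_span[OF h(1)]] by (simp add: reynolds_def)
  qed
  then obtain h kap where h: "h \<in> hom_poly kap" "reynolds (\<lambda>v. h v * q None v) v0 \<noteq> 0" by blast
  define r where "r i = reynolds (\<lambda>v. h v * q i v)" for i
  define a where "a i = kap + Tot - E i" for i
  have r_inv: "r i \<in> invariant_poly (a i)" for i
  proof -
    have "(\<lambda>v. h v * q i v) \<in> hom_poly (kap + (Tot - E i))"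
      by (rule hom_poly_mult[OF h(1) q_hom])
    then show ?thesis unfolding r_def a_def using reynolds_invariants by (simp add: algebra_simps)
  qed
  have r_rel: "(\<Sum>i\<in>UNIV. r i v *s mm i v) = 0" for v
  proof -
    have "(\<Sum>i\<in>UNIV. q i (w *v v) *s mm i v) = 0" if w: "w \<in> W" for w
    proof -
      have "w *v (\<Sum>i\<in>UNIV. q i (w *v v) *s mm i v) = (\<Sum>i\<in>UNIV. q i (w *v v) *s mm i (w *v v))"
        using mm_cov w by (simp add: matrix_vector_sum vector_scalar_commute covariants_def)
      then have "w *v (\<Sum>i\<in>UNIV. q i (w *v v) *s mm i v) = w *v 0" by (simp add: q_rel)
      then show ?thesis using W_inj[OF w] by blast
    qed
    then have "(\<Sum>w\<in>W. h (w *v v) *s (\<Sum>i\<in>UNIV. q i (w *v v) *s mm i v)) = 0"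
      by (intro sum.neutral) auto
    also have "(\<Sum>w\<in>W. h (w *v v) *s (\<Sum>i\<in>UNIV. q i (w *v v) *s mm i v))
        = (\<Sum>i\<in>UNIV. (\<Sum>w\<in>W. h (w *v v) * q i (w *v v)) *s mm i v)"
      by (simp add: vec.scale_sum_right vec.scale_sum_left, subst sum.swap, simp)
    finally have "(1 / of_nat (card W)) *s (\<Sum>i\<in>UNIV. (\<Sum>w\<in>W. h (w *v v) * q i (w *v v)) *s mm i v) = 0"
      by simp
    then show ?thesis by (simp add: r_def reynolds_def vec.scale_sum_right)
  qed
  define G where "G J \<longleftrightarrow> (\<forall>i. \<exists>c. (\<forall>j\<in>J. c j \<in> invariant_poly (a i - a j)) \<and>
      (\<forall>v. r i v = (\<Sum>j\<in>J. c j v * r j v)))" for J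
  have "G UNIV"
    unfolding G_def
  proof (intro allI exI conjI ballI)
    fix i j v
    show "(\<lambda>j v. if j = i then 1 else 0) j \<in> invariant_poly (a i - a j)"
      by (auto simp: invariants_zero invariants_const)
    show "r i v = (\<Sum>j\<in>UNIV. (\<lambda>j v. if j = i then 1 else 0) j v * r j v)"
      by (simp add: if_distrib[of "\<lambda>c. c * _"] cong: if_cong)
  qed
  from ex_has_least_nat[of G, OF this, of card]
  obtain J where J: "G J" and Jmin: "\<And>J'. G J' \<Longrightarrow> card J \<le> card J'" by blast
  have "J \<noteq> {}"
  proof
    assume "J = {}"
    then have "r None v0 = 0" using J unfolding G_def by auto
    then show False using h(2) by (simp add: r_def)
  qed
  then obtain l where l: "l \<in> J" by auto
  have finJ: "finite J" by (rule finite)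
  have irred: "\<not> (\<exists>c. (\<forall>j\<in>J - {l}. c j \<in> invariant_poly (a l - a j)) \<and>
                    (\<forall>v. r l v = (\<Sum>j\<in>J - {l}. c j v * r j v)))"
  proof
    assume "\<exists>c. (\<forall>j\<in>J - {l}. c j \<in> invariant_poly (a l - a j)) \<and>
                    (\<forall>v. r l v = (\<Sum>j\<in>J - {l}. c j v * r j v))"
    then obtain c where c: "\<And>j. j \<in> J - {l} \<Longrightarrow> c j \<in> invariant_poly (a l - a j)"
      "\<And>v. r l v = (\<Sum>j\<in>J - {l}. c j v * r j v)" by blast
    have "G (J - {l})"
      unfolding G_def
    proof
      fix i
      obtain b where b: "\<And>j. j \<in> J \<Longrightarrow> b j \<in> invariant_poly (a i - a j)"
        "\<And>v. r i v = (\<Sum>j\<in>J. b j v * r j v)" using J unfolding G_def by blast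
      have "(\<lambda>v. b l v * c j v + b j v) \<in> invariant_poly (a i - a j)" if "j \<in> J - {l}" for j
      proof (rule invariants_add)
        show "(\<lambda>v. b l v * c j v) \<in> invariant_poly (a i - a j)"
          using invariants_mult[OF b(1)[OF l] c(1)[OF that]] by simp
        show "b j \<in> invariant_poly (a i - a j)" using b(1) that by simp
      qed
      moreover have "r i v = (\<Sum>j\<in>J - {l}. (b l v * c j v + b j v) * r j v)" for v
      proof -
        have "r i v = b l v * r l v + (\<Sum>j\<in>J - {l}. b j v * r j v)"
          using b(2) sum.remove[OF finJ l] by metis
        then show ?thesis
          by (simp add: c(2) sum_distrib_left sum.distrib[symmetric] algebra_simps)
      qed
      ultimately show "\<exists>c. (\<forall>j\<in>J - {l}. c j \<in> invariant_poly (a i - a j)) \<and>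
          (\<forall>v. r i v = (\<Sum>j\<in>J - {l}. c j v * r j v))"
        by (intro exI[of _ "\<lambda>j v. b l v * c j v + b j v"]) blast
    qed
    then have "card J \<le> card (J - {l})" by (rule Jmin)
    then show False using l finJ by (metis card_Diff1_less not_le)
  qed
  have "\<forall>i. \<exists>c. (\<forall>j\<in>J. c j \<in> invariant_poly (a i - a j)) \<and> (\<forall>v. r i v = (\<Sum>j\<in>J. c j v * r j v))"
    using J unfolding G_def .
  then obtain C where C: "\<And>i j. j \<in> J \<Longrightarrow> C i j \<in> invariant_poly (a i - a j)"
    "\<And>i v. r i v = (\<Sum>j\<in>J. C i j v * r j v)" by metis
  define z where "z j v = mm j v + (\<Sum>i\<in>-J. C i j v *s mm i v)" for j v
  have Cl: "C i l \<in> invariant_poly (E l - E i)" for i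
    using C(1)[OF l, of i] by (simp add: a_def)
  have z_cov: "z j \<in> covariants (E j)" if "j \<in> J" for j
  proof -
    have "(\<lambda>v. C i j v *s mm i v) \<in> covariants (E j)" for i
      using covariants_mult[OF C(1)[OF that] mm_cov[of i], of i] by (simp add: a_def)
    then show ?thesis unfolding z_def[abs_def]
      by (intro covariants_add covariants_sum mm_cov)
  qed
  have z_rel: "(\<Sum>j\<in>J. r j v *s z j v) = 0" for v
  proof -
    have "(\<Sum>j\<in>J. r j v *s z j v)
        = (\<Sum>j\<in>J. r j v *s mm j v) + (\<Sum>j\<in>J. \<Sum>i\<in>-J. (C i j v * r j v) *s mm i v)"
    proof -
      have "r j v *s z j v = r j v *s mm j v + (\<Sum>i\<in>-J. (C i j v * r j v) *s mm i v)" for j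
        unfolding z_def vec.scale_right_distrib vec.scale_sum_right vec.scale_scale
        by (simp only: mult.commute[of "r j v"])
      then show ?thesis by (simp only: sum.distrib)
    qed
    also have "(\<Sum>j\<in>J. \<Sum>i\<in>-J. (C i j v * r j v) *s mm i v) = (\<Sum>i\<in>-J. r i v *s mm i v)"
    proof -
      have "(\<Sum>j\<in>J. (C i j v * r j v) *s mm i v) = r i v *s mm i v" for i
        unfolding vec.scale_sum_left[symmetric] C(2)[of i v, symmetric] ..
      then show ?thesis by (subst sum.swap) (simp only:)
    qed
    also have "(\<Sum>j\<in>J. r j v *s mm j v) + \<dots> = (\<Sum>i\<in>UNIV. r i v *s mm i v)"
      by (subst sum.union_disjoint[symmetric]) auto
    finally show ?thesis by (simp add: r_rel)
  qed
  have zl_dec: "z l \<in> decomposable_covariants (E l)"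
  proof (rule covariant_in_ideal_decomposable[OF z_cov[OF l]])
    fix k
    have "(\<lambda>v. z l v $ k) \<in> invariant_ideal ((kap + Tot) - a l)"
    proof (rule chevalley[OF finJ l r_inv irred, of "\<lambda>j v. z j v $ k"])
      show "(\<lambda>v. z j v $ k) \<in> hom_poly (kap + Tot - a j)" if "j \<in> J" for j
        using z_cov[OF that] by (simp add: covariants_def a_def)
      show "(\<Sum>j\<in>J. r j v * z j v $ k) = 0" for v
        using arg_cong[OF z_rel[of v], of "\<lambda>x. x $ k"] by (simp add: sum_component)
    qed
    then show "(\<lambda>v. z l v $ k) \<in> invariant_ideal (E l)" by (simp add: a_def)
  qed
  have rest: "(\<lambda>v. \<Sum>i\<in>-J - {None}. C i l v *s mm i v) \<in> generated_by m e (E l)"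
  proof (rule generated_by_sum)
    fix i assume "i \<in> -J - {None}"
    then obtain j where "i = Some j" by auto
    then show "(\<lambda>v. C i l v *s mm i v) \<in> generated_by m e (E l)"
      using generated_by_mult[OF Cl[of i] generated_by_base[of m j e]] by simp
  qed simp
  show ?case
  proof (cases l)
    case None
    then have "-J - {None} = -J" using l by auto
    then have eq: "y v = z l v + (-1) *s (\<Sum>i\<in>-J - {None}. C i l v *s mm i v)" for v
      by (simp add: z_def None vec.scale_minus_left)
    have "(\<lambda>v. (-1) *s (\<Sum>i\<in>-J - {None}. C i l v *s mm i v)) \<in> generated_by m e (0 + E l)"
      by (rule generated_by_mult[OF invariants_const rest])
    then have 2: "(\<lambda>v. (-1) *s (\<Sum>i\<in>-J - {None}. C i l v *s mm i v)) \<in> generated_by m e d"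
      using None by simp
    have "z l \<in> generated_by m e d" using zl_dec None by (intro dec) simp
    then have "(\<lambda>v. z l v + (-1) *s (\<Sum>i\<in>-J - {None}. C i l v *s mm i v)) \<in> generated_by m e d"
      using 2 by (rule generated_by_add)
    then show ?thesis using eq by (metis (no_types, lifting) ext)
  next
    case (Some k)
    have dec0: "rowdet (m(k := n)) v = 0" if "n \<in> decomposable_covariants (e k)" for n v
      using that
    proof (induction rule: decomposable_covariants.induct)
      case (gen r a n)
      then show ?case using min[OF gen(3)] by (simp only: rowdet_upd_scale) simp
    next
      case (add f g)
      then show ?case by (simp only: rowdet_upd_add add_0_left)
    qed
    have "0 = rowdet (m(k := z l)) v" for v
      using dec0[of "z l" v] zl_dec Some by simp
    also have "rowdet (m(k := z l)) v
        = rowdet m v + (\<Sum>i\<in>-J. C i l v * rowdet (m(k := mm i)) v)" for v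
    proof -
      have "rowdet (m(k := z l)) v = rowdet (m(k := (\<lambda>v. mm l v + (\<Sum>i\<in>-J. C i l v *s mm i v)))) v"
        by (simp only: z_def[abs_def])
      also have "\<dots> = rowdet (m(k := mm l)) v + rowdet (m(k := (\<lambda>v. \<Sum>i\<in>-J. C i l v *s mm i v))) v"
        by (rule rowdet_upd_add)
      also have "rowdet (m(k := (\<lambda>v. \<Sum>i\<in>-J. C i l v *s mm i v))) v = (\<Sum>i\<in>-J. C i l v * rowdet (m(k := mm i)) v)"
        by (rule rowdet_upd_sum) simp
      also have "m(k := mm l) = m" by (simp add: Some)
      finally show ?thesis .
    qed
    finally have 0: "0 = rowdet m v + (\<Sum>i\<in>-J. C i l v * rowdet (m(k := mm i)) v)" for v .
    have other: "rowdet (m(k := mm i)) v = 0" if i: "i \<in> -J - {None}" for i v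
    proof -
      obtain j where j: "i = Some j" using i by (cases i) auto
      then have "j \<noteq> k" using i l Some by auto
      then show ?thesis using rowdet_upd_other j by simp
    qed
    have "None \<in> -J"
    proof (rule ccontr)
      assume "None \<notin> -J"
      then have "-J - {None} = -J" by auto
      then have "(\<Sum>i\<in>-J. C i l v0 * rowdet (m(k := mm i)) v0) = 0"
        using other by (intro sum.neutral) auto
      then show False using 0[of v0] v0 by simp
    qed
    then have split: "(\<Sum>i\<in>-J. f i) = f None + (\<Sum>i\<in>-J - {None}. f i)"
      for f :: "'n option \<Rightarrow> 'b::comm_monoid_add"
      by (intro sum.remove) auto
    have "(\<Sum>i\<in>-J - {None}. C i l v0 * rowdet (m(k := mm i)) v0) = 0"
      using other by (intro sum.neutral) auto
    then have "rowdet m v0 + C None l v0 * rowdet (m(k := y)) v0 = 0"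
      using 0[of v0] by (simp add: split)
    then have nz: "C None l v0 \<noteq> 0" "rowdet (m(k := y)) v0 \<noteq> 0"
      using v0 by auto
    have "C None l \<in> hom_poly (e k - d)" using Cl[of None] Some by (simp add: invariants_hom_poly)
    then have "\<not> e k - d < 0" using nz(1) hom_poly_degree_negative by blast
    moreover have "\<not> d < e k" using min[OF y] nz(2) by blast
    ultimately have dk: "d = e k" by simp
    define gam where "gam = C None l 0"
    have Cg: "C None l v = gam" for v
      using hom_poly_degree_zero[of "C None l" v] \<open>C None l \<in> hom_poly (e k - d)\<close> dk by (simp add: gam_def)
    have g0: "gam \<noteq> 0" using Cg nz(1) by metis
    let ?t = "\<lambda>v. z l v + ((-1) *s m k v + (-1) *s (\<Sum>i\<in>-J - {None}. C i l v *s mm i v))"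
    have "?t \<in> generated_by m e (0 + d)"
    proof (intro generated_by_add)
      show "z l \<in> generated_by m e (0 + d)" using dec zl_dec Some dk by simp
      show "(\<lambda>v. (-1) *s m k v) \<in> generated_by m e (0 + d)"
        unfolding dk by (rule generated_by_mult[OF invariants_const generated_by_base])
      show "(\<lambda>v. (-1) *s (\<Sum>i\<in>-J - {None}. C i l v *s mm i v)) \<in> generated_by m e (0 + d)"
        using generated_by_mult[OF invariants_const[of "-1"] rest] Some dk by simp
    qed
    then have "(\<lambda>v. (1 / gam) *s ?t v) \<in> generated_by m e (0 + (0 + d))"
      by (rule generated_by_mult[OF invariants_const])
    moreover have "(1 / gam) *s ?t v = y v" for v
    proof -
      have "z l v = m k v + (gam *s y v + (\<Sum>i\<in>-J - {None}. C i l v *s mm i v))"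
      proof -
        have "mm l v = m k v" "mm None v = y v" by (simp_all add: Some)
        then show ?thesis by (simp only: z_def split Cg)
      qed
      then have "?t v = gam *s y v" by (simp add: vec.scale_minus_left)
      then show ?thesis using g0 by simp
    qed
    ultimately show ?thesis by simp
  qed
qed

lemma rowdet_nonzero_free_point:
  assumes gen: "\<And>d y. y \<in> covariants d \<Longrightarrow> y \<in> generated_by m e d"
    and free: "\<And>w. w \<in> W \<Longrightarrow> w *v v = v \<Longrightarrow> w = mat 1"
  shows "rowdet m v \<noteq> 0"
proof -
  obtain b where b: "\<And>j. b j \<in> {y v | y k. y \<in> covariants k}" "det (\<chi> j. b j) \<noteq> 0"
    using spanning_set_rowdet[OF covariants_span_free_point[OF free]] by blast
  have "\<forall>j. \<exists>c. b j = (\<Sum>i\<in>UNIV. c i *s m i v)"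
  proof
    fix j
    obtain y k where "b j = y v" "y \<in> covariants k" using b(1) by blast
    then obtain c where "b j = (\<Sum>i\<in>UNIV. c i v *s m i v)"
      using gen unfolding generated_by_def by fastforce
    then show "\<exists>c. b j = (\<Sum>i\<in>UNIV. c i *s m i v)" by (intro exI[of _ "\<lambda>i. c i v"])
  qed
  then obtain c where c: "\<And>j. b j = (\<Sum>i\<in>UNIV. c j i *s m i v)" by metis
  have "(\<chi> j. b j) = (\<chi> j i. c j i) ** (\<chi> i. m i v)"
    by (simp add: vec_eq_iff matrix_matrix_mult_def c sum_component)
  then have "det (\<chi> j. b j) = det (\<chi> j i. c j i) * rowdet m v"
    by (simp add: det_mul rowdet_def)
  then show ?thesis using b(2) by auto
qed

text \<open>The determinant vanishes at non-free points only. At a point off the reflecting hyperplanes the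
  non-free points nearby form a union of subspaces of codimension at least two, so some complex plane
  through the point meets it in that point alone; but a holomorphic function of two variables has no
  isolated zero, by the maximum modulus principle for its inverse.\<close>

theorem steinberg_free:
  assumes v: "v \<in> hyperplane_complement UNIV W" and "w \<in> W" "w *v v = v"
  shows "w = mat 1"
proof -
  obtain m e where cb: "covariant_basis m e"
    and min: "\<And>k d y v. y \<in> covariants d \<Longrightarrow> d < e k \<Longrightarrow> rowdet (m(k := y)) v = 0"
    using minimal_covariant_basis_exists by blast
  have gen: "y \<in> generated_by m e d" if "y \<in> covariants d" for y d
    by (rule minimal_basis_generates[OF cb _ that]) (rule min)
  have m_hom: "(\<lambda>v. m j v $ i) \<in> hom_poly (e j)" for i j
    using cb by (auto simp: covariant_basis_def covariants_def)
  have Qpoly: "rowdet m \<in> poly_fun"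
    using rowdet_hom_poly[of m e] m_hom hom_poly_poly_fun by blast
  have "rowdet m v \<noteq> 0"
  proof
    assume Q0: "rowdet m v = 0"
    define S where "S = {x \<in> W. x \<noteq> mat 1 \<and> x *v v = v}"
    have nonrefl: "\<not> is_reflection x" if "x \<in> S" for x
    proof
      assume "is_reflection x"
      then have "{u. (x - mat 1) *v u = 0} \<in> reflecting_hyperplanes W"
        using that by (auto simp: reflecting_hyperplanes_def S_def)
      moreover have "v \<in> {u. (x - mat 1) *v u = 0}"
        using that by (simp add: S_def matrix_vector_mult_diff_rdistrib)
      ultimately show False using v by (auto simp: hyperplane_complement_def)
    qed
    have "\<forall>x\<in>S. \<exists>p q. p \<noteq> 0 \<and> (\<forall>c. q \<noteq> c *s p) \<and> (\<forall>u. x *v u = u \<longrightarrow> form p u = 0 \<and> form q u = 0)"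
    proof
      fix x assume "x \<in> S"
      then have "x \<noteq> mat 1" "\<not> is_reflection x" using nonrefl by (auto simp: S_def)
      then show "\<exists>p q. p \<noteq> 0 \<and> (\<forall>c. q \<noteq> c *s p) \<and> (\<forall>u. x *v u = u \<longrightarrow> form p u = 0 \<and> form q u = 0)"
        using nonreflection_forms[of x] by metis
    qed
    then obtain p q where pq: "\<And>x. x \<in> S \<Longrightarrow> p x \<noteq> 0" "\<And>x c. x \<in> S \<Longrightarrow> q x \<noteq> c *s p x"
      "\<And>x u. x \<in> S \<Longrightarrow> x *v u = u \<Longrightarrow> form (p x) u = 0 \<and> form (q x) u = 0" by metis
    have finS: "finite S" by (simp add: S_def)
    obtain a where a: "\<And>x. x \<in> S \<Longrightarrow> form (p x) a \<noteq> 0"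
      using exists_avoiding_forms[of "p ` S"] finS pq(1) by fastforce
    define k where "k x = form (p x) a *s q x - form (q x) a *s p x" for x
    have k0: "k x \<noteq> 0" if "x \<in> S" for x
    proof
      assume "k x = 0"
      then have "form (p x) a *s q x = form (q x) a *s p x" by (simp add: k_def)
      then have "(1 / form (p x) a) *s (form (p x) a *s q x) = (1 / form (p x) a) *s (form (q x) a *s p x)"
        by simp
      then have "q x = (form (q x) a / form (p x) a) *s p x" using a[OF that] by simp
      then show False using pq(2)[OF that] by blast
    qed
    obtain b where b: "\<And>x. x \<in> S \<Longrightarrow> form (k x) b \<noteq> 0"
      using exists_avoiding_forms[of "k ` S"] finS k0 by fastforce
    define F where "F t = v + fst t *s a + snd t *s b" for t
    have SF: "x *v F t \<noteq> F t" if x: "x \<in> S" and "t \<noteq> 0" for x t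
    proof
      assume "x *v F t = F t"
      then have "x *v (fst t *s a + snd t *s b) = fst t *s a + snd t *s b"
        using x by (simp add: F_def S_def matrix_vector_right_distrib add.assoc)
      then have 1: "fst t * form (p x) a + snd t * form (p x) b = 0"
        and 2: "fst t * form (q x) a + snd t * form (q x) b = 0"
        using pq(3)[OF x] by force+
      have "snd t * form (k x) b = form (p x) a * (fst t * form (q x) a + snd t * form (q x) b)
          - form (q x) a * (fst t * form (p x) a + snd t * form (p x) b)"
        by (simp add: k_def form_left_diff form_left_scale algebra_simps)
      then have "snd t = 0" using 1 2 b[OF x] by simp
      moreover from this have "fst t = 0" using 1 a[OF x] by simp
      ultimately show False using \<open>t \<noteq> 0\<close> by (simp add: prod_eq_iff)
    qed
    have contF: "continuous_on UNIV F"
      unfolding F_def vector_scalar_mult_def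
      by (intro continuous_intros continuous_on_vec_lambda)
    define U where "U = (\<Inter>x\<in>W - S - {mat 1}. {t. x *v F t \<noteq> F t})"
    have "open U"
      unfolding U_def
    proof (intro open_INT ballI)
      fix x :: "complex^'n^'n"
      have "continuous_on UNIV (\<lambda>t. x *v F t)"
        unfolding matrix_vector_mult_def
        by (intro continuous_on_vec_lambda continuous_intros continuous_on_component contF)
      then show "open {t. x *v F t \<noteq> F t}"
        using contF by (rule open_Collect_neq)
    qed simp
    moreover have "0 \<in> U" by (auto simp: U_def F_def S_def)
    ultimately obtain e0 where e0: "e0 > 0" "ball 0 e0 \<subseteq> U" by (auto simp: open_contains_ball)
    define ep where "ep = e0 / 3"
    have ep: "ep > 0" using e0 by (simp add: ep_def)
    define g where "g z y = rowdet m (F (z, y))" for z y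
    have gnz: "g z y \<noteq> 0" if "norm z \<le> ep" "norm y \<le> ep" "(z, y) \<noteq> 0" for z y
    proof -
      have "norm (z, y) \<le> norm z + norm y" by (rule norm_Pair_le)
      then have "(z, y) \<in> ball 0 e0" using that e0(1) by (simp add: ep_def)
      then have inU: "(z, y) \<in> U" using e0 by blast
      show ?thesis
        unfolding g_def
      proof (rule rowdet_nonzero_free_point[OF gen])
        fix x assume x: "x \<in> W" "x *v F (z, y) = F (z, y)"
        then have "x \<notin> S" using SF that(3) by blast
        then show "x = mat 1" using x inU by (auto simp: U_def)
      qed
    qed
    have contQ: "continuous_on UNIV (rowdet m)" by (rule continuous_on_poly_fun[OF Qpoly])
    have contg: "continuous_on T (\<lambda>t. g (fst t) (snd t))" for T
      unfolding g_def
      using continuous_on_compose2[OF contQ continuous_on_subset[OF contF, of T]] by simp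
    let ?K = "sphere (0::complex) ep \<times> cball (0::complex) ep"
    have Kne: "?K \<noteq> {}" using ep by simp
    have "compact ?K" by (intro compact_Times compact_sphere compact_cball)
    moreover have "continuous_on ?K (\<lambda>t. norm (g (fst t) (snd t)))"
      by (intro continuous_on_norm contg)
    ultimately have "\<exists>t0\<in>?K. \<forall>t\<in>?K. norm (g (fst t0) (snd t0)) \<le> norm (g (fst t) (snd t))"
      using Kne by (intro continuous_attains_inf)
    then obtain t0 where t0: "t0 \<in> ?K" "\<And>t. t \<in> ?K \<Longrightarrow> norm (g (fst t0) (snd t0)) \<le> norm (g (fst t) (snd t))"
      by metis
    define del where "del = norm (g (fst t0) (snd t0))"
    have del: "del > 0"
    proof -
      obtain z1 y1 where t1: "t0 = (z1, y1)" by fastforce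
      then have "norm z1 = ep" "norm y1 \<le> ep" using t0(1) by auto
      moreover have "(z1, y1) \<noteq> 0" using \<open>norm z1 = ep\<close> ep by (auto simp: zero_prod_def)
      ultimately have "g z1 y1 \<noteq> 0" by (intro gnz) auto
      then show ?thesis by (simp add: del_def t1)
    qed
    have lower: "del \<le> norm (g 0 y)" if y: "norm y \<le> ep" "y \<noteq> 0" for y
    proof -
      obtain P where P: "\<And>z. rowdet m ((v + y *s b) + z *s a) = poly P z"
        using poly_fun_on_line[OF Qpoly] by metis
      have gP: "g z y = poly P z" for z
        using P[of z] by (simp add: g_def F_def algebra_simps)
      have Pnz: "poly P z \<noteq> 0" if "norm z \<le> ep" for z
        using gnz[OF that y(1)] y(2) by (simp add: gP[symmetric] zero_prod_def)
      have "norm ((\<lambda>z. 1 / poly P z) 0) \<le> 1 / del"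
      proof (rule maximum_modulus_frontier[where S = "ball 0 ep" and f = "\<lambda>z. 1 / poly P z"])
        show "(\<lambda>z. 1 / poly P z) holomorphic_on interior (ball 0 ep)"
          using Pnz by (intro holomorphic_intros) auto
        show "continuous_on (closure (ball 0 ep)) (\<lambda>z. 1 / poly P z)"
          using Pnz ep by (intro continuous_intros) auto
        show "norm (1 / poly P z) \<le> 1 / del" if "z \<in> frontier (ball 0 ep)" for z
        proof -
          have "(z, y) \<in> ?K" using that y ep by (simp add: frontier_ball)
          then have "del \<le> norm (poly P z)" using t0(2)[of "(z, y)"] by (simp add: del_def gP)
          then show ?thesis using del by (simp add: norm_divide frac_le)
        qed
      qed (use ep in auto)
      moreover have "poly P 0 \<noteq> 0" using Pnz[of 0] ep by simp
      ultimately show ?thesis using del by (simp add: gP norm_divide field_simps)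
    qed
    have "continuous_on UNIV (\<lambda>y. g 0 y)"
      using continuous_on_compose2[OF contg[of UNIV], of UNIV "\<lambda>y. (0, y)"]
      by (simp add: continuous_intros)
    then have "isCont (\<lambda>y. g 0 y) 0" by (simp add: continuous_on_eq_continuous_at)
    then obtain eta where eta: "eta > 0" "\<And>y. norm y < eta \<Longrightarrow> norm (g 0 y - g 0 0) < del"
      unfolding continuous_at_eps_delta using del by (force simp: dist_norm)
    define y :: complex where "y = of_real (min ep eta / 2)"
    have ny: "norm y = min ep eta / 2" using ep eta by (simp add: y_def)
    have "g 0 0 = 0" using Q0 by (simp add: g_def F_def)
    then have "norm (g 0 y) < del" using eta(2)[of y] ny ep eta(1) by simp
    moreover have "del \<le> norm (g 0 y)"
      using ep eta(1) by (intro lower) (auto simp: ny, simp add: y_def)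
    ultimately show False by simp
  qed
  moreover have "w *v m j v = m j v" for j
  proof -
    have "m j \<in> covariants (e j)" using cb by (simp add: covariant_basis_def)
    then have "m j (w *v v) = w *v m j v" using assms(2) by (simp add: covariants_def)
    then show ?thesis by (simp add: assms(3))
  qed
  ultimately have "w *v u = u" for u
  proof -
    obtain x where "u = (\<Sum>j\<in>UNIV. x j *s m j v)"
      using rowdet_nonzero_solve[OF \<open>rowdet m v \<noteq> 0\<close>] by blast
    then show ?thesis
      using \<open>\<And>j. w *v m j v = m j v\<close> by (simp add: matrix_vector_sum vector_scalar_commute)
  qed
  then show ?thesis by (simp add: matrix_eq)
qed

end


section \<open>Path functors on the complement of an arrangement\<close>

lemma exists_near_avoiding_im:
  fixes S :: "(complex^'n) set"
  assumes "finite S" "0 \<notin> S" "0 < r"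
  shows "\<exists>z. dist c z < r \<and> (\<forall>a\<in>S. Im (form a z) \<noteq> 0)"
  using assms
proof (induction S)
  case empty
  then show ?case by (intro exI[of _ c]) auto
next
  case (insert a S)
  then obtain z where z: "dist c z < r" "\<forall>b\<in>S. Im (form b z) \<noteq> 0" by auto
  obtain v0 where v0: "form a v0 = 1" using form_nonzero insert.prems by auto
  define v where "v = \<i> *s v0"
  have v: "form a v = \<i>" using v0 by (simp add: v_def)
  define e where "e = (r - dist c z) / (norm v + 1)"
  have e: "e > 0" using z(1) by (simp add: e_def add_nonneg_pos)
  let ?bad = "insert (- Im (form a z)) ((\<lambda>b. - Im (form b z) / Im (form b v)) ` S)"
  have "infinite ({0<..<e} - ?bad)"
    using insert.hyps(1) e by (intro Diff_infinite_finite) auto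
  then obtain t where t: "t \<in> {0<..<e}" "t \<notin> ?bad"
    by (metis (no_types, lifting) DiffD1 DiffD2 finite.emptyI subsetI subset_empty equals0I)
  have "dist c (z + t *\<^sub>R v) \<le> dist c z + t * norm v"
    using dist_triangle[of c "z + t *\<^sub>R v" z] t by (simp add: dist_norm)
  also have "t * norm v \<le> t * (norm v + 1)" using t by (simp add: algebra_simps)
  also have "t * (norm v + 1) < e * (norm v + 1)"
    using t by (intro mult_strict_right_mono) (auto intro: add_nonneg_pos)
  also have "e * (norm v + 1) = r - dist c z"
    using add_nonneg_pos[OF norm_ge_zero[of v] zero_less_one] by (simp add: e_def)
  finally have 1: "dist c (z + t *\<^sub>R v) < r" by simp
  have "Im (form b (z + t *\<^sub>R v)) \<noteq> 0" if "b \<in> insert a S" for b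
  proof (cases "b = a")
    case True
    then show ?thesis using t v by auto
  next
    case False
    then have b: "b \<in> S" using that by auto
    show ?thesis
    proof
      assume e0: "Im (form b (z + t *\<^sub>R v)) = 0"
      then have "Im (form b v) \<noteq> 0" using z(2) b by auto
      then have "t = - Im (form b z) / Im (form b v)"
        using e0 by (simp add: field_simps)
      then show False using t b by auto
    qed
  qed
  then show ?case using 1 by blast
qed

lemma complex_line_path:
  fixes B :: "(complex^'n) set"
  assumes B: "finite B" and x: "\<And>b. b \<in> B \<Longrightarrow> form b x \<noteq> 0" and y: "\<And>b. b \<in> B \<Longrightarrow> form b y \<noteq> 0"
  obtains z where "path z" "pathstart z = 0" "pathfinish z = (1::complex)"
    "\<And>t b. t \<in> {0..1} \<Longrightarrow> b \<in> B \<Longrightarrow> form b (x + z t *s (y - x)) \<noteq> 0"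
proof -
  define bad where "bad = (\<lambda>b. - form b x / form b (y - x)) ` {b \<in> B. form b (y - x) \<noteq> 0}"
  have "path_connected (- bad)"
    using B by (intro path_connected_complement_countable) (auto simp: bad_def countable_finite)
  moreover have good: "form b (x + c *s (y - x)) \<noteq> 0" if "c \<notin> bad" "b \<in> B" for b c
  proof
    assume e: "form b (x + c *s (y - x)) = 0"
    from e have e': "form b x + c * form b (y - x) = 0" by (simp only: form_add form_scale)
    then have nz: "form b (y - x) \<noteq> 0" using x[OF that(2)] by auto
    have "c * form b (y - x) = - form b x"
      using e' by (metis add_eq_0_iff)
    then have "c = - form b x / form b (y - x)"
      using nz by (metis nonzero_mult_div_cancel_right)
    then show False using that nz by (auto simp: bad_def)
  qed
  moreover have "0 \<in> - bad" using x by (auto simp: bad_def)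
  moreover have "1 \<in> - bad"
  proof
    assume "1 \<in> bad"
    then obtain b where b: "b \<in> B" "form b (y - x) \<noteq> 0" "1 = - form b x / form b (y - x)"
      by (auto simp: bad_def)
    then have "form b (y - x) = - form b x" by (metis divide_eq_1_iff)
    then show False using y[OF b(1)] by simp
  qed
  ultimately obtain z where z: "path z" "path_image z \<subseteq> - bad" "pathstart z = 0" "pathfinish z = 1"
    unfolding path_connected_def by blast
  show ?thesis
  proof (rule that[OF z(1,3,4)])
    fix t b assume "t \<in> {0..1::real}" "b \<in> B"
    then have "z t \<in> - bad" using z(2) unfolding path_image_def by blast
    then show "form b (x + z t *s (y - x)) \<noteq> 0"
      using \<open>b \<in> B\<close> by (intro good) auto
  qed
qed

lemma continuous_on_vsmult [continuous_intros]:
  fixes f :: "'x::topological_space \<Rightarrow> complex" and g :: "'x \<Rightarrow> complex^'m"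
  assumes "continuous_on S f" "continuous_on S g"
  shows "continuous_on S (\<lambda>x. f x *s g x)"
  unfolding vector_scalar_mult_def using assms
  by (intro continuous_on_vec_lambda continuous_intros continuous_on_component)

locale path_functor =
  fixes forms :: "(complex^'n) set" and u :: "complex^'n"
    and A :: "('g, 'k) monoid_scheme" and F :: "(real \<Rightarrow> complex^'n) \<Rightarrow> 'g"
    and M :: "(complex^'n) set"
  assumes finite_forms: "finite forms" and form_u: "\<And>a. a \<in> forms \<Longrightarrow> form a u = 1"
    and M_def: "M = {x. \<forall>a\<in>forms. form a x \<noteq> 0}"
    and comm_A: "comm_group A"
    and F_carrier: "\<And>g. path g \<Longrightarrow> path_image g \<subseteq> M \<Longrightarrow> F g \<in> carrier A"
    and F_join: "\<And>g h. path g \<Longrightarrow> path_image g \<subseteq> M \<Longrightarrow> path h \<Longrightarrow> path_image h \<subseteq> M \<Longrightarrow>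
      pathfinish g = pathstart h \<Longrightarrow> F (g +++ h) = F g \<otimes>\<^bsub>A\<^esub> F h"
    and F_homotopic: "\<And>g h. homotopic_paths M g h \<Longrightarrow> F g = F h"
begin

sublocale A: comm_group A by (rule comm_A)

lemma forms_nonzero: "a \<in> forms \<Longrightarrow> a \<noteq> 0"
  using form_u by fastforce

lemma F_in_simply_connected:
  assumes "simply_connected S" "S \<subseteq> M" "path g" "path_image g \<subseteq> S" "path h" "path_image h \<subseteq> S"
    "pathstart g = pathstart h" "pathfinish g = pathfinish h"
  shows "F g = F h"
proof (rule F_homotopic)
  have "homotopic_paths S g h"
    using assms by (auto simp: simply_connected_eq_homotopic_paths)
  then show "homotopic_paths M g h" using assms(2) homotopic_paths_subset by blast
qed

lemma F_const: "x \<in> M \<Longrightarrow> F (linepath x x) = \<one>\<^bsub>A\<^esub>"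
proof -
  assume x: "x \<in> M"
  have c: "F (linepath x x) \<in> carrier A" using x by (intro F_carrier) auto
  have "F (linepath x x) \<otimes>\<^bsub>A\<^esub> F (linepath x x) = F (linepath x x +++ linepath x x)"
    using x by (intro F_join[symmetric]) auto
  also have "linepath x x +++ linepath x x = linepath x x"
    by (auto simp: joinpaths_def linepath_refl)
  finally show ?thesis using c A.l_cancel_one by blast
qed

lemma F_linepath_triangle:
  assumes "convex S" "S \<subseteq> M" "x \<in> S" "y \<in> S" "z \<in> S"
  shows "F (linepath x y) \<otimes>\<^bsub>A\<^esub> F (linepath y z) = F (linepath x z)"
proof -
  have sub: "closed_segment x y \<subseteq> S" "closed_segment y z \<subseteq> S" "closed_segment x z \<subseteq> S"
    using assms closed_segment_subset by blast+
  have "F (linepath x y) \<otimes>\<^bsub>A\<^esub> F (linepath y z) = F (linepath x y +++ linepath y z)"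
    using sub assms by (intro F_join[symmetric]) auto
  also have "\<dots> = F (linepath x z)"
  proof (rule F_in_simply_connected[OF convex_imp_simply_connected[OF assms(1)] assms(2)])
    show "path_image (linepath x y +++ linepath y z) \<subseteq> S"
      using sub by (intro order.trans[OF path_image_join_subset]) auto
  qed (use sub in auto)
  finally show ?thesis .
qed

lemma F_square:
  assumes cont: "continuous_on ({0..1} \<times> {0..1}) H" and im: "H ` ({0..1} \<times> {0..1}) \<subseteq> M"
  shows "F (\<lambda>t. H (0, t)) \<otimes>\<^bsub>A\<^esub> F (\<lambda>s. H (s, 1)) = F (\<lambda>s. H (s, 0)) \<otimes>\<^bsub>A\<^esub> F (\<lambda>t. H (1, t))"
proof -
  let ?S = "{0..1::real} \<times> {0..1::real}"
  define a where "a = (linepath (0,0) (0,1) :: real \<Rightarrow> real \<times> real)"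
  define b where "b = (linepath (0,1) (1,1) :: real \<Rightarrow> real \<times> real)"
  define c where "c = (linepath (0,0) (1,0) :: real \<Rightarrow> real \<times> real)"
  define d where "d = (linepath (1,0) (1,1) :: real \<Rightarrow> real \<times> real)"
  have cv: "convex ?S" by (intro convex_Times) auto
  have seg: "closed_segment p q \<subseteq> ?S" if "p \<in> ?S" "q \<in> ?S" for p q
    using closed_segment_subset[OF that cv] .
  have pi: "path_image a \<subseteq> ?S" "path_image b \<subseteq> ?S" "path_image c \<subseteq> ?S" "path_image d \<subseteq> ?S"
    unfolding a_def b_def c_def d_def path_image_linepath by (intro seg; simp)+
  have ps: "path a" "path b" "path c" "path d" "pathfinish a = pathstart b" "pathfinish c = pathstart d"
    "pathstart a = pathstart c" "pathfinish b = pathfinish d"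
    by (auto simp: a_def b_def c_def d_def)
  have "homotopic_paths ?S (a +++ b) (c +++ d)"
    using convex_imp_simply_connected[OF cv] ps pi
    by (auto simp: simply_connected_eq_homotopic_paths path_image_join)
  then have "homotopic_paths M (H \<circ> (a +++ b)) (H \<circ> (c +++ d))"
    using cont im by (intro homotopic_paths_continuous_image[of ?S]) auto
  then have eq: "F ((H \<circ> a) +++ (H \<circ> b)) = F ((H \<circ> c) +++ (H \<circ> d))"
    using F_homotopic by (simp add: path_compose_join)
  have p: "path (H \<circ> g)" "path_image (H \<circ> g) \<subseteq> M" if "path g" "path_image g \<subseteq> ?S" for g :: "real \<Rightarrow> real \<times> real"
  proof -
    show "path (H \<circ> g)"
      using that cont by (intro path_continuous_image) (auto intro: continuous_on_subset)
    show "path_image (H \<circ> g) \<subseteq> M" using that im by (auto simp: path_image_compose)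
  qed
  have "F ((H \<circ> a) +++ (H \<circ> b)) = F (H \<circ> a) \<otimes>\<^bsub>A\<^esub> F (H \<circ> b)"
    using p ps pi by (intro F_join) (auto simp: pathstart_compose pathfinish_compose)
  moreover have "F ((H \<circ> c) +++ (H \<circ> d)) = F (H \<circ> c) \<otimes>\<^bsub>A\<^esub> F (H \<circ> d)"
    using p ps pi by (intro F_join) (auto simp: pathstart_compose pathfinish_compose)
  moreover have "H \<circ> a = (\<lambda>t. H (0, t))" "H \<circ> b = (\<lambda>s. H (s, 1))"
    "H \<circ> c = (\<lambda>s. H (s, 0))" "H \<circ> d = (\<lambda>t. H (1, t))"
    by (auto simp: a_def b_def c_def d_def linepath_def fun_eq_iff)
  ultimately show ?thesis using eq by simp
qed

lemma F_free_homotopy: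
  fixes H :: "real \<times> real \<Rightarrow> complex^'n"
  assumes cont: "continuous_on ({0..1} \<times> {0..1}) H" and im: "H ` ({0..1} \<times> {0..1}) \<subseteq> M"
    and loop: "\<And>s. H (s, 0) = H (s, 1)"
  shows "F (\<lambda>t. H (0, t)) = F (\<lambda>t. H (1, t))"
proof -
  have sec: "path (\<lambda>t. H (f t))" "path_image (\<lambda>t. H (f t)) \<subseteq> M"
    if "continuous_on {0..1} f" "f ` {0..1} \<subseteq> {0..1} \<times> {0..1}" for f :: "real \<Rightarrow> real \<times> real"
  proof -
    show "path (\<lambda>t. H (f t))" using continuous_on_compose2[OF cont that] by (simp add: path_def)
    have "H (f t) \<in> M" if "t \<in> {0..1}" for t
      using \<open>f ` {0..1} \<subseteq> {0..1} \<times> {0..1}\<close> im that by blast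
    then show "path_image (\<lambda>t. H (f t)) \<subseteq> M" by (auto simp: path_image_def)
  qed
  have "F (\<lambda>t. H (0, t)) \<in> carrier A" "F (\<lambda>t. H (1, t)) \<in> carrier A" "F (\<lambda>s. H (s, 0)) \<in> carrier A"
    by (intro F_carrier sec; auto intro!: continuous_intros)+
  moreover have "F (\<lambda>s. H (s, 0)) = F (\<lambda>s. H (s, 1))" using loop by simp
  ultimately show ?thesis
    using F_square[OF cont im] by (metis A.m_comm A.r_cancel)
qed

definition face :: "complex^'n \<Rightarrow> (complex^'n) set" where
  "face a = {q. form a q = 0 \<and> (\<forall>b\<in>forms - {a}. form b q \<noteq> 0)}"

definition circle :: "complex^'n \<Rightarrow> complex \<Rightarrow> real \<Rightarrow> complex^'n" where
  "circle q d = (\<lambda>t. q + (d * exp (2 * of_real pi * \<i> * of_real t)) *s u)"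

definition small_radius :: "complex^'n \<Rightarrow> complex^'n \<Rightarrow> complex \<Rightarrow> bool" where
  "small_radius a q d \<longleftrightarrow> d \<noteq> 0 \<and> (\<forall>b\<in>forms - {a}. norm d < norm (form b q))"

lemma norm_exp_circle [simp]: "norm (exp (2 * of_real pi * \<i> * of_real t)) = 1"
  by (simp add: norm_exp_eq_Re)

lemma circle_in_M:
  assumes "a \<in> forms" "q \<in> face a" "small_radius a q d"
  shows "circle q d t \<in> M"
proof -
  have "form b (circle q d t) \<noteq> 0" if b: "b \<in> forms" for b
  proof (cases "b = a")
    case True
    then show ?thesis using assms form_u by (auto simp: circle_def face_def small_radius_def)
  next
    case False
    have "norm (d * exp (2 * of_real pi * \<i> * of_real t)) < norm (form b q)"
      using assms False b by (simp add: norm_mult small_radius_def)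
    then have "form b q + d * exp (2 * of_real pi * \<i> * of_real t) \<noteq> 0"
      by (metis add_eq_0_iff norm_minus_cancel order_less_irrefl)
    then show ?thesis using form_u[OF b] by (simp add: circle_def)
  qed
  then show ?thesis by (simp add: M_def)
qed

lemma circle_homotopy:
  fixes qq :: "real \<Rightarrow> complex^'n" and dd :: "real \<Rightarrow> complex"
  assumes "a \<in> forms" and "continuous_on {0..1} qq" "continuous_on {0..1} dd"
    and "\<And>s. s \<in> {0..1} \<Longrightarrow> qq s \<in> face a" "\<And>s. s \<in> {0..1} \<Longrightarrow> small_radius a (qq s) (dd s)"
  shows "F (circle (qq 0) (dd 0)) = F (circle (qq 1) (dd 1))"
proof -
  let ?H = "\<lambda>(s, t). circle (qq s) (dd s) t"
  have "F (\<lambda>t. ?H (0, t)) = F (\<lambda>t. ?H (1, t))"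
  proof (rule F_free_homotopy)
    have "continuous_on ({0..1} \<times> {0..1}) (\<lambda>p. qq (fst p))" "continuous_on ({0..1} \<times> {0..1}) (\<lambda>p. dd (fst p))"
      by (auto intro!: continuous_on_compose2[OF assms(2)] continuous_on_compose2[OF assms(3)] continuous_intros)
    then show "continuous_on ({0..1} \<times> {0..1}) ?H"
      unfolding circle_def split_def by (intro continuous_intros)
    show "?H ` ({0..1} \<times> {0..1}) \<subseteq> M"
      using assms by (auto intro!: circle_in_M)
    show "?H (s, 0) = ?H (s, 1)" for s
      by (simp add: circle_def)
  qed
  then show ?thesis by simp
qed

lemma circle_radius_independent:
  assumes "a \<in> forms" "q \<in> face a" "small_radius a q d" "small_radius a q d'"
  shows "F (circle q d) = F (circle q d')"
proof -
  define z where "z = Ln (d' / d)"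
  have nz: "d \<noteq> 0" "d' \<noteq> 0" using assms by (auto simp: small_radius_def)
  have "F (circle q (d * exp (of_real 0 * z))) = F (circle q (d * exp (of_real 1 * z)))"
  proof (rule circle_homotopy[OF assms(1), of "\<lambda>_. q" "\<lambda>s. d * exp (of_real s * z)"])
    show "small_radius a q (d * exp (of_real s * z))" if s: "s \<in> {0..1}" for s
    proof -
      have "norm (d * exp (of_real s * z)) \<le> max (norm d) (norm d')"
      proof -
        have "Re z = ln (norm d' / norm d)" using nz by (simp add: z_def norm_divide)
        then have "norm (d * exp (of_real s * z)) = norm d * exp (s * ln (norm d' / norm d))"
          by (simp add: norm_mult norm_exp_eq_Re)
        also have "\<dots> = norm d powr (1 - s) * norm d' powr s"
          using nz by (simp add: powr_def exp_add[symmetric] ln_div algebra_simps)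
             (simp add: exp_diff exp_add field_simps)
        also have "\<dots> \<le> max (norm d) (norm d') powr (1 - s) * max (norm d) (norm d') powr s"
          using s by (intro mult_mono powr_mono2) auto
        also have "\<dots> = max (norm d) (norm d')"
          using nz by (simp add: powr_add[symmetric] abs_of_nonneg le_max_iff_disj)
        finally show ?thesis .
      qed
      moreover have "max (norm d) (norm d') < norm (form b q)" if "b \<in> forms - {a}" for b
        using assms(3,4) that by (simp add: small_radius_def)
      ultimately show ?thesis using nz unfolding small_radius_def by (fastforce intro: le_less_trans)
    qed
  qed (use assms in \<open>auto intro!: continuous_intros\<close>)
  then show ?thesis using nz by (simp add: z_def)
qed

text \<open>A face is connected, and along a path in it one radius can be chosen small enough throughout.\<close>

lemma circle_independent:
  assumes a: "a \<in> forms" and q: "q \<in> face a" "small_radius a q d" and q': "q' \<in> face a" "small_radius a q' d'"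
  shows "F (circle q d) = F (circle q' d')"
proof -
  obtain z where z: "path z" "pathstart z = 0" "pathfinish z = (1::complex)"
    "\<And>t b. t \<in> {0..1} \<Longrightarrow> b \<in> forms - {a} \<Longrightarrow> form b (q + z t *s (q' - q)) \<noteq> 0"
    using complex_line_path[of "forms - {a}" q q'] finite_forms q(1) q'(1)
    by (auto simp: face_def)
  define g where "g t = q + z t *s (q' - q)" for t
  have contg: "continuous_on {0..1} g"
    unfolding g_def using z(1) by (intro continuous_intros) (simp add: path_def)
  have gf: "g t \<in> face a" if "t \<in> {0..1}" for t
    using z(4)[OF that] q(1) q'(1) by (auto simp: g_def face_def)
  have "\<exists>r>0. \<forall>t\<in>{0..1}. \<forall>b\<in>forms - {a}. r < norm (form b (g t))"
  proof (cases "forms - {a} = {}")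
    case True
    then show ?thesis by (intro exI[of _ 1]) auto
  next
    case False
    define K where "K = (\<Union>b\<in>forms - {a}. (\<lambda>t. norm (form b (g t))) ` {0..1})"
    have "compact K" unfolding K_def
      using finite_forms contg by (intro compact_UN compact_continuous_image continuous_intros) auto
    moreover have "K \<noteq> {}" using False by (auto simp: K_def)
    ultimately obtain m where m: "m \<in> K" "\<forall>y\<in>K. m \<le> y" using compact_attains_inf by blast
    obtain b t where bt: "b \<in> forms - {a}" "t \<in> {0..1}" "m = norm (form b (g t))"
      using m(1) unfolding K_def by blast
    have "form b (g t) \<noteq> 0" using gf[OF bt(2)] bt(1) by (simp add: face_def)
    then have "m > 0" using bt(3) by simp
    have "m / 2 < norm (form b (g t))" if "t \<in> {0..1}" "b \<in> forms - {a}" for t b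
    proof -
      have "norm (form b (g t)) \<in> K" using that unfolding K_def by blast
      then show ?thesis using m(2) \<open>m > 0\<close> by fastforce
    qed
    then show ?thesis using \<open>m > 0\<close> by (intro exI[of _ "m / 2"]) simp
  qed
  then obtain r where r: "r > 0" "\<And>t b. t \<in> {0..1} \<Longrightarrow> b \<in> forms - {a} \<Longrightarrow> r < norm (form b (g t))" by blast
  have sr: "small_radius a (g t) (of_real r)" if "t \<in> {0..1}" for t
    using r that by (simp add: small_radius_def)
  have ends: "g 0 = q" "g 1 = q'" using z(2,3) by (simp_all add: g_def pathstart_def pathfinish_def)
  have "F (circle q d) = F (circle q (of_real r))"
    using sr[of 0] ends q by (intro circle_radius_independent[OF a]) auto
  also have "\<dots> = F (circle q' (of_real r))"
    using circle_homotopy[OF a contg, of "\<lambda>_. of_real r"] gf sr ends by simp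
  also have "\<dots> = F (circle q' d')"
    using sr[of 1] ends q' by (intro circle_radius_independent[OF a]) auto
  finally show ?thesis .
qed

definition cut :: "(complex^'n) set" where
  "cut = {x. \<forall>a\<in>forms. form a x \<notin> \<real>\<^sub>\<le>\<^sub>0}"

definition crossings :: "(complex^'n) set" where
  "crossings = {x. \<exists>a\<in>forms. \<exists>b\<in>forms. a \<noteq> b \<and> Im (form a x) = 0 \<and> Im (form b x) = 0}"

lemma cut_subset_M: "cut \<subseteq> M"
  by (auto simp: cut_def M_def)

lemma u_cut: "u \<in> cut"
  by (auto simp: cut_def form_u)

lemma cut_starlike: "closed_segment u x \<subseteq> cut" if "x \<in> cut"
proof
  fix y assume "y \<in> closed_segment u x"
  then obtain t where t: "0 \<le> t" "t \<le> 1" "y = (1 - t) *\<^sub>R u + t *\<^sub>R x" by (auto simp: in_segment)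
  have "form a y \<notin> \<real>\<^sub>\<le>\<^sub>0" if a: "a \<in> forms" for a
  proof
    assume n: "form a y \<in> \<real>\<^sub>\<le>\<^sub>0"
    have fy: "form a y = of_real (1 - t) + of_real t * form a x"
      by (simp add: t(3) form_u[OF a] scaleR_conv_of_real[where 'a = complex])
    have fx: "form a x \<notin> \<real>\<^sub>\<le>\<^sub>0" using \<open>x \<in> cut\<close> a by (simp add: cut_def)
    show False
    proof (cases "t = 0")
      case True
      then show ?thesis using n fy by simp
    next
      case False
      then have "Im (form a x) = 0" "Re (form a x) > 0 \<or> Im (form a x) \<noteq> 0"
        using n fx t form_u[OF a] by (auto simp: fy complex_nonpos_Reals_iff)
      then have "t * Re (form a x) > 0" using False t by auto
      then show ?thesis using n t form_u[OF a] by (auto simp: fy complex_nonpos_Reals_iff)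
    qed
  qed
  then show "y \<in> cut" by (simp add: cut_def)
qed

lemma simply_connected_cut: "simply_connected cut"
  using cut_starlike u_cut by (intro starlike_imp_simply_connected) (auto simp: starlike_def)

lemma open_cut: "open cut"
proof -
  have "cut = (\<Inter>a\<in>forms. {x. form a x \<notin> \<real>\<^sub>\<le>\<^sub>0})" by (auto simp: cut_def)
  moreover have "open {x. form a x \<notin> \<real>\<^sub>\<le>\<^sub>0}" for a
  proof -
    have "open ((\<lambda>x. form a x) -` (- \<real>\<^sub>\<le>\<^sub>0))"
      by (intro open_vimage) (auto intro!: continuous_intros)
    then show ?thesis by (simp add: vimage_def)
  qed
  ultimately show ?thesis using finite_forms by auto
qed

lemma open_M: "open M"
proof -
  have "M = (\<Inter>a\<in>forms. {x. form a x \<noteq> 0})" by (auto simp: M_def)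
  moreover have "open {x. form a x \<noteq> 0}" for a
    by (intro open_Collect_neq continuous_intros)
  ultimately show ?thesis using finite_forms by auto
qed

lemma cut_dense: "0 < r \<Longrightarrow> \<exists>y\<in>cut. dist x y < r"
  using exists_near_avoiding_im[OF finite_forms, of r x] forms_nonzero
  by (force simp: cut_def complex_nonpos_Reals_iff)

definition ray_value :: "complex^'n \<Rightarrow> 'g" where
  "ray_value x = F (linepath x u)"

lemma ray_value_carrier: "x \<in> cut \<Longrightarrow> ray_value x \<in> carrier A"
  unfolding ray_value_def using cut_starlike[of x] cut_subset_M
  by (intro F_carrier) (auto simp: closed_segment_commute)

lemma ray_value_path:
  assumes "path g" "path_image g \<subseteq> cut"
  shows "F g \<otimes>\<^bsub>A\<^esub> ray_value (pathfinish g) = ray_value (pathstart g)"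
proof -
  have fin: "pathfinish g \<in> cut" "pathstart g \<in> cut" using assms by auto
  have seg: "closed_segment (pathfinish g) u \<subseteq> cut" "closed_segment (pathstart g) u \<subseteq> cut"
    using cut_starlike[OF fin(1)] cut_starlike[OF fin(2)] by (simp_all add: closed_segment_commute)
  have "F g \<otimes>\<^bsub>A\<^esub> ray_value (pathfinish g) = F (g +++ linepath (pathfinish g) u)"
    unfolding ray_value_def using assms seg cut_subset_M by (intro F_join[symmetric]) auto
  also have "\<dots> = ray_value (pathstart g)"
    unfolding ray_value_def
  proof (rule F_in_simply_connected[OF simply_connected_cut cut_subset_M])
    show "path_image (g +++ linepath (pathfinish g) u) \<subseteq> cut"
      using assms seg by (intro order.trans[OF path_image_join_subset]) auto
  qed (use assms seg in auto)
  finally show ?thesis .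
qed


lemma ball_triangle:
  assumes "ball c r \<subseteq> M" "x \<in> ball c r" "y \<in> ball c r"
  shows "F (linepath c x) \<otimes>\<^bsub>A\<^esub> F (linepath x y) = F (linepath c y)"
    "F (linepath x y) \<in> carrier A"
proof -
  have c: "c \<in> ball c r" using assms(2) by (metis centre_in_ball dist_not_less_zero mem_ball not_less order.strict_trans1 zero_le_dist)
  show "F (linepath c x) \<otimes>\<^bsub>A\<^esub> F (linepath x y) = F (linepath c y)"
    by (rule F_linepath_triangle[OF convex_ball assms(1) c assms(2,3)])
  have "closed_segment x y \<subseteq> M"
    using closed_segment_subset[OF assms(2,3) convex_ball] assms(1) by blast
  then show "F (linepath x y) \<in> carrier A" by (intro F_carrier) auto
qed

text \<open>The value of \<open>F\<close> on the detour through a cut point \<open>y\<close> near \<open>c\<close>; it will not depend on \<open>y\<close>.\<close>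

definition detour :: "complex^'n \<Rightarrow> complex^'n \<Rightarrow> 'g" where
  "detour c y = F (linepath c y) \<otimes>\<^bsub>A\<^esub> ray_value y"

lemma detour_segment:
  assumes "ball c r \<subseteq> M" "y \<in> ball c r" "y' \<in> ball c r" "closed_segment y y' \<subseteq> cut"
  shows "detour c y = detour c y'"
proof -
  have y: "y \<in> cut" "y' \<in> cut" using assms(4) by auto
  have c: "c \<in> ball c r" using assms(2) by (metis centre_in_ball dist_not_less_zero mem_ball not_less order.strict_trans1 zero_le_dist)
  have "detour c y' = (F (linepath c y) \<otimes>\<^bsub>A\<^esub> F (linepath y y')) \<otimes>\<^bsub>A\<^esub> ray_value y'"
    using ball_triangle(1)[OF assms(1-3)] by (simp add: detour_def)
  also have "\<dots> = F (linepath c y) \<otimes>\<^bsub>A\<^esub> (F (linepath y y') \<otimes>\<^bsub>A\<^esub> ray_value y')"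
    using ball_triangle(2)[OF assms(1) c assms(2)] ball_triangle(2)[OF assms(1-3)] y
    by (intro A.m_assoc ray_value_carrier)
  also have "F (linepath y y') \<otimes>\<^bsub>A\<^esub> ray_value y' = ray_value y"
    using ray_value_path[of "linepath y y'"] assms(4) by simp
  finally show ?thesis by (simp add: detour_def)
qed

text \<open>Crossing a wall: the ellipse through the wall point \<open>p\<close> is freely homotopic to a small circle around
  the face behind it, and all of it except \<open>p\<close> lies in the cut space.\<close>

lemma crossing:
  assumes a: "a \<in> forms" and pa: "Im (form a p) = 0" "Re (form a p) < 0"
    and others: "\<And>b. b \<in> forms - {a} \<Longrightarrow> form b p \<notin> \<real>\<^sub>\<le>\<^sub>0"
    and trivial: "\<And>q d. q \<in> face a \<Longrightarrow> small_radius a q d \<Longrightarrow> F (circle q d) = \<one>\<^bsub>A\<^esub>"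
    and r: "0 < r" "ball p r \<subseteq> M"
  shows "\<exists>y\<in>ball p r. \<exists>y'\<in>ball p r. y \<in> cut \<and> y' \<in> cut \<and> Im (form a y) > 0 \<and> Im (form a y') < 0 \<and>
    detour p y = detour p y'"
proof -
  define rho where "rho = - Re (form a p)"
  have rho: "rho > 0" "form a p = - of_real rho" using pa by (auto simp: rho_def complex_eq_iff)
  define e0 where "e0 = Min (insert rho ((\<lambda>b. infdist (form b p) \<real>\<^sub>\<le>\<^sub>0) ` (forms - {a})))"
  have dpos: "infdist (form b p) \<real>\<^sub>\<le>\<^sub>0 > 0" if "b \<in> forms - {a}" for b
  proof -
    have "(0 :: complex) \<in> \<real>\<^sub>\<le>\<^sub>0" by simp
    then have "(\<real>\<^sub>\<le>\<^sub>0 :: complex set) \<noteq> {}" by blast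
    then show ?thesis
      using in_closed_iff_infdist_zero[OF closed_nonpos_Reals_complex, of "form b p"] others[OF that]
        infdist_nonneg[of "form b p" "\<real>\<^sub>\<le>\<^sub>0"] by force
  qed
  have e0: "e0 > 0" "e0 \<le> rho" "\<And>b. b \<in> forms - {a} \<Longrightarrow> e0 \<le> infdist (form b p) \<real>\<^sub>\<le>\<^sub>0"
    using finite_forms rho dpos by (auto simp: e0_def)
  define e where "e = e0 / 2"
  have e: "e > 0" "e < rho" "\<And>b. b \<in> forms - {a} \<Longrightarrow> e < infdist (form b p) \<real>\<^sub>\<le>\<^sub>0"
    using e0 by (auto simp: e_def) (smt (verit) field_sum_of_halves DiffI singletonD)+
  have far: "form b p + z \<notin> \<real>\<^sub>\<le>\<^sub>0" if b: "b \<in> forms - {a}" and z: "0 \<le> Re z" "\<bar>Im z\<bar> \<le> e" for b z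
  proof
    assume n: "form b p + z \<in> \<real>\<^sub>\<le>\<^sub>0"
    define x where "x = form b p + \<i> * of_real (Im z)"
    have "Re x \<le> 0 \<and> Im x = 0" using n z by (auto simp: x_def complex_nonpos_Reals_iff)
    then have "x \<in> \<real>\<^sub>\<le>\<^sub>0" by (simp add: complex_nonpos_Reals_iff)
    then have "infdist (form b p) \<real>\<^sub>\<le>\<^sub>0 \<le> dist (form b p) x" by (rule infdist_le)
    also have "\<dots> = \<bar>Im z\<bar>" by (simp add: x_def dist_norm norm_mult)
    finally show False using e(3)[OF b] z by simp
  qed
  define q where "q = p - form a p *s u"
  define zeta where "zeta al be t = of_real rho - (of_real (al * cos (2 * pi * t)) + \<i> * of_real (be * sin (2 * pi * t)))"
    for al be t :: real
  have zeta: "Re (zeta al be t) = rho - al * cos (2 * pi * t)" "Im (zeta al be t) = - be * sin (2 * pi * t)" for al be t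
    by (simp_all add: zeta_def)
  have bound: "\<bar>x * cos y\<bar> \<le> \<bar>x\<bar>" "\<bar>x * sin y\<bar> \<le> \<bar>x\<bar>" for x y :: real
    by (simp_all add: abs_mult mult_left_le)
  have zM: "p + zeta al be t *s u \<in> M"
    if "0 < al" "al \<le> rho" "0 < be" "be \<le> e" for al be t
  proof -
    have "form b (p + zeta al be t *s u) \<noteq> 0" if b: "b \<in> forms" for b
    proof (cases "b = a")
      case True
      have "form a (p + zeta al be t *s u) = - (of_real (al * cos (2 * pi * t)) + \<i> * of_real (be * sin (2 * pi * t)))"
        using rho form_u[OF a] by (simp add: zeta_def)
      moreover have "al * cos (2 * pi * t) \<noteq> 0 \<or> be * sin (2 * pi * t) \<noteq> 0"
        using \<open>0 < al\<close> \<open>0 < be\<close> by simp (metis cos_zero_iff_int sin_cos_eq sin_zero_abs_cos_one abs_zero zero_neq_one)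
      ultimately show ?thesis using True by (simp add: complex_eq_iff)
    next
      case False
      have "form b p + zeta al be t \<notin> \<real>\<^sub>\<le>\<^sub>0"
      proof (rule far)
        show "0 \<le> Re (zeta al be t)" using bound(1)[of al "2 * pi * t"] that zeta \<open>0 < al\<close> \<open>al \<le> rho\<close> by simp
        show "\<bar>Im (zeta al be t)\<bar> \<le> e" using bound(2)[of be "2 * pi * t"] zeta \<open>0 < be\<close> \<open>be \<le> e\<close> by simp
      qed (use b False in simp)
      then show ?thesis using form_u[OF b] by auto
    qed
    then show ?thesis by (simp add: M_def)
  qed
  have qface: "q \<in> face a"
  proof -
    have "form b q \<noteq> 0" if "b \<in> forms - {a}" for b
    proof
      assume "form b q = 0"
      then have "form b p = form a p" using form_u that by (simp add: q_def)
      then show False using others[OF that] rho by (simp add: complex_nonpos_Reals_iff)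
    qed
    then show ?thesis using form_u[OF a] by (simp add: face_def q_def)
  qed
  have sr: "small_radius a q (of_real (- e))"
    unfolding small_radius_def
  proof (intro conjI ballI)
    show "of_real (- e) \<noteq> (0::complex)" using e by simp
    fix b assume b: "b \<in> forms - {a}"
    have "infdist (form b p) \<real>\<^sub>\<le>\<^sub>0 \<le> dist (form b p) (form a p)"
      using rho by (intro infdist_le) (simp add: complex_nonpos_Reals_iff)
    then show "norm (of_real (- e) :: complex) < norm (form b q)"
      using e(1) e(3)[OF b] form_u b by (simp add: q_def dist_norm)
  qed
  define ell where "ell t = p + zeta rho e t *s u" for t
  have contz: "continuous_on S (\<lambda>x. zeta (f x) (g x) (h x))"
    if "continuous_on S f" "continuous_on S g" "continuous_on S h" for S :: "'x::metric_space set" and f g h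
    unfolding zeta_def using that by (intro continuous_intros)
  have "F ell = F (circle q (of_real (- e)))"
  proof -
    let ?al = "\<lambda>s. (1 - s) * rho + s * e"
    let ?H = "\<lambda>x. p + zeta (?al (fst x)) e (snd x) *s u"
    have "F (\<lambda>t. ?H (0, t)) = F (\<lambda>t. ?H (1, t))"
    proof (rule F_free_homotopy)
      show "continuous_on ({0..1} \<times> {0..1}) ?H"
        by (intro continuous_intros contz)
      show "?H ` ({0..1} \<times> {0..1}) \<subseteq> M"
      proof
        fix y assume "y \<in> ?H ` ({0..1} \<times> {0..1})"
        then obtain s t where st: "s \<in> {0..1}" "y = p + zeta (?al s) e t *s u" by force
        then have s: "0 \<le> s" "s \<le> 1" "y = p + zeta (?al s) e t *s u" by simp_all
        have "?al s > 0"
        proof (cases "s = 0")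
          case False
          then show ?thesis using s e rho by (intro add_nonneg_pos mult_nonneg_nonneg mult_pos_pos) auto
        qed (use rho in simp)
        moreover have "?al s \<le> rho"
          using convex_bound_le[of rho rho e "1 - s" s] s e by (simp add: add.commute)
        ultimately show "y \<in> M" unfolding s(3) using e by (intro zM) auto
      qed
    qed (simp add: zeta_def)
    moreover have "(\<lambda>t. ?H (1, t)) = circle q (of_real (- e))"
    proof
      fix t
      have "zeta e e t = of_real rho - of_real e * exp (2 * of_real pi * \<i> * of_real t)"
        by (simp add: zeta_def complex_eq_iff exp_Euler Re_exp Im_exp cis_conv_exp[symmetric])
      then show "?H (1, t) = circle q (of_real (- e)) t"
        using rho by (simp add: circle_def q_def vec.scale_left_distrib vec.scale_left_diff_distrib vec.scale_minus_left)
    qed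
    moreover have "(\<lambda>t. ?H (0, t)) = ell" by (simp add: ell_def fun_eq_iff)
    ultimately show ?thesis by simp
  qed
  then have F1: "F ell = \<one>\<^bsub>A\<^esub>" using trivial[OF qface sr] by simp
  have cont: "continuous_on {0..1} ell" unfolding ell_def by (intro continuous_intros contz)
  have pell: "path ell" "path_image ell \<subseteq> M"
    using cont zM[of rho e] rho e by (auto simp: path_def path_image_def ell_def)
  have ell0: "ell 0 = p" "ell 1 = p" by (simp_all add: ell_def zeta_def)
  have cutell: "ell t \<in> cut" if "0 < t" "t < 1" for t
  proof -
    have "form b (ell t) \<notin> \<real>\<^sub>\<le>\<^sub>0" if b: "b \<in> forms" for b
    proof (cases "b = a")
      case True
      have f: "form a (ell t) = - (of_real (rho * cos (2 * pi * t)) + \<i> * of_real (e * sin (2 * pi * t)))"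
        using rho form_u[OF a] by (simp add: zeta_def ell_def)
      show ?thesis
      proof
        assume "form b (ell t) \<in> \<real>\<^sub>\<le>\<^sub>0"
        then have "sin (2 * pi * t) = 0" "cos (2 * pi * t) \<ge> 0"
          using True f e rho by (auto simp: complex_nonpos_Reals_iff zero_le_mult_iff)
        then have "cos (2 * pi * t) = 1"
          by (metis abs_of_nonneg sin_zero_abs_cos_one)
        then obtain n :: int where "2 * pi * t = of_int n * 2 * pi" by (auto simp: cos_one_2pi_int)
        then have "t = of_int n" by simp
        then show False using \<open>0 < t\<close> \<open>t < 1\<close> by simp
      qed
    next
      case False
      have "form b p + zeta rho e t \<notin> \<real>\<^sub>\<le>\<^sub>0"
      proof (rule far)
        show "0 \<le> Re (zeta rho e t)" using bound(1)[of rho "2 * pi * t"] zeta rho by simp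
        show "\<bar>Im (zeta rho e t)\<bar> \<le> e" using bound(2)[of e "2 * pi * t"] zeta e by simp
      qed (use b False in simp)
      then show ?thesis using form_u[OF b] by (simp add: ell_def)
    qed
    then show ?thesis by (simp add: cut_def)
  qed
  obtain t0 where t0: "0 < t0" "t0 < 1/4" "\<And>t. 0 \<le> t \<Longrightarrow> t \<le> t0 \<Longrightarrow> ell t \<in> ball p r"
    "\<And>t. 1 - t0 \<le> t \<Longrightarrow> t \<le> 1 \<Longrightarrow> ell t \<in> ball p r"
  proof -
    have "\<exists>d>0. \<forall>t\<in>{0..1}. dist t x < d \<longrightarrow> dist (ell t) (ell x) < r" if "x \<in> {0..1}" for x
      using cont r(1) that unfolding continuous_on_iff by blast
    from this[of 0] this[of 1]
    have "\<exists>d>0. \<forall>t\<in>{0..1}. dist t 0 < d \<longrightarrow> dist (ell t) (ell 0) < r"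
      "\<exists>d>0. \<forall>t\<in>{0..1}. dist t 1 < d \<longrightarrow> dist (ell t) (ell 1) < r"
      by simp_all
    then obtain d1 d2 where d: "d1 > 0" "d2 > 0"
      "\<And>t. t \<in> {0..1} \<Longrightarrow> dist t 0 < d1 \<Longrightarrow> dist (ell t) p < r"
      "\<And>t. t \<in> {0..1} \<Longrightarrow> dist t 1 < d2 \<Longrightarrow> dist (ell t) p < r" using ell0 by metis
    define t0 where "t0 = min (1/8) (min d1 d2 / 2)"
    have "0 < t0" "t0 < 1/4" "t0 < d1" "t0 < d2" using d(1,2) by (auto simp: t0_def min_def)
    then show ?thesis
      using d(3,4) by (intro that[of t0]) (auto simp: dist_real_def dist_commute)
  qed
  define y' where "y' = ell t0"
  define y where "y = ell (1 - t0)"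
  have ball: "y \<in> ball p r" "y' \<in> ball p r" using t0 by (auto simp: y_def y'_def)
  have cuty: "y \<in> cut" "y' \<in> cut" using t0 cutell by (auto simp: y_def y'_def)
  have sub: "path (subpath s t ell)" "path_image (subpath s t ell) \<subseteq> M" if "s \<in> {0..1}" "t \<in> {0..1}" for s t
    using that pell path_image_subpath_subset[of s t ell] by (auto intro: path_subpath)
  have "F ell = F (subpath 0 t0 ell) \<otimes>\<^bsub>A\<^esub> (F (subpath t0 (1 - t0) ell) \<otimes>\<^bsub>A\<^esub> F (subpath (1 - t0) 1 ell))"
  proof -
    have j: "F (subpath s t ell) \<otimes>\<^bsub>A\<^esub> F (subpath t x ell) = F (subpath s x ell)"
      if "s \<in> {0..1}" "t \<in> {0..1}" "x \<in> {0..1}" for s t x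
    proof -
      have "F (subpath s t ell) \<otimes>\<^bsub>A\<^esub> F (subpath t x ell) = F (subpath s t ell +++ subpath t x ell)"
        using sub that by (intro F_join[symmetric]) auto
      also have "\<dots> = F (subpath s x ell)"
        using pell that by (intro F_homotopic homotopic_join_subpaths) auto
      finally show ?thesis .
    qed
    have "subpath 0 1 ell = ell" by simp
    then show ?thesis using t0 by (simp add: j)
  qed
  moreover have "F (subpath 0 t0 ell) = F (linepath p y')"
  proof (rule F_in_simply_connected[OF convex_imp_simply_connected[OF convex_ball] r(2)])
    show "path_image (subpath 0 t0 ell) \<subseteq> ball p r"
      using t0 by (auto simp: path_image_subpath)
    show "path_image (linepath p y') \<subseteq> ball p r"
      using ball r closed_segment_subset[of p "ball p r" y'] by simp
  qed (use t0 sub ell0 in \<open>auto simp: y'_def\<close>)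
  moreover have "F (subpath (1 - t0) 1 ell) = F (linepath y p)"
  proof (rule F_in_simply_connected[OF convex_imp_simply_connected[OF convex_ball] r(2)])
    show "path_image (subpath (1 - t0) 1 ell) \<subseteq> ball p r"
      using t0 by (auto simp: path_image_subpath)
    show "path_image (linepath y p) \<subseteq> ball p r"
      using ball r closed_segment_subset[of y "ball p r" p] by simp
  qed (use t0 sub ell0 in \<open>auto simp: y_def\<close>)
  moreover have mid: "F (subpath t0 (1 - t0) ell) \<otimes>\<^bsub>A\<^esub> ray_value y = ray_value y'"
  proof -
    have "path_image (subpath t0 (1 - t0) ell) \<subseteq> cut"
      using t0 cutell by (auto simp: path_image_subpath)
    then show ?thesis
      using ray_value_path[of "subpath t0 (1 - t0) ell"] sub t0 by (simp add: y_def y'_def)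
  qed
  ultimately have loop: "\<one>\<^bsub>A\<^esub> = F (linepath p y') \<otimes>\<^bsub>A\<^esub> (F (subpath t0 (1 - t0) ell) \<otimes>\<^bsub>A\<^esub> F (linepath y p))"
    using F1 by simp
  have pb: "p \<in> ball p r" using r by simp
  have car: "F (linepath p y') \<in> carrier A" "F (linepath y p) \<in> carrier A" "F (linepath p y) \<in> carrier A"
    "ray_value y \<in> carrier A" "F (subpath t0 (1 - t0) ell) \<in> carrier A"
  proof -
    show "F (linepath p y') \<in> carrier A" "F (linepath y p) \<in> carrier A" "F (linepath p y) \<in> carrier A"
      by (intro ball_triangle(2)[OF r(2)] pb ball)+
    show "ray_value y \<in> carrier A" by (rule ray_value_carrier[OF cuty(1)])
    show "F (subpath t0 (1 - t0) ell) \<in> carrier A" using t0 by (intro F_carrier sub) auto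
  qed
  have inv: "F (linepath y p) \<otimes>\<^bsub>A\<^esub> F (linepath p y) = \<one>\<^bsub>A\<^esub>"
    using F_linepath_triangle[OF convex_ball r(2) ball(1) pb ball(1)] F_const[of y] ball r by auto
  have "detour p y' = F (linepath p y') \<otimes>\<^bsub>A\<^esub> (F (subpath t0 (1 - t0) ell) \<otimes>\<^bsub>A\<^esub> ray_value y)"
    by (simp add: detour_def mid)
  also have "\<dots> = F (linepath p y') \<otimes>\<^bsub>A\<^esub> (F (subpath t0 (1 - t0) ell) \<otimes>\<^bsub>A\<^esub>
      ((F (linepath y p) \<otimes>\<^bsub>A\<^esub> F (linepath p y)) \<otimes>\<^bsub>A\<^esub> ray_value y))"
    using car by (simp add: inv)
  also have "\<dots> = (F (linepath p y') \<otimes>\<^bsub>A\<^esub> (F (subpath t0 (1 - t0) ell) \<otimes>\<^bsub>A\<^esub> F (linepath y p))) \<otimes>\<^bsub>A\<^esub> detour p y"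
    using car by (simp add: detour_def A.m_assoc)
  also have "\<dots> = detour p y" using car by (simp add: loop[symmetric] detour_def)
  finally have "detour p y = detour p y'" by simp
  moreover have "Im (form a y) > 0" "Im (form a y') < 0"
  proof -
    have "sin (2 * pi * t0) > 0" using t0 by (intro sin_gt_zero) auto
    moreover have "sin (2 * pi * (1 - t0)) = - sin (2 * pi * t0)"
      by (simp add: right_diff_distrib sin_diff)
    ultimately show "Im (form a y) > 0" "Im (form a y') < 0"
      using rho e form_u[OF a] by (auto simp: y_def y'_def ell_def zeta mult_pos_neg mult_neg_pos)
  qed
  ultimately show ?thesis using ball cuty by blast
qed


definition kills_circles :: bool where
  "kills_circles \<longleftrightarrow> (\<forall>a\<in>forms. \<forall>q\<in>face a. \<forall>d. small_radius a q d \<longrightarrow> F (circle q d) = \<one>\<^bsub>A\<^esub>)"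

text \<open>Near a point where at most one form is real, the detour does not depend on the cut point used.\<close>

lemma detour_locally_constant:
  assumes trivial: "kills_circles"
    and p: "p \<in> M" "p \<notin> crossings"
  shows "\<exists>r>0. ball p r \<subseteq> M \<and> (\<forall>y\<in>ball p r \<inter> cut. \<forall>y'\<in>ball p r \<inter> cut. detour p y = detour p y')"
proof (cases "p \<in> cut")
  case True
  then obtain r where r: "r > 0" "ball p r \<subseteq> cut" using open_cut by (meson openE)
  have "detour p y = detour p y'" if "y \<in> ball p r" "y' \<in> ball p r" for y y'
    using r cut_subset_M that closed_segment_subset[OF that convex_ball]
    by (intro detour_segment[of p r]) auto
  then show ?thesis using r cut_subset_M by blast
next
  case False
  then obtain a where a: "a \<in> forms" "form a p \<in> \<real>\<^sub>\<le>\<^sub>0" by (auto simp: cut_def)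
  have "form a p \<noteq> 0" using p(1) a by (auto simp: M_def)
  then have pa: "Im (form a p) = 0" "Re (form a p) < 0"
    using a(2) by (auto simp: complex_nonpos_Reals_iff complex_eq_iff)
  have others: "form b p \<notin> \<real>\<^sub>\<le>\<^sub>0" if "b \<in> forms - {a}" for b
    using p(2) a(1) pa(1) that by (auto simp: crossings_def complex_nonpos_Reals_iff)
  define U where "U = M \<inter> {x. Re (form a x) < 0} \<inter> (\<Inter>b\<in>forms - {a}. {x. form b x \<notin> \<real>\<^sub>\<le>\<^sub>0})"
  have "open {x. form b x \<notin> \<real>\<^sub>\<le>\<^sub>0}" for b
  proof -
    have "open ((\<lambda>x. form b x) -` (- \<real>\<^sub>\<le>\<^sub>0))"
      by (intro open_vimage) (auto intro!: continuous_intros)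
    then show ?thesis by (simp add: vimage_def)
  qed
  moreover have "open {x. Re (form a x) < 0}"
    by (intro open_Collect_less continuous_intros)
  ultimately have "open U" unfolding U_def using finite_forms open_M by (intro open_Int open_INT) auto
  moreover have "p \<in> U" using p pa others by (auto simp: U_def)
  ultimately obtain r where r: "r > 0" "ball p r \<subseteq> U" by (meson openE)
  have rM: "ball p r \<subseteq> M" using r by (auto simp: U_def)
  have cut_iff: "y \<in> cut \<longleftrightarrow> Im (form a y) \<noteq> 0" if "y \<in> ball p r" for y
    using r that a(1) by (auto simp: U_def cut_def complex_nonpos_Reals_iff)
  have same: "detour p y = detour p y'"
    if y: "y \<in> ball p r" "y' \<in> ball p r" and sg: "0 < Im (form a y) \<and> 0 < Im (form a y') \<or>
      Im (form a y) < 0 \<and> Im (form a y') < 0" for y y'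
  proof (rule detour_segment[OF rM y])
    show "closed_segment y y' \<subseteq> cut"
    proof
      fix x assume x: "x \<in> closed_segment y y'"
      then have xb: "x \<in> ball p r" using closed_segment_subset[OF y convex_ball] by blast
      obtain t where t: "0 \<le> t" "t \<le> 1" "x = (1 - t) *\<^sub>R y + t *\<^sub>R y'" using x by (auto simp: in_segment)
      have im: "Im (form a x) = (1 - t) * Im (form a y) + t * Im (form a y')" by (simp add: t(3))
      have "Im (form a x) \<noteq> 0"
      proof (cases "0 < Im (form a y)")
        case True
        then have "0 < (1 - t) * Im (form a y) + t * Im (form a y')"
          using convex_bound_lt[of "- Im (form a y)" 0 "- Im (form a y')" "1 - t" t] sg t by simp
        then show ?thesis using im by simp
      next
        case False
        then have "(1 - t) * Im (form a y) + t * Im (form a y') < 0"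
          using convex_bound_lt[of "Im (form a y)" 0 "Im (form a y')" "1 - t" t] sg t by simp
        then show ?thesis using im by simp
      qed
      then show "x \<in> cut" using cut_iff[OF xb] by simp
    qed
  qed
  obtain z z' where z: "z \<in> ball p r" "z' \<in> ball p r" "Im (form a z) > 0" "Im (form a z') < 0"
    "detour p z = detour p z'"
  proof -
    have "F (circle q d) = \<one>\<^bsub>A\<^esub>" if "q \<in> face a" "small_radius a q d" for q d
      using trivial a(1) that by (auto simp: kills_circles_def)
    then show ?thesis using crossing[OF a(1) pa others _ r(1) rM] that by blast
  qed
  have "detour p y = detour p z" if y: "y \<in> ball p r \<inter> cut" for y
  proof (cases "Im (form a y) > 0")
    case True
    then show ?thesis using same[of y z] y z by simp
  next
    case False
    then have "Im (form a y) < 0" using cut_iff[of y] y by auto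
    then show ?thesis using same[of y z'] y z by simp
  qed
  then have "\<forall>y\<in>ball p r \<inter> cut. \<forall>y'\<in>ball p r \<inter> cut. detour p y = detour p y'" by metis
  then show ?thesis using r rM by blast
qed

text \<open>The exceptional points form finitely many real subspaces of codimension two: two points off them can
  be joined by two segments through a third point in general position.\<close>

lemma connected_minus_crossings:
  assumes "0 < r"
  shows "connected (ball c r - crossings)"
proof -
  have "path_connected (ball c r - crossings)"
    unfolding path_connected_def
  proof (intro ballI)
    fix x y assume xy: "x \<in> ball c r - crossings" "y \<in> ball c r - crossings"
    define cov where "cov x p = of_real (Im (form (fst p) x)) *s snd p - of_real (Im (form (snd p) x)) *s fst p"
      for x and p :: "(complex^'n) \<times> (complex^'n)"
    let ?pairs = "{(a, b). a \<in> forms \<and> b \<in> forms \<and> a \<noteq> b}"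
    have finp: "finite ?pairs"
      by (rule finite_subset[of _ "forms \<times> forms"]) (use finite_forms in auto)
    have nz: "cov w p \<noteq> 0" if w: "w \<notin> crossings" and p: "p \<in> ?pairs" for w p
    proof
      obtain a b where ab: "p = (a, b)" "a \<in> forms" "b \<in> forms" "a \<noteq> b" using p by auto
      assume "cov w p = 0"
      then have eq: "of_real (Im (form a w)) *s b = of_real (Im (form b w)) *s a"
        by (simp add: cov_def ab)
      then have "form (of_real (Im (form a w)) *s b) u = form (of_real (Im (form b w)) *s a) u" by simp
      then have same: "Im (form a w) = Im (form b w)"
        using form_u ab by (simp add: form_left_scale)
      have "Im (form a w) \<noteq> 0" using w ab same by (auto simp: crossings_def)
      then have "b = a" using eq same by (simp add: vec.scale_left_imp_eq)
      then show False using ab by simp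
    qed
    have "0 \<notin> (\<lambda>p. cov x p) ` ?pairs \<union> (\<lambda>p. cov y p) ` ?pairs"
      using nz[of x] nz[of y] xy by fastforce
    moreover have "finite ((\<lambda>p. cov x p) ` ?pairs \<union> (\<lambda>p. cov y p) ` ?pairs)" using finp by blast
    ultimately obtain z where z: "dist c z < r"
      "\<forall>k\<in>(\<lambda>p. cov x p) ` ?pairs \<union> (\<lambda>p. cov y p) ` ?pairs. Im (form k z) \<noteq> 0"
      using exists_near_avoiding_im[OF _ _ assms] by meson
    have seg: "closed_segment w z \<subseteq> ball c r - crossings"
      if w: "w \<in> ball c r - crossings" and gen: "\<And>p. p \<in> ?pairs \<Longrightarrow> Im (form (cov w p) z) \<noteq> 0" for w
    proof
      fix v assume v: "v \<in> closed_segment w z"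
      have "v \<in> ball c r" using v w z(1) closed_segment_subset[of w "ball c r" z] by auto
      moreover have "v \<notin> crossings"
      proof
        assume "v \<in> crossings"
        then obtain a b where ab: "a \<in> forms" "b \<in> forms" "a \<noteq> b" "Im (form a v) = 0" "Im (form b v) = 0"
          by (auto simp: crossings_def)
        obtain t where t: "v = (1 - t) *\<^sub>R w + t *\<^sub>R z" using v by (auto simp: in_segment)
        have 1: "(1 - t) * Im (form a w) + t * Im (form a z) = 0"
          "(1 - t) * Im (form b w) + t * Im (form b z) = 0"
          using ab(4,5) by (simp_all add: t)
        have k: "Im (form (cov w (a, b)) z) = Im (form a w) * Im (form b z) - Im (form b w) * Im (form a z)"
          by (simp add: cov_def form_left_diff form_left_scale)
        have "t * Im (form (cov w (a, b)) z)
            = Im (form a w) * ((1 - t) * Im (form b w) + t * Im (form b z))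
              - Im (form b w) * ((1 - t) * Im (form a w) + t * Im (form a z))"
          unfolding k by (simp add: algebra_simps)
        then have "t = 0" using 1 gen[of "(a, b)"] ab by simp
        then show False using w ab t by (auto simp: crossings_def)
      qed
      ultimately show "v \<in> ball c r - crossings" by simp
    qed
    have "closed_segment x z \<subseteq> ball c r - crossings" "closed_segment y z \<subseteq> ball c r - crossings"
      using z(2) by (intro seg xy; blast)+
    then show "\<exists>g. path g \<and> path_image g \<subseteq> ball c r - crossings \<and> pathstart g = x \<and> pathfinish g = y"
      by (intro exI[of _ "linepath x z +++ linepath z y"])
         (simp add: path_image_join closed_segment_commute)
  qed
  then show ?thesis by (rule path_connected_imp_connected)
qed


lemma detour_shift:
  assumes "ball c r \<subseteq> M" "p \<in> ball c r" "y \<in> ball c r" "closed_segment p y \<subseteq> M" "y \<in> cut"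
  shows "detour c y = F (linepath c p) \<otimes>\<^bsub>A\<^esub> detour p y"
proof -
  have c: "c \<in> ball c r" using assms(2) by (metis centre_in_ball dist_not_less_zero mem_ball not_less order.strict_trans1 zero_le_dist)
  have "detour c y = (F (linepath c p) \<otimes>\<^bsub>A\<^esub> F (linepath p y)) \<otimes>\<^bsub>A\<^esub> ray_value y"
    using ball_triangle(1)[OF assms(1-3)] by (simp add: detour_def)
  also have "\<dots> = F (linepath c p) \<otimes>\<^bsub>A\<^esub> detour p y"
    unfolding detour_def
    using ball_triangle(2)[OF assms(1) c assms(2)] ball_triangle(2)[OF assms(1-3)] assms(5)
    by (intro A.m_assoc ray_value_carrier)
  finally show ?thesis .
qed

lemma detour_independent:
  assumes trivial: "kills_circles"
    and r: "ball c r \<subseteq> M" and y: "y \<in> ball c r \<inter> cut" "y' \<in> ball c r \<inter> cut"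
  shows "detour c y = detour c y'"
proof -
  have r0: "r > 0" using y(1) by (metis IntD1 ball_empty empty_iff not_le)
  let ?G = "ball c r - crossings"
  define D where "D = {z \<in> ball c r. \<forall>a\<in>forms. Im (form a z) \<noteq> 0}"
  have D: "D \<subseteq> cut" "D \<subseteq> ?G" "D \<subseteq> ball c r"
    by (auto simp: D_def cut_def crossings_def complex_nonpos_Reals_iff)
  have near: "\<exists>z\<in>D. dist x z < s" if "x \<in> ball c r" "s > 0" for x s
  proof -
    define m where "m = min s (r - dist c x)"
    have "m > 0" using that by (simp add: m_def)
    then obtain z where z: "dist x z < m" "\<forall>a\<in>forms. Im (form a z) \<noteq> 0"
      using exists_near_avoiding_im[OF finite_forms, of m x] forms_nonzero by blast
    have "dist c z < r" using dist_triangle[of c z x] z(1) by (simp add: m_def)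
    then show ?thesis using z by (auto simp: D_def m_def)
  qed
  have loc: "\<exists>s>0. \<forall>z\<in>ball p s \<inter> cut \<inter> ball c r. \<forall>z'\<in>ball p s \<inter> cut \<inter> ball c r. detour c z = detour c z'"
    if p: "p \<in> ?G" for p
  proof -
    have "p \<in> M" "p \<notin> crossings" using p r by auto
    from detour_locally_constant[OF trivial this]
    obtain s where s: "s > 0" "ball p s \<subseteq> M"
      "\<And>z z'. z \<in> ball p s \<inter> cut \<Longrightarrow> z' \<in> ball p s \<inter> cut \<Longrightarrow> detour p z = detour p z'"
      by blast
    have "detour c z = F (linepath c p) \<otimes>\<^bsub>A\<^esub> detour p z" if "z \<in> ball p s \<inter> cut \<inter> ball c r" for z
      using closed_segment_subset[of p "ball c r" z] p that r by (intro detour_shift[OF r]) auto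
    then show ?thesis using s by (metis IntD1)
  qed
  have const: "detour c y1 = detour c y0" if y0: "y0 \<in> D" and y1: "y1 \<in> D" for y0 y1
  proof -
    define P where "P p \<longleftrightarrow> (\<exists>s>0. \<forall>z\<in>ball p s \<inter> cut \<inter> ball c r. detour c z = detour c y0)" for p
    have self: "z \<in> ball z s \<inter> cut \<inter> ball c r" if "z \<in> D" "s > 0" for z s
      using that D by auto
    have "P y1"
    proof (rule connected_induction_simple[of ?G y0 y1 P])
      show "connected ?G" by (rule connected_minus_crossings[OF r0])
      show "y0 \<in> ?G" "y1 \<in> ?G" using D y0 y1 by auto
      show "P y0" using loc[of y0] self[OF y0] D y0 unfolding P_def by (meson subsetD)
      fix p assume p: "p \<in> ?G"
      obtain s where s: "s > 0" "\<And>z z'. z \<in> ball p s \<inter> cut \<inter> ball c r \<Longrightarrow> z' \<in> ball p s \<inter> cut \<inter> ball c r \<Longrightarrow> detour c z = detour c z'"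
        using loc[OF p] by blast
      show "\<exists>T. openin (top_of_set ?G) T \<and> p \<in> T \<and> (\<forall>x\<in>T. \<forall>y\<in>T. P x \<longrightarrow> P y)"
      proof (intro exI[of _ "?G \<inter> ball p s"] conjI ballI impI)
        show "openin (top_of_set ?G) (?G \<inter> ball p s)" by (intro openin_open_Int open_ball)
        show "p \<in> ?G \<inter> ball p s" using p s by simp
        fix x x' assume x: "x \<in> ?G \<inter> ball p s" and x': "x' \<in> ?G \<inter> ball p s" and "P x"
        then obtain s1 where s1: "s1 > 0" "\<And>z. z \<in> ball x s1 \<inter> cut \<inter> ball c r \<Longrightarrow> detour c z = detour c y0"
          unfolding P_def by blast
        obtain z where z: "z \<in> D" "dist x z < min s1 (s - dist p x)"
          using near[of x "min s1 (s - dist p x)"] x s1 by auto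
        have "dist p z < s" using dist_triangle[of p z x] z(2) by simp
        then have z1: "z \<in> ball p s \<inter> cut \<inter> ball c r" "z \<in> ball x s1 \<inter> cut \<inter> ball c r" using z D by auto
        show "P x'"
          unfolding P_def
        proof (intro exI[of _ "s - dist p x'"] conjI ballI)
          show "0 < s - dist p x'" using x' by simp
          fix z' assume z': "z' \<in> ball x' (s - dist p x') \<inter> cut \<inter> ball c r"
          then have "dist p z' < s" using dist_triangle[of p z' x'] by simp
          then have "z' \<in> ball p s \<inter> cut \<inter> ball c r" using z' by simp
          then have "detour c z' = detour c z" by (rule s(2)[OF _ z1(1)])
          then show "detour c z' = detour c y0" using s1(2)[OF z1(2)] by simp
        qed
      qed
    qed
    then obtain s where s: "s > 0" "\<forall>z\<in>ball y1 s \<inter> cut \<inter> ball c r. detour c z = detour c y0"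
      unfolding P_def by (elim exE conjE) (rule that)
    show ?thesis by (rule bspec[OF s(2) self[OF y1 s(1)]])
  qed
  have reach: "\<exists>y1\<in>D. detour c x = detour c y1" if x: "x \<in> ball c r \<inter> cut" for x
  proof -
    have "open (ball c r \<inter> cut)" using open_cut by (intro open_Int) auto
    then obtain s where s: "s > 0" "ball x s \<subseteq> ball c r \<inter> cut" using x by (meson openE)
    obtain y1 where y1: "y1 \<in> D" "dist x y1 < s" using near[of x s] x s by auto
    have "closed_segment x y1 \<subseteq> ball x s" using s y1 closed_segment_subset[of x "ball x s" y1] by auto
    then have "detour c x = detour c y1" using s y1 D x by (intro detour_segment[OF r]) auto
    then show ?thesis using y1 by blast
  qed
  show ?thesis using reach[OF y(1)] reach[OF y(2)] const by metis
qed

definition potential :: "complex^'n \<Rightarrow> 'g" where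
  "potential c = (SOME h. \<exists>r>0. ball c r \<subseteq> M \<and> (\<forall>y\<in>ball c r \<inter> cut. detour c y = h))"

text \<open>A functor that kills all small circles is a coboundary: it is the difference of the potential at the two
  ends of a path. In particular it kills all loops.\<close>

theorem trivial_on_loops:
  assumes trivial: "kills_circles"
    and g: "path g" "path_image g \<subseteq> M" "pathstart g = pathfinish g"
  shows "F g = \<one>\<^bsub>A\<^esub>"
proof -
  have pot: "detour c y = potential c" if "ball c r \<subseteq> M" "y \<in> ball c r" "y \<in> cut" for c r y
  proof -
    have r0: "r > 0" using that(2) by (metis ball_empty empty_iff not_le)
    have "\<exists>h. \<exists>r>0. ball c r \<subseteq> M \<and> (\<forall>y\<in>ball c r \<inter> cut. detour c y = h)"
      using detour_independent[OF trivial that(1)] that r0 by blast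
    from someI_ex[OF this] obtain r' where r': "r' > 0" "ball c r' \<subseteq> M"
      "\<And>y. y \<in> ball c r' \<inter> cut \<Longrightarrow> detour c y = potential c" unfolding potential_def by blast
    obtain z where z: "z \<in> cut" "dist c z < min r r'" using cut_dense[of "min r r'" c] r0 r' by auto
    have "detour c y = detour c z" using z that by (intro detour_independent[OF trivial that(1)]) auto
    then show ?thesis using r'(3)[of z] z by simp
  qed
  have det_car: "detour c y \<in> carrier A" if "ball c r \<subseteq> M" "y \<in> ball c r" "y \<in> cut" for c r y
  proof -
    have "c \<in> ball c r" using that(2) by (metis ball_empty centre_in_ball empty_iff not_le)
    then show ?thesis
      using ball_triangle(2)[OF that(1) _ that(2)] that(3) unfolding detour_def
      by (intro A.m_closed ray_value_carrier)
  qed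
  have nbhd: "\<exists>r>0. ball c r \<subseteq> M" if "c \<in> M" for c using open_M that by (meson openE)
  have pot_car: "potential c \<in> carrier A" if cM: "c \<in> M" for c
  proof -
    obtain r where r: "r > 0" "ball c r \<subseteq> M" using nbhd[OF cM] by blast
    obtain z where "z \<in> cut" "dist c z < r" using cut_dense[OF r(1)] by blast
    then show ?thesis using pot[OF r(2), of z] det_car[OF r(2), of z] by simp
  qed
  have seg: "F (linepath c x) \<otimes>\<^bsub>A\<^esub> potential x = potential c"
    if c: "ball c r \<subseteq> M" "x \<in> ball c r" for c r x
  proof -
    have "x \<in> M" using c by auto
    define s where "s = r - dist c x"
    have s: "s > 0" "ball x s \<subseteq> ball c r"
    proof -
      show "s > 0" using c(2) by (simp add: s_def)
      show "ball x s \<subseteq> ball c r"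
      proof
        fix z assume "z \<in> ball x s"
        then show "z \<in> ball c r" using dist_triangle[of c z x] by (simp add: s_def)
      qed
    qed
    obtain z where z: "z \<in> cut" "dist x z < s" using cut_dense[OF s(1)] by blast
    have zb: "z \<in> ball c r" using z s by auto
    have "closed_segment x z \<subseteq> M" using closed_segment_subset[OF c(2) zb convex_ball] c(1) by blast
    then have "detour c z = F (linepath c x) \<otimes>\<^bsub>A\<^esub> detour x z"
      by (intro detour_shift[OF c(1,2) zb]) (use z in auto)
    moreover have "detour x z = potential x" using z s c by (intro pot[of x s]) auto
    moreover have "detour c z = potential c" using z zb c by (intro pot[of c r]) auto
    ultimately show ?thesis by simp
  qed
  have centre: "c \<in> ball c r" if "x \<in> ball c r" for c x :: "complex^'n" and r
    using that by (metis ball_empty centre_in_ball empty_iff not_le)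
  have lin: "F (linepath x y) \<otimes>\<^bsub>A\<^esub> potential y = potential x"
    if c: "ball c r \<subseteq> M" "x \<in> ball c r" "y \<in> ball c r" for c r x y
  proof -
    have cc: "c \<in> ball c r" by (rule centre[OF c(2)])
    have "x \<in> M" "y \<in> M" using c by blast+
    then have car: "F (linepath c x) \<in> carrier A" "F (linepath x y) \<in> carrier A"
      "potential x \<in> carrier A" "potential y \<in> carrier A"
      using pot_car ball_triangle(2)[OF c(1) cc c(2)] ball_triangle(2)[OF c] by blast+
    have "F (linepath c x) \<otimes>\<^bsub>A\<^esub> (F (linepath x y) \<otimes>\<^bsub>A\<^esub> potential y) = F (linepath c y) \<otimes>\<^bsub>A\<^esub> potential y"
      unfolding ball_triangle(1)[OF c, symmetric] by (rule A.m_assoc[symmetric, OF car(1,2,4)])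
    also have "\<dots> = F (linepath c x) \<otimes>\<^bsub>A\<^esub> potential x" using seg[OF c(1,2)] seg[OF c(1,3)] by simp
    finally show ?thesis using car by (metis A.l_cancel A.m_closed)
  qed
  define P where "P t \<longleftrightarrow> F (subpath 0 t g) \<otimes>\<^bsub>A\<^esub> potential (g t) = potential (g 0)" for t
  have gM: "g t \<in> M" if "t \<in> {0..1}" for t using g(2) that by (auto simp: path_image_def)
  have sub: "path (subpath s t g)" "path_image (subpath s t g) \<subseteq> M" if "s \<in> {0..1}" "t \<in> {0..1}" for s t
    using that g path_image_subpath_subset[of s t g] by (auto intro: path_subpath)
  have contg: "continuous_on {0..1} g" using g(1) by (simp add: path_def)
  have "P 1"
  proof (rule connected_induction_simple[of "{0..1::real}" 0 1 P])
    show "P 0"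
      unfolding P_def using F_const[OF gM, of 0] pot_car[OF gM, of 0]
      by (simp add: subpath_refl linepath_refl[symmetric])
    fix t :: real assume t: "t \<in> {0..1}"
    obtain r where r: "r > 0" "ball (g t) r \<subseteq> M" using nbhd[OF gM[OF t]] by blast
    obtain d where d: "d > 0" "\<And>s. s \<in> {0..1} \<Longrightarrow> dist s t < d \<Longrightarrow> dist (g s) (g t) < r"
      using contg t r(1) unfolding continuous_on_iff by blast
    show "\<exists>T. openin (top_of_set {0..1}) T \<and> t \<in> T \<and> (\<forall>x\<in>T. \<forall>y\<in>T. P x \<longrightarrow> P y)"
    proof (intro exI[of _ "{0..1} \<inter> ball t d"] conjI ballI impI)
      show "openin (top_of_set {0..1}) ({0..1} \<inter> ball t d)" by (intro openin_open_Int open_ball)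
      show "t \<in> {0..1} \<inter> ball t d" using t d by simp
      fix x y assume x: "x \<in> {0..1} \<inter> ball t d" and y: "y \<in> {0..1} \<inter> ball t d" and "P x"
      have inball: "g s \<in> ball (g t) r" if "s \<in> closed_segment x y" for s
      proof -
        have "s \<in> {0..1} \<inter> ball t d"
          using that closed_segment_subset[OF x y convex_Int[OF convex_real_interval(5) convex_ball]] by blast
        then show ?thesis using d(2)[of s] by (simp add: dist_commute)
      qed
      have gx: "g x \<in> ball (g t) r" "g y \<in> ball (g t) r" by (intro inball; simp)+
      have eq: "F (subpath x y g) = F (linepath (g x) (g y))"
      proof (rule F_in_simply_connected[OF convex_imp_simply_connected[OF convex_ball] r(2)])
        show "path_image (subpath x y g) \<subseteq> ball (g t) r"
          using inball by (auto simp: path_image_subpath_gen)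
        show "path_image (linepath (g x) (g y)) \<subseteq> ball (g t) r"
          using closed_segment_subset[OF gx convex_ball] by simp
        show "path (subpath x y g)" using sub x y by auto
      qed auto
      have "F (subpath 0 y g) = F (subpath 0 x g +++ subpath x y g)"
        using g x y by (intro F_homotopic homotopic_paths_sym[OF homotopic_join_subpaths]) auto
      also have "\<dots> = F (subpath 0 x g) \<otimes>\<^bsub>A\<^esub> F (subpath x y g)"
        using sub x y by (intro F_join) auto
      finally have 1: "F (subpath 0 y g) = F (subpath 0 x g) \<otimes>\<^bsub>A\<^esub> F (linepath (g x) (g y))" by (simp add: eq)
      have car: "F (subpath 0 x g) \<in> carrier A" "F (linepath (g x) (g y)) \<in> carrier A" "potential (g y) \<in> carrier A"
        using sub[of 0 x] x y gM ball_triangle(2)[OF r(2) gx] by (auto intro: F_carrier pot_car)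
      then have "F (subpath 0 y g) \<otimes>\<^bsub>A\<^esub> potential (g y) = F (subpath 0 x g) \<otimes>\<^bsub>A\<^esub> potential (g x)"
        using 1 lin[OF r(2) gx] by (simp add: A.m_assoc)
      then show "P y" using \<open>P x\<close> by (simp add: P_def)
    qed
  qed auto
  then have "F g \<otimes>\<^bsub>A\<^esub> potential (g 0) = potential (g 0)"
    using g(3) by (simp add: P_def pathstart_def pathfinish_def)
  then show ?thesis using F_carrier[OF g(1,2)] pot_car[OF gM, of 0] by (simp add: A.r_cancel_one)
qed

end


section \<open>The complement of the hyperplanes and its quotient\<close>

context reflection_group
begin

lemma finite_reflecting_hyperplanes: "finite (reflecting_hyperplanes W)"
proof -
  have "reflecting_hyperplanes W \<subseteq> (\<lambda>s. {v. (s - mat 1) *v v = 0}) ` W"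
    by (auto simp: reflecting_hyperplanes_def)
  then show ?thesis by (rule finite_subset) simp
qed

lemma hyperplane_form:
  assumes "H \<in> reflecting_hyperplanes W"
  shows "\<exists>a. a \<noteq> 0 \<and> H = {v. form a v = 0}"
proof -
  obtain s where "is_reflection s" "H = {v. (s - mat 1) *v v = 0}"
    using assms by (auto simp: reflecting_hyperplanes_def)
  then show ?thesis by (metis reflection_form)
qed

abbreviation "Xreg \<equiv> hyperplane_complement UNIV W"

lemma X_iff: "x \<in> Xreg \<longleftrightarrow> (\<forall>s\<in>W. is_reflection s \<longrightarrow> s *v x \<noteq> x)"
  by (auto simp: hyperplane_complement_def reflecting_hyperplanes_def matrix_vector_mult_diff_rdistrib)

lemma open_X: "open Xreg"
proof -
  have "closed H" if H: "H \<in> reflecting_hyperplanes W" for H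
  proof -
    obtain a where "H = {v. form a v = 0}" using hyperplane_form[OF H] by auto
    then show ?thesis by (simp add: closed_Collect_eq continuous_on_form)
  qed
  then have "closed (\<Union>(reflecting_hyperplanes W))"
    using finite_reflecting_hyperplanes by (intro closed_Union) auto
  then show ?thesis by (simp add: hyperplane_complement_def open_Diff)
qed

lemma reflection_conjugate:
  assumes s: "is_reflection s" and w: "w \<in> W"
  shows "is_reflection (w ** s ** winv w)"
proof -
  obtain a b where ab: "a \<noteq> 0" "b \<noteq> 0" "\<And>v. s *v v = v + form a v *s b"
    using reflection_form[OF s] by metis
  have conj: "(w ** s ** winv w) *v v = v + form (a v* winv w) v *s (w *v b)" for v
    using w by (simp add: matrix_vector_mul_assoc[symmetric] ab(3) matrix_vector_right_distrib
        vector_scalar_commute form_mult_vec)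
  obtain c where c: "form a c = 1" using form_nonzero[OF ab(1)] by auto
  have "form (a v* winv w) (w *v c) = 1" using w c by (simp add: form_mult_vec[symmetric])
  then have a': "a v* winv w \<noteq> 0" by auto
  have "w *v b \<noteq> 0" using ab(2) w W_inj[of w b 0] by simp
  then have "w ** s ** winv w \<noteq> mat 1"
    using conj[of "w *v c"] \<open>form (a v* winv w) (w *v c) = 1\<close> by auto
  moreover have "\<forall>v\<in>{v. form (a v* winv w) v = 0}. (w ** s ** winv w) *v v = v"
    by (simp add: conj)
  ultimately show ?thesis
    using hyperplane_form_kernel[OF a'] unfolding is_reflection_def by blast
qed

lemma W_X: "w \<in> W \<Longrightarrow> x \<in> Xreg \<Longrightarrow> w *v x \<in> Xreg"
proof -
  assume w: "w \<in> W" and x: "x \<in> Xreg"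
  show "w *v x \<in> Xreg"
    unfolding X_iff
  proof (intro ballI impI notI)
    fix s assume s: "s \<in> W" "is_reflection s" and e: "s *v (w *v x) = w *v x"
    let ?s = "winv w ** s ** winv (winv w)"
    have "is_reflection ?s" "?s \<in> W" using reflection_conjugate[OF s(2) winv(1)[OF w]] s w by simp_all
    moreover have "?s *v x = x" using w e by (simp add: matrix_vector_mul_assoc[symmetric])
    ultimately show False using x unfolding X_iff by blast
  qed
qed

lemma W_X_iff: "w \<in> W \<Longrightarrow> w *v x \<in> Xreg \<longleftrightarrow> x \<in> Xreg"
  by (metis W_X winv(1) winv_vec(1))

lemma W_free:
  assumes "x \<in> Xreg" "v \<in> W" "w \<in> W" "v *v x = w *v x"
  shows "v = w"
proof -
  have "(winv w ** v) *v x = x"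
    using assms by (simp add: matrix_vector_mul_assoc[symmetric])
  then have "winv w ** v = mat 1" using steinberg_free assms by simp
  then show ?thesis using assms by (metis matrix_mul_assoc matrix_mul_lid matrix_mul_rid winv(3))
qed

lemma orbit_of_eq_iff: "orbit_of W x = orbit_of W y \<longleftrightarrow> (\<exists>w\<in>W. y = w *v x)"
proof
  assume "orbit_of W x = orbit_of W y"
  moreover have "y \<in> orbit_of W y" unfolding orbit_of_def by (rule image_eqI[of _ _ "mat 1"]) auto
  ultimately show "\<exists>w\<in>W. y = w *v x" by (auto simp: orbit_of_def)
next
  assume "\<exists>w\<in>W. y = w *v x"
  then obtain w where w: "w \<in> W" "y = w *v x" by auto
  have "u *v x \<in> orbit_of W y" if "u \<in> W" for u
    unfolding orbit_of_def using w that
    by (intro image_eqI[of _ _ "u ** winv w"]) (auto simp: matrix_vector_mul_assoc[symmetric])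
  moreover have "u *v y \<in> orbit_of W x" if "u \<in> W" for u
    unfolding orbit_of_def using w that
    by (intro image_eqI[of _ _ "u ** w"]) (auto simp: matrix_vector_mul_assoc[symmetric])
  ultimately show "orbit_of W x = orbit_of W y" by (auto simp: orbit_of_def)
qed

lemma orbit_of_act [simp]: "w \<in> W \<Longrightarrow> orbit_of W (w *v x) = orbit_of W x"
  using orbit_of_eq_iff by metis

lemma finite_orbit: "finite (orbit_of W x)" "orbit_of W x \<noteq> {}"
  by (auto simp: orbit_of_def)

abbreviation "Xorb \<equiv> orbit_space Xreg W"

text \<open>The library proves the lifting theorems for covering spaces inside normed vector spaces. An orbit
  is therefore replaced by its truncated distance function, a bounded continuous function; this map is
  continuous and injective on the orbit space, which is all that the lifting of paths needs.\<close>

definition orbit_function :: "(complex^'n) set \<Rightarrow> (complex^'n) \<Rightarrow>\<^sub>C real" where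
  "orbit_function S = Bcontfun (\<lambda>z. min 1 (infdist z S))"

lemma orbit_function_apply: "apply_bcontfun (orbit_function S) z = min 1 (infdist z S)"
proof -
  have "(\<lambda>z. min 1 (infdist z S)) \<in> bcontfun"
    by (rule bcontfun_normI[where b = 1])
       (auto intro!: continuous_intros simp: infdist_nonneg)
  then show ?thesis by (simp add: orbit_function_def Bcontfun_inverse)
qed

lemma orbit_function_inj:
  assumes "orbit_function (orbit_of W x) = orbit_function (orbit_of W y)"
  shows "orbit_of W x = orbit_of W y"
proof -
  have "x \<in> orbit_of W x" unfolding orbit_of_def by (rule image_eqI[of _ _ "mat 1"]) auto
  then have "min 1 (infdist x (orbit_of W y)) = 0"
    using orbit_function_apply[of "orbit_of W x" x] assms orbit_function_apply[of "orbit_of W y" x]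
    by simp
  then have "infdist x (orbit_of W y) = 0" by (simp add: min_def split: if_splits)
  then have "x \<in> orbit_of W y"
    using in_closed_iff_infdist_zero[of "orbit_of W y" x] finite_orbit[of y]
    by (simp add: finite_imp_closed)
  then obtain w where "w \<in> W" "x = w *v y" by (auto simp: orbit_of_def)
  then show ?thesis by simp
qed

definition orbit_map :: "complex^'n \<Rightarrow> (complex^'n) \<Rightarrow>\<^sub>C real" where
  "orbit_map x = orbit_function (orbit_of W x)"

lemma orbit_map_eq_iff: "orbit_map x = orbit_map y \<longleftrightarrow> (\<exists>w\<in>W. y = w *v x)"
  unfolding orbit_map_def orbit_of_eq_iff[symmetric] using orbit_function_inj by auto

lemma continuous_on_act: "continuous_on S g \<Longrightarrow> continuous_on S (\<lambda>t. w *v (g t :: complex^'n))"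
  unfolding matrix_vector_mult_def
  by (intro continuous_on_vec_lambda continuous_intros continuous_on_component)

lemma continuous_on_orbit_map: "continuous_on S orbit_map"
proof (rule continuous_on_subset[of UNIV])
  show "continuous_on UNIV orbit_map"
    unfolding continuous_on_iff
  proof (intro ballI allI impI)
    fix x :: "complex^'n" and e :: real assume e: "0 < e"
    have "\<forall>w\<in>W. \<exists>d>0. \<forall>y. dist y x < d \<longrightarrow> dist (w *v y) (w *v x) < e / 2"
    proof
      fix w :: "complex^'n^'n"
      have "continuous_on UNIV (\<lambda>t. w *v t)" using continuous_on_act[OF continuous_on_id, of UNIV w] by simp
      then show "\<exists>d>0. \<forall>y. dist y x < d \<longrightarrow> dist (w *v y) (w *v x) < e / 2"
        using e unfolding continuous_on_iff by (metis UNIV_I half_gt_zero)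
    qed
    then obtain d where d: "\<And>w. w \<in> W \<Longrightarrow> d w > 0"
      "\<And>w y. w \<in> W \<Longrightarrow> dist y x < d w \<Longrightarrow> dist (w *v y) (w *v x) < e / 2" by metis
    define D where "D = Min (d ` W)"
    have D: "D > 0" "\<And>w. w \<in> W \<Longrightarrow> D \<le> d w" using d(1) by (auto simp: D_def)
    have key: "infdist z (orbit_of W u) \<le> infdist z (orbit_of W v) + e / 2"
      if "\<And>w. w \<in> W \<Longrightarrow> dist (w *v u) (w *v v) \<le> e / 2" for u v z
    proof -
      obtain p where p: "p \<in> orbit_of W v" "infdist z (orbit_of W v) = dist z p"
        using infdist_attains_inf[of "orbit_of W v" z] finite_orbit[of v] finite_imp_closed by metis
      then obtain w where w: "w \<in> W" "p = w *v v" by (auto simp: orbit_of_def)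
      have "infdist z (orbit_of W u) \<le> dist z (w *v u)"
        using w by (intro infdist_le) (auto simp: orbit_of_def)
      also have "\<dots> \<le> dist z p + dist (w *v u) (w *v v)"
        unfolding w(2) by (metis dist_commute dist_triangle)
      finally show ?thesis using p(2) that[OF w(1)] by simp
    qed
    show "\<exists>d>0. \<forall>y\<in>UNIV. dist y x < d \<longrightarrow> dist (orbit_map y) (orbit_map x) < e"
    proof (intro exI[of _ D] conjI ballI impI)
      fix y assume y: "dist y x < D"
      have 1: "dist (w *v y) (w *v x) \<le> e / 2" if "w \<in> W" for w
        using d(2)[OF that, of y] y D(2)[OF that] by simp
      have "dist (orbit_map y) (orbit_map x) \<le> e / 2"
      proof (rule dist_bound)
        fix z
        have "infdist z (orbit_of W y) \<le> infdist z (orbit_of W x) + e / 2" using 1 by (rule key)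
        moreover have "infdist z (orbit_of W x) \<le> infdist z (orbit_of W y) + e / 2"
          using 1 by (intro key) (simp add: dist_commute)
        ultimately show "dist (apply_bcontfun (orbit_map y) z) (apply_bcontfun (orbit_map x) z) \<le> e / 2"
          unfolding orbit_map_def orbit_function_apply dist_real_def by linarith
      qed
      then show "dist (orbit_map y) (orbit_map x) < e" using e by simp
    qed (rule D(1))
  qed
qed simp

lemma orbit_map_open_image:
  assumes "open U" "U \<subseteq> Xreg"
  shows "openin (top_of_set (orbit_map ` Xreg)) (orbit_map ` U)"
  unfolding openin_euclidean_subtopology_iff
proof (intro conjI ballI)
  show "orbit_map ` U \<subseteq> orbit_map ` Xreg" using assms by auto
  fix p assume "p \<in> orbit_map ` U"
  then obtain x where x: "x \<in> U" "p = orbit_map x" by auto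
  obtain e where e: "e > 0" "ball x e \<subseteq> U" using assms x by (meson openE)
  show "\<exists>e>0. \<forall>p'\<in>orbit_map ` Xreg. dist p' p < e \<longrightarrow> p' \<in> orbit_map ` U"
  proof (intro exI[of _ "min 1 e"] conjI ballI impI)
    fix p' assume "p' \<in> orbit_map ` Xreg" "dist p' p < min 1 e"
    then obtain y where y: "y \<in> Xreg" "p' = orbit_map y" by auto
    have "x \<in> orbit_of W x" unfolding orbit_of_def by (rule image_eqI[of _ _ "mat 1"]) auto
    then have "dist (min 1 (infdist x (orbit_of W y))) 0 < min 1 e"
      using dist_fun_lt_imp_dist_val_lt[OF \<open>dist p' p < min 1 e\<close>, of x]
      by (simp add: y x orbit_map_def orbit_function_apply)
    then have "infdist x (orbit_of W y) < e" by (auto simp: min_def split: if_splits)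
    then obtain q where "q \<in> orbit_of W y" "dist x q < e"
      using infdist_attains_inf[of "orbit_of W y" x] finite_orbit[of y] finite_imp_closed by metis
    then obtain w where w: "w \<in> W" "w *v y \<in> U" using e by (auto simp: orbit_of_def)
    then have "p' = orbit_map (w *v y)" unfolding y(2) orbit_map_eq_iff by blast
    then show "p' \<in> orbit_map ` U" using w by blast
  qed (use e in auto)
qed

lemma small_neighbourhood:
  assumes x: "x \<in> Xreg"
  obtains U where "open U" "x \<in> U" "U \<subseteq> Xreg"
    "\<And>y w. y \<in> U \<Longrightarrow> w \<in> W \<Longrightarrow> w *v y \<in> U \<Longrightarrow> w = mat 1"
proof -
  have "\<forall>w\<in>W - {mat 1}. \<exists>A C. open A \<and> open C \<and> x \<in> A \<and> w *v x \<in> C \<and> A \<inter> C = {}"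
  proof
    fix w assume "w \<in> W - {mat 1}"
    then have "w *v x \<noteq> x" using steinberg_free[OF x] by auto
    then show "\<exists>A C. open A \<and> open C \<and> x \<in> A \<and> w *v x \<in> C \<and> A \<inter> C = {}"
      using hausdorff[of x "w *v x"] by auto
  qed
  then obtain A C where AC: "\<And>w. w \<in> W - {mat 1} \<Longrightarrow> open (A w) \<and> open (C w) \<and> x \<in> A w \<and> w *v x \<in> C w \<and> A w \<inter> C w = {}"
    by metis
  define U where "U = Xreg \<inter> (\<Inter>w\<in>W - {mat 1}. A w \<inter> (\<lambda>y. w *v y) -` C w)"
  show ?thesis
  proof
    have "open ((\<lambda>y. w *v y) -` C w)" if "w \<in> W - {mat 1}" for w
      using AC[OF that] continuous_on_act[OF continuous_on_id, of UNIV w]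
      by (intro open_vimage) auto
    then show "open U" unfolding U_def using AC open_X by (intro open_Int open_INT) auto
    show "x \<in> U" "U \<subseteq> Xreg" using x AC by (auto simp: U_def)
    show "w = mat 1" if "y \<in> U" "w \<in> W" "w *v y \<in> U" for y w
    proof (rule ccontr)
      assume "w \<noteq> mat 1"
      then have "w \<in> W - {mat 1}" using that by simp
      then have "w *v y \<in> A w" "w *v y \<in> C w" "A w \<inter> C w = {}" using that AC by (auto simp: U_def)
      then show False by blast
    qed
  qed
qed

lemma covering_orbit_map: "covering_space Xreg orbit_map (orbit_map ` Xreg)"
proof
  fix p assume "p \<in> orbit_map ` Xreg"
  then obtain x where x: "x \<in> Xreg" "p = orbit_map x" by auto
  obtain U where U: "open U" "x \<in> U" "U \<subseteq> Xreg"
    "\<And>y w. y \<in> U \<Longrightarrow> w \<in> W \<Longrightarrow> w *v y \<in> U \<Longrightarrow> w = mat 1" using small_neighbourhood[OF x(1)] by metis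
  have img_act: "orbit_map ` ((*v) w ` V) = orbit_map ` V" if "w \<in> W" for w V
  proof -
    have "orbit_map (w *v v) = orbit_map v" for v
      using orbit_map_eq_iff[of v "w *v v"] that by auto
    then show ?thesis by (simp add: image_image)
  qed
  have op: "open ((*v) w ` V)" if "open V" "w \<in> W" for w V
  proof -
    have "(*v) w ` V = (\<lambda>y. winv w *v y) -` V"
      using that by (auto intro!: image_eqI[of _ _ "winv w *v _"])
    moreover have "open ((\<lambda>y. winv w *v y) -` V)"
      using that continuous_on_act[OF continuous_on_id, of UNIV] by (intro open_vimage) auto
    ultimately show ?thesis by simp
  qed
  show "\<exists>T. p \<in> T \<and> openin (top_of_set (orbit_map ` Xreg)) T \<and>
     (\<exists>v. \<Union>v = Xreg \<inter> orbit_map -` T \<and> (\<forall>u\<in>v. openin (top_of_set Xreg) u) \<and>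
       pairwise disjnt v \<and> (\<forall>u\<in>v. \<exists>q. homeomorphism u T orbit_map q))"
  proof (intro exI[of _ "orbit_map ` U"] conjI exI[of _ "(\<lambda>w. (*v) w ` U) ` W"] ballI)
    show "p \<in> orbit_map ` U" using x U by auto
    show "openin (top_of_set (orbit_map ` Xreg)) (orbit_map ` U)" using U by (intro orbit_map_open_image)
    show "\<Union>((\<lambda>w. (*v) w ` U) ` W) = Xreg \<inter> orbit_map -` orbit_map ` U"
    proof (intro equalityI subsetI)
      fix y assume "y \<in> \<Union>((\<lambda>w. (*v) w ` U) ` W)"
      then obtain w u where wu: "w \<in> W" "u \<in> U" "y = w *v u" by auto
      then have "orbit_map y = orbit_map u" using orbit_map_eq_iff[of u y] by auto
      then show "y \<in> Xreg \<inter> orbit_map -` orbit_map ` U" using wu U W_X by auto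
    next
      fix y assume "y \<in> Xreg \<inter> orbit_map -` orbit_map ` U"
      then obtain u where "u \<in> U" "orbit_map u = orbit_map y" by auto
      then obtain w where "w \<in> W" "y = w *v u" using orbit_map_eq_iff by blast
      then show "y \<in> \<Union>((\<lambda>w. (*v) w ` U) ` W)" using \<open>u \<in> U\<close> by blast
    qed
    show "openin (top_of_set Xreg) u" if "u \<in> (\<lambda>w. (*v) w ` U) ` W" for u
      using that U op W_X by (auto intro!: openin_open_subtopology[THEN iffD2] simp: open_X open_openin[symmetric])
    show "pairwise disjnt ((\<lambda>w. (*v) w ` U) ` W)"
    proof (rule pairwiseI)
      fix P Q assume "P \<in> (\<lambda>w. (*v) w ` U) ` W" "Q \<in> (\<lambda>w. (*v) w ` U) ` W" "P \<noteq> Q"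
      then obtain v w where vw: "v \<in> W" "w \<in> W" "P = (*v) v ` U" "Q = (*v) w ` U" by auto
      show "disjnt P Q"
      proof (rule ccontr)
        assume "\<not> disjnt P Q"
        then obtain a b where ab: "a \<in> U" "b \<in> U" "v *v a = w *v b" using vw by (auto simp: disjnt_def)
        then have "(winv w ** v) *v a = b" using vw by (simp add: matrix_vector_mul_assoc[symmetric])
        then have "winv w ** v = mat 1" using U(4)[of a "winv w ** v"] ab vw by simp
        then have "v = w" using vw by (metis matrix_mul_assoc matrix_mul_lid matrix_mul_rid winv(3))
        then show False using vw \<open>P \<noteq> Q\<close> by simp
      qed
    qed
    fix u assume "u \<in> (\<lambda>w. (*v) w ` U) ` W"
    then obtain w where w: "w \<in> W" "u = (*v) w ` U" by auto
    have "open u" "u \<subseteq> Xreg" using w U op W_X by auto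
    have "\<exists>g. homeomorphism u (orbit_map ` U) orbit_map g"
    proof (rule homeomorphism_injective_open_map)
      show "continuous_on u orbit_map" by (rule continuous_on_orbit_map)
      show "orbit_map ` u = orbit_map ` U" using w img_act by simp
      show "inj_on orbit_map u"
      proof (rule inj_onI)
        fix a b assume "a \<in> u" "b \<in> u" "orbit_map a = orbit_map b"
        then obtain a' b' y where *: "a' \<in> U" "b' \<in> U" "a = w *v a'" "b = w *v b'" "y \<in> W" "b = y *v a"
          using w orbit_map_eq_iff by blast
        then have "(winv w ** y ** w) *v a' = b'" using w by (simp add: matrix_vector_mul_assoc[symmetric])
        then have "winv w ** y ** w = mat 1" using U(4)[of a' "winv w ** y ** w"] * w by simp
        then show "a = b" using \<open>(winv w ** y ** w) *v a' = b'\<close> * by simp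
      qed
      show "openin (top_of_set (orbit_map ` U)) (orbit_map ` V)" if "openin (top_of_set u) V" for V
      proof -
        have "open V" "V \<subseteq> u" using that \<open>open u\<close> by (auto simp: openin_open_eq)
        then have "openin (top_of_set (orbit_map ` Xreg)) (orbit_map ` V)"
          using \<open>u \<subseteq> Xreg\<close> by (intro orbit_map_open_image) auto
        moreover have "orbit_map ` V \<subseteq> orbit_map ` U" using \<open>V \<subseteq> u\<close> w img_act by blast
        moreover have "orbit_map ` U \<subseteq> orbit_map ` Xreg" using U by auto
        ultimately show ?thesis by (meson openin_subset_trans)
      qed
    qed blast
    then show "\<exists>q. homeomorphism u (orbit_map ` U) orbit_map q" .
  qed
qed (auto simp: continuous_on_orbit_map)

end


section \<open>Fundamental groups by loop classes\<close>

lemma loops_at_top_of_set: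
  "g \<in> loops_at (top_of_set S) x \<longleftrightarrow> path g \<and> path_image g \<subseteq> S \<and> pathstart g = x \<and> pathfinish g = x"
  by (auto simp: loops_at_def path_def path_image_def pathstart_def pathfinish_def)

lemma loop_homotopy_rel_top_of_set:
  "(f, g) \<in> loop_homotopy_rel (top_of_set S) x \<longleftrightarrow>
     f \<in> loops_at (top_of_set S) x \<and> g \<in> loops_at (top_of_set S) x \<and> homotopic_paths S f g"
  unfolding loop_homotopy_rel_def homotopic_paths_def
  by (auto simp: loops_at_top_of_set pathstart_def pathfinish_def)

lemma loop_join_joinpaths: "loop_join = (+++)"
  by (intro ext) (simp add: loop_join_def joinpaths_def)

lemma equiv_loop_homotopy: "equiv (loops_at T x) (loop_homotopy_rel T x)"
proof (rule equivI)
  show "loop_homotopy_rel T x \<subseteq> loops_at T x \<times> loops_at T x"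
    by (auto simp: loop_homotopy_rel_def)
  show "refl_on (loops_at T x) (loop_homotopy_rel T x)"
    by (rule refl_onI) (auto simp: loop_homotopy_rel_def loops_at_def)
  show "sym (loop_homotopy_rel T x)"
    by (rule symI) (auto simp: loop_homotopy_rel_def homotopic_with_sym)
  show "trans (loop_homotopy_rel T x)"
    unfolding loop_homotopy_rel_def by (rule transI) (clarsimp, erule (1) homotopic_with_trans)
qed

lemma loop_class_eq_iff:
  assumes "f \<in> loops_at T x" "g \<in> loops_at T x"
  shows "loop_class T x f = loop_class T x g \<longleftrightarrow> (f, g) \<in> loop_homotopy_rel T x"
  unfolding loop_class_def by (rule eq_equiv_class_iff[OF equiv_loop_homotopy assms])

lemma loop_class_self: "f \<in> loops_at T x \<Longrightarrow> f \<in> loop_class T x f"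
  unfolding loop_class_def by (rule equiv_class_self[OF equiv_loop_homotopy])

lemma mem_loop_class: "f \<in> loop_class T x g \<longleftrightarrow> (g, f) \<in> loop_homotopy_rel T x"
  by (simp add: loop_class_def)

lemma carrier_fundamental_group: "carrier (fundamental_group T x) = loop_class T x ` loops_at T x"
  by (auto simp: fundamental_group_def quotient_def loop_class_def)

lemma loop_class_cong:
  assumes "f \<in> loops_at T x" "\<And>t. t \<in> {0..1} \<Longrightarrow> f t = g t"
  shows "loop_class T x f = loop_class T x g" "g \<in> loops_at T x"
proof -
  show g: "g \<in> loops_at T x"
    using assms continuous_map_eq[of "top_of_set {0..1}" T f g] by (auto simp: loops_at_def)
  have "homotopic_with (\<lambda>h. h 0 = x \<and> h 1 = x) (top_of_set {0..1}) T f g"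
    using assms g by (intro homotopic_with_equal) (auto simp: loops_at_def)
  then show "loop_class T x f = loop_class T x g"
    using loop_class_eq_iff[OF assms(1) g] assms(1) g by (simp add: loop_homotopy_rel_def)
qed

lemma fundamental_group_mult_unique:
  assumes "f \<in> loops_at T x" "g \<in> loops_at T x"
    and "\<And>f' g'. (f, f') \<in> loop_homotopy_rel T x \<Longrightarrow> (g, g') \<in> loop_homotopy_rel T x \<Longrightarrow>
           loop_class T x (loop_join f' g') = c"
  shows "loop_class T x f \<otimes>\<^bsub>fundamental_group T x\<^esub> loop_class T x g = c"
proof -
  have "(\<Union>f'\<in>loop_class T x f. \<Union>g'\<in>loop_class T x g. loop_class T x (loop_join f' g')) = c"
    using assms(3) loop_class_self[OF assms(1)] loop_class_self[OF assms(2)]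
    by (auto simp: mem_loop_class)
  then show ?thesis by (simp add: fundamental_group_def)
qed


section \<open>The braid group as classes of paths\<close>

text \<open>A loop of the orbit space is the projection of a path that starts at the base point and ends in its
  orbit; two loops are homotopic iff these paths are. The translated second path continues the first.\<close>

locale base_point = reflection_group W for W :: "(complex^'n^'n) set" +
  fixes x0 :: "complex^'n"
  assumes x0: "x0 \<in> hyperplane_complement UNIV W"
begin

abbreviation "B \<equiv> braid_group UNIV W x0"
abbreviation "P \<equiv> pure_braid_group W x0"
abbreviation "orb \<equiv> orbit_of W"

definition lifts :: "(real \<Rightarrow> complex^'n) set" where
  "lifts = {g. path g \<and> path_image g \<subseteq> Xreg \<and> pathstart g = x0 \<and> (\<exists>w\<in>W. pathfinish g = w *v x0)}"

definition end_elt :: "(real \<Rightarrow> complex^'n) \<Rightarrow> complex^'n^'n" where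
  "end_elt g = (THE w. w \<in> W \<and> pathfinish g = w *v x0)"

definition cls :: "(real \<Rightarrow> complex^'n) \<Rightarrow> (real \<Rightarrow> (complex^'n) set) set" where
  "cls g = loop_class Xorb (orb x0) (orb \<circ> g)"

definition act :: "complex^'n^'n \<Rightarrow> (real \<Rightarrow> complex^'n) \<Rightarrow> real \<Rightarrow> complex^'n" where
  "act w g = (\<lambda>t. w *v g t)"

definition extend :: "(real \<Rightarrow> complex^'n) \<Rightarrow> (real \<Rightarrow> complex^'n) \<Rightarrow> real \<Rightarrow> complex^'n" where
  "extend g h = g +++ act (end_elt g) h"

lemma end_elt: "g \<in> lifts \<Longrightarrow> end_elt g \<in> W \<and> pathfinish g = end_elt g *v x0"
  unfolding end_elt_def by (rule theI') (auto simp: lifts_def intro: W_free[OF x0])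

lemma end_elt_W [simp]: "g \<in> lifts \<Longrightarrow> end_elt g \<in> W"
  using end_elt by blast

lemma end_elt_eqI: "g \<in> lifts \<Longrightarrow> w \<in> W \<Longrightarrow> pathfinish g = w *v x0 \<Longrightarrow> end_elt g = w"
  using end_elt W_free[OF x0] by metis

lemma liftsD: "g \<in> lifts \<Longrightarrow> path g" "g \<in> lifts \<Longrightarrow> path_image g \<subseteq> Xreg" "g \<in> lifts \<Longrightarrow> pathstart g = x0"
  by (auto simp: lifts_def)

lemma path_act: "path g \<Longrightarrow> path (act w g)"
  unfolding path_def act_def by (rule continuous_on_act)

lemma path_image_act: "w \<in> W \<Longrightarrow> path_image g \<subseteq> Xreg \<Longrightarrow> path_image (act w g) \<subseteq> Xreg"
  using W_X by (auto simp: path_image_def act_def)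

lemma act_start [simp]: "pathstart (act w g) = w *v pathstart g"
  and act_finish [simp]: "pathfinish (act w g) = w *v pathfinish g"
  by (simp_all add: act_def pathstart_def pathfinish_def)

lemma act_join: "act w (g +++ h) = act w g +++ act w h"
  by (auto simp: act_def joinpaths_def)

lemma act_act: "act v (act w g) = act (v ** w) g"
  by (simp add: act_def matrix_vector_mul_assoc)

lemma act_one [simp]: "act (mat 1) g = g"
  by (simp add: act_def)

lemma homotopic_act: "w \<in> W \<Longrightarrow> homotopic_paths Xreg g h \<Longrightarrow> homotopic_paths Xreg (act w g) (act w h)"
  using homotopic_paths_continuous_image[of Xreg g h "\<lambda>x. w *v x" Xreg]
    continuous_on_act[OF continuous_on_id, of Xreg w] W_X
  by (auto simp: act_def comp_def image_subset_iff)

lemma orb_act: "w \<in> W \<Longrightarrow> orb \<circ> act w g = orb \<circ> g"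
  by (auto simp: act_def)

lemma extend_lifts:
  assumes "g \<in> lifts" "h \<in> lifts"
  shows "extend g h \<in> lifts" "end_elt (extend g h) = end_elt g ** end_elt h"
proof -
  have w: "end_elt g \<in> W" "end_elt h \<in> W" using assms by auto
  have fin: "pathfinish (extend g h) = (end_elt g ** end_elt h) *v x0"
    using end_elt[OF assms(2)] by (simp add: extend_def matrix_vector_mul_assoc)
  have j: "pathfinish g = pathstart (act (end_elt g) h)"
    using end_elt[OF assms(1)] liftsD(3)[OF assms(2)] by simp
  show l: "extend g h \<in> lifts"
    using j fin w assms path_act path_image_act[OF w(1)] unfolding extend_def lifts_def
    by (auto simp: path_image_join intro!: bexI[of _ "end_elt g ** end_elt h"])
  show "end_elt (extend g h) = end_elt g ** end_elt h"
    by (rule end_elt_eqI[OF l _ fin]) (use w in auto)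
qed

lemma orb_loop: "g \<in> lifts \<Longrightarrow> orb \<circ> g \<in> loops_at Xorb (orb x0)"
proof -
  assume g: "g \<in> lifts"
  have "continuous_map (top_of_set {0..1}) (top_of_set Xreg) g"
    using liftsD[OF g] by (auto simp: path_def path_image_def)
  then have "continuous_map (top_of_set {0..1}) Xorb (orb \<circ> g)"
    using quotient_imp_continuous_map[OF quotient_map_orbit_space] continuous_map_compose by blast
  then show ?thesis
    using end_elt[OF g] liftsD(3)[OF g] by (simp add: loops_at_def pathstart_def pathfinish_def)
qed

lemma orb_homotopic:
  assumes "g \<in> lifts" "h \<in> lifts" "homotopic_paths Xreg g h"
  shows "(orb \<circ> g, orb \<circ> h) \<in> loop_homotopy_rel Xorb (orb x0)"
proof -
  have hom: "homotopic_with (\<lambda>r. pathstart r = pathstart g \<and> pathfinish r = pathfinish g)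
      (top_of_set {0..1}) (top_of_set Xreg) g h"
    using assms(3) by (simp add: homotopic_paths_def)
  have "homotopic_with (\<lambda>r. r 0 = orb x0 \<and> r 1 = orb x0) (top_of_set {0..1}) Xorb (orb \<circ> g) (orb \<circ> h)"
  proof (rule homotopic_with_compose_continuous_map_left[OF hom])
    show "continuous_map (top_of_set Xreg) Xorb orb"
      using quotient_imp_continuous_map[OF quotient_map_orbit_space] .
    show "(orb \<circ> j) 0 = orb x0 \<and> (orb \<circ> j) 1 = orb x0"
      if "pathstart j = pathstart g \<and> pathfinish j = pathfinish g" for j
      using that end_elt[OF assms(1)] liftsD(3)[OF assms(1)] by (simp add: pathstart_def pathfinish_def)
  qed
  then show ?thesis using orb_loop assms by (simp add: loop_homotopy_rel_def)
qed

lemma continuous_orbit_function: "continuous_map Xorb (top_of_set (orbit_map ` Xreg)) orbit_function"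
proof -
  have "continuous_map (top_of_set Xreg) (top_of_set (orbit_map ` Xreg)) (orbit_function \<circ> orb)"
    using continuous_on_orbit_map[of Xreg] by (auto simp: orbit_map_def[abs_def] comp_def)
  then show ?thesis using continuous_compose_quotient_map[OF quotient_map_orbit_space] by blast
qed

lemma lift_loop:
  assumes f: "f \<in> loops_at Xorb (orb x0)"
  obtains g where "g \<in> lifts" "\<And>t. t \<in> {0..1} \<Longrightarrow> orb (g t) = f t"
proof -
  have cf: "continuous_map (top_of_set {0..1}) Xorb f" "f 0 = orb x0" "f 1 = orb x0"
    using f by (auto simp: loops_at_def)
  have "continuous_map (top_of_set {0..1}) (top_of_set (orbit_map ` Xreg)) (orbit_function \<circ> f)"
    using continuous_map_compose[OF cf(1) continuous_orbit_function] .
  then have p: "path (orbit_function \<circ> f)" "path_image (orbit_function \<circ> f) \<subseteq> orbit_map ` Xreg"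
    by (auto simp: path_def path_image_def Pi_iff comp_def)
  have "pathstart (orbit_function \<circ> f) = orbit_map x0" by (simp add: pathstart_def cf orbit_map_def)
  from covering_space_lift_path_strong[OF covering_orbit_map x0 p this]
  obtain g where g: "path g" "path_image g \<subseteq> Xreg" "pathstart g = x0"
    "\<And>t. t \<in> {0..1} \<Longrightarrow> orbit_map (g t) = (orbit_function \<circ> f) t" by blast
  have "topspace Xorb = orb ` Xreg"
    using quotient_map_orbit_space[of Xreg W] by (auto simp: quotient_map_def)
  have e: "orb (g t) = f t" if t: "t \<in> {0..1}" for t
  proof -
    have "f t \<in> topspace Xorb" using cf(1) t by (auto simp: continuous_map_def)
    then obtain y where "f t = orb y" using \<open>topspace Xorb = orb ` Xreg\<close> by auto
    then show ?thesis using g(4)[OF t] orbit_function_inj by (simp add: orbit_map_def)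
  qed
  have "orb (g 1) = orb x0" using e[of 1] cf by simp
  then obtain w where "w \<in> W" "g 1 = w *v x0" using orbit_of_eq_iff by metis
  then have "g \<in> lifts" using g by (auto simp: lifts_def pathfinish_def)
  then show ?thesis using e that by blast
qed

lemma lift_homotopy:
  assumes "(f, f') \<in> loop_homotopy_rel Xorb (orb x0)" "g \<in> lifts" "g' \<in> lifts"
    and "\<And>t. t \<in> {0..1} \<Longrightarrow> orb (g t) = f t" "\<And>t. t \<in> {0..1} \<Longrightarrow> orb (g' t) = f' t"
  shows "homotopic_paths Xreg g g'"
proof -
  have hom: "homotopic_with (\<lambda>h. h 0 = orb x0 \<and> h 1 = orb x0) (top_of_set {0..1}) Xorb f f'"
    and ff: "f \<in> loops_at Xorb (orb x0)" "f' \<in> loops_at Xorb (orb x0)"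
    using assms(1) by (auto simp: loop_homotopy_rel_def)
  have f01: "f 0 = orb x0" "f 1 = orb x0" using ff by (auto simp: loops_at_def)
  have "homotopic_with (\<lambda>r. pathstart r = pathstart (orbit_function \<circ> f) \<and> pathfinish r = pathfinish (orbit_function \<circ> f))
     (top_of_set {0..1}) (top_of_set (orbit_map ` Xreg)) (orbit_function \<circ> f) (orbit_function \<circ> f')"
    by (rule homotopic_with_compose_continuous_map_left[OF hom continuous_orbit_function])
       (simp add: pathstart_def pathfinish_def f01)
  then have h: "homotopic_paths (orbit_map ` Xreg) (orbit_function \<circ> f) (orbit_function \<circ> f')"
    by (simp add: homotopic_paths_def)
  show ?thesis
  proof (rule covering_space_lift_homotopic_paths[OF covering_orbit_map _ _ _ _ h])
    show "path (orbit_function \<circ> f)" "path (orbit_function \<circ> f')"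
      "path_image (orbit_function \<circ> f) \<subseteq> orbit_map ` Xreg" "path_image (orbit_function \<circ> f') \<subseteq> orbit_map ` Xreg"
      using homotopic_paths_imp_path[OF h] homotopic_paths_imp_subset[OF h] by auto
    show "path g" "path g'" "path_image g \<subseteq> Xreg" "path_image g' \<subseteq> Xreg" "pathstart g = pathstart g'"
      using liftsD assms(2,3) by auto
    show "orbit_map (g t) = (orbit_function \<circ> f) t" if "t \<in> {0..1}" for t
      using assms(4)[OF that] by (simp add: orbit_map_def)
    show "orbit_map (g' t) = (orbit_function \<circ> f') t" if "t \<in> {0..1}" for t
      using assms(5)[OF that] by (simp add: orbit_map_def)
  qed
qed

lemma cls_eq_iff: "g \<in> lifts \<Longrightarrow> h \<in> lifts \<Longrightarrow> cls g = cls h \<longleftrightarrow> homotopic_paths Xreg g h"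
  unfolding cls_def using loop_class_eq_iff[OF orb_loop orb_loop] orb_homotopic lift_homotopy[of "orb \<circ> g" "orb \<circ> h" g h]
  by auto

lemma cls_lift: "g \<in> lifts \<Longrightarrow> (\<And>t. t \<in> {0..1} \<Longrightarrow> orb (g t) = f t) \<Longrightarrow> loop_class Xorb (orb x0) f = cls g"
  unfolding cls_def using loop_class_cong(1)[OF orb_loop, of g f] by simp

lemma carrier_B: "carrier B = cls ` lifts"
proof
  show "carrier B \<subseteq> cls ` lifts"
  proof
    fix b assume "b \<in> carrier B"
    then obtain f where f: "f \<in> loops_at Xorb (orb x0)" "b = loop_class Xorb (orb x0) f"
      by (auto simp: braid_group_def carrier_fundamental_group)
    obtain g where "g \<in> lifts" "\<And>t. t \<in> {0..1} \<Longrightarrow> orb (g t) = f t" using lift_loop[OF f(1)] by blast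
    then show "b \<in> cls ` lifts" using f(2) cls_lift by blast
  qed
  show "cls ` lifts \<subseteq> carrier B"
    using orb_loop by (auto simp: braid_group_def carrier_fundamental_group cls_def)
qed

lemma cls_carrier [simp]: "g \<in> lifts \<Longrightarrow> cls g \<in> carrier B"
  by (simp add: carrier_B)

lemma carrierE: assumes "b \<in> carrier B" obtains g where "g \<in> lifts" "b = cls g"
  using assms by (auto simp: carrier_B)

lemma homotopic_lifts_end:
  assumes "g \<in> lifts" "h \<in> lifts" "homotopic_paths Xreg g h"
  shows "end_elt g = end_elt h"
  using homotopic_paths_imp_pathfinish[OF assms(3)] by (simp add: end_elt_def)

lemma cls_mult:
  assumes "g \<in> lifts" "h \<in> lifts"
  shows "cls g \<otimes>\<^bsub>B\<^esub> cls h = cls (extend g h)"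
  unfolding braid_group_def cls_def
proof (rule fundamental_group_mult_unique[OF orb_loop orb_loop])
  fix f f' assume rel: "(orb \<circ> g, f) \<in> loop_homotopy_rel Xorb (orb x0)"
    "(orb \<circ> h, f') \<in> loop_homotopy_rel Xorb (orb x0)"
  then have "f \<in> loops_at Xorb (orb x0)" "f' \<in> loops_at Xorb (orb x0)" by (auto simp: loop_homotopy_rel_def)
  then obtain k k' where k: "k \<in> lifts" "\<And>t. t \<in> {0..1} \<Longrightarrow> orb (k t) = f t"
    and k': "k' \<in> lifts" "\<And>t. t \<in> {0..1} \<Longrightarrow> orb (k' t) = f' t" using lift_loop by metis
  have hk: "homotopic_paths Xreg g k" "homotopic_paths Xreg h k'"
    using lift_homotopy[OF rel(1) assms(1) k(1)] lift_homotopy[OF rel(2) assms(2) k'(1)] k k' by auto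
  have e: "end_elt g = end_elt k" by (rule homotopic_lifts_end[OF assms(1) k(1) hk(1)])
  have "loop_class Xorb (orb x0) (loop_join f f') = cls (extend k k')"
  proof (rule cls_lift[OF extend_lifts(1)[OF k(1) k'(1)]])
    fix t :: real assume "t \<in> {0..1}"
    then show "orb (extend k k' t) = loop_join f f' t"
      using k k' by (auto simp: extend_def loop_join_def joinpaths_def act_def)
  qed
  also have "\<dots> = cls (extend g h)"
  proof -
    have "homotopic_paths Xreg (extend k k') (extend g h)"
      unfolding extend_def e
      using hk k(1) k'(1) end_elt[OF k(1)] liftsD(3)[OF k'(1)]
      by (intro homotopic_paths_join homotopic_act homotopic_paths_sym[OF hk(1)] homotopic_paths_sym[OF hk(2)])
        auto
    then show ?thesis using cls_eq_iff extend_lifts(1) k(1) k'(1) assms by simp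
  qed
  finally show "loop_class Xorb (orb x0) (loop_join f f') = loop_class Xorb (orb x0) (orb \<circ> extend g h)"
    by (simp add: cls_def)
qed (use assms in auto)

definition const_lift :: "real \<Rightarrow> complex^'n" where "const_lift = (\<lambda>_. x0)"

lemma const_lift: "const_lift \<in> lifts" "end_elt const_lift = mat 1"
proof -
  show l: "const_lift \<in> lifts"
    using x0 by (auto simp: lifts_def const_lift_def path_def path_image_def pathstart_def pathfinish_def
        intro!: bexI[of _ "mat 1"])
  show "end_elt const_lift = mat 1"
    by (rule end_elt_eqI[OF l]) (auto simp: const_lift_def pathfinish_def)
qed

lemma one_B: "\<one>\<^bsub>B\<^esub> = cls const_lift"
  by (simp add: braid_group_def fundamental_group_def cls_def const_lift_def comp_def)

lemma const_lift_linepath: "const_lift = linepath x0 x0"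
  by (simp add: const_lift_def linepath_refl)

lemma inverse_lift:
  assumes g: "g \<in> lifts"
  defines "h \<equiv> act (winv (end_elt g)) (reversepath g)"
  shows "h \<in> lifts" "end_elt h = winv (end_elt g)" "cls h \<otimes>\<^bsub>B\<^esub> cls g = \<one>\<^bsub>B\<^esub>"
proof -
  have w: "end_elt g \<in> W" "pathfinish g = end_elt g *v x0" using end_elt[OF g] by auto
  have fin: "pathfinish h = winv (end_elt g) *v x0" using liftsD(3)[OF g] by (simp add: h_def)
  show h: "h \<in> lifts"
    unfolding lifts_def mem_Collect_eq
  proof (intro conjI)
    show "path h" unfolding h_def using liftsD(1)[OF g] by (intro path_act) simp
    show "path_image h \<subseteq> Xreg" unfolding h_def using liftsD(2)[OF g] w by (intro path_image_act) auto
    show "pathstart h = x0" using w by (simp add: h_def)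
    show "\<exists>w\<in>W. pathfinish h = w *v x0" using fin w winv(1) by blast
  qed
  show e: "end_elt h = winv (end_elt g)" by (rule end_elt_eqI[OF h _ fin]) (use w in simp)
  have "extend h g = act (winv (end_elt g)) (reversepath g +++ g)"
    unfolding extend_def e act_join by (simp only: h_def)
  moreover have "homotopic_paths Xreg (act (winv (end_elt g)) (reversepath g +++ g))
      (act (winv (end_elt g)) (linepath (pathfinish g) (pathfinish g)))"
    using liftsD[OF g] w by (intro homotopic_act homotopic_paths_linv) auto
  moreover have "act (winv (end_elt g)) (linepath (pathfinish g) (pathfinish g)) = const_lift"
    using w by (simp add: act_def const_lift_def linepath_refl fun_eq_iff)
  ultimately have "homotopic_paths Xreg (extend h g) const_lift" by simp
  then show "cls h \<otimes>\<^bsub>B\<^esub> cls g = \<one>\<^bsub>B\<^esub>"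
    using cls_mult[OF h g] cls_eq_iff[OF extend_lifts(1)[OF h g] const_lift(1)] one_B by simp
qed

lemma group_B: "group B"
proof (rule groupI)
  show "\<one>\<^bsub>B\<^esub> \<in> carrier B" using one_B const_lift by simp
next
  fix x y assume "x \<in> carrier B" "y \<in> carrier B"
  then obtain g h where "g \<in> lifts" "h \<in> lifts" "x = cls g" "y = cls h" by (metis carrierE)
  then show "x \<otimes>\<^bsub>B\<^esub> y \<in> carrier B" using cls_mult extend_lifts(1) by simp
next
  fix x y z assume "x \<in> carrier B" "y \<in> carrier B" "z \<in> carrier B"
  then obtain g h k where l: "g \<in> lifts" "h \<in> lifts" "k \<in> lifts" and xyz: "x = cls g" "y = cls h" "z = cls k"
    by (metis carrierE)
  define u v where "u = end_elt g" and "v = end_elt h"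
  have uv: "u \<in> W" "v \<in> W" "pathfinish g = u *v x0" "pathfinish h = v *v x0"
    using end_elt l by (auto simp: u_def v_def)
  have "homotopic_paths Xreg (g +++ (act u h +++ act (u ** v) k)) ((g +++ act u h) +++ act (u ** v) k)"
    using l uv liftsD path_act path_image_act
    by (intro homotopic_paths_assoc) (auto simp: matrix_vector_mul_assoc[symmetric] liftsD(3))
  then have "homotopic_paths Xreg (extend g (extend h k)) (extend (extend g h) k)"
    using extend_lifts(2)[OF l(1,2)] by (simp add: extend_def act_join act_act u_def v_def)
  then show "x \<otimes>\<^bsub>B\<^esub> y \<otimes>\<^bsub>B\<^esub> z = x \<otimes>\<^bsub>B\<^esub> (y \<otimes>\<^bsub>B\<^esub> z)"
    using l cls_mult extend_lifts(1) cls_eq_iff by (simp add: xyz homotopic_paths_sym_eq)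
next
  fix x assume "x \<in> carrier B"
  then obtain g where g: "g \<in> lifts" "x = cls g" by (metis carrierE)
  have "homotopic_paths Xreg (linepath (pathstart g) (pathstart g) +++ g) g"
    using liftsD g by (intro homotopic_paths_lid) auto
  then have "homotopic_paths Xreg (extend const_lift g) g"
    using liftsD(3)[OF g(1)] by (simp add: extend_def const_lift(2)) (simp add: const_lift_linepath)
  then show "\<one>\<^bsub>B\<^esub> \<otimes>\<^bsub>B\<^esub> x = x"
    using g const_lift cls_mult[OF const_lift(1) g(1)] cls_eq_iff extend_lifts(1) by (simp add: one_B)
next
  fix x assume "x \<in> carrier B"
  then obtain g where g: "g \<in> lifts" "x = cls g" by (metis carrierE)
  show "\<exists>y\<in>carrier B. y \<otimes>\<^bsub>B\<^esub> x = \<one>\<^bsub>B\<^esub>"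
    using inverse_lift[OF g(1)] g(2) cls_carrier by blast
qed

definition to_W :: "(real \<Rightarrow> (complex^'n) set) set \<Rightarrow> complex^'n^'n" where
  "to_W = braid_to_reflection_group W x0"

lemma to_W_cls:
  assumes g: "g \<in> lifts"
  shows "to_W (cls g) = end_elt g"
  unfolding to_W_def braid_to_reflection_group_def
proof (rule the_equality)
  have "continuous_map (top_of_set {0..1}) (top_of_set Xreg) g"
    using liftsD[OF g] by (auto simp: path_def path_image_def)
  then show "end_elt g \<in> W \<and> (\<exists>k. continuous_map (top_of_set {0..1}) (top_of_set Xreg) k \<and>
      k 0 = x0 \<and> k 1 = end_elt g *v x0 \<and> orb \<circ> k \<in> cls g)"
    using end_elt[OF g] liftsD(3)[OF g] loop_class_self[OF orb_loop[OF g]]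
    by (auto simp: pathstart_def pathfinish_def cls_def intro!: exI[of _ g])
next
  fix w assume "w \<in> W \<and> (\<exists>k. continuous_map (top_of_set {0..1}) (top_of_set Xreg) k \<and>
      k 0 = x0 \<and> k 1 = w *v x0 \<and> orb \<circ> k \<in> cls g)"
  then obtain k where w: "w \<in> W" and k: "continuous_map (top_of_set {0..1}) (top_of_set Xreg) k"
    "k 0 = x0" "k 1 = w *v x0" "orb \<circ> k \<in> cls g" by blast
  have kl: "k \<in> lifts"
    using k w by (auto simp: lifts_def path_def path_image_def pathstart_def pathfinish_def)
  have "(orb \<circ> g, orb \<circ> k) \<in> loop_homotopy_rel Xorb (orb x0)"
    using k(4) by (simp add: cls_def mem_loop_class)
  then have "homotopic_paths Xreg g k" using lift_homotopy[of _ _ g k] g kl by auto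
  then have "end_elt g = end_elt k" by (rule homotopic_lifts_end[OF g kl])
  then show "w = end_elt g" using end_elt_eqI[OF kl w] k by (simp add: pathfinish_def)
qed

lemma to_W_hom: "to_W \<in> hom B (matrix_group W)"
proof (rule homI)
  fix x assume "x \<in> carrier B"
  then show "to_W x \<in> carrier (matrix_group W)" using to_W_cls by (auto elim!: carrierE)
next
  fix x y assume "x \<in> carrier B" "y \<in> carrier B"
  then obtain g h where "g \<in> lifts" "h \<in> lifts" "x = cls g" "y = cls h" by (metis carrierE)
  then show "to_W (x \<otimes>\<^bsub>B\<^esub> y) = to_W x \<otimes>\<^bsub>matrix_group W\<^esub> to_W y"
    using to_W_cls cls_mult extend_lifts by simp
qed

text \<open>Two points of the complement span a complex line, which meets the hyperplanes in finitely many
  points.\<close>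

lemma path_in_Xreg:
  assumes "x \<in> Xreg" "y \<in> Xreg"
  obtains g where "path g" "path_image g \<subseteq> Xreg" "pathstart g = x" "pathfinish g = y"
proof -
  define fm :: "(complex^'n) set \<Rightarrow> complex^'n" where "fm H = (SOME a. a \<noteq> 0 \<and> H = {v. form a v = 0})" for H
  have fm: "fm H \<noteq> 0" "H = {v. form (fm H) v = 0}" if "H \<in> reflecting_hyperplanes W" for H
    using someI_ex[OF hyperplane_form[OF that]] unfolding fm_def[symmetric] by blast+
  have iff: "z \<in> Xreg \<longleftrightarrow> (\<forall>b\<in>fm ` reflecting_hyperplanes W. form b z \<noteq> 0)" for z
    using fm by (auto simp: hyperplane_complement_def)
  obtain z where z: "path z" "pathstart z = 0" "pathfinish z = (1::complex)"
    "\<And>t b. t \<in> {0..1} \<Longrightarrow> b \<in> fm ` reflecting_hyperplanes W \<Longrightarrow> form b (x + z t *s (y - x)) \<noteq> 0"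
    using complex_line_path[of "fm ` reflecting_hyperplanes W" x y] finite_reflecting_hyperplanes assms iff by blast
  show ?thesis
  proof (rule that[of "\<lambda>t. x + z t *s (y - x)"])
    show "path (\<lambda>t. x + z t *s (y - x))"
      using z(1) unfolding path_def by (intro continuous_intros)
    show "path_image (\<lambda>t. x + z t *s (y - x)) \<subseteq> Xreg"
      using z(4) iff by (auto simp: path_image_def)
  qed (use z(2,3) in \<open>auto simp: pathstart_def pathfinish_def\<close>)
qed

lemma to_W_surj: "w \<in> W \<Longrightarrow> \<exists>g\<in>lifts. end_elt g = w"
proof -
  assume w: "w \<in> W"
  obtain g where g: "path g" "path_image g \<subseteq> Xreg" "pathstart g = x0" "pathfinish g = w *v x0"
    using path_in_Xreg[OF x0 W_X[OF w x0]] by blast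
  then have "g \<in> lifts" using w by (auto simp: lifts_def)
  then show ?thesis using end_elt_eqI g(4) w by blast
qed


section \<open>The pure braid group\<close>

definition loops :: "(real \<Rightarrow> complex^'n) set" where
  "loops = loops_at (top_of_set Xreg) x0"

definition pcls :: "(real \<Rightarrow> complex^'n) \<Rightarrow> (real \<Rightarrow> complex^'n) set" where
  "pcls g = loop_class (top_of_set Xreg) x0 g"

lemma loops_iff: "g \<in> loops \<longleftrightarrow> path g \<and> path_image g \<subseteq> Xreg \<and> pathstart g = x0 \<and> pathfinish g = x0"
  by (simp add: loops_def loops_at_top_of_set)

lemma loops_lifts: "g \<in> loops \<longleftrightarrow> g \<in> lifts \<and> end_elt g = mat 1"
proof
  assume g: "g \<in> loops"
  then have "g \<in> lifts" by (auto simp: loops_iff lifts_def intro!: bexI[of _ "mat 1"])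
  moreover have "end_elt g = mat 1" by (rule end_elt_eqI[OF calculation]) (use g in \<open>auto simp: loops_iff\<close>)
  ultimately show "g \<in> lifts \<and> end_elt g = mat 1" by simp
next
  assume "g \<in> lifts \<and> end_elt g = mat 1"
  then show "g \<in> loops" using end_elt[of g] by (auto simp: loops_iff lifts_def)
qed

lemma pcls_eq_iff: "g \<in> loops \<Longrightarrow> h \<in> loops \<Longrightarrow> pcls g = pcls h \<longleftrightarrow> homotopic_paths Xreg g h"
  unfolding pcls_def loops_def by (simp add: loop_class_eq_iff loop_homotopy_rel_top_of_set)

lemma carrier_P: "carrier P = pcls ` loops"
  by (simp add: pure_braid_group_def carrier_fundamental_group pcls_def[abs_def] loops_def)

lemma pure_to_braid_pcls:
  assumes g: "g \<in> loops"
  shows "pure_to_braid W x0 (pcls g) = cls g"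
proof -
  have "loop_class Xorb (orb x0) (orb \<circ> h) = cls g" if "h \<in> pcls g" for h
  proof -
    have "h \<in> loops" "homotopic_paths Xreg g h"
      using that unfolding pcls_def mem_loop_class loop_homotopy_rel_top_of_set by (auto simp: loops_def)
    then show ?thesis using cls_eq_iff[of g h] g loops_lifts by (simp add: cls_def)
  qed
  moreover have "g \<in> pcls g" using g loop_class_self by (auto simp: pcls_def loops_def)
  ultimately show ?thesis unfolding pure_to_braid_def induced_map_def by auto
qed

lemma pcls_mult:
  assumes "g \<in> loops" "h \<in> loops"
  shows "pcls g \<otimes>\<^bsub>P\<^esub> pcls h = pcls (g +++ h)" "g +++ h \<in> loops"
proof -
  have l: "g +++ h \<in> loops" if "g \<in> loops" "h \<in> loops" for g h
    using that by (auto simp: loops_iff path_image_join)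
  then show "g +++ h \<in> loops" using assms by blast
  show "pcls g \<otimes>\<^bsub>P\<^esub> pcls h = pcls (g +++ h)"
    unfolding pure_braid_group_def pcls_def
  proof (rule fundamental_group_mult_unique)
    fix f f' assume "(g, f) \<in> loop_homotopy_rel (top_of_set Xreg) x0" "(h, f') \<in> loop_homotopy_rel (top_of_set Xreg) x0"
    then have "f \<in> loops" "f' \<in> loops" "homotopic_paths Xreg g f" "homotopic_paths Xreg h f'"
      by (auto simp: loop_homotopy_rel_top_of_set loops_def)
    then have "homotopic_paths Xreg (f +++ f') (g +++ h)"
      using assms by (intro homotopic_paths_join) (auto simp: loops_iff homotopic_paths_sym)
    then show "loop_class (top_of_set Xreg) x0 (loop_join f f') = loop_class (top_of_set Xreg) x0 (g +++ h)"
      using pcls_eq_iff[OF l[OF \<open>f \<in> loops\<close> \<open>f' \<in> loops\<close>] \<open>g +++ h \<in> loops\<close>]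
      by (simp add: pcls_def loop_join_joinpaths)
  qed (use assms in \<open>auto simp: loops_def\<close>)
qed

lemma extend_loops: "g \<in> loops \<Longrightarrow> extend g h = g +++ h"
  using loops_lifts by (simp add: extend_def)

lemma pure_to_braid_inj: "inj_on (pure_to_braid W x0) (carrier P)"
proof (rule inj_onI)
  fix x y assume "x \<in> carrier P" "y \<in> carrier P" "pure_to_braid W x0 x = pure_to_braid W x0 y"
  then show "x = y"
  proof -
    obtain g h where gh: "g \<in> loops" "h \<in> loops" "x = pcls g" "y = pcls h"
      using \<open>x \<in> carrier P\<close> \<open>y \<in> carrier P\<close> unfolding carrier_P by blast
    then have "cls g = cls h" using \<open>pure_to_braid W x0 x = pure_to_braid W x0 y\<close> pure_to_braid_pcls by simp
    then have "homotopic_paths Xreg g h" using gh cls_eq_iff loops_lifts by blast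
    then show ?thesis using gh pcls_eq_iff by blast
  qed
qed

lemma pure_to_braid_mult:
  "x \<in> carrier P \<Longrightarrow> y \<in> carrier P \<Longrightarrow> pure_to_braid W x0 (x \<otimes>\<^bsub>P\<^esub> y) = pure_to_braid W x0 x \<otimes>\<^bsub>B\<^esub> pure_to_braid W x0 y"
proof -
  assume "x \<in> carrier P" "y \<in> carrier P"
  then obtain g h where gh: "g \<in> loops" "h \<in> loops" "x = pcls g" "y = pcls h"
    unfolding carrier_P by blast
  have "pure_to_braid W x0 (x \<otimes>\<^bsub>P\<^esub> y) = cls (g +++ h)"
    using pcls_mult[OF gh(1,2)] pure_to_braid_pcls[OF pcls_mult(2)[OF gh(1,2)]] gh(3,4) by simp
  moreover have "cls g \<otimes>\<^bsub>B\<^esub> cls h = cls (g +++ h)"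
    using cls_mult[of g h] extend_loops[OF gh(1)] gh(1,2) loops_lifts by simp
  ultimately show ?thesis using pure_to_braid_pcls gh by simp
qed

lemma pure_to_braid_image: "pure_to_braid W x0 ` carrier P = kernel B (matrix_group W) to_W"
proof
  show "pure_to_braid W x0 ` carrier P \<subseteq> kernel B (matrix_group W) to_W"
    using loops_lifts by (auto simp: carrier_P pure_to_braid_pcls kernel_def to_W_cls)
  show "kernel B (matrix_group W) to_W \<subseteq> pure_to_braid W x0 ` carrier P"
  proof
    fix b assume "b \<in> kernel B (matrix_group W) to_W"
    then obtain g where g: "g \<in> lifts" "b = cls g" "end_elt g = mat 1"
      by (auto simp: kernel_def to_W_cls elim!: carrierE)
    then have "g \<in> loops" using loops_lifts by simp
    then show "b \<in> pure_to_braid W x0 ` carrier P"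
      using g(2) pure_to_braid_pcls by (auto simp: carrier_P intro!: image_eqI[of _ _ "pcls g"])
  qed
qed

lemma group_P: "group P"
proof -
  interpret B: group B by (rule group_B)
  interpret to_W: group_hom B "matrix_group W" to_W
    by (intro group_hom.intro group_hom_axioms.intro group_B group_W to_W_hom)
  have sub: "subgroup (kernel B (matrix_group W) to_W) B" by (rule to_W.subgroup_kernel)
  let ?i = "pure_to_braid W x0"
  have ki: "?i x \<in> kernel B (matrix_group W) to_W" if "x \<in> carrier P" for x
    using that pure_to_braid_image by blast
  have pre: "\<exists>x\<in>carrier P. ?i x = b" if "b \<in> kernel B (matrix_group W) to_W" for b
    using that pure_to_braid_image by (metis imageE)
  have one: "?i \<one>\<^bsub>P\<^esub> = \<one>\<^bsub>B\<^esub>" "\<one>\<^bsub>P\<^esub> \<in> carrier P"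
  proof -
    have c: "const_lift \<in> loops" using const_lift loops_lifts by simp
    have "\<one>\<^bsub>P\<^esub> = pcls const_lift"
      by (simp add: pure_braid_group_def fundamental_group_def pcls_def const_lift_def)
    then show "?i \<one>\<^bsub>P\<^esub> = \<one>\<^bsub>B\<^esub>" "\<one>\<^bsub>P\<^esub> \<in> carrier P"
      using c pure_to_braid_pcls one_B by (auto simp: carrier_P)
  qed
  have closed: "x \<otimes>\<^bsub>P\<^esub> y \<in> carrier P" if "x \<in> carrier P" "y \<in> carrier P" for x y
    using that pcls_mult by (auto simp: carrier_P)
  have inB: "?i x \<in> carrier B" if "x \<in> carrier P" for x using ki[OF that] by (simp add: kernel_def)
  show ?thesis
  proof (rule groupI)
    show "x \<otimes>\<^bsub>P\<^esub> y \<otimes>\<^bsub>P\<^esub> z = x \<otimes>\<^bsub>P\<^esub> (y \<otimes>\<^bsub>P\<^esub> z)"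
      if "x \<in> carrier P" "y \<in> carrier P" "z \<in> carrier P" for x y z
      using that inB by (intro inj_onD[OF pure_to_braid_inj]) (simp_all add: pure_to_braid_mult closed B.m_assoc)
    show "\<one>\<^bsub>P\<^esub> \<otimes>\<^bsub>P\<^esub> x = x" if "x \<in> carrier P" for x
      using that inB one by (intro inj_onD[OF pure_to_braid_inj]) (simp_all add: pure_to_braid_mult closed)
    show "\<exists>y\<in>carrier P. y \<otimes>\<^bsub>P\<^esub> x = \<one>\<^bsub>P\<^esub>" if x: "x \<in> carrier P" for x
    proof -
      have "inv\<^bsub>B\<^esub> ?i x \<in> kernel B (matrix_group W) to_W"
        using subgroup.m_inv_closed[OF sub ki[OF x]] .
      then obtain y where y: "y \<in> carrier P" "?i y = inv\<^bsub>B\<^esub> ?i x" using pre by blast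
      then have "?i (y \<otimes>\<^bsub>P\<^esub> x) = ?i \<one>\<^bsub>P\<^esub>"
        using x inB one by (simp add: pure_to_braid_mult)
      then show ?thesis using inj_onD[OF pure_to_braid_inj] closed x y one by blast
    qed
  qed (use one closed in auto)
qed

end


section \<open>Winding numbers around the hyperplanes\<close>

lemma winding_number_scale:
  assumes "path p" "0 \<notin> path_image p" "c \<noteq> 0"
  shows "winding_number (\<lambda>t. c * p t) 0 = winding_number p 0"
proof -
  have "path_image p \<subseteq> - {0}" using assms(2) by blast
  then obtain q where q: "path q" "\<And>t. t \<in> {0..1} \<Longrightarrow> exp (q t) = p t"
    by (rule covering_space_lift_path[OF covering_space_exp_punctured_plane assms(1)]) (rule that)
  have 1: "winding_number p 0 = winding_number (exp \<circ> q) 0"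
    by (rule winding_number_cong) (use q in auto)
  have 2: "winding_number (\<lambda>t. c * p t) 0 = winding_number (exp \<circ> (\<lambda>t. Ln c + q t)) 0"
    by (rule winding_number_cong) (use q assms(3) in \<open>auto simp: exp_add\<close>)
  have "path (\<lambda>t. Ln c + q t)" using q(1) unfolding path_def by (intro continuous_intros)
  then show ?thesis
    using q(1) by (simp add: 1 2 winding_number_compose_exp pathstart_def pathfinish_def)
qed

lemma homotopic_backtrack:
  fixes S :: "'a::real_normed_vector set"
  assumes "path a" "path_image a \<subseteq> S" "path g" "path_image g \<subseteq> S" "path c" "path_image c \<subseteq> S"
    "path k" "path_image k \<subseteq> S"
    "pathfinish a = pathstart g" "pathfinish g = pathfinish c" "pathfinish c = pathstart k"
  shows "homotopic_paths S ((a +++ (g +++ reversepath c)) +++ (c +++ k)) (a +++ (g +++ k))"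
proof -
  let ?rc = "reversepath c"
  have rc: "path ?rc" "path_image ?rc \<subseteq> S" "pathstart ?rc = pathfinish c" "pathfinish ?rc = pathstart c"
    using assms by auto
  have j: "path_image (x +++ y) \<subseteq> S" if "path_image x \<subseteq> S" "path_image y \<subseteq> S" for x y :: "real \<Rightarrow> 'a"
    using that path_image_join_subset[of x y] by blast
  have "homotopic_paths S ((a +++ (g +++ ?rc)) +++ (c +++ k)) (a +++ ((g +++ ?rc) +++ (c +++ k)))"
    using assms rc by (intro homotopic_paths_sym[OF homotopic_paths_assoc] j) auto
  also have "homotopic_paths S (a +++ ((g +++ ?rc) +++ (c +++ k))) (a +++ (g +++ (?rc +++ (c +++ k))))"
    using assms rc by (intro homotopic_paths_join homotopic_paths_sym[OF homotopic_paths_assoc] j) auto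
  also have "homotopic_paths S (a +++ (g +++ (?rc +++ (c +++ k)))) (a +++ (g +++ ((?rc +++ c) +++ k)))"
    using assms rc by (intro homotopic_paths_join homotopic_paths_assoc j) auto
  also have "homotopic_paths S (a +++ (g +++ ((?rc +++ c) +++ k)))
      (a +++ (g +++ (linepath (pathstart k) (pathstart k) +++ k)))"
    using assms rc homotopic_paths_linv[of c S] by (intro homotopic_paths_join j) auto
  also have "homotopic_paths S (a +++ (g +++ (linepath (pathstart k) (pathstart k) +++ k))) (a +++ (g +++ k))"
    using assms by (intro homotopic_paths_join homotopic_paths_lid j) auto
  finally show ?thesis .
qed

context base_point
begin

abbreviation "HH \<equiv> reflecting_hyperplanes W"

lemma transversal_exists: "\<exists>v. \<forall>H\<in>HH. v \<notin> H"
proof -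
  have "\<forall>H\<in>HH. \<exists>a. a \<noteq> 0 \<and> H = {v. form a v = 0}" using hyperplane_form by blast
  then obtain fm where fm: "\<And>H. H \<in> HH \<Longrightarrow> fm H \<noteq> 0 \<and> H = {v. form (fm H) v = 0}" by metis
  obtain v where "\<forall>a\<in>fm ` HH. form a v \<noteq> 0"
    using exists_avoiding_forms[of "fm ` HH"] finite_reflecting_hyperplanes fm by fastforce
  then show ?thesis using fm by (intro exI[of _ v]) fastforce
qed

definition dir :: "complex^'n" where "dir = (SOME v. \<forall>H\<in>HH. v \<notin> H)"

definition al :: "(complex^'n) set \<Rightarrow> complex^'n" where
  "al H = (SOME a. form a dir = 1 \<and> H = {v. form a v = 0})"

lemma al: assumes "H \<in> HH" shows "form (al H) dir = 1" "v \<in> H \<longleftrightarrow> form (al H) v = 0"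
proof -
  have d: "dir \<notin> H" using someI_ex[OF transversal_exists] assms unfolding dir_def[symmetric] by blast
  obtain a where a: "a \<noteq> 0" "H = {v. form a v = 0}" using hyperplane_form[OF assms] by blast
  then have "form a dir \<noteq> 0" using d by auto
  then have "\<exists>a. form a dir = 1 \<and> H = {v. form a v = 0}"
    using a by (intro exI[of _ "(1 / form a dir) *s a"]) (auto simp: form_left_scale)
  from someI_ex[OF this] show "form (al H) dir = 1" "v \<in> H \<longleftrightarrow> form (al H) v = 0"
    unfolding al_def[symmetric] by blast+
qed

lemma al_inj: "H \<in> HH \<Longrightarrow> H' \<in> HH \<Longrightarrow> al H = al H' \<Longrightarrow> H = H'"
  by (rule Set.set_eqI) (simp only: al(2))

lemma Xreg_al: "x \<in> Xreg \<longleftrightarrow> (\<forall>H\<in>HH. form (al H) x \<noteq> 0)"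
  using al(2) by (auto simp: hyperplane_complement_def)

lemma Xreg_forms: "Xreg = {x. \<forall>a\<in>al ` HH. form a x \<noteq> 0}"
  using Xreg_al by auto

definition wind :: "(complex^'n) set \<Rightarrow> (real \<Rightarrow> complex^'n) \<Rightarrow> complex" where
  "wind H g = winding_number (\<lambda>t. form (al H) (g t)) 0"

lemma form_path:
  assumes "H \<in> HH" "path g" "path_image g \<subseteq> Xreg"
  shows "path (\<lambda>t. form (al H) (g t))" "0 \<notin> path_image (\<lambda>t. form (al H) (g t))"
  using assms Xreg_al by (auto simp: path_def path_image_def intro!: continuous_intros)

lemma wind_homotopic:
  assumes "H \<in> HH" "homotopic_paths Xreg g h"
  shows "wind H g = wind H h"
proof -
  have "homotopic_paths (-{0}) (form (al H) \<circ> g) (form (al H) \<circ> h)"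
  proof (rule homotopic_paths_continuous_image[OF assms(2)])
    show "continuous_on Xreg (form (al H))"
      using continuous_on_form[OF continuous_on_id, of Xreg "al H"] by simp
    show "form (al H) \<in> Xreg \<rightarrow> - {0}" using Xreg_al assms(1) by auto
  qed
  then show ?thesis using winding_number_homotopic_paths by (auto simp: wind_def comp_def)
qed

lemma wind_join:
  assumes "H \<in> HH" "path g" "path_image g \<subseteq> Xreg" "path h" "path_image h \<subseteq> Xreg" "pathfinish g = pathstart h"
  shows "wind H (g +++ h) = wind H g + wind H h"
proof -
  have "(\<lambda>t. form (al H) ((g +++ h) t)) = (\<lambda>t. form (al H) (g t)) +++ (\<lambda>t. form (al H) (h t))"
    by (auto simp: joinpaths_def)
  then show ?thesis
    using winding_number_join[OF form_path[OF assms(1-3)] form_path[OF assms(1,4,5)]] assms(6)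
    by (simp add: wind_def pathstart_def pathfinish_def)
qed

lemma wind_reverse:
  assumes "H \<in> HH" "path g" "path_image g \<subseteq> Xreg"
  shows "wind H (reversepath g) = - wind H g"
proof -
  have "(\<lambda>t. form (al H) (reversepath g t)) = reversepath (\<lambda>t. form (al H) (g t))"
    by (auto simp: reversepath_def)
  then show ?thesis using winding_number_reversepath[OF form_path[OF assms]] by (simp add: wind_def)
qed

lemma wind_exp:
  assumes "H \<in> HH" "path g" "path_image g \<subseteq> Xreg"
  shows "form (al H) (pathfinish g) = exp (2 * pi * \<i> * wind H g) * form (al H) (pathstart g)"
  using winding_number_exp_2pi[OF form_path[OF assms]] by (simp add: wind_def pathstart_def pathfinish_def)

lemma wind_loop_int:
  assumes "H \<in> HH" "g \<in> loops"
  shows "wind H g \<in> \<int>"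
  using integer_winding_number_eq[OF form_path[OF assms(1)]] assms(2)
  by (simp add: wind_def loops_iff pathstart_def pathfinish_def)

lemma wind_act:
  assumes H: "H \<in> HH" and w: "w \<in> W" and g: "path g" "path_image g \<subseteq> Xreg"
  shows "(*v) (winv w) ` H \<in> HH" "wind H (act w g) = wind ((*v) (winv w) ` H) g"
proof -
  obtain s where s: "s \<in> W" "is_reflection s" "H = {v. (s - mat 1) *v v = 0}"
    using H by (auto simp: reflecting_hyperplanes_def)
  let ?s = "winv w ** s ** winv (winv w)"
  have s': "is_reflection ?s" "?s \<in> W" using reflection_conjugate[OF s(2) winv(1)[OF w]] s w by simp_all
  have mem: "v \<in> (*v) (winv w) ` H \<longleftrightarrow> w *v v \<in> H" for v
    using w by (auto intro!: image_eqI[of _ _ "w *v v"])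
  have "(*v) (winv w) ` H = {v. (?s - mat 1) *v v = 0}"
  proof (rule Set.set_eqI)
    fix v
    have eqv: "?s *v v = v \<longleftrightarrow> s *v (w *v v) = w *v v"
      using w W_inj[OF winv(1)[OF w], of "s *v (w *v v)" "w *v v"]
      by (simp add: matrix_vector_mul_assoc[symmetric])
    show "v \<in> (*v) (winv w) ` H \<longleftrightarrow> v \<in> {v. (?s - mat 1) *v v = 0}"
      unfolding mem using eqv by (simp add: s(3) matrix_vector_mult_diff_rdistrib)
  qed
  then show H': "(*v) (winv w) ` H \<in> HH" (is "?H \<in> HH")
    using s' by (auto simp: reflecting_hyperplanes_def)
  define k where "k = form (al H) (w *v dir)"
  have eq: "form (al H) (w *v v) = k * form (al ?H) v" for v
  proof -
    have "v - form (al ?H) v *s dir \<in> ?H" using al[OF H'] by simp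
    then have "w *v (v - form (al ?H) v *s dir) \<in> H" using mem by blast
    then show ?thesis using al(2)[OF H]
      by (simp add: k_def matrix_vector_mult_diff_distrib vector_scalar_commute)
  qed
  have k: "k \<noteq> 0"
  proof
    assume "k = 0"
    then have "form (al H) (w *v (winv w *v dir)) = 0" using eq by simp
    then show False using al(1)[OF H] w by simp
  qed
  show "wind H (act w g) = wind ?H g"
    using winding_number_scale[OF form_path[OF H' g] k] by (simp add: wind_def act_def eq)
qed


section \<open>The abelianization of the pure braid group\<close>

definition connector :: "complex^'n \<Rightarrow> real \<Rightarrow> complex^'n" where
  "connector x = (SOME g. path g \<and> path_image g \<subseteq> Xreg \<and> pathstart g = x0 \<and> pathfinish g = x)"

lemma connector:
  assumes "x \<in> Xreg"
  shows "path (connector x)" "path_image (connector x) \<subseteq> Xreg" "pathstart (connector x) = x0" "pathfinish (connector x) = x"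
proof -
  have "\<exists>g. path g \<and> path_image g \<subseteq> Xreg \<and> pathstart g = x0 \<and> pathfinish g = x"
    using path_in_Xreg[OF x0 assms] by blast
  from someI_ex[OF this] show "path (connector x)" "path_image (connector x) \<subseteq> Xreg"
    "pathstart (connector x) = x0" "pathfinish (connector x) = x"
    unfolding connector_def[symmetric] by blast+
qed

definition close_up :: "(real \<Rightarrow> complex^'n) \<Rightarrow> real \<Rightarrow> complex^'n" where
  "close_up g = connector (pathstart g) +++ (g +++ reversepath (connector (pathfinish g)))"

lemma close_up_loops: "path g \<Longrightarrow> path_image g \<subseteq> Xreg \<Longrightarrow> close_up g \<in> loops"
proof -
  assume g: "path g" "path_image g \<subseteq> Xreg"
  then have e: "pathstart g \<in> Xreg" "pathfinish g \<in> Xreg" by auto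
  have j: "path_image (x +++ y) \<subseteq> Xreg" if "path_image x \<subseteq> Xreg" "path_image y \<subseteq> Xreg" for x y :: "real \<Rightarrow> complex^'n"
    using that path_image_join_subset[of x y] by blast
  show ?thesis
    unfolding loops_iff close_up_def using g connector[OF e(1)] connector[OF e(2)] j by simp
qed

text \<open>A homomorphism to an abelian group extends from loops to all paths, by closing them up.\<close>

lemma path_functor_of_hom:
  assumes A: "comm_group A" and f: "f \<in> hom P A"
  shows "path_functor (al ` HH) dir A (\<lambda>g. f (pcls (close_up g))) Xreg"
proof (rule path_functor.intro)
  show "finite (al ` HH)" using finite_reflecting_hyperplanes by simp
  show "form a dir = 1" if "a \<in> al ` HH" for a using that al(1) by auto
  show "Xreg = {x. \<forall>a\<in>al ` HH. form a x \<noteq> 0}" by (rule Xreg_forms)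
  show "comm_group A" by (rule A)
  show "f (pcls (close_up g)) \<in> carrier A" if "path g" "path_image g \<subseteq> Xreg" for g
    using hom_in_carrier[OF f] close_up_loops[OF that] by (simp add: carrier_P)
  show "f (pcls (close_up (g +++ h))) = f (pcls (close_up g)) \<otimes>\<^bsub>A\<^esub> f (pcls (close_up h))"
    if g: "path g" "path_image g \<subseteq> Xreg" and h: "path h" "path_image h \<subseteq> Xreg" and gh: "pathfinish g = pathstart h" for g h
  proof -
    have e: "pathstart g \<in> Xreg" "pathfinish g \<in> Xreg" "pathfinish h \<in> Xreg" using g h by auto
    note cn = connector[OF e(1)] connector[OF e(2)] connector[OF e(3)]
    have j: "path_image (x +++ y) \<subseteq> Xreg" if "path_image x \<subseteq> Xreg" "path_image y \<subseteq> Xreg" for x y :: "real \<Rightarrow> complex^'n"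
      using that path_image_join_subset[of x y] by blast
    have jl: "g +++ h \<in> loops" if "g \<in> loops" "h \<in> loops" for g h using pcls_mult(2) that by blast
    have "homotopic_paths Xreg (close_up g +++ close_up h)
        (connector (pathstart g) +++ (g +++ (h +++ reversepath (connector (pathfinish h)))))"
      unfolding close_up_def gh[symmetric] using g h cn gh by (intro homotopic_backtrack j) auto
    also have "homotopic_paths Xreg \<dots> (close_up (g +++ h))"
      unfolding close_up_def pathstart_join pathfinish_join
      using g h cn gh by (intro homotopic_paths_join homotopic_paths_assoc j) auto
    finally have "pcls (close_up g +++ close_up h) = pcls (close_up (g +++ h))"
      using pcls_eq_iff[OF jl[OF close_up_loops[OF g] close_up_loops[OF h]] close_up_loops[of "g +++ h"]] g h gh j by simp
    then have "pcls (close_up (g +++ h)) = pcls (close_up g) \<otimes>\<^bsub>P\<^esub> pcls (close_up h)"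
      using pcls_mult(1)[OF close_up_loops[OF g] close_up_loops[OF h]] by simp
    then show ?thesis
      using hom_mult[OF f] close_up_loops[OF g] close_up_loops[OF h] by (simp add: carrier_P)
  qed
  show "f (pcls (close_up g)) = f (pcls (close_up h))" if hom: "homotopic_paths Xreg g h" for g h
  proof -
    have g: "path g" "path_image g \<subseteq> Xreg" "path h" "path_image h \<subseteq> Xreg"
      "pathstart h = pathstart g" "pathfinish h = pathfinish g"
      using homotopic_paths_imp_path[OF hom] homotopic_paths_imp_subset[OF hom]
        homotopic_paths_imp_pathstart[OF hom] homotopic_paths_imp_pathfinish[OF hom] by auto
    then have e: "pathstart g \<in> Xreg" "pathfinish g \<in> Xreg" by auto
    have "homotopic_paths Xreg (close_up g) (close_up h)"
      unfolding close_up_def g(5,6) using hom g connector[OF e(1)] connector[OF e(2)]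
      by (intro homotopic_paths_join) auto
    then have "pcls (close_up g) = pcls (close_up h)"
      using pcls_eq_iff close_up_loops g by blast
    then show ?thesis by simp
  qed
qed

lemma meridian_data_exists:
  assumes "H \<in> HH"
  shows "\<exists>q r. 0 < r \<and> form (al H) q = 0 \<and> (\<forall>H'\<in>HH - {H}. r < norm (form (al H') q))"
proof -
  let ?S = "(\<lambda>H'. al H' - al H) ` (HH - {H})"
  have "al H' \<noteq> al H" if "H' \<in> HH - {H}" for H' using al_inj that assms by blast
  then have "0 \<noteq> al H' - al H" if "H' \<in> HH - {H}" for H' using that by (metis eq_iff_diff_eq_0)
  then have "0 \<notin> ?S" by blast
  moreover have "finite ?S" using finite_reflecting_hyperplanes by blast
  ultimately obtain z where z: "\<forall>a\<in>?S. form a z \<noteq> 0" using exists_avoiding_forms by blast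
  define q where "q = z - form (al H) z *s dir"
  have q: "form (al H') q \<noteq> 0" if "H' \<in> HH - {H}" for H'
    using z that al(1)[of H'] by (auto simp: q_def form_left_diff)
  define r where "r = Min (insert 1 ((\<lambda>H'. norm (form (al H') q)) ` (HH - {H}))) / 2"
  have m: "Min (insert 1 ((\<lambda>H'. norm (form (al H') q)) ` (HH - {H}))) > 0"
    using finite_reflecting_hyperplanes q by auto
  have "r < norm (form (al H') q)" if "H' \<in> HH - {H}" for H'
  proof -
    have "Min (insert 1 ((\<lambda>H'. norm (form (al H') q)) ` (HH - {H}))) \<le> norm (form (al H') q)"
      using finite_reflecting_hyperplanes that by (intro Min_le) auto
    then show ?thesis using m by (simp add: r_def)
  qed
  moreover have "r > 0" using m by (simp add: r_def)
  moreover have "form (al H) q = 0" using al(1)[OF assms] by (simp add: q_def)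
  ultimately show ?thesis by blast
qed

definition foot_radius :: "(complex^'n) set \<Rightarrow> (complex^'n) \<times> real" where
  "foot_radius H = (SOME p. 0 < snd p \<and> form (al H) (fst p) = 0 \<and> (\<forall>H'\<in>HH - {H}. snd p < norm (form (al H') (fst p))))"

definition small_circle :: "(complex^'n) set \<Rightarrow> real \<Rightarrow> complex^'n" where
  "small_circle H = (\<lambda>t. fst (foot_radius H) +
     (of_real (snd (foot_radius H)) * exp (2 * of_real pi * \<i> * of_real t)) *s dir)"

definition meridian :: "(complex^'n) set \<Rightarrow> real \<Rightarrow> complex^'n" where
  "meridian H = close_up (small_circle H)"

lemma foot_radius:
  assumes "H \<in> HH"
  shows "0 < snd (foot_radius H)" "form (al H) (fst (foot_radius H)) = 0"
    "H' \<in> HH - {H} \<Longrightarrow> snd (foot_radius H) < norm (form (al H') (fst (foot_radius H)))"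
proof -
  have "\<exists>p. 0 < snd p \<and> form (al H) (fst p) = 0 \<and> (\<forall>H'\<in>HH - {H}. snd p < norm (form (al H') (fst p)))"
    using meridian_data_exists[OF assms] by force
  from someI_ex[OF this]
  show "0 < snd (foot_radius H)" "form (al H) (fst (foot_radius H)) = 0"
    "H' \<in> HH - {H} \<Longrightarrow> snd (foot_radius H) < norm (form (al H') (fst (foot_radius H)))"
    unfolding foot_radius_def[symmetric] by blast+
qed

lemma small_circle_form:
  assumes "H' \<in> HH"
  shows "(\<lambda>t. form (al H') (small_circle H t)) =
    circlepath (form (al H') (fst (foot_radius H))) (snd (foot_radius H))"
  using al(1)[OF assms] by (simp add: small_circle_def circlepath fun_eq_iff)

lemma small_circle:
  assumes H: "H \<in> HH"
  shows "path (small_circle H)" "path_image (small_circle H) \<subseteq> Xreg"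
    "pathfinish (small_circle H) = pathstart (small_circle H)"
proof -
  show "path (small_circle H)" unfolding path_def small_circle_def by (intro continuous_intros)
  show "pathfinish (small_circle H) = pathstart (small_circle H)"
    by (simp add: pathfinish_def pathstart_def small_circle_def)
  show "path_image (small_circle H) \<subseteq> Xreg"
  proof
    fix x assume "x \<in> path_image (small_circle H)"
    then obtain t where t: "t \<in> {0..1}" "x = small_circle H t" by (auto simp: path_image_def)
    have "form (al H') x \<noteq> 0" if H': "H' \<in> HH" for H'
    proof
      assume e: "form (al H') x = 0"
      have "form (al H') x = circlepath (form (al H') (fst (foot_radius H))) (snd (foot_radius H)) t"
        using fun_cong[OF small_circle_form[OF H', of H], of t] t by simp
      then have "0 \<in> path_image (circlepath (form (al H') (fst (foot_radius H))) (snd (foot_radius H)))"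
        using t(1) e unfolding path_image_def by (metis imageI)
      then have "norm (form (al H') (fst (foot_radius H))) = snd (foot_radius H)"
        using foot_radius(1)[OF H] by (simp add: path_image_circlepath)
      then show False using foot_radius(1,2)[OF H] foot_radius(3)[OF H, of H'] H' by (cases "H' = H") auto
    qed
    then show "x \<in> Xreg" using Xreg_al by blast
  qed
qed

lemma meridian_loops: "H \<in> HH \<Longrightarrow> meridian H \<in> loops"
  unfolding meridian_def using small_circle by (intro close_up_loops)

lemma wind_close_up:
  assumes "H \<in> HH" "path g" "path_image g \<subseteq> Xreg" "pathfinish g = pathstart g"
  shows "wind H (close_up g) = wind H g"
proof -
  have e: "pathstart g \<in> Xreg" using assms by auto
  note c = connector[OF e]
  have j: "path_image (g +++ reversepath (connector (pathstart g))) \<subseteq> Xreg"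
    using assms c path_image_join_subset[of g "reversepath (connector (pathstart g))"] by auto
  show ?thesis
    unfolding close_up_def assms(4)
    using assms c j by (simp add: wind_join wind_reverse)
qed

lemma wind_meridian:
  assumes H: "H \<in> HH" "H' \<in> HH"
  shows "wind H' (meridian H) = (if H' = H then 1 else 0)"
proof -
  let ?c = "form (al H') (fst (foot_radius H))" and ?r = "snd (foot_radius H)"
  have r: "?r > 0" using foot_radius(1)[OF H(1)] .
  have "wind H' (meridian H) = wind H' (small_circle H)"
    unfolding meridian_def using H small_circle by (intro wind_close_up) auto
  also have "\<dots> = winding_number (circlepath ?c ?r) 0"
    by (simp add: wind_def small_circle_form[OF H(2)])
  also have "\<dots> = (if H' = H then 1 else 0)"
  proof (cases "H' = H")
    case True
    then show ?thesis using winding_number_circlepath_centre[OF r, of 0] foot_radius(2)[OF H(1)] by simp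
  next
    case False
    then have "?r < norm ?c" using foot_radius(3)[OF H(1)] H(2) by simp
    then show ?thesis
      using False r winding_number_zero_outside[of "circlepath ?c ?r" "cball ?c ?r" 0]
      by (simp add: path_image_circlepath dist_norm)
  qed
  finally show ?thesis .
qed

text \<open>All small circles around one hyperplane are freely homotopic, so a homomorphism that kills the
  meridians kills all of them, and then every loop.\<close>

theorem hom_trivial_on_meridians:
  assumes A: "comm_group A" and f: "f \<in> hom P A"
    and mer: "\<And>H. H \<in> HH \<Longrightarrow> f (pcls (meridian H)) = \<one>\<^bsub>A\<^esub>" and x: "x \<in> carrier P"
  shows "f x = \<one>\<^bsub>A\<^esub>"
proof -
  interpret pf: path_functor "al ` HH" dir A "\<lambda>g. f (pcls (close_up g))" Xreg
    by (rule path_functor_of_hom[OF A f])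
  interpret PG: group P by (rule group_P)
  have "pf.kills_circles"
    unfolding pf.kills_circles_def
  proof (intro ballI allI impI)
    fix a q d assume a: "a \<in> al ` HH" and q: "q \<in> pf.face a" "pf.small_radius a q d"
    obtain H where H: "H \<in> HH" "a = al H" using a by auto
    have sub: "al ` HH - {al H} \<subseteq> al ` (HH - {H})" by auto
    have f0: "fst (foot_radius H) \<in> pf.face a"
      using foot_radius[OF H(1)] sub unfolding pf.face_def H(2) by force
    have s0: "pf.small_radius a (fst (foot_radius H)) (of_real (snd (foot_radius H)))"
      using foot_radius[OF H(1)] sub unfolding pf.small_radius_def H(2) by force
    have "f (pcls (close_up (pf.circle q d)))
        = f (pcls (close_up (pf.circle (fst (foot_radius H)) (of_real (snd (foot_radius H))))))"
      by (rule pf.circle_independent[OF a q f0 s0])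
    also have "pf.circle (fst (foot_radius H)) (of_real (snd (foot_radius H))) = small_circle H"
      by (simp add: pf.circle_def small_circle_def)
    also have "f (pcls (close_up (small_circle H))) = \<one>\<^bsub>A\<^esub>"
      using mer[OF H(1)] by (simp add: meridian_def)
    finally show "f (pcls (close_up (pf.circle q d))) = \<one>\<^bsub>A\<^esub>" .
  qed
  note triv = pf.trivial_on_loops[OF this]
  obtain g where g: "g \<in> loops" "x = pcls g" using x by (auto simp: carrier_P)
  then have g': "path g" "path_image g \<subseteq> Xreg" "pathstart g = x0" "pathfinish g = x0" by (auto simp: loops_iff)
  have 1: "f (pcls (close_up g)) = \<one>\<^bsub>A\<^esub>" using triv[of g] g' by simp
  define c where "c = connector x0"
  have c: "path c" "path_image c \<subseteq> Xreg" "pathstart c = x0" "pathfinish c = x0"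
    using connector[OF x0] by (auto simp: c_def)
  then have cl: "c \<in> loops" "reversepath c \<in> loops" by (auto simp: loops_iff)
  have "close_up g = c +++ (g +++ reversepath c)" by (simp add: close_up_def g' c_def)
  then have 2: "pcls (close_up g) = pcls c \<otimes>\<^bsub>P\<^esub> (pcls g \<otimes>\<^bsub>P\<^esub> pcls (reversepath c))"
    using pcls_mult cl g by simp
  have "homotopic_paths Xreg (reversepath c +++ c) const_lift"
    using homotopic_paths_linv[OF c(1,2)] c(4) by (simp add: const_lift_linepath)
  then have "pcls (reversepath c +++ c) = pcls const_lift"
    using pcls_eq_iff[of "reversepath c +++ c" const_lift] pcls_mult(2)[OF cl(2,1)] const_lift loops_lifts by simp
  moreover have "\<one>\<^bsub>P\<^esub> = pcls const_lift"
    by (simp add: pure_braid_group_def fundamental_group_def pcls_def const_lift_def)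
  ultimately have 3: "pcls (reversepath c) \<otimes>\<^bsub>P\<^esub> pcls c = \<one>\<^bsub>P\<^esub>"
    using pcls_mult(1)[OF cl(2,1)] by simp
  have pc: "pcls c \<in> carrier P" "pcls g \<in> carrier P" "pcls (reversepath c) \<in> carrier P"
    using cl g by (auto simp: carrier_P)
  have fc: "f (pcls c) \<in> carrier A" "f (pcls g) \<in> carrier A" "f (pcls (reversepath c)) \<in> carrier A"
    using pc hom_in_carrier[OF f] by auto
  have gh: "group_hom P A f"
    using f PG.group_axioms pf.A.group_axioms by (simp add: group_hom_def group_hom_axioms_def)
  have 4: "f (pcls (reversepath c)) \<otimes>\<^bsub>A\<^esub> f (pcls c) = \<one>\<^bsub>A\<^esub>"
    using hom_mult[OF f pc(3,1)] 3 group_hom.hom_one[OF gh] by simp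
  have "\<one>\<^bsub>A\<^esub> = f (pcls c) \<otimes>\<^bsub>A\<^esub> (f (pcls g) \<otimes>\<^bsub>A\<^esub> f (pcls (reversepath c)))"
    using 1 2 pc hom_mult[OF f] by simp
  also have "\<dots> = f (pcls g) \<otimes>\<^bsub>A\<^esub> (f (pcls (reversepath c)) \<otimes>\<^bsub>A\<^esub> f (pcls c))"
    using fc by (simp add: pf.A.m_ac)
  also have "\<dots> = f (pcls g)" using 4 fc by simp
  finally show ?thesis using g(2) by simp
qed

definition braid_wind :: "(complex^'n) set \<Rightarrow> (real \<Rightarrow> (complex^'n) set) set \<Rightarrow> complex" where
  "braid_wind H b = wind H (SOME g. g \<in> lifts \<and> b = cls g)"

lemma braid_wind_cls:
  assumes "H \<in> HH" "g \<in> lifts"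
  shows "braid_wind H (cls g) = wind H g"
proof -
  define h where "h = (SOME h. h \<in> lifts \<and> cls g = cls h)"
  have h: "h \<in> lifts \<and> cls g = cls h"
    unfolding h_def by (rule someI[of "\<lambda>h. h \<in> lifts \<and> cls g = cls h" g]) (use assms in simp)
  then have "h \<in> lifts" "cls g = cls h" by blast+
  then have "homotopic_paths Xreg g h" using cls_eq_iff[OF assms(2) \<open>h \<in> lifts\<close>] by blast
  then show ?thesis
    using wind_homotopic[OF assms(1)] by (simp add: braid_wind_def h_def)
qed

lemma braid_wind_mult:
  assumes H: "H \<in> HH" and b: "b \<in> carrier B" "c \<in> carrier B"
  shows "braid_wind H (b \<otimes>\<^bsub>B\<^esub> c) = braid_wind H b + braid_wind ((*v) (winv (to_W b)) ` H) c"
    "(*v) (winv (to_W b)) ` H \<in> HH"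
proof -
  obtain g h where gh: "g \<in> lifts" "h \<in> lifts" "b = cls g" "c = cls h" using b by (metis carrierE)
  have w: "end_elt g \<in> W" "pathfinish g = end_elt g *v x0" using end_elt gh by auto
  show H': "(*v) (winv (to_W b)) ` H \<in> HH"
    using wind_act(1)[OF H w(1) liftsD(1,2)[OF gh(2)]] by (simp add: gh to_W_cls)
  have "wind H (extend g h) = wind H g + wind H (act (end_elt g) h)"
    unfolding extend_def using H liftsD gh w path_act path_image_act
    by (intro wind_join) auto
  then show "braid_wind H (b \<otimes>\<^bsub>B\<^esub> c) = braid_wind H b + braid_wind ((*v) (winv (to_W b)) ` H) c"
    using H H' gh w wind_act(2)[OF H w(1) liftsD(1,2)[OF gh(2)]]
    by (simp add: cls_mult braid_wind_cls extend_lifts(1) to_W_cls)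
qed

definition pure_wind :: "(complex^'n) set \<Rightarrow> (real \<Rightarrow> complex^'n) set \<Rightarrow> int" where
  "pure_wind H x = \<lfloor>Re (braid_wind H (pure_to_braid W x0 x))\<rfloor>"

lemma pure_wind:
  assumes "H \<in> HH" "x \<in> carrier P"
  shows "of_int (pure_wind H x) = braid_wind H (pure_to_braid W x0 x)"
proof -
  obtain g where g: "g \<in> loops" "x = pcls g" using assms by (auto simp: carrier_P)
  have "braid_wind H (pure_to_braid W x0 x) = wind H g"
    using braid_wind_cls[OF assms(1)] g pure_to_braid_pcls loops_lifts by simp
  then show ?thesis using wind_loop_int[OF assms(1) g(1)] by (auto simp: pure_wind_def elim!: Ints_cases)
qed

lemma to_W_pure: "x \<in> carrier P \<Longrightarrow> to_W (pure_to_braid W x0 x) = mat 1 \<and> pure_to_braid W x0 x \<in> carrier B"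
  using pure_to_braid_image by (auto simp: kernel_def)

lemma image_one [simp]: "(*v) (mat 1) ` H = (H :: (complex^'n) set)"
  by simp

lemma winv_one [simp]: "winv (mat 1) = mat 1"
  by (rule winv_unique) auto

lemma pure_wind_mult:
  assumes "H \<in> HH" "x \<in> carrier P" "y \<in> carrier P"
  shows "pure_wind H (x \<otimes>\<^bsub>P\<^esub> y) = pure_wind H x + pure_wind H y"
proof -
  interpret PG: group P by (rule group_P)
  have "(of_int (pure_wind H (x \<otimes>\<^bsub>P\<^esub> y)) :: complex) = of_int (pure_wind H x + pure_wind H y)"
    using assms braid_wind_mult(1)[OF assms(1)] to_W_pure
    by (simp add: pure_wind pure_to_braid_mult)
  then show ?thesis by (simp only: of_int_eq_iff)
qed

lemma pure_wind_meridian: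
  assumes "H \<in> HH" "H' \<in> HH"
  shows "pure_wind H' (pcls (meridian H)) = (if H' = H then 1 else 0)"
  using meridian_loops[OF assms(1)] wind_meridian[OF assms] loops_lifts
  by (simp add: pure_wind_def pure_to_braid_pcls braid_wind_cls[OF assms(2)])

text \<open>The winding numbers are coordinates on the abelianization: a class divided by the product of the
  meridians raised to its winding numbers is a homomorphism that kills the meridians.\<close>

theorem derived_P_iff:
  assumes x: "x \<in> carrier P"
  shows "x \<in> derived P (carrier P) \<longleftrightarrow> (\<forall>H\<in>HH. pure_wind H x = 0)"
proof
  interpret PG: group P by (rule group_P)
  assume "x \<in> derived P (carrier P)"
  then have "x \<in> generate P (derived_set P (carrier P))" by (simp add: derived_def)
  then show "\<forall>H\<in>HH. pure_wind H x = 0"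
  proof (intro ballI)
    fix H assume H: "H \<in> HH"
    have one: "pure_wind H \<one>\<^bsub>P\<^esub> = 0" using pure_wind_mult[OF H, of "\<one>\<^bsub>P\<^esub>" "\<one>\<^bsub>P\<^esub>"] by simp
    have neg: "pure_wind H (inv\<^bsub>P\<^esub> y) = - pure_wind H y" if "y \<in> carrier P" for y
      using pure_wind_mult[OF H, of y "inv\<^bsub>P\<^esub> y"] that one by simp
    have com: "pure_wind H h = 0 \<and> h \<in> carrier P" if h: "h \<in> derived_set P (carrier P)" for h
    proof -
      obtain a b where ab: "a \<in> carrier P" "b \<in> carrier P" "h = a \<otimes>\<^bsub>P\<^esub> b \<otimes>\<^bsub>P\<^esub> inv\<^bsub>P\<^esub> a \<otimes>\<^bsub>P\<^esub> inv\<^bsub>P\<^esub> b"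
        using h by blast
      then show ?thesis using pure_wind_mult[OF H] neg by simp
    qed
    have "pure_wind H x = 0 \<and> x \<in> carrier P"
      using \<open>x \<in> generate P (derived_set P (carrier P))\<close>
    proof (induction rule: generate.induct)
      case one
      show ?case using \<open>pure_wind H \<one>\<^bsub>P\<^esub> = 0\<close> by simp
    next
      case (incl h)
      then show ?case by (rule com)
    next
      case (inv h)
      then show ?case using com[of h] neg[of h] by simp
    next
      case (eng h1 h2)
      then show ?case using pure_wind_mult[OF H] by simp
    qed
    then show "pure_wind H x = 0" by simp
  qed
next
  assume zero: "\<forall>H\<in>HH. pure_wind H x = 0"
  interpret PG: group P by (rule group_P)
  let ?D = "derived P (carrier P)"
  define A where "A = P Mod ?D"
  have nD: "?D \<lhd> P" by (rule PG.derived_self_is_normal)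
  interpret D: normal ?D P by (rule nD)
  interpret A: comm_group A unfolding A_def by (rule PG.derived_quot_is_comm_group)
  define q where "q y = ?D #>\<^bsub>P\<^esub> y" for y
  have qhom: "q \<in> hom P A" unfolding q_def[abs_def] A_def by (rule D.r_coset_hom_Mod)
  have qc: "q y \<in> carrier A" if "y \<in> carrier P" for y using hom_in_carrier[OF qhom that] .
  define m where "m H = q (pcls (meridian H))" for H
  have mc: "m H \<in> carrier A" if "H \<in> HH" for H
    unfolding m_def using meridian_loops[OF that] by (intro qc) (auto simp: carrier_P)
  define p where "p y = finprod A (\<lambda>H. m H [^]\<^bsub>A\<^esub> pure_wind H y) HH" for y
  have pc: "p y \<in> carrier A" for y unfolding p_def using mc by (intro A.finprod_closed) auto
  define f where "f y = q y \<otimes>\<^bsub>A\<^esub> inv\<^bsub>A\<^esub> (p y)" for y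
  have pm: "p (y \<otimes>\<^bsub>P\<^esub> z) = p y \<otimes>\<^bsub>A\<^esub> p z" if yz: "y \<in> carrier P" "z \<in> carrier P" for y z
  proof -
    have "p (y \<otimes>\<^bsub>P\<^esub> z) = finprod A (\<lambda>H. m H [^]\<^bsub>A\<^esub> pure_wind H y \<otimes>\<^bsub>A\<^esub> m H [^]\<^bsub>A\<^esub> pure_wind H z) HH"
      unfolding p_def using mc yz by (intro A.finprod_cong') (auto simp: pure_wind_mult A.int_pow_mult)
    also have "\<dots> = p y \<otimes>\<^bsub>A\<^esub> p z"
      unfolding p_def using mc by (intro A.finprod_multf) auto
    finally show ?thesis .
  qed
  have fhom: "f \<in> hom P A"
  proof (rule homI)
    show "f y \<in> carrier A" if "y \<in> carrier P" for y using qc[OF that] pc by (simp add: f_def)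
    show "f (y \<otimes>\<^bsub>P\<^esub> z) = f y \<otimes>\<^bsub>A\<^esub> f z" if yz: "y \<in> carrier P" "z \<in> carrier P" for y z
      using qc[OF yz(1)] qc[OF yz(2)] pc[of y] pc[of z] pm[OF yz] hom_mult[OF qhom yz]
      by (simp add: f_def A.inv_mult A.m_ac)
  qed
  have "f x = \<one>\<^bsub>A\<^esub>"
  proof (rule hom_trivial_on_meridians[OF A.comm_group_axioms fhom _ x])
    fix H assume H: "H \<in> HH"
    have "p (pcls (meridian H)) = finprod A (\<lambda>H'. if H = H' then m H' else \<one>\<^bsub>A\<^esub>) HH"
      unfolding p_def using mc H by (intro A.finprod_cong') (auto simp: pure_wind_meridian A.int_pow_1)
    also have "\<dots> = m H"
      using mc H finite_reflecting_hyperplanes by (intro A.finprod_singleton) auto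
    finally show "f (pcls (meridian H)) = \<one>\<^bsub>A\<^esub>"
      using mc[OF H] by (simp add: f_def m_def[symmetric])
  qed
  moreover have "p x = \<one>\<^bsub>A\<^esub>"
    unfolding p_def using zero mc by (intro A.finprod_one_eqI) auto
  ultimately have "q x = \<one>\<^bsub>A\<^esub>" using qc[OF x] by (simp add: f_def)
  then have "?D #>\<^bsub>P\<^esub> x = ?D" by (simp add: q_def A_def FactGroup_def)
  then show "x \<in> ?D" using PG.coset_join1[OF _ x PG.derived_is_subgroup] D.subset by blast
qed

end


section \<open>Irreducible components\<close>

context reflection_group
begin

definition block_product :: "(nat \<Rightarrow> complex^'n^'n) \<Rightarrow> nat \<Rightarrow> complex^'n^'n" where
  "block_product g r = foldr (\<lambda>k A. g k ** A) [0..<r] (mat 1)"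

lemma direct_sum_matrix_eqI:
  fixes A A' :: "complex^'n^'n"
  assumes "\<And>x. \<exists>v. (\<forall>k<r. v k \<in> V k) \<and> x = (\<Sum>k<r. v k)"
    and "\<And>k v. k < r \<Longrightarrow> v \<in> V k \<Longrightarrow> A *v v = A' *v v"
  shows "A = A'"
proof -
  have "A *v x = A' *v x" for x
  proof -
    obtain v where v: "\<forall>k<r. v k \<in> V k" "x = (\<Sum>k<r. v k)" using assms(1) by blast
    show ?thesis unfolding v(2) matrix_vector_sum using v(1) assms(2) by (intro sum.cong) auto
  qed
  then show ?thesis by (simp add: matrix_eq)
qed

end

text \<open>Blocks: subgroups \<open>Wc k\<close> that preserve \<open>V k\<close> and act trivially on the other summands.\<close>

locale block_decomposition = reflection_group W for W :: "(complex^'n^'n) set" +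
  fixes r :: nat and V :: "nat \<Rightarrow> (complex^'n) set" and Wc :: "nat \<Rightarrow> (complex^'n^'n) set"
  assumes V_sub: "\<And>k. k < r \<Longrightarrow> vec.subspace (V k)"
    and V_sum: "\<And>x. \<exists>v. (\<forall>k<r. v k \<in> V k) \<and> x = (\<Sum>k<r. v k)"
    and V_ind: "\<And>v. (\<forall>k<r. v k \<in> V k) \<Longrightarrow> (\<Sum>k<r. v k) = 0 \<Longrightarrow> \<forall>k<r. v k = 0"
    and Wc_W: "\<And>k. k < r \<Longrightarrow> Wc k \<subseteq> W"
    and Wc_one: "\<And>k. k < r \<Longrightarrow> mat 1 \<in> Wc k"
    and Wc_mult: "\<And>k v w. k < r \<Longrightarrow> v \<in> Wc k \<Longrightarrow> w \<in> Wc k \<Longrightarrow> v ** w \<in> Wc k"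
    and Wc_V: "\<And>k w v. k < r \<Longrightarrow> w \<in> Wc k \<Longrightarrow> v \<in> V k \<Longrightarrow> w *v v \<in> V k"
    and Wc_triv: "\<And>k j w v. k < r \<Longrightarrow> j < r \<Longrightarrow> j \<noteq> k \<Longrightarrow> w \<in> Wc k \<Longrightarrow> v \<in> V j \<Longrightarrow> w *v v = v"
begin

lemmas matrix_eqI = direct_sum_matrix_eqI[where V = V and r = r, OF V_sum]

lemma V_disjoint:
  assumes "j < r" "k < r" "j \<noteq> k" "v \<in> V j" "v \<in> V k"
  shows "v = 0"
proof -
  let ?f = "\<lambda>i. if i = j then v else if i = k then - v else 0"
  have "\<forall>i<r. ?f i \<in> V i"
    using assms V_sub by (auto intro: vec.subspace_0 vec.subspace_neg)
  moreover have "(\<Sum>i<r. ?f i) = 0"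
  proof -
    have "(\<Sum>i<r. ?f i) = (\<Sum>i<r. (if i = j then v else 0) + (if i = k then - v else 0))"
      using assms(3) by (intro sum.cong) auto
    also have "\<dots> = 0" using assms by (simp add: sum.distrib)
    finally show ?thesis .
  qed
  ultimately show ?thesis using V_ind assms(1) by force
qed

lemma foldr_blocks:
  assumes "distinct ks" "set ks \<subseteq> {..<r}" "\<And>k. k < r \<Longrightarrow> g k \<in> Wc k" "j < r" "v \<in> V j"
  shows "foldr (\<lambda>k A. g k ** A) ks (mat 1) *v v = (if j \<in> set ks then g j *v v else v)"
  using assms(1,2)
proof (induction ks)
  case (Cons k ks)
  have k: "k < r" "k \<notin> set ks" using Cons.prems by auto
  have IH: "foldr (\<lambda>k A. g k ** A) ks (mat 1) *v v = (if j \<in> set ks then g j *v v else v)"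
    using Cons by auto
  have 1: "foldr (\<lambda>k A. g k ** A) (k # ks) (mat 1) *v v = g k *v (if j \<in> set ks then g j *v v else v)"
    by (simp add: matrix_vector_mul_assoc[symmetric] IH)
  show ?case
  proof (cases "j \<in> set ks")
    case True
    then have "j \<noteq> k" using k by auto
    moreover have "g j *v v \<in> V j" using Wc_V assms by blast
    ultimately show ?thesis using 1 True Wc_triv[OF k(1) assms(4) _ assms(3)[OF k(1)]] by simp
  next
    case False
    then show ?thesis using 1 Wc_triv[OF k(1) assms(4) _ assms(3)[OF k(1)] assms(5)] by auto
  qed
qed simp

lemma block_product_act:
  "(\<And>k. k < r \<Longrightarrow> g k \<in> Wc k) \<Longrightarrow> j < r \<Longrightarrow> v \<in> V j \<Longrightarrow> block_product g r *v v = g j *v v"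
  unfolding block_product_def using foldr_blocks[of "[0..<r]" g j v] by (simp add: atLeast0LessThan)

lemma block_product_W:
  assumes "\<And>k. k < r \<Longrightarrow> g k \<in> Wc k"
  shows "block_product g r \<in> W"
proof -
  have "set ks \<subseteq> {..<r} \<Longrightarrow> foldr (\<lambda>k A. g k ** A) ks (mat 1) \<in> W" for ks
    using assms by (induction ks) (auto intro!: mult_W intro: subsetD[OF Wc_W])
  then show ?thesis unfolding block_product_def by (metis atLeast_upt order_refl)
qed

lemma block_product_mult:
  assumes "\<And>k. k < r \<Longrightarrow> g k \<in> Wc k" "\<And>k. k < r \<Longrightarrow> h k \<in> Wc k"
  shows "block_product (\<lambda>k\<in>{..<r}. g k ** h k) r = block_product g r ** block_product h r"
proof (rule matrix_eqI)
  fix k v assume k: "k < r" "v \<in> V k"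
  have "block_product (\<lambda>k\<in>{..<r}. g k ** h k) r *v v = (g k ** h k) *v v"
    using block_product_act[of "\<lambda>k\<in>{..<r}. g k ** h k", OF _ k] assms Wc_mult k by simp
  moreover have "(block_product g r ** block_product h r) *v v = g k *v (h k *v v)"
    using block_product_act[OF assms(2) k] block_product_act[OF assms(1) k(1) Wc_V[OF k(1) assms(2)[OF k(1)] k(2)]]
    by (simp add: matrix_vector_mul_assoc[symmetric])
  ultimately show "block_product (\<lambda>k\<in>{..<r}. g k ** h k) r *v v = (block_product g r ** block_product h r) *v v"
    by (simp add: matrix_vector_mul_assoc)
qed

lemma block_eqI:
  assumes "k < r" "g \<in> Wc k" "h \<in> Wc k" "\<And>v. v \<in> V k \<Longrightarrow> g *v v = h *v v"
  shows "g = h"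
proof (rule matrix_eqI)
  fix j v assume "j < r" "v \<in> V j"
  then show "g *v v = h *v v" using assms Wc_triv[OF assms(1)] by (cases "j = k") auto
qed

lemma block_product_inj:
  assumes "\<And>k. k < r \<Longrightarrow> g k \<in> Wc k" "\<And>k. k < r \<Longrightarrow> h k \<in> Wc k" "block_product g r = block_product h r" "k < r"
  shows "g k = h k"
  using block_product_act[OF assms(1,4)] block_product_act[OF assms(2,4)] assms
  by (intro block_eqI[OF assms(4)]) auto

lemma block_product_single:
  assumes "k < r" "s \<in> Wc k"
  shows "block_product (\<lambda>j\<in>{..<r}. if j = k then s else mat 1) r = s"
proof (rule matrix_eqI)
  fix j v assume j: "j < r" "v \<in> V j"
  have "block_product (\<lambda>j\<in>{..<r}. if j = k then s else mat 1) r *v v = (if j = k then s else mat 1) *v v"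
    using block_product_act[of "\<lambda>j\<in>{..<r}. if j = k then s else mat 1", OF _ j] assms Wc_one j by simp
  then show "block_product (\<lambda>j\<in>{..<r}. if j = k then s else mat 1) r *v v = s *v v"
    using Wc_triv[OF assms(1) j(1) _ assms(2) j(2)] by auto
qed

lemma reflection_trivial_off_block:
  assumes inv: "\<And>k v. k < r \<Longrightarrow> v \<in> V k \<Longrightarrow> s *v v \<in> V k" and s: "is_reflection s"
  obtains k where "k < r" "\<And>j v. j < r \<Longrightarrow> j \<noteq> k \<Longrightarrow> v \<in> V j \<Longrightarrow> s *v v = v"
    "\<And>a b. (\<And>v. s *v v = v + form a v *s b) \<Longrightarrow> b \<in> V k"
proof -
  obtain a b where ab: "a \<noteq> 0" "b \<noteq> 0" "\<And>v. s *v v = v + form a v *s b"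
    using reflection_form[OF s] by metis
  have bV: "b' \<in> V k" if k: "k < r" "v \<in> V k" "s *v v \<noteq> v" and ab': "\<And>v. s *v v = v + form a' v *s b'" for k v a' b'
  proof -
    have "s *v v - v \<in> V k" using inv k V_sub vec.subspace_diff by blast
    then have "form a' v *s b' \<in> V k" using ab' by simp
    moreover have fa: "form a' v \<noteq> 0" using k(3) ab'[of v] by auto
    ultimately have "(1 / form a' v) *s (form a' v *s b') \<in> V k" using V_sub[OF k(1)] vec.subspace_scale by blast
    then show ?thesis using fa by simp
  qed
  have "\<exists>k<r. \<exists>v\<in>V k. s *v v \<noteq> v"
  proof (rule ccontr)
    assume "\<not> ?thesis"
    then have "s = mat 1" by (intro matrix_eqI) auto
    then show False using s by (simp add: is_reflection_def)
  qed
  then obtain k v where k: "k < r" "v \<in> V k" "s *v v \<noteq> v" by blast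
  show ?thesis
  proof (rule that[OF k(1)])
    show "s *v u = u" if j: "j < r" "j \<noteq> k" "u \<in> V j" for j u
    proof (rule ccontr)
      assume "s *v u \<noteq> u"
      then have "b \<in> V j" using bV[OF j(1,3)] ab(3) by blast
      moreover have "b \<in> V k" using bV[OF k] ab(3) by blast
      ultimately show False using V_disjoint j k ab(2) by blast
    qed
    show "b' \<in> V k" if "\<And>v. s *v v = v + form a' v *s b'" for a' b' using bV[OF k that] .
  qed
qed

end

context reflection_group
begin

definition W_subspace :: "(complex^'n) set \<Rightarrow> bool" where
  "W_subspace U \<longleftrightarrow> vec.subspace U \<and> (\<forall>w\<in>W. \<forall>v\<in>U. w *v v \<in> U)"

text \<open>Maschke: averaging a projection gives a projection that commutes with the group.\<close>

lemma invariant_complement: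
  assumes U: "W_subspace U" and T: "W_subspace T" and UT: "U \<subseteq> T"
  obtains U' where "W_subspace U'" "U' \<subseteq> T" "U \<inter> U' = {0}" "\<And>x. x \<in> T \<Longrightarrow> \<exists>u\<in>U. \<exists>u'\<in>U'. x = u + u'"
proof -
  have subU: "vec.subspace U" and subT: "vec.subspace T" using U T by (auto simp: W_subspace_def)
  obtain Ba where Ba: "Ba \<subseteq> U" "vec.independent Ba" "U \<subseteq> vec.span Ba" using vec.basis_exists[of U] by metis
  have spB: "vec.span Ba = U" using Ba subU by (metis vec.span_subspace)
  obtain g where g: "Vector_Spaces.linear (*s) (*s) g" "\<forall>x\<in>Ba. g x = id x" "range g = vec.span (id ` Ba)"
    using vec.linear_independent_extend_subspace[OF Ba(2), of id] by blast
  define p where "p = matrix g"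
  have p: "p *v x = g x" for x using matrix_works[OF g(1)] by (simp add: p_def)
  have pU: "p *v x \<in> U" for x using g(3) spB p by (metis id_apply image_id rangeI)
  have pid: "p *v x = x" if "x \<in> U" for x
  proof -
    have "x \<in> vec.span Ba" using that spB by simp
    then have "(p - mat 1) *v x = 0"
    proof (induction rule: vec.span_induct_alt)
      case base
      then show ?case by simp
    next
      case (step c x y)
      have "p *v x = x" using p g(2) step by simp
      then show ?case using step by (simp add: matrix_vector_mult_diff_rdistrib matrix_vector_right_distrib vector_scalar_commute)
    qed
    then show ?thesis by (simp add: matrix_vector_mult_diff_rdistrib)
  qed
  define pi where "pi x = (1 / of_nat (card W)) *s (\<Sum>w\<in>W. w *v (p *v (winv w *v x)))" for x
  have piU: "pi x \<in> U" for x
    unfolding pi_def using U pU subU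
    by (intro vec.subspace_scale[OF subU] vec.subspace_sum[OF subU]) (auto simp: W_subspace_def)
  have piid: "pi x = x" if "x \<in> U" for x
  proof -
    have "(\<Sum>w\<in>W. w *v (p *v (winv w *v x))) = (\<Sum>w\<in>W. x)"
      using that U pid by (intro sum.cong) (auto simp: W_subspace_def)
    then have "pi x $ i = (1 / of_nat (card W)) * (\<Sum>w\<in>W. x $ i)" for i
      unfolding pi_def by (simp only: vector_smult_component sum_component)
    then have "pi x $ i = x $ i" for i by simp
    then show ?thesis by (simp add: vec_eq_iff)
  qed
  have pilin: "pi (x + y) = pi x + pi y" "pi (c *s x) = c *s pi x" "pi 0 = 0" for x y c
    by (simp_all add: pi_def matrix_vector_right_distrib sum.distrib vec.scale_right_distrib vector_scalar_commute
        vec.scale_sum_right mult.commute)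
  have pieq: "pi (y *v x) = y *v pi x" if y: "y \<in> W" for x y
  proof -
    have "(\<Sum>w\<in>W. w *v (p *v (winv w *v (y *v x)))) = (\<Sum>w\<in>W. (y ** w) *v (p *v (winv (y ** w) *v (y *v x))))"
      using sum_W_left[OF y, of "\<lambda>w. w *v (p *v (winv w *v (y *v x)))"] by simp
    also have "\<dots> = (\<Sum>w\<in>W. y *v (w *v (p *v (winv w *v x))))"
    proof (rule sum.cong[OF refl])
      fix w assume w: "w \<in> W"
      have "winv (y ** w) = winv w ** winv y"
        using w y by (intro winv_unique) (auto simp: matrix_mul_assoc[symmetric], simp add: matrix_mul_assoc)
      then have "winv (y ** w) *v (y *v x) = winv w *v x" using y by (simp add: matrix_vector_mul_assoc[symmetric])
      then show "(y ** w) *v (p *v (winv (y ** w) *v (y *v x))) = y *v (w *v (p *v (winv w *v x)))"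
        by (simp add: matrix_vector_mul_assoc[symmetric])
    qed
    finally show ?thesis by (simp add: pi_def vector_scalar_commute matrix_vector_sum)
  qed
  define U' where "U' = {x \<in> T. pi x = 0}"
  show ?thesis
  proof
    show "W_subspace U'"
      using T pilin pieq unfolding W_subspace_def U'_def vec.subspace_def by auto
    show "U' \<subseteq> T" by (auto simp: U'_def)
    show "U \<inter> U' = {0}"
      using piid pilin(3) subU subT by (auto simp: U'_def vec.subspace_0)
    fix x assume x: "x \<in> T"
    have "pi (x + (-1) *s pi x) = pi x + (-1) *s pi (pi x)" by (simp only: pilin(1,2))
    also have "\<dots> = 0" by (simp add: piid[OF piU])
    finally have "pi (x + (-1) *s pi x) = 0" .
    moreover have "x + (-1) *s pi x \<in> T"
      using x piU UT subT by (intro vec.subspace_add vec.subspace_scale) auto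
    ultimately have "x + (-1) *s pi x \<in> U'" by (simp add: U'_def)
    moreover have "x = pi x + (x + (-1) *s pi x)" by simp
    ultimately show "\<exists>u\<in>U. \<exists>u'\<in>U'. x = u + u'" using piU by blast
  qed
qed

lemma irreducible_sum_exists:
  assumes "W_subspace T"
  shows "\<exists>(r::nat) V. (\<forall>k<r. W_subspace (V k) \<and> V k \<noteq> {0} \<and> V k \<subseteq> T \<and>
      (\<forall>U. W_subspace U \<and> U \<subseteq> V k \<longrightarrow> U = {0} \<or> U = V k)) \<and>
    (\<forall>x\<in>T. \<exists>v. (\<forall>k<r. v k \<in> V k) \<and> x = (\<Sum>k<r. v k)) \<and>
    (\<forall>v. (\<forall>k<r. v k \<in> V k) \<and> (\<Sum>k<r. v k) = 0 \<longrightarrow> (\<forall>k<r. v k = 0))"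
  using assms
proof (induction "vec.dim T" arbitrary: T rule: less_induct)
  case less
  have subT: "vec.subspace T" using less.prems by (simp add: W_subspace_def)
  show ?case
  proof (cases "T = {0}")
    case True
    show ?thesis unfolding True by (rule exI[of _ "0::nat"]) auto
  next
    case False
    define Q where "Q U \<longleftrightarrow> W_subspace U \<and> U \<subseteq> T \<and> U \<noteq> {0}" for U
    have "Q T" using less.prems False by (simp add: Q_def)
    from ex_has_least_nat[of Q, OF this, of vec.dim]
    obtain U where U: "Q U" and min: "\<And>U'. Q U' \<Longrightarrow> vec.dim U \<le> vec.dim U'" by blast
    have subU: "vec.subspace U" "W_subspace U" "U \<subseteq> T" "U \<noteq> {0}" using U by (auto simp: Q_def W_subspace_def)
    have irr: "U' = {0} \<or> U' = U" if "W_subspace U'" "U' \<subseteq> U" for U'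
    proof (rule ccontr)
      assume n: "\<not> (U' = {0} \<or> U' = U)"
      then have "Q U'" using that subU by (auto simp: Q_def)
      moreover have "vec.dim U' < vec.dim U"
      proof (rule vec.dim_psubset)
        show "vec.span U' \<subset> vec.span U"
          using that subU n by (metis W_subspace_def psubsetI vec.span_eq_iff)
      qed
      ultimately show False using min by fastforce
    qed
    obtain U' where U': "W_subspace U'" "U' \<subseteq> T" "U \<inter> U' = {0}" "\<And>x. x \<in> T \<Longrightarrow> \<exists>u\<in>U. \<exists>u'\<in>U'. x = u + u'"
      using invariant_complement[OF subU(2) less.prems subU(3)] by blast
    have subU': "vec.subspace U'" using U' by (simp add: W_subspace_def)
    have "vec.dim U' < vec.dim T"
    proof (rule vec.dim_psubset)
      have "U' \<noteq> T"
      proof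
        assume "U' = T"
        then have "U = {0}" using U'(3) subU(3) by auto
        then show False using subU by simp
      qed
      then show "vec.span U' \<subset> vec.span T"
        using U' subU' subT by (metis psubsetI vec.span_eq_iff)
    qed
    from less.hyps[OF this U'(1)] obtain r :: nat and V where
      V0: "\<forall>k<r. W_subspace (V k) \<and> V k \<noteq> {0} \<and> V k \<subseteq> U' \<and>
        (\<forall>U. W_subspace U \<and> U \<subseteq> V k \<longrightarrow> U = {0} \<or> U = V k)"
      "\<forall>x\<in>U'. \<exists>v. (\<forall>k<r. v k \<in> V k) \<and> x = (\<Sum>k<r. v k)"
      "\<forall>v. (\<forall>k<r. v k \<in> V k) \<and> (\<Sum>k<r. v k) = 0 \<longrightarrow> (\<forall>k<r. v k = 0)"
      by (elim exE conjE) (rule that; assumption)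
    have V: "\<And>k. k < r \<Longrightarrow> W_subspace (V k) \<and> V k \<noteq> {0} \<and> V k \<subseteq> U' \<and>
        (\<forall>U. W_subspace U \<and> U \<subseteq> V k \<longrightarrow> U = {0} \<or> U = V k)"
      "\<And>x. x \<in> U' \<Longrightarrow> \<exists>v. (\<forall>k<r. v k \<in> V k) \<and> x = (\<Sum>k<r. v k)"
      "\<And>v. (\<forall>k<r. v k \<in> V k) \<Longrightarrow> (\<Sum>k<r. v k) = 0 \<Longrightarrow> \<forall>k<r. v k = 0"
      using V0 by (blast, blast, blast)
    define V' where "V' = V(r := U)"
    have V'1: "\<forall>k<Suc r. W_subspace (V' k) \<and> V' k \<noteq> {0} \<and> V' k \<subseteq> T \<and>
        (\<forall>U. W_subspace U \<and> U \<subseteq> V' k \<longrightarrow> U = {0} \<or> U = V' k)"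
    proof (intro allI impI)
      fix k assume "k < Suc r"
      then consider "k = r" | "k < r" "k \<noteq> r" by linarith
      then show "W_subspace (V' k) \<and> V' k \<noteq> {0} \<and> V' k \<subseteq> T \<and>
          (\<forall>U. W_subspace U \<and> U \<subseteq> V' k \<longrightarrow> U = {0} \<or> U = V' k)"
      proof cases
        case 1
        then show ?thesis using subU irr by (simp add: V'_def)
      next
        case 2
        then have "V' k = V k" by (simp add: V'_def)
        then show ?thesis using V(1)[OF 2(1)] U'(2) by (simp only:) blast
      qed
    qed
    have V'2: "\<exists>v. (\<forall>k<Suc r. v k \<in> V' k) \<and> x = (\<Sum>k<Suc r. v k)" if "x \<in> T" for x
    proof -
      obtain u u' where u: "u \<in> U" "u' \<in> U'" "x = u + u'" using U'(4) \<open>x \<in> T\<close> by blast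
      obtain v where v: "\<forall>k<r. v k \<in> V k" "u' = (\<Sum>k<r. v k)" using V(2)[OF u(2)] by blast
      have "(\<Sum>k<r. (v(r := u)) k) = (\<Sum>k<r. v k)" by (intro sum.cong) auto
      then show ?thesis
        using u v by (intro exI[of _ "v(r := u)"]) (auto simp: V'_def less_Suc_eq add.commute)
    qed
    have V'3: "\<forall>k<Suc r. v k = 0" if v: "\<forall>k<Suc r. v k \<in> V' k" "(\<Sum>k<Suc r. v k) = 0" for v
    proof -
      have vk: "\<forall>k<r. v k \<in> V k" "v r \<in> U" using v(1) by (auto simp: V'_def less_Suc_eq)
      have "(\<Sum>k<r. v k) \<in> U'"
        using vk V(1) by (intro vec.subspace_sum[OF subU']) auto
      moreover have s: "(\<Sum>k<r. v k) = - v r" using v(2) by (simp add: eq_neg_iff_add_eq_0)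
      ultimately have "- v r \<in> U \<inter> U'" using vk(2) vec.subspace_neg[OF subU(1)] by simp
      then have "- v r = 0" unfolding U'(3) by blast
      then have vr: "v r = 0" by simp
      then have "(\<Sum>k<r. v k) = 0" using s by simp
      then have "\<forall>k<r. v k = 0" by (rule V(3)[OF vk(1)])
      then show ?thesis using vr by (simp add: less_Suc_eq)
    qed
    show ?thesis
      by (intro exI[of _ "Suc r"] exI[of _ V'] conjI ballI allI impI) (use V'1 V'2 V'3 in blast)+
  qed
qed

lemma direct_sum_unique:
  fixes V :: "nat \<Rightarrow> (complex^'n) set"
  assumes sub: "\<And>k. k < r \<Longrightarrow> vec.subspace (V k)"
  shows "(\<forall>x. \<exists>!v. v \<in> (\<Pi>\<^sub>E k\<in>{..<r}. V k) \<and> x = (\<Sum>k<r. v k)) \<longleftrightarrow>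
    (\<forall>x. \<exists>v. (\<forall>k<r. v k \<in> V k) \<and> x = (\<Sum>k<r. v k)) \<and>
    (\<forall>v. (\<forall>k<r. v k \<in> V k) \<and> (\<Sum>k<r. v k) = 0 \<longrightarrow> (\<forall>k<r. v k = 0))"
    (is "?L \<longleftrightarrow> ?R1 \<and> ?R2")
proof
  assume L: ?L
  have "?R1"
  proof
    fix x
    obtain v where "v \<in> (\<Pi>\<^sub>E k\<in>{..<r}. V k)" "x = (\<Sum>k<r. v k)" using L by blast
    then show "\<exists>v. (\<forall>k<r. v k \<in> V k) \<and> x = (\<Sum>k<r. v k)" by (intro exI[of _ v]) (auto simp: PiE_iff)
  qed
  moreover have "?R2"
  proof (intro allI impI)
    fix v k assume v: "(\<forall>k<r. v k \<in> V k) \<and> (\<Sum>k<r. v k) = 0" and k: "k < r"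
    have "restrict v {..<r} \<in> (\<Pi>\<^sub>E k\<in>{..<r}. V k)" "0 = (\<Sum>k<r. restrict v {..<r} k)"
      using v by (auto simp: PiE_iff)
    moreover have "restrict (\<lambda>_. 0) {..<r} \<in> (\<Pi>\<^sub>E k\<in>{..<r}. V k)" "0 = (\<Sum>k<r. restrict (\<lambda>_. 0) {..<r} k)"
      using sub by (auto simp: PiE_iff vec.subspace_0)
    ultimately have "restrict v {..<r} = restrict (\<lambda>_. 0) {..<r}" using L by blast
    then show "v k = 0" using k by (metis lessThan_iff restrict_apply')
  qed
  ultimately show "?R1 \<and> ?R2" ..
next
  assume R: "?R1 \<and> ?R2"
  show ?L
  proof
    fix x
    obtain v where v: "\<forall>k<r. v k \<in> V k" "x = (\<Sum>k<r. v k)" using R by blast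
    show "\<exists>!v. v \<in> (\<Pi>\<^sub>E k\<in>{..<r}. V k) \<and> x = (\<Sum>k<r. v k)"
    proof (rule ex1I[of _ "restrict v {..<r}"])
      show "restrict v {..<r} \<in> (\<Pi>\<^sub>E k\<in>{..<r}. V k) \<and> x = (\<Sum>k<r. restrict v {..<r} k)"
        using v by (auto simp: PiE_iff)
      fix u assume u: "u \<in> (\<Pi>\<^sub>E k\<in>{..<r}. V k) \<and> x = (\<Sum>k<r. u k)"
      have "\<forall>k<r. u k - v k \<in> V k" using u v sub by (auto simp: PiE_iff intro: vec.subspace_diff)
      moreover have "(\<Sum>k<r. u k - v k) = 0" using u v by (simp add: sum_subtractf)
      ultimately have "\<forall>k<r. u k - v k = 0" using R[THEN conjunct2, rule_format, of "\<lambda>k. u k - v k"] by blast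
      then show "u = restrict v {..<r}" using u by (intro extensionalityI[of _ "{..<r}"]) (auto simp: PiE_iff)
    qed
  qed
qed

theorem irreducible_decomposition_exists: "\<exists>r V Wc. irreducible_decomposition W r V Wc"
proof -
  have "W_subspace UNIV" by (simp add: W_subspace_def vec.subspace_UNIV)
  from irreducible_sum_exists[OF this] obtain r :: nat and V where
    V0: "\<forall>k<r. W_subspace (V k) \<and> V k \<noteq> {0} \<and> V k \<subseteq> UNIV \<and>
        (\<forall>U. W_subspace U \<and> U \<subseteq> V k \<longrightarrow> U = {0} \<or> U = V k)"
      "\<forall>x\<in>UNIV. \<exists>v. (\<forall>k<r. v k \<in> V k) \<and> x = (\<Sum>k<r. v k)"
      "\<forall>v. (\<forall>k<r. v k \<in> V k) \<and> (\<Sum>k<r. v k) = 0 \<longrightarrow> (\<forall>k<r. v k = 0)"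
    by (elim exE conjE) (rule that; assumption)
  have V: "\<And>k. k < r \<Longrightarrow> W_subspace (V k) \<and> V k \<noteq> {0} \<and>
        (\<forall>U. W_subspace U \<and> U \<subseteq> V k \<longrightarrow> U = {0} \<or> U = V k)"
      "\<And>x. \<exists>v. (\<forall>k<r. v k \<in> V k) \<and> x = (\<Sum>k<r. v k)"
      "\<And>v. (\<forall>k<r. v k \<in> V k) \<Longrightarrow> (\<Sum>k<r. v k) = 0 \<Longrightarrow> \<forall>k<r. v k = 0"
    using V0 by (blast, blast, blast)
  define Wc where "Wc k = {w \<in> W. \<forall>j<r. j \<noteq> k \<longrightarrow> (\<forall>v\<in>V j. w *v v = v)}" for k
  have sub: "vec.subspace (V k)" if "k < r" for k using V(1)[OF that] by (simp add: W_subspace_def)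
  interpret block_decomposition W r V Wc
    by unfold_locales
      (use V sub in \<open>auto simp: Wc_def W_subspace_def matrix_vector_mul_assoc[symmetric]\<close>)
  have Wc_inv: "winv w \<in> Wc k" if "k < r" "w \<in> Wc k" for k w
    using that by (auto simp: Wc_def) (metis winv_vec(1))
  have sg: "subgroup (Wc k) (matrix_group W)" if k: "k < r" for k
  proof
    show "Wc k \<subseteq> carrier (matrix_group W)" using Wc_W[OF k] by simp
    show "inv\<^bsub>matrix_group W\<^esub> w \<in> Wc k" if "w \<in> Wc k" for w
      using Wc_inv[OF k that] by (simp add: winv_def)
  qed (use Wc_one[OF k] Wc_mult[OF k] in auto)
  have refl_block: "\<exists>k<r. s \<in> Wc k" if s: "s \<in> W" "is_reflection s" for s
  proof -
    have "\<And>k v. k < r \<Longrightarrow> v \<in> V k \<Longrightarrow> s *v v \<in> V k" using V(1) s by (auto simp: W_subspace_def)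
    then obtain k where "k < r" "\<And>j v. j < r \<Longrightarrow> j \<noteq> k \<Longrightarrow> v \<in> V j \<Longrightarrow> s *v v = v"
      using reflection_trivial_off_block[OF _ s(2)] by metis
    then show ?thesis using s(1) by (auto simp: Wc_def)
  qed
  let ?G = "product_group {..<r} (\<lambda>k. matrix_group (Wc k))"
  have car: "g \<in> carrier ?G \<longleftrightarrow> g \<in> (\<Pi>\<^sub>E k\<in>{..<r}. Wc k)" for g
    by (simp add: product_group_def)
  have gW: "g k \<in> Wc k" if "g \<in> carrier ?G" "k < r" for g k using that by (auto simp: car)
  have iso: "(\<lambda>g. block_product g r) \<in> iso ?G (matrix_group W)"
  proof (rule isoI)
    show "(\<lambda>g. block_product g r) \<in> hom ?G (matrix_group W)"
    proof (rule homI)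
      show "block_product g r \<in> carrier (matrix_group W)" if "g \<in> carrier ?G" for g
        using block_product_W gW[OF that] by simp
      show "block_product (g \<otimes>\<^bsub>?G\<^esub> h) r = block_product g r \<otimes>\<^bsub>matrix_group W\<^esub> block_product h r"
        if "g \<in> carrier ?G" "h \<in> carrier ?G" for g h
        using block_product_mult[OF gW[OF that(1)] gW[OF that(2)]] by (simp add: product_group_def)
    qed
    have "inj_on (\<lambda>g. block_product g r) (carrier ?G)"
    proof (rule inj_onI)
      fix g h assume g: "g \<in> carrier ?G" and h: "h \<in> carrier ?G" and eq: "block_product g r = block_product h r"
      have "g k = h k" if "k < r" for k using block_product_inj[OF gW[OF g] gW[OF h] eq that] by simp
      then show "g = h" using g h unfolding car by (intro extensionalityI[of _ "{..<r}"]) (auto simp: PiE_iff)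
    qed
    moreover have "(\<lambda>g. block_product g r) ` carrier ?G = W"
    proof
      show "(\<lambda>g. block_product g r) ` carrier ?G \<subseteq> W" using block_product_W gW by blast
      show "W \<subseteq> (\<lambda>g. block_product g r) ` carrier ?G"
      proof (rule reflection_generated)
        have single: "s \<in> (\<lambda>g. block_product g r) ` carrier ?G" if "k < r" "s \<in> Wc k" for s k
        proof (rule image_eqI)
          show "s = block_product (\<lambda>j\<in>{..<r}. if j = k then s else mat 1) r"
            using block_product_single[OF that] by simp
          show "(\<lambda>j\<in>{..<r}. if j = k then s else mat 1) \<in> carrier ?G"
            using that Wc_one by (auto simp: car)
        qed
        show "s \<in> (\<lambda>g. block_product g r) ` carrier ?G" if "s \<in> W" "is_reflection s" for s
          using refl_block[OF that] single by blast
        show "u ** v \<in> (\<lambda>g. block_product g r) ` carrier ?G"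
          if uv: "u \<in> (\<lambda>g. block_product g r) ` carrier ?G" "v \<in> (\<lambda>g. block_product g r) ` carrier ?G" for u v
        proof -
          obtain g h where gh: "g \<in> carrier ?G" "h \<in> carrier ?G" "u = block_product g r" "v = block_product h r"
            using uv by blast
          have "(\<lambda>k\<in>{..<r}. g k ** h k) \<in> carrier ?G"
            using gW[OF gh(1)] gW[OF gh(2)] Wc_mult by (auto simp: car)
          moreover have "u ** v = block_product (\<lambda>k\<in>{..<r}. g k ** h k) r"
            using block_product_mult[OF gW[OF gh(1)] gW[OF gh(2)]] gh by simp
          ultimately show ?thesis by blast
        qed
        show "mat 1 \<in> (\<lambda>g. block_product g r) ` carrier ?G"
        proof (rule image_eqI)
          show "mat 1 = block_product (\<lambda>j\<in>{..<r}. mat 1) r"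
            by (rule matrix_eqI) (simp add: block_product_act Wc_one)
          show "(\<lambda>j\<in>{..<r}. mat 1) \<in> carrier ?G" using Wc_one by (auto simp: car)
        qed
      qed
    qed
    ultimately show "bij_betw (\<lambda>g. block_product g r) (carrier ?G) (carrier (matrix_group W))"
      by (simp add: bij_betw_def)
  qed
  have irr: "acts_irreducibly (Wc k) (V k)" if k: "k < r" for k
    unfolding acts_irreducibly_def
  proof (intro conjI allI impI)
    show "vec.subspace (V k)" "V k \<noteq> {0}" using sub[OF k] V(1)[OF k] by auto
    show "\<forall>w\<in>Wc k. (*v) w ` V k \<subseteq> V k" using Wc_V[OF k] by blast
    fix U assume U: "vec.subspace U \<and> U \<subseteq> V k \<and> (\<forall>w\<in>Wc k. (*v) w ` U \<subseteq> U)"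
    have "w *v v \<in> U" if w: "w \<in> W" and v: "v \<in> U" for w v
    proof -
      have "w \<in> (\<lambda>g. block_product g r) ` carrier ?G"
        using iso w by (auto simp: iso_def bij_betw_def)
      then obtain g where g: "g \<in> carrier ?G" "w = block_product g r" by blast
      have "w *v v = g k *v v" using block_product_act[OF gW[OF g(1)] k] U v g by blast
      then show ?thesis using gW[OF g(1) k] U v by auto
    qed
    then have "W_subspace U" using U by (simp add: W_subspace_def)
    then show "U = {0} \<or> U = V k" using V(1)[OF k] U by blast
  qed
  have "irreducible_decomposition W r V Wc"
    unfolding irreducible_decomposition_def
  proof (intro conjI)
    show "\<forall>x. \<exists>!v. v \<in> (\<Pi>\<^sub>E k\<in>{..<r}. V k) \<and> x = (\<Sum>k<r. v k)"
      by (rule iffD2[OF direct_sum_unique], erule sub) (use V0(2,3) in simp)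
    show "(\<lambda>g. foldr (\<lambda>k A. g k ** A) [0..<r] (mat 1)) \<in> iso ?G (matrix_group W)"
      using iso by (simp add: block_product_def)
  qed (use sg irr Wc_triv in auto)
  then show ?thesis by blast
qed

end


section \<open>Centers of the irreducible components\<close>

text \<open>A finite multiplicative submonoid of \<open>\<complex>\<^sup>*\<close> consists of all roots of unity of its order: multiplication
  by an element permutes it, so that element raised to the order is \<open>1\<close>.\<close>

lemma finite_multiplicative_set_roots:
  fixes M :: "complex set"
  assumes fin: "finite M" and nz: "0 \<notin> M" and ne: "M \<noteq> {}"
    and cl: "\<And>a b. a \<in> M \<Longrightarrow> b \<in> M \<Longrightarrow> a * b \<in> M"
  shows "M = {z. z ^ card M = 1}"
proof (rule card_subset_eq)
  have pos: "card M > 0" using fin ne by (simp add: card_gt_0_iff)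
  show "finite {z::complex. z ^ card M = 1}" using pos by (intro finite_roots_unity) simp
  show "card M = card {z::complex. z ^ card M = 1}" using pos by (simp add: card_roots_unity_eq)
  show "M \<subseteq> {z. z ^ card M = 1}"
  proof
    fix c assume c: "c \<in> M"
    have inj: "inj_on ((*) c) M" using c nz by (auto intro!: inj_onI)
    have "(*) c ` M = M" using c cl by (intro endo_inj_surj[OF fin _ inj]) auto
    then have "(\<Prod>m\<in>M. m) = (\<Prod>m\<in>M. c * m)"
      using prod.reindex[OF inj, of "\<lambda>m. m"] by simp
    also have "\<dots> = c ^ card M * (\<Prod>m\<in>M. m)" by (simp add: prod.distrib)
    finally have "c ^ card M = 1" using nz fin by (simp add: prod_zero_iff)
    then show "c \<in> {z. z ^ card M = 1}" by simp
  qed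
qed

locale irreducible_blocks = reflection_group W for W :: "(complex^'n^'n) set" +
  fixes r :: nat and V :: "nat \<Rightarrow> (complex^'n) set" and Wc :: "nat \<Rightarrow> (complex^'n^'n) set"
  assumes decomposition: "irreducible_decomposition W r V Wc"
begin

lemma irreducible: "k < r \<Longrightarrow> acts_irreducibly (Wc k) (V k)"
  and component_subgroup: "k < r \<Longrightarrow> subgroup (Wc k) (matrix_group W)"
  and component_trivial: "k < r \<Longrightarrow> j < r \<Longrightarrow> j \<noteq> k \<Longrightarrow> w \<in> Wc k \<Longrightarrow> v \<in> V j \<Longrightarrow> w *v v = v"
  and direct_sum: "\<exists>!v. v \<in> (\<Pi>\<^sub>E k\<in>{..<r}. V k) \<and> x = (\<Sum>k<r. v k)"
  and block_product_iso: "(\<lambda>g. block_product g r) \<in> iso (product_group {..<r} (\<lambda>k. matrix_group (Wc k))) (matrix_group W)"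
  using decomposition by (auto simp: irreducible_decomposition_def block_product_def)

lemma component_subspace: "k < r \<Longrightarrow> vec.subspace (V k)"
  using irreducible by (simp add: acts_irreducibly_def)

end

sublocale irreducible_blocks \<subseteq> block_decomposition W r V Wc
proof
  have ds: "(\<forall>x. \<exists>v. (\<forall>k<r. v k \<in> V k) \<and> x = (\<Sum>k<r. v k)) \<and>
    (\<forall>v. (\<forall>k<r. v k \<in> V k) \<and> (\<Sum>k<r. v k) = 0 \<longrightarrow> (\<forall>k<r. v k = 0))"
    by (rule iffD1[OF direct_sum_unique], erule component_subspace) (intro allI direct_sum)
  show "\<exists>v. (\<forall>k<r. v k \<in> V k) \<and> x = (\<Sum>k<r. v k)" for x using ds by blast
  show "\<forall>k<r. v k = 0" if "\<forall>k<r. v k \<in> V k" "(\<Sum>k<r. v k) = 0" for v using ds that by blast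
  fix k assume k: "k < r"
  show "vec.subspace (V k)" using component_subspace[OF k] .
  show "Wc k \<subseteq> W" using subgroup.subset[OF component_subgroup[OF k]] by simp
  show "mat 1 \<in> Wc k" using subgroup.one_closed[OF component_subgroup[OF k]] by simp
  show "v ** w \<in> Wc k" if "v \<in> Wc k" "w \<in> Wc k" for v w
    using subgroup.m_closed[OF component_subgroup[OF k] that] by simp
  show "w *v v \<in> V k" if "w \<in> Wc k" "v \<in> V k" for w v
    using irreducible[OF k] that by (auto simp: acts_irreducibly_def)
  show "w *v v = v" if "j < r" "j \<noteq> k" "w \<in> Wc k" "v \<in> V j" for j w v
    using component_trivial[OF k that] .
qed

context irreducible_blocks
begin

lemma block_product_surj:
  assumes "w \<in> W"
  obtains g where "\<And>k. k < r \<Longrightarrow> g k \<in> Wc k" "w = block_product g r"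
proof -
  have "w \<in> (\<lambda>g. block_product g r) ` carrier (product_group {..<r} (\<lambda>k. matrix_group (Wc k)))"
    using block_product_iso assms unfolding iso_def bij_betw_def by simp
  then obtain g where g: "g \<in> carrier (product_group {..<r} (\<lambda>k. matrix_group (Wc k)))" "w = block_product g r"
    by (rule imageE)
  show ?thesis by (rule that[OF _ g(2)]) (use g(1) in auto)
qed

lemma W_V:
  assumes "w \<in> W" "k < r" "v \<in> V k"
  shows "w *v v \<in> V k"
proof -
  obtain g where g: "\<And>k. k < r \<Longrightarrow> g k \<in> Wc k" "w = block_product g r"
    using block_product_surj[OF assms(1)] by blast
  have "w *v v = g k *v v" using block_product_act[OF g(1) assms(2,3)] g(2) by simp
  then show ?thesis using Wc_V[OF assms(2) g(1)[OF assms(2)] assms(3)] by simp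
qed

lemma reflection_in_component:
  assumes s: "s \<in> W" "is_reflection s"
  shows "\<exists>k<r. s \<in> Wc k"
proof -
  obtain k where k: "k < r" "\<And>j v. j < r \<Longrightarrow> j \<noteq> k \<Longrightarrow> v \<in> V j \<Longrightarrow> s *v v = v"
    using reflection_trivial_off_block[OF W_V[OF s(1)] s(2)] by metis
  obtain g where g: "\<And>k. k < r \<Longrightarrow> g k \<in> Wc k" "s = block_product g r"
    using block_product_surj[OF s(1)] by blast
  have "s = g k"
  proof (rule matrix_eqI)
    fix j v assume j: "j < r" "v \<in> V j"
    show "s *v v = g k *v v"
    proof (cases "j = k")
      case True
      then show ?thesis using block_product_act[OF g(1) j] g(2) by simp
    next
      case False
      then show ?thesis using k(2)[OF j(1) _ j(2)] Wc_triv[OF k(1) j(1) _ g(1)[OF k(1)] j(2)] by simp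
    qed
  qed
  then show ?thesis using g(1) k(1) by blast
qed

lemma reflection_in_component_form:
  assumes k: "k < r" and s: "s \<in> Wc k" "is_reflection s" and ab: "\<And>v. s *v v = v + form a v *s b"
  shows "b \<in> V k" "b \<noteq> 0" "\<exists>v\<in>V k. form a v \<noteq> 0"
proof -
  have "\<exists>v\<in>V k. s *v v \<noteq> v"
  proof (rule ccontr)
    assume n: "\<not> ?thesis"
    have "s = mat 1"
    proof (rule matrix_eqI)
      fix j v assume "j < r" "v \<in> V j"
      then show "s *v v = mat 1 *v v" using n Wc_triv[OF k _ _ s(1)] by (cases "j = k") auto
    qed
    then show False using s by (simp add: is_reflection_def)
  qed
  then obtain v where v: "v \<in> V k" "s *v v \<noteq> v" by blast
  have f: "form a v \<noteq> 0" "b \<noteq> 0" using v(2) ab[of v] by auto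
  then show "b \<noteq> 0" "\<exists>v\<in>V k. form a v \<noteq> 0" using v by auto
  have "s *v v - v \<in> V k" using Wc_V[OF k s(1) v(1)] v(1) component_subspace[OF k] vec.subspace_diff by blast
  then have "form a v *s b \<in> V k" using ab by simp
  then have "(1 / form a v) *s (form a v *s b) \<in> V k" using component_subspace[OF k] vec.subspace_scale by blast
  then show "b \<in> V k" using f by simp
qed

lemma component_without_reflections:
  assumes k: "k < r" and no: "\<And>s. s \<in> Wc k \<Longrightarrow> \<not> is_reflection s" and w: "w \<in> W" and v: "v \<in> V k"
  shows "w *v v = v"
proof -
  have "W \<subseteq> {w. \<forall>v\<in>V k. w *v v = v}"
  proof (rule reflection_generated)
    fix s assume s: "s \<in> W" "is_reflection s"
    then obtain j where j: "j < r" "s \<in> Wc j" using reflection_in_component by blast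
    then have "k \<noteq> j" using no s by blast
    then show "s \<in> {w. \<forall>v\<in>V k. w *v v = v}" using Wc_triv[OF j(1) k _ j(2)] by blast
  qed (auto simp: matrix_vector_mul_assoc[symmetric])
  then show ?thesis using w v by blast
qed

abbreviation "Zc k \<equiv> group_center (matrix_group (Wc k))"

lemma Zc_iff: "z \<in> Zc k \<longleftrightarrow> z \<in> Wc k \<and> (\<forall>w\<in>Wc k. z ** w = w ** z)"
  by (auto simp: group_center_def)

text \<open>Schur's lemma. A central element commutes with a reflection \<open>v \<mapsto> v + \<alpha>(v) b\<close>, hence has \<open>b\<close> as an
  eigenvector; the eigenspace is invariant, hence everything. This gives an eigenvalue without
  recourse to characteristic polynomials.\<close>

lemma central_acts_by_scalar:
  assumes k: "k < r" and z: "z \<in> Zc k"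
  shows "\<exists>c. \<forall>v\<in>V k. z *v v = c *s v"
proof (cases "\<exists>s\<in>Wc k. is_reflection s")
  case False
  then have "z *v v = v" if "v \<in> V k" for v
    using component_without_reflections[OF k _ _ that] Wc_W[OF k] z by (auto simp: Zc_iff)
  then show ?thesis by (intro exI[of _ 1]) simp
next
  case True
  then obtain s where s: "s \<in> Wc k" "is_reflection s" by blast
  obtain a b where ab: "\<And>v. s *v v = v + form a v *s b" using reflection_form[OF s(2)] by metis
  have b: "b \<in> V k" "b \<noteq> 0" and "\<exists>v\<in>V k. form a v \<noteq> 0" using reflection_in_component_form[OF k s ab] by auto
  then obtain v where v: "form a v \<noteq> 0" by blast
  have zs: "z *v (w *v u) = w *v (z *v u)" if "w \<in> Wc k" for w u
    using z that by (simp add: Zc_iff matrix_vector_mul_assoc)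
  have "z *v v + form a v *s (z *v b) = z *v v + form a (z *v v) *s b"
    using zs[OF s(1), of v] by (simp add: ab matrix_vector_right_distrib vector_scalar_commute)
  then have "(1 / form a v) *s (form a v *s (z *v b)) = (1 / form a v) *s (form a (z *v v) *s b)" by simp
  then have zb: "z *v b = (form a (z *v v) / form a v) *s b" using v by simp
  define c where "c = form a (z *v v) / form a v"
  define U where "U = {u \<in> V k. z *v u = c *s u}"
  have "vec.subspace U"
    using component_subspace[OF k] unfolding U_def vec.subspace_def
    by (auto simp: matrix_vector_right_distrib vector_scalar_commute vec.scale_right_distrib mult.commute)
  moreover have "(*v) w ` U \<subseteq> U" if "w \<in> Wc k" for w
    using Wc_V[OF k that] zs[OF that] by (auto simp: U_def vector_scalar_commute)
  moreover have "b \<in> U" using b zb by (simp add: U_def c_def)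
  moreover have "U \<subseteq> V k" by (auto simp: U_def)
  ultimately have "U = {0} \<or> U = V k"
    using irreducible[OF k] unfolding acts_irreducibly_def by blast
  then have "U = V k" using \<open>b \<in> U\<close> b(2) by blast
  then show ?thesis by (auto simp: U_def)
qed

definition central_scalar :: "nat \<Rightarrow> complex^'n^'n \<Rightarrow> complex" where
  "central_scalar k z = (SOME c. \<forall>v\<in>V k. z *v v = c *s v)"

lemma central_scalar:
  assumes "k < r" "z \<in> Zc k" "v \<in> V k"
  shows "z *v v = central_scalar k z *s v"
proof -
  have "\<forall>v\<in>V k. z *v v = central_scalar k z *s v"
    unfolding central_scalar_def by (rule someI_ex[OF central_acts_by_scalar[OF assms(1,2)]])
  then show ?thesis using assms(3) by blast
qed

lemma scalar_unique:
  fixes v :: "complex^'n"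
  shows "v \<noteq> 0 \<Longrightarrow> c *s v = c' *s v \<Longrightarrow> c = c'"
  by simp

lemma Zc_mult: "k < r \<Longrightarrow> z \<in> Zc k \<Longrightarrow> y \<in> Zc k \<Longrightarrow> z ** y \<in> Zc k"
  unfolding Zc_iff using Wc_mult by (metis matrix_mul_assoc)

lemma Zc_one: "k < r \<Longrightarrow> mat 1 \<in> Zc k"
  unfolding Zc_iff using Wc_one by simp

lemma Zc_scalars:
  assumes k: "k < r"
  shows "inj_on (central_scalar k) (Zc k)"
    "central_scalar k ` Zc k = {c. c ^ card (Zc k) = 1}" "card (Zc k) > 0"
proof -
  have fin: "finite (Zc k)" using Wc_W[OF k] finite_subset[OF _ finite_W] by (auto simp: group_center_def)
  then show pos: "card (Zc k) > 0" using Zc_one[OF k] by (auto simp: card_gt_0_iff)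
  obtain v where v: "v \<in> V k" "v \<noteq> 0"
    using irreducible[OF k] component_subspace[OF k] vec.subspace_0 by (auto simp: acts_irreducibly_def)
  show inj: "inj_on (central_scalar k) (Zc k)"
  proof (rule inj_onI)
    fix z y assume z: "z \<in> Zc k" "y \<in> Zc k" "central_scalar k z = central_scalar k y"
    show "z = y"
      using z central_scalar[OF k] by (intro block_eqI[OF k]) (auto simp: Zc_iff)
  qed
  let ?M = "central_scalar k ` Zc k"
  have "?M = {c. c ^ card ?M = 1}"
  proof (rule finite_multiplicative_set_roots)
    show "finite ?M" "?M \<noteq> {}" using fin Zc_one[OF k] by auto
    show "0 \<notin> ?M"
    proof
      assume "0 \<in> ?M"
      then obtain z where z: "z \<in> Zc k" "central_scalar k z = 0" by force
      then have "z *v v = z *v 0" using central_scalar[OF k z(1) v(1)] by simp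
      moreover have "z \<in> W" using z Wc_W[OF k] by (auto simp: Zc_iff)
      ultimately show False using W_inj v(2) by blast
    qed
    show "a * b \<in> ?M" if "a \<in> ?M" "b \<in> ?M" for a b
    proof -
      obtain z y where z: "z \<in> Zc k" "y \<in> Zc k" "a = central_scalar k z" "b = central_scalar k y"
        using \<open>a \<in> ?M\<close> \<open>b \<in> ?M\<close> by blast
      have "(z ** y) *v v = (a * b) *s v"
        using z central_scalar[OF k _ v(1)] by (simp add: matrix_vector_mul_assoc[symmetric] vector_scalar_commute mult.commute)
      then have "central_scalar k (z ** y) = a * b"
        using central_scalar[OF k Zc_mult[OF k z(1,2)] v(1)] scalar_unique[OF v(2)] by simp
      then show ?thesis using Zc_mult[OF k z(1,2)] by force
    qed
  qed
  then show "?M = {c. c ^ card (Zc k) = 1}" using card_image[OF inj] by simp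
qed

definition root_of_unity :: "nat \<Rightarrow> complex" where
  "root_of_unity k = exp (2 * of_real pi * \<i> / of_nat (card (Zc k)))"

lemma central_generator:
  assumes k: "k < r"
  obtains w where "w \<in> Zc k" "\<And>v. v \<in> V k \<Longrightarrow> w *v v = root_of_unity k *s v"
proof -
  have "root_of_unity k ^ card (Zc k) = 1"
    using Zc_scalars(3)[OF k] by (simp add: root_of_unity_def exp_of_nat_mult[symmetric])
  then have "root_of_unity k \<in> central_scalar k ` Zc k" using Zc_scalars(2)[OF k] by simp
  then show ?thesis using central_scalar[OF k] that by force
qed

lemma center_generated:
  assumes k: "k < r" and w: "w \<in> Zc k" "\<And>v. v \<in> V k \<Longrightarrow> w *v v = root_of_unity k *s v"
    and S: "mat 1 \<in> S" "\<And>A. A \<in> S \<Longrightarrow> w ** A \<in> S"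
  shows "Zc k \<subseteq> S"
proof
  fix z assume z: "z \<in> Zc k"
  have "central_scalar k z \<in> central_scalar k ` Zc k" using z by blast
  then have "central_scalar k z \<in> {c. c ^ card (Zc k) = 1}" using Zc_scalars(2)[OF k] by simp
  moreover have "{c. c ^ card (Zc k) = 1} =
      {exp (2 * of_real pi * \<i> * of_nat j / of_nat (card (Zc k))) |j. j < card (Zc k)}"
    using Zc_scalars(3)[OF k] by (intro complex_roots_unity) simp
  ultimately have "central_scalar k z \<in> {exp (2 * of_real pi * \<i> * of_nat j / of_nat (card (Zc k))) |j. j < card (Zc k)}"
    by simp
  then obtain j where "central_scalar k z = exp (2 * of_real pi * \<i> * of_nat j / of_nat (card (Zc k)))"
    by blast
  then have j: "central_scalar k z = root_of_unity k ^ j"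
    by (simp add: root_of_unity_def exp_of_nat_mult[symmetric] mult.commute)
  have "\<exists>A\<in>S \<inter> Zc k. \<forall>v\<in>V k. A *v v = root_of_unity k ^ i *s v" for i
  proof (induction i)
    case 0
    show ?case using S(1) Zc_one[OF k] by (intro bexI[of _ "mat 1"]) auto
  next
    case (Suc i)
    then obtain A where A: "A \<in> S \<inter> Zc k" "\<forall>v\<in>V k. A *v v = root_of_unity k ^ i *s v" by blast
    have "(w ** A) *v v = root_of_unity k ^ Suc i *s v" if "v \<in> V k" for v
      using A(2) w(2)[OF that] that by (simp add: matrix_vector_mul_assoc[symmetric] vector_scalar_commute mult.commute)
    then show ?case using A(1) S(2) Zc_mult[OF k w(1)] by (intro bexI[of _ "w ** A"]) auto
  qed
  then obtain A where A: "A \<in> S" "A \<in> Zc k" "\<forall>v\<in>V k. A *v v = root_of_unity k ^ j *s v" by blast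
  have "z = A"
    using central_scalar[OF k z] A j z by (intro block_eqI[OF k]) (auto simp: Zc_iff)
  then show "z \<in> S" using A by simp
qed

lemma component_center_central:
  assumes k: "k < r" and z: "z \<in> Zc k"
  shows "z \<in> group_center (matrix_group W)"
proof -
  have zW: "z \<in> Wc k" "z \<in> W" using z Wc_W[OF k] by (auto simp: Zc_iff)
  have "z ** w = w ** z" if w: "w \<in> W" for w
  proof (rule matrix_eqI)
    fix j v assume j: "j < r" "v \<in> V j"
    show "(z ** w) *v v = (w ** z) *v v"
    proof (cases "j = k")
      case True
      have v: "v \<in> V k" using j True by simp
      show ?thesis using central_scalar[OF k z v] central_scalar[OF k z W_V[OF w k v]]
        by (simp add: matrix_vector_mul_assoc[symmetric] vector_scalar_commute)
    next
      case False
      then show ?thesis using Wc_triv[OF k j(1) _ zW(1) j(2)] Wc_triv[OF k j(1) _ zW(1) W_V[OF w j]]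
        by (simp add: matrix_vector_mul_assoc[symmetric])
    qed
  qed
  then show ?thesis using zW by (simp add: group_center_def)
qed

lemma center_generated_by_components:
  assumes S: "mat 1 \<in> S" "\<And>A A'. A \<in> S \<Longrightarrow> A' \<in> S \<Longrightarrow> A ** A' \<in> S" "\<And>k. k < r \<Longrightarrow> Zc k \<subseteq> S"
  shows "group_center (matrix_group W) \<subseteq> S"
proof
  fix z assume z: "z \<in> group_center (matrix_group W)"
  then have zW: "z \<in> W" and zc: "\<And>w. w \<in> W \<Longrightarrow> z ** w = w ** z" by (auto simp: group_center_def)
  obtain g where g: "\<And>k. k < r \<Longrightarrow> g k \<in> Wc k" "z = block_product g r"
    using block_product_surj[OF zW] by blast
  have gz: "g k *v v = z *v v" if "k < r" "v \<in> V k" for k v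
    using block_product_act[OF g(1) that] g(2) by simp
  have gk: "g k \<in> Zc k" if k: "k < r" for k
    unfolding Zc_iff
  proof (intro conjI ballI)
    show "g k \<in> Wc k" using g k by blast
    fix h assume h: "h \<in> Wc k"
    show "g k ** h = h ** g k"
    proof (rule block_eqI[OF k Wc_mult[OF k g(1)[OF k] h] Wc_mult[OF k h g(1)[OF k]]])
      fix v assume v: "v \<in> V k"
      have "z ** h = h ** z" using zc h Wc_W[OF k] by blast
      then have "z *v (h *v v) = h *v (z *v v)" by (simp add: matrix_vector_mul_assoc)
      then show "(g k ** h) *v v = (h ** g k) *v v"
        using gz[OF k v] gz[OF k Wc_V[OF k h v]] by (simp add: matrix_vector_mul_assoc[symmetric])
    qed
  qed
  have gS: "g k \<in> S" if "k < r" for k using S(3)[OF that] gk[OF that] by blast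
  have "set ks \<subseteq> {..<r} \<Longrightarrow> foldr (\<lambda>k A. g k ** A) ks (mat 1) \<in> S" for ks
    by (induction ks) (auto intro!: S(1,2) gS)
  then show "z \<in> S" unfolding g(2) block_product_def by (metis atLeast_upt order_refl)
qed

end

section \<open>The central elements of the braid group\<close>

locale based_blocks = base_point W x0 + irreducible_blocks W r V Wc
  for W :: "(complex^'n^'n) set" and x0 r V Wc
begin

definition part :: "nat \<Rightarrow> complex^'n" where
  "part k = direct_sum_component r V x0 k"

lemma part: "k < r \<Longrightarrow> part k \<in> V k" "x0 = (\<Sum>k<r. part k)"
proof -
  have *: "direct_sum_component r V x0 \<in> (\<Pi>\<^sub>E k\<in>{..<r}. V k) \<and> x0 = (\<Sum>k<r. direct_sum_component r V x0 k)"
    unfolding direct_sum_component_def by (rule theI'[OF direct_sum])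
  then show "x0 = (\<Sum>k<r. part k)" by (simp add: part_def)
  show "k < r \<Longrightarrow> part k \<in> V k" using * by (auto simp: part_def PiE_iff)
qed

lemma Wc_rest:
  assumes k: "k < r" and w: "w \<in> Wc k"
  shows "w *v (x0 - part k) = x0 - part k"
proof -
  have eq: "x0 - part k = (\<Sum>j\<in>{..<r} - {k}. part j)"
    using part(2) k by (simp add: sum_diff1)
  show ?thesis unfolding eq matrix_vector_sum
    using Wc_triv[OF k _ _ w] part(1) by (intro sum.cong) auto
qed

text \<open>A reflection of another component moves only the coordinates filled in from the base point.\<close>

lemma fill_in_regular:
  assumes k: "k < r" and y: "y \<in> hyperplane_complement (V k) (Wc k)"
  shows "y + (x0 - part k) \<in> Xreg"
  unfolding X_iff
proof (intro ballI impI notI)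
  fix s assume s: "s \<in> W" "is_reflection s" and fx: "s *v (y + (x0 - part k)) = y + (x0 - part k)"
  have yV: "y \<in> V k" using y by (simp add: hyperplane_complement_def)
  obtain j where j: "j < r" "s \<in> Wc j" using reflection_in_component s by blast
  show False
  proof (cases "j = k")
    case True
    then have "s *v y = y" using fx Wc_rest[OF k, of s] j by (simp add: matrix_vector_right_distrib)
    then have "y \<in> {v. (s - mat 1) *v v = 0}" by (simp add: matrix_vector_mult_diff_rdistrib)
    then show False using y s(2) j True by (auto simp: hyperplane_complement_def reflecting_hyperplanes_def)
  next
    case False
    then have tr: "s *v y = y" "s *v part k = part k" using Wc_triv[OF j(1) k _ j(2)] yV part(1)[OF k] by auto
    then have "s *v x0 = x0"
      using fx by (simp add: matrix_vector_right_distrib matrix_vector_mult_diff_distrib)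
    then show False using x0 s by (simp add: X_iff)
  qed
qed

lemma scaled_part_regular:
  assumes k: "k < r" and c: "c \<noteq> 0"
  shows "c *s part k \<in> hyperplane_complement (V k) (Wc k)"
proof -
  have "c *s part k \<in> V k" using part(1)[OF k] component_subspace[OF k] vec.subspace_scale by blast
  moreover have False if s: "s \<in> Wc k" "is_reflection s" "(s - mat 1) *v (c *s part k) = 0" for s
  proof -
    have "s *v part k = part k"
      using s(3) c by (simp add: matrix_vector_mult_diff_rdistrib vector_scalar_commute)
    then have "s *v x0 = x0"
      using Wc_rest[OF k s(1)] matrix_vector_right_distrib[of s "part k" "x0 - part k"] by simp
    moreover have "s \<in> W" using s Wc_W[OF k] by blast
    ultimately show False using x0 s by (simp add: X_iff)
  qed
  ultimately show ?thesis by (auto simp: hyperplane_complement_def reflecting_hyperplanes_def)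
qed

definition rotation :: "nat \<Rightarrow> real \<Rightarrow> complex^'n" where
  "rotation k t = exp (2 * of_real pi * \<i> * of_real t / of_nat (card (Zc k))) *s part k + (x0 - part k)"

lemma component_central_braid:
  assumes k: "k < r" and w: "w \<in> Zc k" "\<And>v. v \<in> V k \<Longrightarrow> w *v v = root_of_unity k *s v"
  shows "rotation k \<in> lifts" "end_elt (rotation k) = w"
    "component_braid_inclusion W x0 r V k (central_braid (V k) (Wc k) (direct_sum_component r V x0 k)) = cls (rotation k)"
proof -
  have wW: "w \<in> Wc k" "w \<in> W" using w Wc_W[OF k] by (auto simp: Zc_iff)
  have reg: "rotation k t \<in> Xreg" for t
    unfolding rotation_def by (rule fill_in_regular[OF k scaled_part_regular[OF k exp_not_eq_zero]])
  have fin: "pathfinish (rotation k) = w *v x0"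
  proof -
    have "w *v x0 = root_of_unity k *s part k + (x0 - part k)"
      using w(2)[OF part(1)[OF k]] Wc_rest[OF k wW(1)] matrix_vector_right_distrib[of w "part k" "x0 - part k"] by simp
    then show ?thesis by (simp add: pathfinish_def rotation_def root_of_unity_def)
  qed
  have "path (rotation k)"
    unfolding path_def rotation_def using Zc_scalars(3)[OF k]
    by (intro continuous_on_add continuous_on_vsmult continuous_intros) auto
  then show lift: "rotation k \<in> lifts"
    using reg wW fin by (auto simp: lifts_def path_image_def pathstart_def rotation_def)
  then show "end_elt (rotation k) = w" using end_elt_eqI wW fin by blast
  let ?Xk = "hyperplane_complement (V k) (Wc k)"
  let ?T = "orbit_space ?Xk (Wc k)"
  let ?rest = "x0 - part k"
  define phi where "phi c = (\<Union>y\<in>c. orb (y + ?rest))" for c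
  define f where "f t = orbit_of (Wc k) (exp (2 * of_real pi * \<i> * of_real t / of_nat (card (Zc k))) *s part k)" for t :: real
  have phi_orb: "phi (orbit_of (Wc k) y) = orb (y + ?rest)" for y
  proof -
    have "orb (u *v y + ?rest) = orb (y + ?rest)" if "u \<in> Wc k" for u
    proof -
      have "u *v y + ?rest = u *v (y + ?rest)" using Wc_rest[OF k that] by (simp add: matrix_vector_right_distrib)
      then show ?thesis using that Wc_W[OF k] orbit_of_act by fastforce
    qed
    then show ?thesis using Wc_one[OF k] by (auto simp: phi_def orbit_of_def[of "Wc k"])
  qed
  have cphi: "continuous_map ?T Xorb phi"
  proof (rule continuous_compose_quotient_map[OF quotient_map_orbit_space])
    have "continuous_map (top_of_set ?Xk) (top_of_set Xreg) (\<lambda>y. y + ?rest)"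
      using fill_in_regular[OF k] by (auto intro!: continuous_intros)
    then have "continuous_map (top_of_set ?Xk) Xorb (orb \<circ> (\<lambda>y. y + ?rest))"
      using quotient_map_orbit_space quotient_imp_continuous_map continuous_map_compose by blast
    then show "continuous_map (top_of_set ?Xk) Xorb (phi \<circ> orbit_of (Wc k))"
      by (simp add: o_def phi_orb)
  qed
  have phif: "phi \<circ> f = orb \<circ> rotation k"
    by (simp add: f_def fun_eq_iff phi_orb rotation_def)
  have fl: "f \<in> loops_at ?T (orbit_of (Wc k) (part k))"
  proof -
    let ?g = "\<lambda>t::real. exp (2 * of_real pi * \<i> * of_real t / of_nat (card (Zc k))) *s part k"
    have "continuous_on {0..1} ?g"
      using Zc_scalars(3)[OF k] by (intro continuous_on_vsmult continuous_intros) auto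
    then have "continuous_map (top_of_set {0..1}) (top_of_set ?Xk) ?g"
      using scaled_part_regular[OF k] by auto
    then have "continuous_map (top_of_set {0..1}) ?T (orbit_of (Wc k) \<circ> ?g)"
      using quotient_map_orbit_space quotient_imp_continuous_map continuous_map_compose by blast
    moreover have "orbit_of (Wc k) \<circ> ?g = f" by (simp add: f_def fun_eq_iff)
    moreover have "f 1 = f 0"
    proof -
      have "f 1 = orbit_of (Wc k) (w *v part k)" using w(2)[OF part(1)[OF k]] by (simp add: f_def root_of_unity_def)
      also have "\<dots> = orbit_of (Wc k) (part k)"
      proof -
        have "\<exists>u\<in>Wc k. v *v part k = u *v (w *v part k)" if v: "v \<in> Wc k" for v
        proof -
          have "winv w \<in> Wc k"
            using subgroup.m_inv_closed[OF component_subgroup[OF k] wW(1)] by (simp add: winv_def)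
          then have "v ** winv w \<in> Wc k" using Wc_mult[OF k v] by blast
          moreover have "v *v part k = (v ** winv w) *v (w *v part k)"
            using wW(2) by (simp add: matrix_vector_mul_assoc[symmetric])
          ultimately show ?thesis by blast
        qed
        moreover have "\<exists>u\<in>Wc k. v *v (w *v part k) = u *v part k" if v: "v \<in> Wc k" for v
          using Wc_mult[OF k v wW(1)] by (auto simp: matrix_vector_mul_assoc)
        ultimately show ?thesis unfolding orbit_of_def by (intro equalityI subsetI) (elim imageE, force)+
      qed
      finally show ?thesis by (simp add: f_def)
    qed
    ultimately show ?thesis by (auto simp: loops_at_def f_def)
  qed
  have cong: "loop_class Xorb (orb x0) (phi \<circ> f') = cls (rotation k)"
    if f': "f' \<in> loop_class ?T (orbit_of (Wc k) (part k)) f" for f'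
  proof -
    let ?y = "orbit_of (Wc k) (part k)"
    have base: "phi ?y = orb x0" by (simp add: phi_orb)
    have hom: "f' \<in> loops_at ?T ?y" "homotopic_with (\<lambda>h. h 0 = ?y \<and> h 1 = ?y) (top_of_set {0..1}) ?T f f'"
      using f' by (auto simp: mem_loop_class loop_homotopy_rel_def)
    have "homotopic_with (\<lambda>h. h 0 = orb x0 \<and> h 1 = orb x0) (top_of_set {0..1}) Xorb (phi \<circ> f) (phi \<circ> f')"
      by (rule homotopic_with_compose_continuous_map_left[OF hom(2) cphi]) (simp add: base)
    moreover have l: "phi \<circ> f \<in> loops_at Xorb (orb x0)" "phi \<circ> f' \<in> loops_at Xorb (orb x0)"
      using fl hom(1) continuous_map_compose[OF _ cphi] base by (auto simp: loops_at_def)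
    ultimately have "(phi \<circ> f, phi \<circ> f') \<in> loop_homotopy_rel Xorb (orb x0)"
      by (simp add: loop_homotopy_rel_def)
    then have "loop_class Xorb (orb x0) (phi \<circ> f) = loop_class Xorb (orb x0) (phi \<circ> f')"
      using loop_class_eq_iff[OF l] by blast
    then show ?thesis by (simp add: cls_def phif)
  qed
  have "component_braid_inclusion W x0 r V k (central_braid (V k) (Wc k) (part k))
      = (\<Union>f'\<in>loop_class ?T (orbit_of (Wc k) (part k)) f. loop_class Xorb (orb x0) (phi \<circ> f'))"
    by (simp add: component_braid_inclusion_def induced_map_def central_braid_def part_def[symmetric]
        phi_def[abs_def] f_def[abs_def])
  also have "\<dots> = cls (rotation k)"
    using cong loop_class_self[OF fl] by auto
  finally show "component_braid_inclusion W x0 r V k (central_braid (V k) (Wc k) (direct_sum_component r V x0 k))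
      = cls (rotation k)" by (simp add: part_def)
qed

end


section \<open>A lattice between two free abelian groups\<close>

text \<open>A group embedded by integer coordinates, in which every coordinate axis contains a nonzero element, is
  free abelian: elements whose last nonzero coordinate is \<open>i\<close>, with that coordinate positive and
  minimal, form a triangular basis, by division with remainder.\<close>

lemma triangular_basis_iso:
  fixes G (structure) and psi :: "'a \<Rightarrow> nat \<Rightarrow> int"
  assumes G: "comm_group G"
    and add: "\<And>x y i. x \<in> carrier G \<Longrightarrow> y \<in> carrier G \<Longrightarrow> i < N \<Longrightarrow> psi (x \<otimes> y) i = psi x i + psi y i"
    and inj: "\<And>x. x \<in> carrier G \<Longrightarrow> (\<forall>i<N. psi x i = 0) \<Longrightarrow> x = \<one>"
    and axes: "\<And>i. i < N \<Longrightarrow> \<exists>x\<in>carrier G. psi x i \<noteq> 0 \<and> (\<forall>j<N. j \<noteq> i \<longrightarrow> psi x j = 0)"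
  shows "\<exists>T. T \<in> iso (free_abelian_of_rank N) G"
proof -
  interpret comm_group G by (rule G)
  have one: "psi \<one> i = 0" if "i < N" for i using add[OF one_closed one_closed that] by simp
  have neg: "psi (inv x) i = - psi x i" if "x \<in> carrier G" "i < N" for x i
    using add[of x "inv x" i] that one by simp
  have npow: "psi (x [^] (n::nat)) i = int n * psi x i" if "x \<in> carrier G" "i < N" for x n i
  proof (induction n)
    case 0
    show ?case using one[OF that(2)] by simp
  next
    case (Suc n)
    have "psi (x [^] Suc n) i = psi (x [^] n) i + psi x i"
      unfolding nat_pow_Suc by (rule add[OF nat_pow_closed[OF that(1)] that])
    then show ?case unfolding Suc by (simp add: distrib_right)
  qed
  have ipow: "psi (x [^] (n::int)) i = n * psi x i" if x: "x \<in> carrier G" "i < N" for x n i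
  proof (cases n rule: int_cases2)
    case (nonneg m)
    show ?thesis unfolding nonneg int_pow_int by (rule npow[OF x])
  next
    case (nonpos m)
    show ?thesis unfolding nonpos int_pow_neg_int[OF x(1)] neg[OF nat_pow_closed[OF x(1)] x(2)] npow[OF x] by simp
  qed
  define Lead where "Lead i x \<longleftrightarrow> x \<in> carrier G \<and> psi x i > 0 \<and> (\<forall>j<N. i < j \<longrightarrow> psi x j = 0)" for i x
  have lead_ex: "\<exists>x. Lead i x" if i: "i < N" for i
  proof -
    obtain x where x: "x \<in> carrier G" "psi x i \<noteq> 0" "\<forall>j<N. j \<noteq> i \<longrightarrow> psi x j = 0" using axes[OF i] by blast
    have "Lead i (if psi x i > 0 then x else inv x)"
      using x i neg[OF x(1)] by (auto simp: Lead_def)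
    then show ?thesis by blast
  qed
  have "\<exists>x. Lead i x \<and> (\<forall>y. Lead i y \<longrightarrow> nat (psi x i) \<le> nat (psi y i))" if i: "i < N" for i
  proof -
    obtain x where "Lead i x" using lead_ex[OF i] by blast
    from ex_has_least_nat[of "Lead i", OF this, of "\<lambda>y. nat (psi y i)"] show ?thesis by blast
  qed
  then have "\<forall>i\<in>{..<N}. \<exists>x. Lead i x \<and> (\<forall>y. Lead i y \<longrightarrow> nat (psi x i) \<le> nat (psi y i))" by blast
  from bchoice[OF this] obtain b where
    b': "\<forall>i\<in>{..<N}. Lead i (b i) \<and> (\<forall>y. Lead i y \<longrightarrow> nat (psi (b i) i) \<le> nat (psi y i))"
    by (rule exE)
  have b: "Lead i (b i)" "Lead i y \<Longrightarrow> nat (psi (b i) i) \<le> nat (psi y i)" if "i < N" for i y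
    using b' that by simp_all
  have bc: "b i \<in> carrier G" "psi (b i) i > 0" "\<And>j. j < N \<Longrightarrow> i < j \<Longrightarrow> psi (b i) j = 0" if "i < N" for i
    using b(1)[OF that] by (auto simp: Lead_def)
  have reduce: "psi (y \<otimes> inv (b i [^] (psi y i div psi (b i) i))) i = 0"
    if i: "i < N" and y: "y \<in> carrier G" "\<And>j. j < N \<Longrightarrow> i < j \<Longrightarrow> psi y j = 0" for i y
  proof -
    let ?y = "y \<otimes> inv (b i [^] (psi y i div psi (b i) i))"
    have yc: "?y \<in> carrier G" using y(1) bc(1)[OF i] by simp
    have co: "psi ?y j = psi y j - (psi y i div psi (b i) i) * psi (b i) j" if "j < N" for j
      using that y(1) bc(1)[OF i] add neg ipow by simp
    then have md: "psi ?y i = psi y i mod psi (b i) i" using i by (simp add: minus_div_mult_eq_mod)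
    show ?thesis
    proof (rule ccontr)
      assume "psi ?y i \<noteq> 0"
      moreover have "psi ?y i \<ge> 0" "psi ?y i < psi (b i) i" unfolding md using bc(2)[OF i] by simp_all
      moreover from calculation have "Lead i ?y" using yc co y(2) bc(3)[OF i] by (auto simp: Lead_def)
      ultimately show False using b(2)[OF i, of ?y] by simp
    qed
  qed
  define T where "T c m = finprod G (\<lambda>i. b i [^] (c i :: int)) {..<m}" for c and m :: nat
  have Tc: "T c m \<in> carrier G" if "m \<le> N" for c m
    unfolding T_def using bc(1) that by (intro finprod_closed) auto
  have TSuc: "T c (Suc m) = b m [^] c m \<otimes> T c m" if "m < N" for c m
    unfolding T_def lessThan_Suc using bc(1) that by (intro finprod_insert) auto
  have psiT: "psi (T c m) j = (\<Sum>i<m. c i * psi (b i) j)" if "m \<le> N" "j < N" for c m j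
    using that(1)
  proof (induction m)
    case 0
    then show ?case using one that by (simp add: T_def)
  next
    case (Suc m)
    then show ?case using TSuc Tc bc(1) add ipow that(2) by simp
  qed
  have surj: "\<exists>c. y = T c m" if "m \<le> N" "y \<in> carrier G" "\<forall>j<N. m \<le> j \<longrightarrow> psi y j = 0" for m y
    using that
  proof (induction m arbitrary: y)
    case 0
    then show ?case using inj[of y] by (simp add: T_def)
  next
    case (Suc m)
    let ?k = "psi y m div psi (b m) m"
    let ?y = "y \<otimes> inv (b m [^] ?k)"
    have m: "m < N" using Suc.prems by simp
    have yc: "?y \<in> carrier G" using Suc.prems bc(1)[OF m] by simp
    have "psi ?y j = 0" if j: "j < N" "m \<le> j" for j
    proof (cases "j = m")
      case True
      then show ?thesis using reduce[OF m Suc.prems(2)] Suc.prems(3) by simp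
    next
      case False
      then have "psi y j = 0" "psi (b m) j = 0" using j Suc.prems(3) bc(3)[OF m] by auto
      then show ?thesis using j Suc.prems(2) bc(1)[OF m] add neg ipow by simp
    qed
    then obtain c where c: "?y = T c m" using Suc.IH[of ?y] yc m by auto
    have "T (c(m := ?k)) m = T c m" unfolding T_def using bc(1) m by (intro finprod_cong') auto
    then have "T (c(m := ?k)) (Suc m) = b m [^] ?k \<otimes> (y \<otimes> inv (b m [^] ?k))" using TSuc[OF m] c by simp
    also have "\<dots> = y" using Suc.prems(2) bc(1)[OF m] by (simp add: m_lcomm)
    finally show ?case by metis
  qed
  let ?F = "free_abelian_of_rank N"
  have "(\<lambda>c. T c N) \<in> iso ?F G"
  proof (rule isoI)
    show "(\<lambda>c. T c N) \<in> hom ?F G"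
    proof (rule homI)
      show "T c N \<in> carrier G" for c using Tc by simp
      fix c d :: "nat \<Rightarrow> int"
      have "T (c \<otimes>\<^bsub>?F\<^esub> d) N = finprod G (\<lambda>i. b i [^] c i \<otimes> b i [^] d i) {..<N}"
        unfolding T_def using bc(1) by (intro finprod_cong') (auto simp: free_abelian_of_rank_def int_pow_mult)
      also have "\<dots> = T c N \<otimes> T d N" unfolding T_def using bc(1) by (intro finprod_multf) auto
      finally show "T (c \<otimes>\<^bsub>?F\<^esub> d) N = T c N \<otimes> T d N" .
    qed
    have "inj_on (\<lambda>c. T c N) (carrier ?F)"
    proof (rule inj_onI, rule ccontr)
      fix c d assume c: "c \<in> carrier ?F" and d: "d \<in> carrier ?F" and eq: "T c N = T d N" and ne: "c \<noteq> d"
      let ?D = "{i. i < N \<and> c i \<noteq> d i}"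
      have ne_D: "?D \<noteq> {}"
      proof
        assume "?D = {}"
        then have "c = d" using c d by (intro extensionalityI[of _ "{..<N}"]) (auto simp: free_abelian_of_rank_def PiE_iff)
        then show False using ne by simp
      qed
      have fin_D: "finite ?D" by simp
      define k where "k = Max ?D"
      have "k \<in> ?D" unfolding k_def by (rule Max_in[OF fin_D ne_D])
      moreover have "c i = d i" if "i < N" "k < i" for i
      proof (rule ccontr)
        assume "c i \<noteq> d i"
        then have "i \<le> k" unfolding k_def using that by (intro Max_ge[OF fin_D]) simp
        then show False using that by simp
      qed
      ultimately have k: "k < N" "c k \<noteq> d k" "\<And>i. i < N \<Longrightarrow> k < i \<Longrightarrow> c i = d i" by simp_all
      have "(\<Sum>i<N. c i * psi (b i) k) = (\<Sum>i<N. d i * psi (b i) k)"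
        using psiT[of N k c] psiT[of N k d] eq k(1) by simp
      then have "(\<Sum>i<N. (c i - d i) * psi (b i) k) = 0" by (simp add: left_diff_distrib sum_subtractf)
      moreover have "(\<Sum>i<N. (c i - d i) * psi (b i) k) = (\<Sum>i\<in>{k}. (c i - d i) * psi (b i) k)"
      proof (rule sum.mono_neutral_right)
        show "\<forall>i\<in>{..<N} - {k}. (c i - d i) * psi (b i) k = 0"
        proof
          fix i assume i: "i \<in> {..<N} - {k}"
          then consider "i < k" "i < N" | "k < i" "i < N" by force
          then show "(c i - d i) * psi (b i) k = 0" using k bc(3) by cases auto
        qed
      qed (use k in auto)
      ultimately show False using k bc(2)[OF k(1)] by simp
    qed
    moreover have "(\<lambda>c. T c N) ` carrier ?F = carrier G"
    proof
      show "(\<lambda>c. T c N) ` carrier ?F \<subseteq> carrier G" using Tc by auto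
      show "carrier G \<subseteq> (\<lambda>c. T c N) ` carrier ?F"
      proof
        fix y assume "y \<in> carrier G"
        then obtain c where c: "y = T c N" using surj[of N y] by auto
        have "T (restrict c {..<N}) N = T c N" unfolding T_def using bc(1) by (intro finprod_cong') auto
        moreover have "restrict c {..<N} \<in> carrier ?F" by (auto simp: free_abelian_of_rank_def)
        ultimately show "y \<in> (\<lambda>c. T c N) ` carrier ?F" using c by (metis image_eqI)
      qed
    qed
    ultimately show "bij_betw (\<lambda>c. T c N) (carrier ?F) (carrier G)" by (simp add: bij_betw_def)
  qed
  then show ?thesis by blast
qed

section \<open>The center of the reflection group\<close>

context reflection_group
begin

abbreviation "ZW \<equiv> group_center (matrix_group W)"

lemma ZW_iff: "z \<in> ZW \<longleftrightarrow> z \<in> W \<and> (\<forall>w\<in>W. z ** w = w ** z)"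
  by (auto simp: group_center_def)

lemma ZW_W: "z \<in> ZW \<Longrightarrow> z \<in> W"
  by (simp add: group_center_def)

lemma ZW_normal: "ZW \<lhd> matrix_group W"
proof -
  interpret M: group "matrix_group W" by (rule group_W)
  have inv_c: "winv z \<in> ZW" if "z \<in> ZW" for z
  proof -
    have "winv z ** w = w ** winv z" if w: "w \<in> W" for w
    proof -
      have "winv z ** w = winv z ** (w ** (z ** winv z))" using \<open>z \<in> ZW\<close> by (simp add: ZW_iff)
      also have "\<dots> = winv z ** ((w ** z) ** winv z)" by (simp add: matrix_mul_assoc)
      also have "\<dots> = winv z ** ((z ** w) ** winv z)" using \<open>z \<in> ZW\<close> w by (simp add: ZW_iff)
      also have "\<dots> = (winv z ** z) ** (w ** winv z)" by (simp add: matrix_mul_assoc)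
      also have "\<dots> = w ** winv z" using \<open>z \<in> ZW\<close> by (simp add: ZW_iff)
      finally show ?thesis .
    qed
    then show ?thesis using that by (simp add: ZW_iff)
  qed
  have mult_c: "y ** z \<in> ZW" if yz: "y \<in> ZW" "z \<in> ZW" for y z
  proof -
    have "(y ** z) ** w = w ** (y ** z)" if w: "w \<in> W" for w
    proof -
      have c: "y ** w = w ** y" "z ** w = w ** z"
        by (rule bspec[OF conjunct2[OF iffD1[OF ZW_iff yz(1)]] w],
            rule bspec[OF conjunct2[OF iffD1[OF ZW_iff yz(2)]] w])
      have "(y ** z) ** w = y ** (z ** w)" by (rule matrix_mul_assoc[symmetric])
      also have "\<dots> = (y ** w) ** z" unfolding c(2) by (rule matrix_mul_assoc)
      also have "\<dots> = w ** (y ** z)" unfolding c(1) by (rule matrix_mul_assoc[symmetric])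
      finally show ?thesis .
    qed
    moreover have "y ** z \<in> W"
      using yz[THEN ZW_W] by (rule mult_W)
    ultimately show ?thesis unfolding ZW_iff by blast
  qed
  have "mat 1 \<in> ZW" by (simp add: ZW_iff)
  have "subgroup ZW (matrix_group W)"
  proof (rule M.subgroupI)
    show "ZW \<subseteq> carrier (matrix_group W)" using ZW_W by auto
    show "ZW \<noteq> {}" using \<open>mat 1 \<in> ZW\<close> by blast
    show "inv\<^bsub>matrix_group W\<^esub> z \<in> ZW" if "z \<in> ZW" for z using inv_c[OF that] by (simp add: winv_def)
    show "y \<otimes>\<^bsub>matrix_group W\<^esub> z \<in> ZW" if "y \<in> ZW" "z \<in> ZW" for y z using mult_c[OF that] by simp
  qed
  moreover have "x ** z ** winv x \<in> ZW" if "x \<in> W" "z \<in> ZW" for x z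
  proof -
    have "x ** z ** winv x = (z ** x) ** winv x" using that by (simp add: ZW_iff)
    also have "\<dots> = z" using that by (simp add: matrix_mul_assoc[symmetric])
    finally show ?thesis using that by simp
  qed
  ultimately show ?thesis unfolding M.normal_inv_iff by (simp add: winv_def[symmetric])
qed

lemma shear_trivial:
  assumes w: "w \<in> W" and shear: "\<And>n. (w [^]\<^bsub>matrix_group W\<^esub> (n::nat)) *v x = x + of_nat n *s u"
  shows "u = 0"
proof -
  interpret M: group "matrix_group W" by (rule group_W)
  have "w [^]\<^bsub>matrix_group W\<^esub> card W = mat 1" using M.pow_order_eq_1[of w] w by (simp add: order_def)
  then have "of_nat (card W) *s u = 0" using shear[of "card W"] by simp
  then have "(1 / of_nat (card W)) *s (of_nat (card W) *s u) = 0" by (simp only: vec.scale_zero_right)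
  then show ?thesis using W_nonempty by (simp add: card_eq_0_iff)
qed

lemma pow_Suc_act: "(w [^]\<^bsub>matrix_group W\<^esub> Suc n) *v x = (w [^]\<^bsub>matrix_group W\<^esub> n) *v (w *v x)"
  by (simp add: matrix_vector_mul_assoc)

text \<open>If \<open>w\<close> maps the hyperplane of the reflection \<open>s\<close> to itself then \<open>s\<close> and \<open>w s w\<inverse>\<close> are reflections of
  the same hyperplane with the same determinant, so they differ by a transvection; in a finite group
  a transvection is trivial.\<close>

lemma commutes_with_reflection:
  assumes w: "w \<in> W" and s: "s \<in> W" "is_reflection s" and stable: "(*v) w ` {v. (s - mat 1) *v v = 0} = {v. (s - mat 1) *v v = 0}"
  shows "w ** s = s ** w"
proof -
  obtain a b where ab: "a \<noteq> 0" "\<And>v. s *v v = v + form a v *s b" "{v. (s - mat 1) *v v = 0} = {v. form a v = 0}"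
    using reflection_form[OF s(2)] by metis
  obtain e where e: "form a e = 1" using form_nonzero[OF ab(1)] by blast
  define t where "t = w ** s ** winv w"
  have tW: "t \<in> W" using w s by (simp add: t_def)
  have inv_fix: "form a (winv w *v v) = 0" if "form a v = 0" for v
  proof -
    have "v \<in> (*v) w ` {v. form a v = 0}" using stable that unfolding ab(3) by simp
    then obtain u where "form a u = 0" "v = w *v u" by blast
    then show ?thesis using w by simp
  qed
  define k where "k = form a (winv w *v e)"
  have k: "form a (winv w *v v) = k * form a v" for v
    using inv_fix[of "v - form a v *s e"] e
    by (simp add: k_def matrix_vector_mult_diff_distrib vector_scalar_commute)
  define c where "c = k *s (w *v b) - b"
  have t: "t *v v = s *v v + form a v *s c" for v
  proof -
    have "t *v v = v + (k * form a v) *s (w *v b)"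
      using w by (simp add: t_def matrix_vector_mul_assoc[symmetric] ab(2) k matrix_vector_right_distrib vector_scalar_commute)
    then show ?thesis by (simp add: ab(2) c_def vec.scale_right_diff_distrib mult.commute)
  qed
  have ac: "form a c = 0" using k[of "w *v b"] w by (simp add: c_def)
  then have sc: "s *v c = c" using ab(2)[of c] by simp
  then have sc': "winv s *v c = c" using winv_vec(1)[OF s(1), of c] by simp
  define q where "q = winv s ** t"
  have q: "q *v v = v + form a v *s c" for v
    using s(1) sc' by (simp add: q_def t matrix_vector_mul_assoc[symmetric] matrix_vector_right_distrib vector_scalar_commute)
  have "(q [^]\<^bsub>matrix_group W\<^esub> (n::nat)) *v v = v + of_nat n *s (form a v *s c)" for n v
  proof (induction n arbitrary: v)
    case (Suc n)
    show ?case unfolding pow_Suc_act Suc using ac by (simp add: q vec.scale_left_distrib ring_distribs)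
  qed simp
  then have "form a e *s c = 0" using tW s by (intro shear_trivial[of q e]) (auto simp: q_def)
  then have "c = 0" using e by simp
  then have "t = s" using t by (simp add: matrix_eq)
  then have "t ** w = s ** w" by simp
  then show ?thesis using w by (simp add: t_def matrix_mul_assoc[symmetric])
qed

lemma central_iff_fixes_hyperplanes:
  assumes w: "w \<in> W"
  shows "w \<in> ZW \<longleftrightarrow> (\<forall>H\<in>reflecting_hyperplanes W. (*v) w ` H = H)"
proof
  assume z: "w \<in> ZW"
  show "\<forall>H\<in>reflecting_hyperplanes W. (*v) w ` H = H"
  proof
    fix H assume "H \<in> reflecting_hyperplanes W"
    then obtain s where s: "s \<in> W" "H = {v. (s - mat 1) *v v = 0}" by (auto simp: reflecting_hyperplanes_def)
    have H: "v \<in> H \<longleftrightarrow> s *v v = v" for v by (simp add: s(2) matrix_vector_mult_diff_rdistrib)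
    have com: "s *v (w *v v) = w *v (s *v v)" for v using z s(1) by (simp add: ZW_iff matrix_vector_mul_assoc)
    have wH: "w *v v \<in> H \<longleftrightarrow> v \<in> H" for v unfolding H com using W_inj[OF w] by simp
    show "(*v) w ` H = H"
    proof
      show "(*v) w ` H \<subseteq> H" using wH by blast
      show "H \<subseteq> (*v) w ` H"
      proof
        fix v assume v: "v \<in> H"
        show "v \<in> (*v) w ` H"
          using wH[of "winv w *v v"] w v by (intro image_eqI[of _ _ "winv w *v v"]) auto
      qed
    qed
  qed
next
  assume stable: "\<forall>H\<in>reflecting_hyperplanes W. (*v) w ` H = H"
  have "W \<subseteq> {u. w ** u = u ** w}"
  proof (rule reflection_generated)
    show "s \<in> {u. w ** u = u ** w}" if "s \<in> W" "is_reflection s" for s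
    proof -
      have "{v. (s - mat 1) *v v = 0} \<in> reflecting_hyperplanes W" using that by (auto simp: reflecting_hyperplanes_def)
      from bspec[OF stable this] have "w ** s = s ** w" by (rule commutes_with_reflection[OF w that])
      then show ?thesis by (rule CollectI)
    qed
    show "u ** v \<in> {u. w ** u = u ** w}" if "u \<in> {u. w ** u = u ** w}" "v \<in> {u. w ** u = u ** w}" for u v
    proof -
      have "w ** (u ** v) = u ** w ** v" using that by (simp add: matrix_mul_assoc)
      also have "\<dots> = u ** (v ** w)" using that by (simp add: matrix_mul_assoc[symmetric])
      finally show ?thesis by (simp add: matrix_mul_assoc)
    qed
  qed simp
  then show "w \<in> ZW" using w by (auto simp: ZW_iff)
qed

end


section \<open>The quotient of the braid group by the commutators of the pure braid group\<close>

context base_point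
begin

abbreviation "N0 \<equiv> pure_commutator W x0"
abbreviation "Gam \<equiv> braid_mod_pure_commutator W x0"
abbreviation "q \<equiv> braid_to_quotient W x0"

definition moved :: "(real \<Rightarrow> (complex^'n) set) set \<Rightarrow> (complex^'n) set \<Rightarrow> (complex^'n) set" where
  "moved b H = (*v) (winv (to_W b)) ` H"

lemma to_W_carrier [simp]: "b \<in> carrier B \<Longrightarrow> to_W b \<in> W"
  using hom_in_carrier[OF to_W_hom] by simp

lemma to_W_mult [simp]: "b \<in> carrier B \<Longrightarrow> c \<in> carrier B \<Longrightarrow> to_W (b \<otimes>\<^bsub>B\<^esub> c) = to_W b ** to_W c"
  using hom_mult[OF to_W_hom] by simp

lemma to_W_one [simp]: "to_W \<one>\<^bsub>B\<^esub> = mat 1"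
  using hom_one[OF to_W_hom group_B group_W] by simp

lemma to_W_inv [simp]: "b \<in> carrier B \<Longrightarrow> to_W (inv\<^bsub>B\<^esub> b) = winv (to_W b)"
proof -
  assume b: "b \<in> carrier B"
  interpret BG: group B by (rule group_B)
  have "to_W (inv\<^bsub>B\<^esub> b) ** to_W b = mat 1" using to_W_mult[of "inv\<^bsub>B\<^esub> b" b] b by simp
  then show ?thesis using winv_unique[OF to_W_carrier[OF b]] by simp
qed

lemma moved [simp]: "H \<in> HH \<Longrightarrow> b \<in> carrier B \<Longrightarrow> moved b H \<in> HH"
  using braid_wind_mult(2) by (simp add: moved_def)

lemma wind_mult: "H \<in> HH \<Longrightarrow> b \<in> carrier B \<Longrightarrow> c \<in> carrier B \<Longrightarrow>
    braid_wind H (b \<otimes>\<^bsub>B\<^esub> c) = braid_wind H b + braid_wind (moved b H) c"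
  using braid_wind_mult(1) by (simp add: moved_def)

lemma moved_pure: "to_W b = mat 1 \<Longrightarrow> moved b H = H"
  by (simp add: moved_def)

lemma wind_one [simp]: "H \<in> HH \<Longrightarrow> braid_wind H \<one>\<^bsub>B\<^esub> = 0"
proof -
  assume H: "H \<in> HH"
  interpret BG: group B by (rule group_B)
  show ?thesis using wind_mult[OF H, of "\<one>\<^bsub>B\<^esub>" "\<one>\<^bsub>B\<^esub>"] by (simp add: moved_pure)
qed

lemma N0_iff: "b \<in> N0 \<longleftrightarrow> b \<in> carrier B \<and> to_W b = mat 1 \<and> (\<forall>H\<in>HH. braid_wind H b = 0)"
proof
  assume "b \<in> N0"
  then obtain x where x: "x \<in> derived P (carrier P)" "b = pure_to_braid W x0 x" by (auto simp: pure_commutator_def)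
  interpret PG: group P by (rule group_P)
  have xP: "x \<in> carrier P" using x(1) PG.derived_in_carrier[of "carrier P"] by blast
  have z: "\<forall>H\<in>HH. pure_wind H x = 0" using derived_P_iff[OF xP] x(1) by blast
  have "braid_wind H b = 0" if "H \<in> HH" for H
    using pure_wind[OF that xP] z that x(2) by simp
  then show "b \<in> carrier B \<and> to_W b = mat 1 \<and> (\<forall>H\<in>HH. braid_wind H b = 0)"
    using to_W_pure[OF xP] x(2) by simp
next
  assume b: "b \<in> carrier B \<and> to_W b = mat 1 \<and> (\<forall>H\<in>HH. braid_wind H b = 0)"
  then have "b \<in> pure_to_braid W x0 ` carrier P" unfolding pure_to_braid_image by (simp add: kernel_def)
  then obtain x where x: "x \<in> carrier P" "b = pure_to_braid W x0 x" by blast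
  have "pure_wind H x = 0" if "H \<in> HH" for H
    using pure_wind[OF that x(1)] b that x(2) by simp
  then have "x \<in> derived P (carrier P)" using derived_P_iff[OF x(1)] by blast
  then show "b \<in> N0" using x(2) by (simp add: pure_commutator_def)
qed

lemma N0_normal: "N0 \<lhd> B"
proof -
  interpret BG: group B by (rule group_B)
  have w_inv: "braid_wind (moved b H) (inv\<^bsub>B\<^esub> b) = - braid_wind H b" if "H \<in> HH" "b \<in> carrier B" for H b
    using wind_mult[OF that, of "inv\<^bsub>B\<^esub> b"] that by (simp add: add_eq_0_iff)
  have sub: "subgroup N0 B"
  proof (rule BG.subgroupI)
    show "N0 \<subseteq> carrier B" by (auto simp: N0_iff)
    show "N0 \<noteq> {}" using N0_iff[of "\<one>\<^bsub>B\<^esub>"] by auto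
    show "inv\<^bsub>B\<^esub> a \<in> N0" if "a \<in> N0" for a
    proof -
      have a: "a \<in> carrier B" "to_W a = mat 1" "\<And>H. H \<in> HH \<Longrightarrow> braid_wind H a = 0" using that by (auto simp: N0_iff)
      show ?thesis unfolding N0_iff using a w_inv[OF _ a(1)] by (simp add: moved_pure)
    qed
    show "a \<otimes>\<^bsub>B\<^esub> b \<in> N0" if "a \<in> N0" "b \<in> N0" for a b
      using that by (simp add: N0_iff wind_mult moved_pure)
  qed
  moreover have "c \<otimes>\<^bsub>B\<^esub> a \<otimes>\<^bsub>B\<^esub> inv\<^bsub>B\<^esub> c \<in> N0" if c: "c \<in> carrier B" and "a \<in> N0" for c a
  proof -
    have a: "a \<in> carrier B" "to_W a = mat 1" "\<And>H. H \<in> HH \<Longrightarrow> braid_wind H a = 0" using that by (auto simp: N0_iff)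
    have "braid_wind H (c \<otimes>\<^bsub>B\<^esub> (a \<otimes>\<^bsub>B\<^esub> inv\<^bsub>B\<^esub> c)) = 0" if H: "H \<in> HH" for H
      using H a c w_inv[OF H c] by (simp add: wind_mult moved_pure)
    then show ?thesis unfolding N0_iff using a c by (simp add: BG.m_assoc)
  qed
  ultimately show ?thesis unfolding BG.normal_inv_iff by blast
qed

lemma group_Gam: "group Gam"
  unfolding braid_mod_pure_commutator_def by (rule normal.factorgroup_is_group[OF N0_normal])

lemma q_hom: "q \<in> hom B Gam"
  unfolding braid_mod_pure_commutator_def braid_to_quotient_def[abs_def]
  by (rule normal.r_coset_hom_Mod[OF N0_normal])

lemma q_mult: "b \<in> carrier B \<Longrightarrow> c \<in> carrier B \<Longrightarrow> q (b \<otimes>\<^bsub>B\<^esub> c) = q b \<otimes>\<^bsub>Gam\<^esub> q c"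
  by (rule hom_mult[OF q_hom])

lemma carrier_Gam: "carrier Gam = q ` carrier B"
  by (simp add: braid_mod_pure_commutator_def braid_to_quotient_def[abs_def] carrier_FactGroup)

lemma one_Gam: "\<one>\<^bsub>Gam\<^esub> = N0"
  by (simp add: braid_mod_pure_commutator_def)

lemma q_one_iff: "b \<in> carrier B \<Longrightarrow> q b = \<one>\<^bsub>Gam\<^esub> \<longleftrightarrow> b \<in> N0"
  unfolding one_Gam braid_to_quotient_def
  using group.coset_join1[OF group_B] group.coset_join2[OF group_B] normal_imp_subgroup[OF N0_normal] by blast

lemma q_eqI:
  assumes bc: "b \<in> carrier B" "c \<in> carrier B" and n: "b \<otimes>\<^bsub>B\<^esub> inv\<^bsub>B\<^esub> c \<in> N0"
  shows "q b = q c"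
proof -
  interpret BG: group B by (rule group_B)
  interpret GG: group Gam by (rule group_Gam)
  have "q b = q ((b \<otimes>\<^bsub>B\<^esub> inv\<^bsub>B\<^esub> c) \<otimes>\<^bsub>B\<^esub> c)" using bc by (simp add: BG.m_assoc)
  also have "\<dots> = q (b \<otimes>\<^bsub>B\<^esub> inv\<^bsub>B\<^esub> c) \<otimes>\<^bsub>Gam\<^esub> q c" using bc by (intro q_mult) auto
  also have "q (b \<otimes>\<^bsub>B\<^esub> inv\<^bsub>B\<^esub> c) = \<one>\<^bsub>Gam\<^esub>" using q_one_iff bc n by simp
  also have "\<one>\<^bsub>Gam\<^esub> \<otimes>\<^bsub>Gam\<^esub> q c = q c" using hom_in_carrier[OF q_hom bc(2)] by simp
  finally show ?thesis .
qed

lemma q_mem: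
  assumes b: "b \<in> carrier B" and c: "c \<in> q b"
  shows "c \<in> carrier B" "to_W c = to_W b" "H \<in> HH \<Longrightarrow> braid_wind H c = braid_wind H b"
proof -
  interpret BG: group B by (rule group_B)
  obtain n where n: "n \<in> N0" "c = n \<otimes>\<^bsub>B\<^esub> b" using c by (auto simp: braid_to_quotient_def r_coset_def)
  then show "c \<in> carrier B" "to_W c = to_W b" "H \<in> HH \<Longrightarrow> braid_wind H c = braid_wind H b"
    using b by (auto simp: N0_iff wind_mult moved_pure)
qed

lemma q_self: "b \<in> carrier B \<Longrightarrow> b \<in> q b"
  unfolding braid_to_quotient_def
  by (rule group.rcos_self[OF group_B _ normal_imp_subgroup[OF N0_normal]])

definition coset_wind :: "(complex^'n) set \<Rightarrow> (real \<Rightarrow> (complex^'n) set) set set \<Rightarrow> complex" where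
  "coset_wind H x = braid_wind H (SOME b. b \<in> x)"

lemma coset_wind: "b \<in> carrier B \<Longrightarrow> H \<in> HH \<Longrightarrow> coset_wind H (q b) = braid_wind H b"
proof -
  assume b: "b \<in> carrier B" and H: "H \<in> HH"
  have "(SOME c. c \<in> q b) \<in> q b" by (rule someI[of "\<lambda>c. c \<in> q b", OF q_self[OF b]])
  then show ?thesis unfolding coset_wind_def by (rule q_mem(3)[OF b _ H])
qed

lemma projection_q: "b \<in> carrier B \<Longrightarrow> quotient_projection W x0 (q b) = ZW #>\<^bsub>matrix_group W\<^esub> to_W b"
proof -
  assume b: "b \<in> carrier B"
  have "to_W ` q b = {to_W b}"
  proof (intro equalityI subsetI)
    fix w assume "w \<in> to_W ` q b"
    then obtain c where c: "w = to_W c" "c \<in> q b" by (rule imageE)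
    show "w \<in> {to_W b}" unfolding c(1) q_mem(2)[OF b c(2)] by (rule singletonI)
  next
    fix w assume "w \<in> {to_W b}"
    then have "w = to_W b" by (rule singletonD)
    then show "w \<in> to_W ` q b" by (rule image_eqI[OF _ q_self[OF b]])
  qed
  then show ?thesis by (simp add: quotient_projection_def to_W_def[symmetric])
qed

lemma projection_epi: "quotient_projection W x0 \<in> epi Gam (central_quotient W)"
proof -
  interpret BG: group B by (rule group_B)
  let ?p = "quotient_projection W x0"
  have h: "(\<lambda>w. ZW #>\<^bsub>matrix_group W\<^esub> w) \<in> hom (matrix_group W) (central_quotient W)"
    unfolding central_quotient_def by (rule normal.r_coset_hom_Mod[OF ZW_normal])
  have c: "carrier (central_quotient W) = (\<lambda>w. ZW #>\<^bsub>matrix_group W\<^esub> w) ` W"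
    by (simp add: central_quotient_def carrier_FactGroup)
  have "?p \<in> hom Gam (central_quotient W)"
  proof (rule homI)
    show "?p x \<in> carrier (central_quotient W)" if "x \<in> carrier Gam" for x
      using that by (auto simp: carrier_Gam projection_q c)
    show "?p (x \<otimes>\<^bsub>Gam\<^esub> y) = ?p x \<otimes>\<^bsub>central_quotient W\<^esub> ?p y" if xy: "x \<in> carrier Gam" "y \<in> carrier Gam" for x y
    proof -
      obtain b b' where b: "b \<in> carrier B" "x = q b" "b' \<in> carrier B" "y = q b'" using xy by (auto simp: carrier_Gam)
      have "?p (x \<otimes>\<^bsub>Gam\<^esub> y) = ZW #>\<^bsub>matrix_group W\<^esub> (to_W b ** to_W b')"
        using b projection_q[of "b \<otimes>\<^bsub>B\<^esub> b'"] by (simp add: q_mult)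
      also have "\<dots> = ?p x \<otimes>\<^bsub>central_quotient W\<^esub> ?p y"
        using hom_mult[OF h, of "to_W b" "to_W b'"] b by (simp add: projection_q)
      finally show ?thesis .
    qed
  qed
  moreover have "?p ` carrier Gam = carrier (central_quotient W)"
  proof -
    have "to_W ` carrier B = W"
    proof
      show "to_W ` carrier B \<subseteq> W" by auto
      show "W \<subseteq> to_W ` carrier B"
      proof
        fix w assume "w \<in> W"
        then obtain g where g: "g \<in> lifts" "end_elt g = w" using to_W_surj by blast
        show "w \<in> to_W ` carrier B"
          using to_W_cls[OF g(1)] cls_carrier[OF g(1)] g(2) by (intro image_eqI[of _ _ "cls g"]) simp_all
      qed
    qed
    then have "(\<lambda>w. ZW #>\<^bsub>matrix_group W\<^esub> w) ` to_W ` carrier B = carrier (central_quotient W)" by (simp add: c)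
    then show ?thesis by (simp add: carrier_Gam image_image projection_q)
  qed
  ultimately show ?thesis by (simp add: epi_def)
qed

definition K0 :: "(real \<Rightarrow> (complex^'n) set) set set" where
  "K0 = {b \<in> carrier B. to_W b \<in> ZW}"

abbreviation "Ker \<equiv> kernel Gam (central_quotient W) (quotient_projection W x0)"

lemma Ker_eq: "Ker = q ` K0"
proof -
  have eq: "ZW #>\<^bsub>matrix_group W\<^esub> w = ZW \<longleftrightarrow> w \<in> ZW" if "w \<in> W" for w
    using group.coset_join1[OF group_W] group.coset_join2[OF group_W] normal_imp_subgroup[OF ZW_normal] that
    by fastforce
  have "q b \<in> Ker \<longleftrightarrow> b \<in> K0" if b: "b \<in> carrier B" for b
    using b eq[OF to_W_carrier[OF b]] by (simp add: kernel_def K0_def carrier_Gam projection_q central_quotient_def)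
  moreover have "Ker \<subseteq> q ` carrier B" unfolding kernel_def carrier_Gam by blast
  moreover have "K0 \<subseteq> carrier B" unfolding K0_def by blast
  ultimately show ?thesis by blast
qed

lemma subgroup_Ker: "subgroup Ker Gam"
proof -
  have "group (central_quotient W)"
    unfolding central_quotient_def by (rule normal.factorgroup_is_group[OF ZW_normal])
  then have "group_hom Gam (central_quotient W) (quotient_projection W x0)"
    using group_Gam projection_epi by (auto simp: group_hom_def group_hom_axioms_def epi_def)
  then show ?thesis by (rule group_hom.subgroup_kernel)
qed

lemma moved_central_iff:
  assumes b: "b \<in> carrier B"
  shows "b \<in> K0 \<longleftrightarrow> (\<forall>H\<in>HH. moved b H = H)"
proof -
  have "winv (to_W b) \<in> ZW \<longleftrightarrow> to_W b \<in> ZW"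
  proof
    have sg: "subgroup ZW (matrix_group W)" using ZW_normal by (rule normal_imp_subgroup)
    show "winv (to_W b) \<in> ZW" if "to_W b \<in> ZW"
      using subgroup.m_inv_closed[OF sg that] by (simp add: winv_def)
    show "to_W b \<in> ZW" if "winv (to_W b) \<in> ZW"
      using subgroup.m_inv_closed[OF sg that] b by (simp add: winv_def[symmetric])
  qed
  then show ?thesis
    using central_iff_fixes_hyperplanes[of "winv (to_W b)"] b by (simp add: K0_def moved_def)
qed

lemma wind_K0: "b \<in> K0 \<Longrightarrow> c \<in> carrier B \<Longrightarrow> H \<in> HH \<Longrightarrow> braid_wind H (b \<otimes>\<^bsub>B\<^esub> c) = braid_wind H b + braid_wind H c"
proof -
  assume b: "b \<in> K0" and c: "c \<in> carrier B" and H: "H \<in> HH"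
  have bB: "b \<in> carrier B" using b by (simp add: K0_def)
  have "moved b H = H" using moved_central_iff[OF bB] b H by blast
  then show ?thesis using wind_mult[OF H bB c] by simp
qed

text \<open>A braid without winding ends where all forms take the values that they take at the base point; the
  difference of its end points is fixed by every reflection, and the finite order of the end element
  makes it vanish.\<close>

lemma wind_zero_N0:
  assumes b: "b \<in> carrier B" and z: "\<And>H. H \<in> HH \<Longrightarrow> braid_wind H b = 0"
  shows "b \<in> N0"
proof -
  obtain g where g: "g \<in> lifts" "b = cls g" using b by (rule carrierE)
  define w where "w = end_elt g"
  have w: "w \<in> W" "pathfinish g = w *v x0" "to_W b = w" using end_elt g by (auto simp: w_def to_W_cls)
  define u where "u = w *v x0 - x0"
  have uH: "form (al H) u = 0" if H: "H \<in> HH" for H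
    using wind_exp[OF H liftsD(1,2)[OF g(1)]] z[OF H] braid_wind_cls[OF H g(1)] g(2) w(2) liftsD(3)[OF g(1)]
    by (simp add: u_def)
  have "W \<subseteq> {v. v *v u = u}"
  proof (rule reflection_generated)
    show "s \<in> {v. v *v u = u}" if s: "s \<in> W" "is_reflection s" for s
    proof -
      let ?H = "{v. (s - mat 1) *v v = 0}"
      have H: "?H \<in> HH" using s by (auto simp: reflecting_hyperplanes_def)
      then have "u \<in> ?H" using al(2)[OF H] uH by blast
      then show ?thesis by (simp add: matrix_vector_mult_diff_rdistrib)
    qed
  qed (auto simp: matrix_vector_mul_assoc[symmetric])
  then have wu: "w *v u = u" using w by blast
  have "(w [^]\<^bsub>matrix_group W\<^esub> (n::nat)) *v x0 = x0 + of_nat n *s u" for n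
  proof (induction n)
    case (Suc n)
    have wn: "(w [^]\<^bsub>matrix_group W\<^esub> m) *v u = u" for m :: nat
    proof (induction m)
      case (Suc m)
      then show ?case unfolding pow_Suc_act wu by simp
    qed simp
    have "w *v x0 = x0 + u" by (simp add: u_def)
    then show ?case unfolding pow_Suc_act using Suc wn
      by (simp add: matrix_vector_right_distrib vec.scale_left_distrib add_ac)
  qed simp
  then have "u = 0" by (rule shear_trivial[OF w(1)])
  then have "w = mat 1" using W_free[OF x0 w(1) one_W] by (simp add: u_def)
  then show ?thesis using b w z by (simp add: N0_iff)
qed

lemma wind_integral:
  assumes b: "b \<in> K0" and H: "H \<in> HH"
  shows "of_nat (card W) * braid_wind H b \<in> \<int>"
proof -
  interpret BG: group B by (rule group_B)
  interpret M: group "matrix_group W" by (rule group_W)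
  have bB: "b \<in> carrier B" using b by (simp add: K0_def)
  let ?c = "b [^]\<^bsub>B\<^esub> card W"
  have pw: "braid_wind H (b [^]\<^bsub>B\<^esub> n) = of_nat n * braid_wind H b \<and> to_W (b [^]\<^bsub>B\<^esub> n) = to_W b [^]\<^bsub>matrix_group W\<^esub> n" for n :: nat
  proof (induction n)
    case (Suc n)
    have "b [^]\<^bsub>B\<^esub> Suc n = b \<otimes>\<^bsub>B\<^esub> b [^]\<^bsub>B\<^esub> n" using bB by (rule BG.nat_pow_Suc2)
    moreover have "to_W b [^]\<^bsub>matrix_group W\<^esub> Suc n = to_W b ** to_W b [^]\<^bsub>matrix_group W\<^esub> n"
      using M.nat_pow_Suc2[of "to_W b" n] bB by simp
    ultimately show ?case using Suc wind_K0[OF b _ H] bB by (simp add: distrib_right del: nat_pow_Suc)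
  qed (use H in simp)
  have "to_W ?c = mat 1"
    using pw M.pow_order_eq_1[of "to_W b"] bB by (simp add: order_def)
  then have "?c \<in> pure_to_braid W x0 ` carrier P" unfolding pure_to_braid_image using bB by (simp add: kernel_def)
  then obtain x where x: "x \<in> carrier P" "?c = pure_to_braid W x0 x" by blast
  have "braid_wind H ?c \<in> \<int>" using pure_wind[OF H x(1)] x(2) by (metis Ints_of_int)
  then show ?thesis using pw by simp
qed

lemma meridian_braid:
  assumes "H \<in> HH"
  shows "cls (meridian H) \<in> K0" "H' \<in> HH \<Longrightarrow> braid_wind H' (cls (meridian H)) = (if H' = H then 1 else 0)"
proof -
  have l: "meridian H \<in> lifts" "end_elt (meridian H) = mat 1" using meridian_loops[OF assms] loops_lifts by auto
  show "cls (meridian H) \<in> K0" using l by (simp add: K0_def to_W_cls ZW_iff)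
  show "H' \<in> HH \<Longrightarrow> braid_wind H' (cls (meridian H)) = (if H' = H then 1 else 0)"
    using braid_wind_cls[OF _ l(1)] wind_meridian[OF assms] by simp
qed

lemma K0_mult: "b \<in> K0 \<Longrightarrow> c \<in> K0 \<Longrightarrow> b \<otimes>\<^bsub>B\<^esub> c \<in> K0"
  and K0_inv: "b \<in> K0 \<Longrightarrow> inv\<^bsub>B\<^esub> b \<in> K0"
proof -
  interpret BG: group B by (rule group_B)
  have sg: "subgroup ZW (matrix_group W)" using ZW_normal by (rule normal_imp_subgroup)
  show "b \<in> K0 \<Longrightarrow> c \<in> K0 \<Longrightarrow> b \<otimes>\<^bsub>B\<^esub> c \<in> K0"
    using subgroup.m_closed[OF sg] by (simp add: K0_def)
  show "b \<in> K0 \<Longrightarrow> inv\<^bsub>B\<^esub> b \<in> K0"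
    using subgroup.m_inv_closed[OF sg] by (simp add: K0_def winv_def)
qed

lemma q_eq_of_wind:
  assumes b: "b \<in> K0" "c \<in> K0" and eq: "\<And>H. H \<in> HH \<Longrightarrow> braid_wind H b = braid_wind H c"
  shows "q b = q c"
proof (rule q_eqI)
  interpret BG: group B by (rule group_B)
  show bc: "b \<in> carrier B" "c \<in> carrier B" using b by (auto simp: K0_def)
  show "b \<otimes>\<^bsub>B\<^esub> inv\<^bsub>B\<^esub> c \<in> N0"
  proof (rule wind_zero_N0)
    show "b \<otimes>\<^bsub>B\<^esub> inv\<^bsub>B\<^esub> c \<in> carrier B" using bc by simp
    fix H assume H: "H \<in> HH"
    have "braid_wind H c + braid_wind H (inv\<^bsub>B\<^esub> c) = 0"
      using wind_K0[OF b(2) _ H, of "inv\<^bsub>B\<^esub> c"] bc H by simp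
    then show "braid_wind H (b \<otimes>\<^bsub>B\<^esub> inv\<^bsub>B\<^esub> c) = 0" using wind_K0[OF b(1) _ H] bc eq[OF H] by simp
  qed
qed

lemma Ker_commutative: "x \<in> Ker \<Longrightarrow> y \<in> Ker \<Longrightarrow> x \<otimes>\<^bsub>Gam\<^esub> y = y \<otimes>\<^bsub>Gam\<^esub> x"
proof -
  assume "x \<in> Ker" "y \<in> Ker"
  then obtain b c where b: "b \<in> K0" "x = q b" and c: "c \<in> K0" "y = q c" unfolding Ker_eq by blast
  have B: "b \<in> carrier B" "c \<in> carrier B" using b c by (auto simp: K0_def)
  have "q (b \<otimes>\<^bsub>B\<^esub> c) = q (c \<otimes>\<^bsub>B\<^esub> b)"
    using b c B by (intro q_eq_of_wind K0_mult) (auto simp: wind_K0)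
  then show ?thesis using b c B by (simp add: q_mult)
qed

theorem Ker_free: "\<exists>T. T \<in> iso (free_abelian_of_rank (card HH)) (Gam\<lparr>carrier := Ker\<rparr>)"
proof -
  interpret BG: group B by (rule group_B)
  interpret GG: group Gam by (rule group_Gam)
  obtain h where h: "bij_betw h {..<card HH} HH"
    using ex_bij_betw_nat_finite[OF finite_reflecting_hyperplanes] by (auto simp: atLeast0LessThan)
  have hH: "h i \<in> HH" if "i < card HH" for i using bij_betwE[OF h] that by blast
  have d: "card W > 0" using W_nonempty by (simp add: card_gt_0_iff)
  define psi where "psi x i = \<lfloor>Re (of_nat (card W) * coset_wind (h i) x)\<rfloor>" for x i
  have psi: "of_int (psi (q b) i) = of_nat (card W) * braid_wind (h i) b" if b: "b \<in> K0" and i: "i < card HH" for b i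
  proof -
    have cw: "coset_wind (h i) (q b) = braid_wind (h i) b"
      using coset_wind[OF _ hH[OF i], of b] b by (simp add: K0_def)
    obtain z where z: "of_nat (card W) * braid_wind (h i) b = of_int z"
      using wind_integral[OF b hH[OF i]] by (rule Ints_cases)
    have "psi (q b) i = z" unfolding psi_def cw z by simp
    then show ?thesis using z by simp
  qed
  let ?G = "Gam\<lparr>carrier := Ker\<rparr>"
  show ?thesis
  proof (rule triangular_basis_iso[of ?G "card HH" psi])
    have "group ?G" by (rule GG.subgroup_imp_group[OF subgroup_Ker])
    then show "comm_group ?G"
      by (rule group.group_comm_groupI) (use Ker_commutative in simp)
    show "psi (x \<otimes>\<^bsub>?G\<^esub> y) i = psi x i + psi y i"
      if xy: "x \<in> carrier ?G" "y \<in> carrier ?G" and i: "i < card HH" for x y i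
    proof -
      have "x \<in> q ` K0" "y \<in> q ` K0" using xy Ker_eq by auto
      then obtain b c where b: "b \<in> K0" "x = q b" and c: "c \<in> K0" "y = q c" by blast
      have B: "b \<in> carrier B" "c \<in> carrier B" using b c by (auto simp: K0_def)
      have "(of_int (psi (q (b \<otimes>\<^bsub>B\<^esub> c)) i) :: complex) = of_int (psi (q b) i + psi (q c) i)"
        using psi[OF K0_mult[OF b(1) c(1)] i] psi[OF b(1) i] psi[OF c(1) i] wind_K0[OF b(1) B(2) hH[OF i]]
        by (simp add: distrib_left)
      then have "psi (q (b \<otimes>\<^bsub>B\<^esub> c)) i = psi (q b) i + psi (q c) i" by (simp only: of_int_eq_iff)
      then show ?thesis using b c B by (simp add: q_mult)
    qed
    show "x = \<one>\<^bsub>?G\<^esub>" if x: "x \<in> carrier ?G" and z: "\<forall>i<card HH. psi x i = 0" for x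
    proof -
      have "x \<in> q ` K0" using x Ker_eq by auto
      then obtain b where b: "b \<in> K0" "x = q b" by blast
      then have bB: "b \<in> carrier B" by (simp add: K0_def)
      have "braid_wind H b = 0" if "H \<in> HH" for H
      proof -
        have "H \<in> h ` {..<card HH}" using h that by (simp add: bij_betw_def)
        then obtain i where i: "i < card HH" "H = h i" by blast
        have "of_nat (card W) * braid_wind H b = 0" using psi[OF b(1) i(1)] z i b(2) by simp
        then show ?thesis using d by simp
      qed
      then have "b \<in> N0" by (rule wind_zero_N0[OF bB])
      then show ?thesis using q_one_iff[OF bB] b(2) by simp
    qed
    show "\<exists>x\<in>carrier ?G. psi x i \<noteq> 0 \<and> (\<forall>j<card HH. j \<noteq> i \<longrightarrow> psi x j = 0)" if i: "i < card HH" for i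
    proof (rule bexI[of _ "q (cls (meridian (h i)))"])
      note m = meridian_braid[OF hH[OF i]]
      have val: "(of_int (psi (q (cls (meridian (h i)))) j) :: complex) = (if h j = h i then of_nat (card W) else 0)"
        if "j < card HH" for j using psi[OF m(1) that] m(2)[OF hH[OF that]] by simp
      have "psi (q (cls (meridian (h i)))) j = 0" if "j < card HH" "j \<noteq> i" for j
      proof -
        have "h j \<noteq> h i" using h that i by (auto simp: bij_betw_def inj_on_def)
        then show ?thesis using val[OF that(1)] by simp
      qed
      moreover have "psi (q (cls (meridian (h i)))) i \<noteq> 0" using val[OF i] d by auto
      ultimately show "psi (q (cls (meridian (h i)))) i \<noteq> 0 \<and>
          (\<forall>j<card HH. j \<noteq> i \<longrightarrow> psi (q (cls (meridian (h i)))) j = 0)" by blast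
      show "q (cls (meridian (h i))) \<in> carrier ?G" using m(1) Ker_eq by auto
    qed
  qed
qed

theorem Ker_maximal_abelian: "maximal_abelian_subgroup Ker Gam"
  unfolding maximal_abelian_subgroup_def
proof (intro conjI allI impI)
  interpret BG: group B by (rule group_B)
  show "abelian_subgroup Ker Gam"
    unfolding abelian_subgroup_def using subgroup_Ker Ker_commutative by blast
  fix A assume A: "abelian_subgroup A Gam \<and> Ker \<subseteq> A"
  have "x \<in> Ker" if x: "x \<in> A" for x
  proof -
    have "x \<in> carrier Gam" using A x subgroup.mem_carrier unfolding abelian_subgroup_def by metis
    then obtain b where b: "b \<in> carrier B" "x = q b" unfolding carrier_Gam by blast
    have "moved b H = H" if H: "H \<in> HH" for H
    proof -
      let ?m = "cls (meridian H)"
      have m: "?m \<in> K0" "?m \<in> carrier B" using meridian_braid(1)[OF H] by (auto simp: K0_def)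
      have "q ?m \<in> A" using m A Ker_eq by blast
      then have "x \<otimes>\<^bsub>Gam\<^esub> q ?m = q ?m \<otimes>\<^bsub>Gam\<^esub> x" using A x unfolding abelian_subgroup_def by blast
      then have "q (b \<otimes>\<^bsub>B\<^esub> ?m) = q (?m \<otimes>\<^bsub>B\<^esub> b)" using b m by (simp add: q_mult)
      then have "braid_wind H (b \<otimes>\<^bsub>B\<^esub> ?m) = braid_wind H (?m \<otimes>\<^bsub>B\<^esub> b)"
        using coset_wind[OF _ H, of "b \<otimes>\<^bsub>B\<^esub> ?m"] coset_wind[OF _ H, of "?m \<otimes>\<^bsub>B\<^esub> b"] b m by simp
      then have "braid_wind (moved b H) ?m = braid_wind H ?m"
        using wind_mult[OF H b(1) m(2)] wind_K0[OF m(1) b(1) H] by simp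
      then show ?thesis using meridian_braid(2)[OF H] H b(1) by (simp split: if_splits)
    qed
    then have "b \<in> K0" using moved_central_iff[OF b(1)] by blast
    then show ?thesis using b(2) Ker_eq by blast
  qed
  then show "A = Ker" using A by blast
qed

theorem Gam_crystallographic: "crystallographic Gam (card HH) (central_quotient W)"
proof -
  obtain T where T: "T \<in> iso (free_abelian_of_rank (card HH)) (Gam\<lparr>carrier := Ker\<rparr>)" using Ker_free by blast
  have im: "T ` carrier (free_abelian_of_rank (card HH)) = Ker" using T by (auto simp: iso_def bij_betw_def)
  have "T \<in> mon (free_abelian_of_rank (card HH)) Gam"
    using T subgroup.subset[OF subgroup_Ker] by (auto simp: mon_def iso_def bij_betw_def hom_def Pi_iff)
  moreover have "group (central_quotient W)"
    unfolding central_quotient_def by (rule normal.factorgroup_is_group[OF ZW_normal])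
  moreover have "finite (carrier (central_quotient W))"
    by (simp add: central_quotient_def carrier_FactGroup)
  ultimately show ?thesis
    unfolding crystallographic_def using group_Gam projection_epi im Ker_maximal_abelian by metis
qed

end

context based_blocks
begin

theorem P0_eq_Ker: "P0_subgroup W x0 r V Wc = Ker"
proof
  interpret BG: group B by (rule group_B)
  interpret GG: group Gam by (rule group_Gam)
  let ?z = "\<lambda>k. component_braid_inclusion W x0 r V k (central_braid (V k) (Wc k) (direct_sum_component r V x0 k))"
  have z: "?z k \<in> K0" if k: "k < r" for k
  proof -
    obtain w where w: "w \<in> Zc k" "\<And>v. v \<in> V k \<Longrightarrow> w *v v = root_of_unity k *s v" using central_generator[OF k] by blast
    show ?thesis using component_central_braid[OF k w] component_center_central[OF k w(1)]
      by (simp add: K0_def to_W_cls)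
  qed
  have sK0: "subgroup K0 B"
  proof (rule BG.subgroupI)
    show "K0 \<subseteq> carrier B" by (auto simp: K0_def)
    have "\<one>\<^bsub>B\<^esub> \<in> K0" by (simp add: K0_def ZW_iff)
    then show "K0 \<noteq> {}" by blast
  qed (fact K0_inv, fact K0_mult)
  have Zsub: "central_braid_subgroup W x0 r V Wc \<subseteq> K0"
    unfolding central_braid_subgroup_def using z by (intro BG.generate_subgroup_incl[OF _ sK0]) auto
  have Psub: "pure_to_braid W x0 ` carrier P \<subseteq> K0"
    using to_W_pure by (auto simp: K0_def ZW_iff)
  have gens: "pure_abelianization W x0 \<union> q ` central_braid_subgroup W x0 r V Wc \<subseteq> Ker"
    unfolding Ker_eq pure_abelianization_def using Zsub Psub by blast
  then show "P0_subgroup W x0 r V Wc \<subseteq> Ker"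
    unfolding P0_subgroup_def by (rule GG.generate_subgroup_incl[OF _ subgroup_Ker])
  let ?P0 = "P0_subgroup W x0 r V Wc"
  have P0: "subgroup ?P0 Gam"
    unfolding P0_subgroup_def using gens subgroup.subset[OF subgroup_Ker] by (intro GG.generate_is_subgroup) blast
  have incl: "x \<in> ?P0" if "x \<in> pure_abelianization W x0 \<union> q ` central_braid_subgroup W x0 r V Wc" for x
    unfolding P0_subgroup_def using that by (rule generate.incl)
  let ?S = "{w. \<exists>b\<in>carrier B. to_W b = w \<and> q b \<in> ?P0}"
  have S1: "mat 1 \<in> ?S"
  proof -
    have "q \<one>\<^bsub>B\<^esub> = \<one>\<^bsub>Gam\<^esub>" using hom_one[OF q_hom group_B group_Gam] .
    then have "q \<one>\<^bsub>B\<^esub> \<in> ?P0" using subgroup.one_closed[OF P0] by simp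
    then show ?thesis using BG.one_closed to_W_one by blast
  qed
  have Sm: "u ** v \<in> ?S" if uv: "u \<in> ?S" "v \<in> ?S" for u v
  proof -
    obtain b c where b: "b \<in> carrier B" "to_W b = u" "q b \<in> ?P0" and c: "c \<in> carrier B" "to_W c = v" "q c \<in> ?P0"
      using uv by blast
    have "q (b \<otimes>\<^bsub>B\<^esub> c) \<in> ?P0" using subgroup.m_closed[OF P0 b(3) c(3)] b c by (simp add: q_mult)
    moreover have "to_W (b \<otimes>\<^bsub>B\<^esub> c) = u ** v" using b c by simp
    ultimately show ?thesis using BG.m_closed[OF b(1) c(1)] by blast
  qed
  have "Zc k \<subseteq> ?S" if k: "k < r" for k
  proof -
    obtain w where w: "w \<in> Zc k" "\<And>v. v \<in> V k \<Longrightarrow> w *v v = root_of_unity k *s v" using central_generator[OF k] by blast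
    have "?z k \<in> central_braid_subgroup W x0 r V Wc"
      unfolding central_braid_subgroup_def using k by (intro generate.incl) blast
    then have "q (?z k) \<in> ?P0" using incl by blast
    moreover have "to_W (?z k) = w" using component_central_braid[OF k w] by (simp add: to_W_cls)
    ultimately have "w \<in> ?S" using z[OF k] unfolding K0_def by blast
    then show ?thesis using center_generated[OF k w S1] Sm by blast
  qed
  then have ZS: "ZW \<subseteq> ?S" using center_generated_by_components[OF S1 Sm] by blast
  show "Ker \<subseteq> ?P0"
  proof
    fix x assume "x \<in> Ker"
    then obtain b where b: "b \<in> K0" "x = q b" unfolding Ker_eq by blast
    then have bB: "b \<in> carrier B" "to_W b \<in> ZW" by (auto simp: K0_def)
    then obtain c where c: "c \<in> carrier B" "to_W c = to_W b" "q c \<in> ?P0" using ZS by blast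
    let ?p = "b \<otimes>\<^bsub>B\<^esub> inv\<^bsub>B\<^esub> c"
    have "?p \<in> pure_to_braid W x0 ` carrier P" unfolding pure_to_braid_image using bB c by (simp add: kernel_def)
    then have "q ?p \<in> ?P0" using incl unfolding pure_abelianization_def by blast
    then have "q ?p \<otimes>\<^bsub>Gam\<^esub> q c \<in> ?P0" using subgroup.m_closed[OF P0] c(3) by blast
    moreover have "q ?p \<otimes>\<^bsub>Gam\<^esub> q c = x"
      using bB c b(2) q_mult[of ?p c] by (simp add: BG.m_assoc)
    ultimately show "x \<in> ?P0" by simp
  qed
qed

end

theorem theorem2p1:
  fixes W :: "(complex^'n^'n) set" and x0 :: "complex^'n"
  assumes "complex_reflection_group W"
    and "x0 \<in> hyperplane_complement UNIV W"
  shows "crystallographic (braid_mod_pure_commutator W x0)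
           (card (reflecting_hyperplanes W)) (central_quotient W) \<and>
         (\<exists>r V Wc. irreducible_decomposition W r V Wc) \<and>
         (\<forall>r V Wc. irreducible_decomposition W r V Wc \<longrightarrow>
            kernel (braid_mod_pure_commutator W x0) (central_quotient W) (quotient_projection W x0)
              = P0_subgroup W x0 r V Wc \<and>
            (braid_mod_pure_commutator W x0)\<lparr>carrier := P0_subgroup W x0 r V Wc\<rparr>
              \<cong> free_abelian_of_rank (card (reflecting_hyperplanes W)))"
proof -
  interpret base_point W x0 by unfold_locales (use assms in auto)
  have "kernel (braid_mod_pure_commutator W x0) (central_quotient W) (quotient_projection W x0)
              = P0_subgroup W x0 r V Wc \<and>
            (braid_mod_pure_commutator W x0)\<lparr>carrier := P0_subgroup W x0 r V Wc\<rparr>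
              \<cong> free_abelian_of_rank (card (reflecting_hyperplanes W))"
    if "irreducible_decomposition W r V Wc" for r V Wc
  proof -
    interpret based_blocks W x0 r V Wc by unfold_locales (rule that)
    have "free_abelian_of_rank (card HH) \<cong> Gam\<lparr>carrier := Ker\<rparr>" using Ker_free by (auto simp: is_iso_def)
    moreover have "group (free_abelian_of_rank (card HH))" by (simp add: free_abelian_of_rank_def)
    ultimately have "Gam\<lparr>carrier := Ker\<rparr> \<cong> free_abelian_of_rank (card HH)" using group.iso_sym by blast
    then show ?thesis by (simp add: P0_eq_Ker)
  qed
  then show ?thesis using Gam_crystallographic irreducible_decomposition_exists by blast
qed

end
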